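(* The following hold. (1) $\mathsf{SC}^+$ is bi-interpretable with $\mathsf{ZFGC}$. (2) $\mathsf{SC}$ is bi-interpretable with $\mathsf{ZFGC}^-+$ "every cardinal has a successor cardinal". (3) $\mathsf{SC}^{\mathrm{reg}}$ is bi-interpretable with $\mathsf{ZFGC}^+$, i.e. with the theory $\mathsf{ZFGC}+$ "$<$ respects the partial order induced by $\operatorname{rank}$".
   Context: $\mathsf{SC}^-$ is the following theory in a two-sorted first-order language: variables $\alpha,\beta,\gamma,\dots$ range over "ordinals", variables $x,y,z,\dots$ range over "bounded sets of ordinals"; there are a binary relation $<$ between ordinals, a binary relation $\in$ between an ordinal and a bounded set, and a unary function $e$ from bounded sets to ordinals. Axioms: (1) Well-ordering: $<$ is a strict linear order of the ordinals, and every non-empty bounded set has a $<$-least element. (2) Replacement Schema: for every formula $\varphi(\gamma,\delta)$ (with parameters), $\forall\alpha\bigl(\forall\gamma<\alpha\,\exists!\delta\,\varphi(\gamma,\delta)\to\exists\beta\,\forall\gamma<\alpha\,\exists\delta<\beta\,\varphi(\gamma,\delta)\bigr)$. (3) Extensionality and Boundedness: $\forall x\forall y(\forall\alpha(\alpha\in x\leftrightarrow\alpha\in y)\to x=y)$ and $\forall x\exists\alpha\forall\beta\in x(\beta<\alpha)$. (4) Bounded Comprehension Schema: for every formula $\varphi(\beta)$ (with parameters), $\forall\alpha\exists x\forall\beta(\beta\in x\leftrightarrow\beta<\alpha\wedge\varphi(\beta))$. (5) Encoding: $e$ is a bijection, i.e. $\forall\alpha\exists x(\alpha=e(x))$ and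 $\forall x\forall y(e(x)=e(y)\to x=y)$. (6) Order Preservation: $\forall\alpha\forall x(\alpha\in x\to\alpha<e(x))$. (7) Infinity: $\exists\alpha>0\,\forall\beta<\alpha\,\exists\gamma<\alpha\,(\beta<\gamma)$, where $0$ is the least ordinal. In $\mathsf{SC}^-$ put $\alpha\mathrel{E}\beta:\Leftrightarrow\exists x(\alpha\in x\wedge\beta=e(x))$; the ordinals with $E$ as membership and $<$ then form a model of $\mathsf{ZFGC}^-$ (defined below). $\mathsf{SC}$ is $\mathsf{SC}^-$ plus Limitlessness in Size: in the model $(\mathrm{Ord},E,<)$ of $\mathsf{ZFGC}^-$, every cardinal has a successor cardinal. $\mathsf{SC}^+$ is $\mathsf{SC}^-$ plus Uniform Boundedness: $\forall\alpha\exists\beta\forall x\bigl(\forall\gamma\in x(\gamma<\alpha)\to e(x)<\beta\bigr)$. $\mathsf{SC}^{\mathrm{reg}}$ is $\mathsf{SC}^-$ plus Regularity of the Encoding: $e(x)<e(y)$ whenever $\sup(x)<\sup(y)$. $\mathsf{ZFC}^-$ is $\mathsf{ZFC}$ without the power set axiom and with the Collection Schema in place of the Replacement Schema. $\mathsf{ZFGC}^-$ is the theory in the language $\{\in,<\}$ consisting of $\mathsf{ZFC}^-$, with the schemas taken for all formulas of the language $\{\in,<\}$, together with axioms saying that $<$ is a set-like global well-ordering of the universe (a strict linear order, every non-empty set has a $<$-least element, and for each $x$ the collection $\{y: y<x\}$ is a set) that respects membership ($x\in y\to x<y$). $\mathsf{ZFGC}$ is $\mathsf{ZFGC}^-$ plus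 the power set axiom. "$<$ respects the partial order induced by $\operatorname{rank}$" means $\operatorname{rank}(x)<\operatorname{rank}(y)\to x<y$. *)

theory Defs
  imports Main
begin

section \<open>Many-sorted first-order logic\<close>

text \<open>
  Variables are de Bruijn indices. A context is a list of sorts: variable \<open>i\<close> has the \<open>i\<close>-th sort of
  the context, and \<open>Forall s\<close> prepends \<open>s\<close> to the context. Every element of the type \<open>'s\<close> is a
  sort; the function and relation symbols are the elements at which the arity maps are defined.
\<close>

datatype 'f trm = Var nat | Fn 'f "'f trm list"

datatype ('s, 'f, 'r) fm =
    Falsum
  | Eq 's "'f trm" "'f trm"
  | Rel 'r "'f trm list"
  | Imp "('s, 'f, 'r) fm" "('s, 'f, 'r) fm"
  | Forall 's "('s, 'f, 'r) fm"

definition Neg :: "('s, 'f, 'r) fm \<Rightarrow> ('s, 'f, 'r) fm" where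
  "Neg p = Imp p Falsum"

definition Top :: "('s, 'f, 'r) fm" where
  "Top = Neg Falsum"

definition Or :: "('s, 'f, 'r) fm \<Rightarrow> ('s, 'f, 'r) fm \<Rightarrow> ('s, 'f, 'r) fm" where
  "Or p q = Imp (Neg p) q"

definition And :: "('s, 'f, 'r) fm \<Rightarrow> ('s, 'f, 'r) fm \<Rightarrow> ('s, 'f, 'r) fm" where
  "And p q = Neg (Imp p (Neg q))"

definition Iff :: "('s, 'f, 'r) fm \<Rightarrow> ('s, 'f, 'r) fm \<Rightarrow> ('s, 'f, 'r) fm" where
  "Iff p q = And (Imp p q) (Imp q p)"

definition Exists :: "'s \<Rightarrow> ('s, 'f, 'r) fm \<Rightarrow> ('s, 'f, 'r) fm" where
  "Exists s p = Neg (Forall s (Neg p))"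

definition Conj :: "('s, 'f, 'r) fm list \<Rightarrow> ('s, 'f, 'r) fm" where
  "Conj ps = foldr And ps Top"

text \<open>The head of the list is bound innermost, so that below the quantifiers variable \<open>i\<close> has sort \<open>ss ! i\<close>.\<close>

definition Foralls :: "'s list \<Rightarrow> ('s, 'f, 'r) fm \<Rightarrow> ('s, 'f, 'r) fm" where
  "Foralls ss p = fold Forall ss p"

definition Existss :: "'s list \<Rightarrow> ('s, 'f, 'r) fm \<Rightarrow> ('s, 'f, 'r) fm" where
  "Existss ss p = fold Exists ss p"

primrec subst_trm :: "(nat \<Rightarrow> 'f trm) \<Rightarrow> 'f trm \<Rightarrow> 'f trm" where
  "subst_trm \<eta> (Var i) = \<eta> i"
| "subst_trm \<eta> (Fn f ts) = Fn f (map (subst_trm \<eta>) ts)"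

definition up :: "(nat \<Rightarrow> 'f trm) \<Rightarrow> nat \<Rightarrow> 'f trm" where
  "up \<eta> = case_nat (Var 0) (\<lambda>i. subst_trm (\<lambda>j. Var (Suc j)) (\<eta> i))"

primrec subst :: "(nat \<Rightarrow> 'f trm) \<Rightarrow> ('s, 'f, 'r) fm \<Rightarrow> ('s, 'f, 'r) fm" where
  "subst \<eta> Falsum = Falsum"
| "subst \<eta> (Eq s t u) = Eq s (subst_trm \<eta> t) (subst_trm \<eta> u)"
| "subst \<eta> (Rel r ts) = Rel r (map (subst_trm \<eta>) ts)"
| "subst \<eta> (Imp p q) = Imp (subst \<eta> p) (subst \<eta> q)"
| "subst \<eta> (Forall s p) = Forall s (subst (up \<eta>) p)"

definition lift :: "('s, 'f, 'r) fm \<Rightarrow> ('s, 'f, 'r) fm" where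
  "lift p = subst (\<lambda>i. Var (Suc i)) p"

definition subst0 :: "'f trm \<Rightarrow> ('s, 'f, 'r) fm \<Rightarrow> ('s, 'f, 'r) fm" where
  "subst0 t p = subst (case_nat t Var) p"

definition inst :: "('s, 'f, 'r) fm \<Rightarrow> nat list \<Rightarrow> ('s, 'f, 'r) fm" where
  "inst p is = subst (\<lambda>i. Var (is ! i)) p"

text \<open>\<open>ins k m p\<close> makes room for \<open>m\<close> further variables at position \<open>k\<close> of the context of \<open>p\<close>.\<close>

definition ins :: "nat \<Rightarrow> nat \<Rightarrow> ('s, 'f, 'r) fm \<Rightarrow> ('s, 'f, 'r) fm" where
  "ins k m p = subst (\<lambda>i. Var (if i < k then i else i + m)) p"

definition Exists1 :: "'s \<Rightarrow> ('s, 'f, 'r) fm \<Rightarrow> ('s, 'f, 'r) fm" where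
  "Exists1 s p = Exists s (And p (Forall s (Imp (ins 1 1 p) (Eq s (Var 0) (Var 1)))))"

record ('s, 'f, 'r) signature =
  fun_ar :: "'f \<Rightarrow> ('s list \<times> 's) option"
  rel_ar :: "'r \<Rightarrow> 's list option"

inductive has_sort :: "('s, 'f, 'r) signature \<Rightarrow> 's list \<Rightarrow> 'f trm \<Rightarrow> 's \<Rightarrow> bool" for \<sigma> \<Gamma> where
  "i < length \<Gamma> \<Longrightarrow> has_sort \<sigma> \<Gamma> (Var i) (\<Gamma> ! i)"
| "fun_ar \<sigma> f = Some (ss, s) \<Longrightarrow> list_all2 (has_sort \<sigma> \<Gamma>) ts ss \<Longrightarrow> has_sort \<sigma> \<Gamma> (Fn f ts) s"

primrec wff :: "('s, 'f, 'r) signature \<Rightarrow> 's list \<Rightarrow> ('s, 'f, 'r) fm \<Rightarrow> bool" where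
  "wff \<sigma> \<Gamma> Falsum \<longleftrightarrow> True"
| "wff \<sigma> \<Gamma> (Eq s t u) \<longleftrightarrow> has_sort \<sigma> \<Gamma> t s \<and> has_sort \<sigma> \<Gamma> u s"
| "wff \<sigma> \<Gamma> (Rel r ts) \<longleftrightarrow> (\<exists>ss. rel_ar \<sigma> r = Some ss \<and> list_all2 (has_sort \<sigma> \<Gamma>) ts ss)"
| "wff \<sigma> \<Gamma> (Imp p q) \<longleftrightarrow> wff \<sigma> \<Gamma> p \<and> wff \<sigma> \<Gamma> q"
| "wff \<sigma> \<Gamma> (Forall s p) \<longleftrightarrow> wff \<sigma> (s # \<Gamma>) p"

text \<open>
  Classical natural deduction with equality: \<open>deriv \<sigma> T \<Gamma> H p\<close> means that \<open>p\<close> is derivable in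
  context \<open>\<Gamma>\<close> from the axioms \<open>T\<close> and the hypotheses \<open>H\<close>. Sorts are non-empty (rule \<open>nonempty\<close>).
\<close>

inductive deriv ::
  "('s, 'f, 'r) signature \<Rightarrow> ('s, 'f, 'r) fm set \<Rightarrow> 's list \<Rightarrow> ('s, 'f, 'r) fm list \<Rightarrow> ('s, 'f, 'r) fm \<Rightarrow> bool"
  for \<sigma> T where
  ax: "p \<in> T \<Longrightarrow> wff \<sigma> [] p \<Longrightarrow> deriv \<sigma> T \<Gamma> H p"
| hyp: "p \<in> set H \<Longrightarrow> wff \<sigma> \<Gamma> p \<Longrightarrow> deriv \<sigma> T \<Gamma> H p"
| impI: "wff \<sigma> \<Gamma> p \<Longrightarrow> deriv \<sigma> T \<Gamma> (p # H) q \<Longrightarrow> deriv \<sigma> T \<Gamma> H (Imp p q)"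
| impE: "deriv \<sigma> T \<Gamma> H (Imp p q) \<Longrightarrow> deriv \<sigma> T \<Gamma> H p \<Longrightarrow> deriv \<sigma> T \<Gamma> H q"
| raa: "wff \<sigma> \<Gamma> p \<Longrightarrow> deriv \<sigma> T \<Gamma> (Neg p # H) Falsum \<Longrightarrow> deriv \<sigma> T \<Gamma> H p"
| forallI: "deriv \<sigma> T (s # \<Gamma>) (map lift H) p \<Longrightarrow> deriv \<sigma> T \<Gamma> H (Forall s p)"
| forallE: "deriv \<sigma> T \<Gamma> H (Forall s p) \<Longrightarrow> has_sort \<sigma> \<Gamma> t s \<Longrightarrow> deriv \<sigma> T \<Gamma> H (subst0 t p)"
| nonempty: "wff \<sigma> \<Gamma> p \<Longrightarrow> deriv \<sigma> T (s # \<Gamma>) (map lift H) (lift p) \<Longrightarrow> deriv \<sigma> T \<Gamma> H p"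
| eqI: "has_sort \<sigma> \<Gamma> t s \<Longrightarrow> deriv \<sigma> T \<Gamma> H (Eq s t t)"
| eqE: "deriv \<sigma> T \<Gamma> H (Eq s t u) \<Longrightarrow> wff \<sigma> (s # \<Gamma>) p \<Longrightarrow> deriv \<sigma> T \<Gamma> H (subst0 t p)
    \<Longrightarrow> deriv \<sigma> T \<Gamma> H (subst0 u p)"

definition proves :: "('s, 'f, 'r) signature \<Rightarrow> ('s, 'f, 'r) fm set \<Rightarrow> ('s, 'f, 'r) fm \<Rightarrow> bool" where
  "proves \<sigma> T p \<longleftrightarrow> deriv \<sigma> T [] [] p"

section \<open>Interpretations and bi-interpretability\<close>

text \<open>
  Parameter-free multi-dimensional interpretations with definable equality. A sort \<open>s\<close> is
  interpreted by tuples of sorts \<open>dims I s\<close> satisfying \<open>dom I s\<close>, modulo \<open>eqv I s\<close>. The formulas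
  interpreting symbols have the concatenation of the tuples of arguments (for a function symbol
  followed by that of the value) as their context.
\<close>

record ('s1, 'f1, 'r1, 's2, 'f2, 'r2) interp =
  dims :: "'s1 \<Rightarrow> 's2 list"
  dom :: "'s1 \<Rightarrow> ('s2, 'f2, 'r2) fm"
  eqv :: "'s1 \<Rightarrow> ('s2, 'f2, 'r2) fm"
  fun_int :: "'f1 \<Rightarrow> ('s2, 'f2, 'r2) fm"
  rel_int :: "'r1 \<Rightarrow> ('s2, 'f2, 'r2) fm"

definition ctx :: "('s1, 'f1, 'r1, 's2, 'f2, 'r2) interp \<Rightarrow> 's1 list \<Rightarrow> 's2 list" where
  "ctx I ss = concat (map (dims I) ss)"

definition wf_interp ::
  "('s1, 'f1, 'r1) signature \<Rightarrow> ('s2, 'f2, 'r2) signature \<Rightarrow> ('s1, 'f1, 'r1, 's2, 'f2, 'r2) interp \<Rightarrow> bool" where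
  "wf_interp \<sigma>1 \<sigma>2 I \<longleftrightarrow>
     (\<forall>s. wff \<sigma>2 (ctx I [s]) (dom I s) \<and> wff \<sigma>2 (ctx I [s, s]) (eqv I s)) \<and>
     (\<forall>f ss s. fun_ar \<sigma>1 f = Some (ss, s) \<longrightarrow> wff \<sigma>2 (ctx I (ss @ [s])) (fun_int I f)) \<and>
     (\<forall>r ss. rel_ar \<sigma>1 r = Some ss \<longrightarrow> wff \<sigma>2 (ctx I ss) (rel_int I r))"

text \<open>\<open>blocks n ks\<close> splits the indices from \<open>n\<close> on into consecutive blocks of lengths \<open>ks\<close>.\<close>

primrec blocks :: "nat \<Rightarrow> nat list \<Rightarrow> nat list list" where
  "blocks n [] = []"
| "blocks n (k # ks) = [n..<n + k] # blocks (n + k) ks"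

type_synonym ('s, 'f, 'r) domain = "'s list \<times> ('s, 'f, 'r) fm"

definition layout :: "('s, 'f, 'r) domain list \<Rightarrow> nat list list" where
  "layout ds = blocks 0 (map (\<lambda>d. length (fst d)) ds)"

definition in_doms :: "('s, 'f, 'r) domain list \<Rightarrow> ('s, 'f, 'r) fm" where
  "in_doms ds = Conj (map (\<lambda>(d, xs). inst (snd d) xs) (zip ds (layout ds)))"

text \<open>
  Quantification over tuples, one from each of the definable domains \<open>ds\<close>. The body is a function
  of the blocks of indices of the new variables; indices of outer variables have to be shifted.
\<close>

definition all_in :: "('s, 'f, 'r) domain list \<Rightarrow> (nat list list \<Rightarrow> ('s, 'f, 'r) fm) \<Rightarrow> ('s, 'f, 'r) fm" where
  "all_in ds F = Foralls (concat (map fst ds)) (Imp (in_doms ds) (F (layout ds)))"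

definition ex_in :: "('s, 'f, 'r) domain list \<Rightarrow> (nat list list \<Rightarrow> ('s, 'f, 'r) fm) \<Rightarrow> ('s, 'f, 'r) fm" where
  "ex_in ds F = Existss (concat (map fst ds)) (And (in_doms ds) (F (layout ds)))"

definition shift :: "nat list list \<Rightarrow> nat list \<Rightarrow> nat list" where
  "shift xss ys = map (\<lambda>y. y + length (concat xss)) ys"

definition dm :: "('s1, 'f1, 'r1, 's2, 'f2, 'r2) interp \<Rightarrow> 's1 \<Rightarrow> ('s2, 'f2, 'r2) domain" where
  "dm I s = (dims I s, dom I s)"

text \<open>
  The environment \<open>\<rho>\<close> sends a source variable to the tuple of target variables representing it;
  \<open>tr_trm \<sigma> I t s \<rho> ys\<close> says that the tuple \<open>ys\<close> represents the value of the term \<open>t\<close> of sort \<open>s\<close>.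
  Arguments of symbols are first named by existentially quantified tuples.
\<close>

definition unnest ::
  "('s1, 'f1, 'r1, 's2, 'f2, 'r2) interp \<Rightarrow> 's1 list
    \<Rightarrow> ('s1 \<Rightarrow> (nat \<Rightarrow> nat list) \<Rightarrow> nat list \<Rightarrow> ('s2, 'f2, 'r2) fm) list
    \<Rightarrow> (nat \<Rightarrow> nat list) \<Rightarrow> (nat list list \<Rightarrow> ('s2, 'f2, 'r2) fm) \<Rightarrow> ('s2, 'f2, 'r2) fm" where
  "unnest I ss gs \<rho> F =
     ex_in (map (dm I) ss) (\<lambda>zss.
       And (Conj (map (\<lambda>(g, s, zs). g s (\<lambda>i. shift zss (\<rho> i)) zs) (zip gs (zip ss zss)))) (F zss))"

primrec tr_trm ::
  "('s1, 'f1, 'r1) signature \<Rightarrow> ('s1, 'f1, 'r1, 's2, 'f2, 'r2) interp \<Rightarrow> 'f1 trm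
    \<Rightarrow> 's1 \<Rightarrow> (nat \<Rightarrow> nat list) \<Rightarrow> nat list \<Rightarrow> ('s2, 'f2, 'r2) fm" where
  "tr_trm \<sigma> I (Var i) = (\<lambda>s \<rho> ys. inst (eqv I s) (\<rho> i @ ys))"
| "tr_trm \<sigma> I (Fn f ts) = (\<lambda>s \<rho> ys.
     unnest I (fst (the (fun_ar \<sigma> f))) (map (tr_trm \<sigma> I) ts) \<rho>
       (\<lambda>zss. inst (fun_int I f) (concat zss @ shift zss ys)))"

primrec tr ::
  "('s1, 'f1, 'r1) signature \<Rightarrow> ('s1, 'f1, 'r1, 's2, 'f2, 'r2) interp \<Rightarrow> ('s1, 'f1, 'r1) fm
    \<Rightarrow> (nat \<Rightarrow> nat list) \<Rightarrow> ('s2, 'f2, 'r2) fm" where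
  "tr \<sigma> I Falsum = (\<lambda>\<rho>. Falsum)"
| "tr \<sigma> I (Eq s t u) = (\<lambda>\<rho>.
     unnest I [s, s] [tr_trm \<sigma> I t, tr_trm \<sigma> I u] \<rho> (\<lambda>zss. inst (eqv I s) (concat zss)))"
| "tr \<sigma> I (Rel r ts) = (\<lambda>\<rho>.
     unnest I (the (rel_ar \<sigma> r)) (map (tr_trm \<sigma> I) ts) \<rho> (\<lambda>zss. inst (rel_int I r) (concat zss)))"
| "tr \<sigma> I (Imp p q) = (\<lambda>\<rho>. Imp (tr \<sigma> I p \<rho>) (tr \<sigma> I q \<rho>))"
| "tr \<sigma> I (Forall s p) = (\<lambda>\<rho>.
     all_in [dm I s] (\<lambda>xss. tr \<sigma> I p (case_nat (xss ! 0) (\<lambda>i. shift xss (\<rho> i)))))"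

text \<open>The translation of a formula in context \<open>ss\<close> is a formula in context \<open>ctx I ss\<close>.\<close>

definition tr_ctx ::
  "('s1, 'f1, 'r1) signature \<Rightarrow> ('s1, 'f1, 'r1, 's2, 'f2, 'r2) interp \<Rightarrow> 's1 list
    \<Rightarrow> ('s1, 'f1, 'r1) fm \<Rightarrow> ('s2, 'f2, 'r2) fm" where
  "tr_ctx \<sigma> I ss p = tr \<sigma> I p (\<lambda>i. layout (map (dm I) ss) ! i)"

text \<open>
  \<open>preserves K K' \<iota> ss p p'\<close>: the formulas \<open>\<iota> s\<close>, relating tuples of \<open>dom K s\<close> and \<open>dom K' s\<close>,
  carry the relation \<open>p\<close> on the domains of \<open>K\<close> of sorts \<open>ss\<close> to the relation \<open>p'\<close> on those of \<open>K'\<close>.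
\<close>

definition preserves ::
  "('s1, 'f1, 'r1, 's2, 'f2, 'r2) interp \<Rightarrow> ('s1, 'f1, 'r1, 's2, 'f2, 'r2) interp
    \<Rightarrow> ('s1 \<Rightarrow> ('s2, 'f2, 'r2) fm) \<Rightarrow> 's1 list \<Rightarrow> ('s2, 'f2, 'r2) fm \<Rightarrow> ('s2, 'f2, 'r2) fm
    \<Rightarrow> ('s2, 'f2, 'r2) fm" where
  "preserves K K' \<iota> ss p p' =
     all_in (map (dm K) ss @ map (dm K') ss) (\<lambda>bs.
       let xss = take (length ss) bs; yss = drop (length ss) bs in
       Imp (Conj (map (\<lambda>(s, xs, ys). inst (\<iota> s) (xs @ ys)) (zip ss (zip xss yss))))
         (Iff (inst p (concat xss)) (inst p' (concat yss))))"

definition interprets ::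
  "('s1, 'f1, 'r1) signature \<Rightarrow> ('s1, 'f1, 'r1) fm set \<Rightarrow> ('s2, 'f2, 'r2) signature \<Rightarrow> ('s2, 'f2, 'r2) fm set
    \<Rightarrow> ('s1, 'f1, 'r1, 's2, 'f2, 'r2) interp \<Rightarrow> bool" where
  "interprets \<sigma>1 T1 \<sigma>2 T2 I \<longleftrightarrow>
     wf_interp \<sigma>1 \<sigma>2 I \<and>
     (\<forall>s. proves \<sigma>2 T2 (ex_in [dm I s] (\<lambda>_. Top)) \<and>
          proves \<sigma>2 T2 (all_in [dm I s] (\<lambda>bs. inst (eqv I s) (bs ! 0 @ bs ! 0))) \<and>
          proves \<sigma>2 T2 (all_in [dm I s, dm I s] (\<lambda>bs.
            Imp (inst (eqv I s) (bs ! 0 @ bs ! 1)) (inst (eqv I s) (bs ! 1 @ bs ! 0)))) \<and>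
          proves \<sigma>2 T2 (all_in [dm I s, dm I s, dm I s] (\<lambda>bs.
            Imp (And (inst (eqv I s) (bs ! 0 @ bs ! 1)) (inst (eqv I s) (bs ! 1 @ bs ! 2)))
              (inst (eqv I s) (bs ! 0 @ bs ! 2))))) \<and>
     (\<forall>r ss. rel_ar \<sigma>1 r = Some ss \<longrightarrow>
          proves \<sigma>2 T2 (preserves I I (eqv I) ss (rel_int I r) (rel_int I r))) \<and>
     (\<forall>f ss s. fun_ar \<sigma>1 f = Some (ss, s) \<longrightarrow>
          proves \<sigma>2 T2 (preserves I I (eqv I) (ss @ [s]) (fun_int I f) (fun_int I f)) \<and>
          proves \<sigma>2 T2 (all_in (map (dm I) ss) (\<lambda>bs.
            ex_in [dm I s] (\<lambda>cs. inst (fun_int I f) (shift cs (concat bs) @ cs ! 0)))) \<and>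
          proves \<sigma>2 T2 (all_in (map (dm I) ([s, s] @ ss)) (\<lambda>bs.
            Imp (And (inst (fun_int I f) (concat (drop 2 bs) @ bs ! 0))
                     (inst (fun_int I f) (concat (drop 2 bs) @ bs ! 1)))
              (inst (eqv I s) (bs ! 0 @ bs ! 1))))) \<and>
     (\<forall>p\<in>T1. proves \<sigma>2 T2 (tr_ctx \<sigma>1 I [] p))"

definition id_interp :: "('s, 'f, 'r) signature \<Rightarrow> ('s, 'f, 'r, 's, 'f, 'r) interp" where
  "id_interp \<sigma> = \<lparr>
     dims = (\<lambda>s. [s]),
     dom = (\<lambda>s. Top),
     eqv = (\<lambda>s. Eq s (Var 0) (Var 1)),
     fun_int = (\<lambda>f. let (ss, s) = the (fun_ar \<sigma> f); n = length ss in
                    Eq s (Fn f (map Var [0..<n])) (Var n)),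
     rel_int = (\<lambda>r. Rel r (map Var [0..<length (the (rel_ar \<sigma> r))]))\<rparr>"

text \<open>First \<open>I\<close>, an interpretation of \<open>\<sigma>1\<close> in \<open>\<sigma>2\<close>, then \<open>J\<close>, an interpretation of \<open>\<sigma>2\<close>.\<close>

definition comp_interp ::
  "('s1, 'f1, 'r1) signature \<Rightarrow> ('s2, 'f2, 'r2) signature
    \<Rightarrow> ('s1, 'f1, 'r1, 's2, 'f2, 'r2) interp \<Rightarrow> ('s2, 'f2, 'r2, 's3, 'f3, 'r3) interp
    \<Rightarrow> ('s1, 'f1, 'r1, 's3, 'f3, 'r3) interp" where
  "comp_interp \<sigma>1 \<sigma>2 I J = \<lparr>
     dims = (\<lambda>s. ctx J (dims I s)),
     dom = (\<lambda>s. And (in_doms (map (dm J) (dims I s))) (tr_ctx \<sigma>2 J (dims I s) (dom I s))),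
     eqv = (\<lambda>s. tr_ctx \<sigma>2 J (ctx I [s, s]) (eqv I s)),
     fun_int = (\<lambda>f. let (ss, s) = the (fun_ar \<sigma>1 f) in tr_ctx \<sigma>2 J (ctx I (ss @ [s])) (fun_int I f)),
     rel_int = (\<lambda>r. tr_ctx \<sigma>2 J (ctx I (the (rel_ar \<sigma>1 r))) (rel_int I r))\<rparr>"

text \<open>
  \<open>T\<close> proves that the formulas \<open>\<iota> s\<close> define an isomorphism between the structures given by the
  interpretations \<open>K\<close> and \<open>K'\<close> of \<open>\<sigma>1\<close> in \<open>\<sigma>\<close>.
\<close>

definition definable_iso ::
  "('s, 'f, 'r) signature \<Rightarrow> ('s, 'f, 'r) fm set \<Rightarrow> ('s1, 'f1, 'r1) signature
    \<Rightarrow> ('s1, 'f1, 'r1, 's, 'f, 'r) interp \<Rightarrow> ('s1, 'f1, 'r1, 's, 'f, 'r) interp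
    \<Rightarrow> ('s1 \<Rightarrow> ('s, 'f, 'r) fm) \<Rightarrow> bool" where
  "definable_iso \<sigma> T \<sigma>1 K K' \<iota> \<longleftrightarrow>
     (\<forall>s. wff \<sigma> (ctx K [s] @ ctx K' [s]) (\<iota> s) \<and>
          proves \<sigma> T (all_in [dm K s] (\<lambda>bs. ex_in [dm K' s] (\<lambda>cs. inst (\<iota> s) (shift cs (bs ! 0) @ cs ! 0)))) \<and>
          proves \<sigma> T (all_in [dm K' s] (\<lambda>cs. ex_in [dm K s] (\<lambda>bs. inst (\<iota> s) (bs ! 0 @ shift bs (cs ! 0))))) \<and>
          proves \<sigma> T (preserves K K' \<iota> [s, s] (eqv K s) (eqv K' s))) \<and>
     (\<forall>r ss. rel_ar \<sigma>1 r = Some ss \<longrightarrow>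
          proves \<sigma> T (preserves K K' \<iota> ss (rel_int K r) (rel_int K' r))) \<and>
     (\<forall>f ss s. fun_ar \<sigma>1 f = Some (ss, s) \<longrightarrow>
          proves \<sigma> T (preserves K K' \<iota> (ss @ [s]) (fun_int K f) (fun_int K' f)))"

definition bi_interpretable ::
  "('s1, 'f1, 'r1) signature \<Rightarrow> ('s1, 'f1, 'r1) fm set \<Rightarrow> ('s2, 'f2, 'r2) signature \<Rightarrow> ('s2, 'f2, 'r2) fm set \<Rightarrow> bool" where
  "bi_interpretable \<sigma>1 T1 \<sigma>2 T2 \<longleftrightarrow>
     (\<exists>I J \<iota> \<kappa>.
        interprets \<sigma>1 T1 \<sigma>2 T2 I \<and> interprets \<sigma>2 T2 \<sigma>1 T1 J \<and>
        definable_iso \<sigma>1 T1 \<sigma>1 (id_interp \<sigma>1) (comp_interp \<sigma>1 \<sigma>2 I J) \<iota> \<and>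
        definable_iso \<sigma>2 T2 \<sigma>2 (id_interp \<sigma>2) (comp_interp \<sigma>2 \<sigma>1 J I) \<kappa>)"

section \<open>Set theory with a global well-ordering\<close>

datatype set_rel = Mem | Prec

text \<open>One sort and no function symbols.\<close>

definition set_sig :: "(unit, unit, set_rel) signature" where
  "set_sig = \<lparr>fun_ar = (\<lambda>_. None), rel_ar = (\<lambda>_. Some [(), ()])\<rparr>"

type_synonym set_fm = "(unit, unit, set_rel) fm"

abbreviation all :: "set_fm \<Rightarrow> set_fm" where "all \<equiv> Forall ()"
abbreviation ex :: "set_fm \<Rightarrow> set_fm" where "ex \<equiv> Exists ()"
abbreviation eq :: "nat \<Rightarrow> nat \<Rightarrow> set_fm" where "eq i j \<equiv> Eq () (Var i) (Var j)"
abbreviation mem :: "nat \<Rightarrow> nat \<Rightarrow> set_fm" where "mem i j \<equiv> Rel Mem [Var i, Var j]"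
abbreviation prec :: "nat \<Rightarrow> nat \<Rightarrow> set_fm" where "prec i j \<equiv> Rel Prec [Var i, Var j]"

text \<open>In the following formulas the arguments are the indices of the variables talked about.\<close>

definition subset_fm :: "nat \<Rightarrow> nat \<Rightarrow> set_fm" where
  "subset_fm x y = all (Imp (mem 0 (x+1)) (mem 0 (y+1)))"

definition upair_fm :: "nat \<Rightarrow> nat \<Rightarrow> nat \<Rightarrow> set_fm" where \<comment> \<open>\<open>z = {a, b}\<close>\<close>
  "upair_fm z a b = all (Iff (mem 0 (z+1)) (Or (eq 0 (a+1)) (eq 0 (b+1))))"

definition opair_fm :: "nat \<Rightarrow> nat \<Rightarrow> nat \<Rightarrow> set_fm" where \<comment> \<open>\<open>p = {{a}, {a, b}}\<close>\<close>
  "opair_fm p a b =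
     ex (ex (And (upair_fm 1 (a+2) (a+2)) (And (upair_fm 0 (a+2) (b+2)) (upair_fm (p+2) 1 0))))"

definition app_fm :: "nat \<Rightarrow> nat \<Rightarrow> nat \<Rightarrow> set_fm" where \<comment> \<open>\<open>(a, b) \<in> f\<close>\<close>
  "app_fm f a b = ex (And (mem 0 (f+1)) (opair_fm 0 (a+1) (b+1)))"

definition function_fm :: "nat \<Rightarrow> set_fm" where
  "function_fm f =
     And (all (Imp (mem 0 (f+1)) (ex (ex (opair_fm 2 1 0)))))
         (all (all (all (Imp (And (app_fm (f+3) 2 1) (app_fm (f+3) 2 0)) (eq 1 0)))))"

definition bijection_fm :: "nat \<Rightarrow> nat \<Rightarrow> nat \<Rightarrow> set_fm" where \<comment> \<open>\<open>f\<close> is a bijection from \<open>a\<close> to \<open>b\<close>\<close>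
  "bijection_fm f a b = Conj [
     function_fm f,
     all (all (Imp (app_fm (f+2) 1 0) (And (mem 1 (a+2)) (mem 0 (b+2))))),
     all (Imp (mem 0 (a+1)) (ex (app_fm (f+2) 1 0))),
     all (Imp (mem 0 (b+1)) (ex (app_fm (f+2) 0 1))),
     all (all (all (Imp (And (app_fm (f+3) 2 0) (app_fm (f+3) 1 0)) (eq 2 1))))]"

text \<open>Transitive and linearly ordered by membership; well-foundedness is given by Foundation.\<close>

definition ordinal_fm :: "nat \<Rightarrow> set_fm" where
  "ordinal_fm x =
     And (all (Imp (mem 0 (x+1)) (subset_fm 0 (x+1))))
         (all (all (Imp (And (mem 1 (x+2)) (mem 0 (x+2))) (Or (mem 1 0) (Or (eq 1 0) (mem 0 1))))))"

definition cardinal_fm :: "nat \<Rightarrow> set_fm" where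
  "cardinal_fm k =
     And (ordinal_fm k) (all (Imp (mem 0 (k+1)) (Neg (ex (bijection_fm 0 1 (k+2))))))"

text \<open>
  \<open>r\<close> is the rank of \<open>x\<close>: some function \<open>f\<close> with transitive domain satisfies
  \<open>f(u) = sup {f(v) + 1 | v \<in> u}\<close>, i.e. \<open>w \<in> f(u)\<close> iff \<open>w \<in> f(v)\<close> or \<open>w = f(v)\<close> for some \<open>v \<in> u\<close>, and \<open>f(x) = r\<close>.
\<close>

definition rank_fm :: "nat \<Rightarrow> nat \<Rightarrow> set_fm" where
  "rank_fm x r = ex (Conj [
     function_fm 0,
     app_fm 0 (x+1) (r+1),
     all (all (Imp (app_fm 2 1 0)
       (And (all (Imp (mem 0 2) (ex (app_fm 4 1 0))))
            (all (Iff (mem 0 1)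
              (ex (ex (Conj [mem 1 4, app_fm 5 1 0, Or (mem 2 0) (eq 2 0)]))))))))])"

definition extensionality_ax :: set_fm where
  "extensionality_ax = all (all (Imp (all (Iff (mem 0 2) (mem 0 1))) (eq 1 0)))"

definition foundation_ax :: set_fm where
  "foundation_ax =
     all (Imp (ex (mem 0 1)) (ex (And (mem 0 1) (all (Imp (mem 0 1) (Neg (mem 0 2)))))))"

definition pairing_ax :: set_fm where
  "pairing_ax = all (all (ex (upair_fm 0 2 1)))"

definition union_ax :: set_fm where
  "union_ax = all (ex (all (Iff (mem 0 1) (ex (And (mem 0 3) (mem 1 0))))))"

definition infinity_ax :: set_fm where
  "infinity_ax = ex (And
     (ex (And (all (Neg (mem 0 1))) (mem 0 1)))
     (all (Imp (mem 0 1) (ex (And (mem 0 2) (all (Iff (mem 0 1) (Or (mem 0 2) (eq 0 2)))))))))"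

text \<open>Every set of non-empty, pairwise disjoint sets has a transversal.\<close>

definition choice_ax :: set_fm where
  "choice_ax = all (Imp
     (And (all (Imp (mem 0 1) (ex (mem 0 1))))
          (all (all (Imp (Conj [mem 1 2, mem 0 2, ex (And (mem 0 2) (mem 0 1))]) (eq 1 0)))))
     (ex (all (Imp (mem 0 2) (Exists1 () (And (mem 0 1) (mem 0 2)))))))"

definition power_set_ax :: set_fm where
  "power_set_ax = all (ex (all (Iff (mem 0 1) (subset_fm 0 2))))"

text \<open>In the schemas, \<open>\<Gamma>\<close> is the context of the parameters of \<open>p\<close>, in which the axiom is closed universally.\<close>

definition separation_ax :: "set_fm \<Rightarrow> set_fm" where
  "separation_ax p = all (ex (all (Iff (mem 0 1) (And (mem 0 2) (ins 1 2 p)))))"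

definition separation_schema :: "set_fm set" where
  "separation_schema = {Foralls \<Gamma> (separation_ax p) | \<Gamma> p. wff set_sig (() # \<Gamma>) p}"

text \<open>In \<open>p\<close>, variable 0 is the value and variable 1 the argument; likewise in \<open>replacement_ax\<close> below.\<close>

definition collection_ax :: "set_fm \<Rightarrow> set_fm" where
  "collection_ax p = all (Imp
     (all (Imp (mem 0 1) (ex (ins 2 1 p))))
     (ex (all (Imp (mem 0 2) (ex (And (mem 0 2) (ins 2 2 p)))))))"

definition collection_schema :: "set_fm set" where
  "collection_schema = {Foralls \<Gamma> (collection_ax p) | \<Gamma> p. wff set_sig (() # () # \<Gamma>) p}"

definition ZFC_minus :: "set_fm set" where
  "ZFC_minus =
     {extensionality_ax, foundation_ax, pairing_ax, union_ax, infinity_ax, choice_ax}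
     \<union> separation_schema \<union> collection_schema"

definition global_wellorder_axs :: "set_fm set" where
  "global_wellorder_axs = {
     all (Neg (prec 0 0)),
     all (all (all (Imp (And (prec 2 1) (prec 1 0)) (prec 2 0)))),
     all (all (Or (prec 1 0) (Or (eq 1 0) (prec 0 1)))),
     all (Imp (ex (mem 0 1)) (ex (And (mem 0 1) (all (Imp (mem 0 2) (Or (eq 1 0) (prec 1 0))))))),
     all (ex (all (Iff (mem 0 1) (prec 0 2)))),
     all (all (Imp (mem 1 0) (prec 1 0)))}"

definition ZFGC_minus :: "set_fm set" where
  "ZFGC_minus = ZFC_minus \<union> global_wellorder_axs"

definition ZFGC :: "set_fm set" where
  "ZFGC = ZFGC_minus \<union> {power_set_ax}"

definition successor_cardinals_ax :: set_fm where
  "successor_cardinals_ax = all (Imp (cardinal_fm 0)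
     (ex (Conj [cardinal_fm 0, mem 1 0,
       all (Imp (And (cardinal_fm 0) (mem 2 0)) (Or (eq 1 0) (mem 1 0)))])))"

definition rank_ax :: set_fm where
  "rank_ax = all (all (Imp
     (ex (ex (Conj [rank_fm 3 1, rank_fm 2 0, mem 1 0]))) (prec 1 0)))"

definition ZFGC_plus :: "set_fm set" where
  "ZFGC_plus = ZFGC \<union> {rank_ax}"

section \<open>Theories of ordinals and bounded sets of ordinals\<close>

datatype sc_sort = Ordinal | BSet

datatype sc_fun = Enc

datatype sc_rel = Less | In

definition sc_sig :: "(sc_sort, sc_fun, sc_rel) signature" where
  "sc_sig = \<lparr>
     fun_ar = (\<lambda>_. Some ([BSet], Ordinal)),
     rel_ar = case_sc_rel (Some [Ordinal, Ordinal]) (Some [Ordinal, BSet])\<rparr>"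

type_synonym sc_fm = "(sc_sort, sc_fun, sc_rel) fm"

abbreviation all_ord :: "sc_fm \<Rightarrow> sc_fm" where "all_ord \<equiv> Forall Ordinal"
abbreviation ex_ord :: "sc_fm \<Rightarrow> sc_fm" where "ex_ord \<equiv> Exists Ordinal"
abbreviation all_set :: "sc_fm \<Rightarrow> sc_fm" where "all_set \<equiv> Forall BSet"
abbreviation ex_set :: "sc_fm \<Rightarrow> sc_fm" where "ex_set \<equiv> Exists BSet"
abbreviation enc :: "nat \<Rightarrow> sc_fun trm" where "enc x \<equiv> Fn Enc [Var x]"
abbreviation oeq :: "nat \<Rightarrow> nat \<Rightarrow> sc_fm" where "oeq i j \<equiv> Eq Ordinal (Var i) (Var j)"
abbreviation less :: "nat \<Rightarrow> nat \<Rightarrow> sc_fm" where "less i j \<equiv> Rel Less [Var i, Var j]"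
abbreviation elem :: "nat \<Rightarrow> nat \<Rightarrow> sc_fm" where "elem i x \<equiv> Rel In [Var i, Var x]"

definition wellorder_axs :: "sc_fm set" where
  "wellorder_axs = {
     all_ord (Neg (less 0 0)),
     all_ord (all_ord (all_ord (Imp (And (less 2 1) (less 1 0)) (less 2 0)))),
     all_ord (all_ord (Or (less 1 0) (Or (oeq 1 0) (less 0 1)))),
     all_set (Imp (ex_ord (elem 0 1))
       (ex_ord (And (elem 0 1) (all_ord (Imp (elem 0 2) (Or (oeq 1 0) (less 1 0)))))))}"

definition replacement_ax :: "sc_fm \<Rightarrow> sc_fm" where
  "replacement_ax p = all_ord (Imp
     (all_ord (Imp (less 0 1) (Exists1 Ordinal (ins 2 1 p))))
     (ex_ord (all_ord (Imp (less 0 2) (ex_ord (And (less 0 2) (ins 2 2 p)))))))"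

definition replacement_schema :: "sc_fm set" where
  "replacement_schema = {Foralls \<Gamma> (replacement_ax p) | \<Gamma> p. wff sc_sig (Ordinal # Ordinal # \<Gamma>) p}"

definition set_extensionality_ax :: sc_fm where
  "set_extensionality_ax =
     all_set (all_set (Imp (all_ord (Iff (elem 0 2) (elem 0 1))) (Eq BSet (Var 1) (Var 0))))"

definition boundedness_ax :: sc_fm where
  "boundedness_ax = all_set (ex_ord (all_ord (Imp (elem 0 2) (less 0 1))))"

definition comprehension_ax :: "sc_fm \<Rightarrow> sc_fm" where
  "comprehension_ax p = all_ord (ex_set (all_ord (Iff (elem 0 1) (And (less 0 2) (ins 1 2 p)))))"

definition comprehension_schema :: "sc_fm set" where
  "comprehension_schema = {Foralls \<Gamma> (comprehension_ax p) | \<Gamma> p. wff sc_sig (Ordinal # \<Gamma>) p}"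

definition encoding_axs :: "sc_fm set" where
  "encoding_axs = {
     all_ord (ex_set (Eq Ordinal (Var 1) (enc 0))),
     all_set (all_set (Imp (Eq Ordinal (enc 1) (enc 0)) (Eq BSet (Var 1) (Var 0))))}"

definition order_preservation_ax :: sc_fm where
  "order_preservation_ax = all_ord (all_set (Imp (elem 1 0) (Rel Less [Var 1, enc 0])))"

definition ord_infinity_ax :: sc_fm where
  "ord_infinity_ax = ex_ord (And
     (ex_ord (And (all_ord (Or (oeq 1 0) (less 1 0))) (less 0 1)))
     (all_ord (Imp (less 0 1) (ex_ord (And (less 0 2) (less 1 0))))))"

definition SC_minus :: "sc_fm set" where
  "SC_minus =
     wellorder_axs \<union> replacement_schema \<union> {set_extensionality_ax, boundedness_ax}
     \<union> comprehension_schema \<union> encoding_axs \<union> {order_preservation_ax, ord_infinity_ax}"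

text \<open>The structure \<open>(Ord, E, <)\<close>, where \<open>a E b\<close> iff \<open>a \<in> x\<close> and \<open>b = e(x)\<close> for some \<open>x\<close>.\<close>

definition E_interp :: "(unit, unit, set_rel, sc_sort, sc_fun, sc_rel) interp" where
  "E_interp = \<lparr>
     dims = (\<lambda>_. [Ordinal]),
     dom = (\<lambda>_. Top),
     eqv = (\<lambda>_. oeq 0 1),
     fun_int = (\<lambda>_. Falsum),
     rel_int = case_set_rel (ex_set (And (elem 1 0) (Eq Ordinal (Var 2) (enc 0)))) (less 0 1)\<rparr>"

definition limitlessness_ax :: sc_fm where
  "limitlessness_ax = tr_ctx set_sig E_interp [] successor_cardinals_ax"

definition uniform_boundedness_ax :: sc_fm where
  "uniform_boundedness_ax =
     all_ord (ex_ord (all_set (Imp (all_ord (Imp (elem 0 1) (less 0 3))) (Rel Less [enc 0, Var 1]))))"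

text \<open>\<open>s\<close> is the least upper bound of \<open>x\<close>, i.e. the least \<open>s\<close> with \<open>b \<le> s\<close> for all \<open>b \<in> x\<close>.\<close>

definition upper_bound_fm :: "nat \<Rightarrow> nat \<Rightarrow> sc_fm" where
  "upper_bound_fm s x = all_ord (Imp (elem 0 (x+1)) (Or (oeq 0 (s+1)) (less 0 (s+1))))"

definition sup_fm :: "nat \<Rightarrow> nat \<Rightarrow> sc_fm" where
  "sup_fm s x = And (upper_bound_fm s x)
     (all_ord (Imp (upper_bound_fm 0 (x+1)) (Or (oeq (s+1) 0) (less (s+1) 0))))"

definition regularity_ax :: sc_fm where
  "regularity_ax = all_set (all_set (Imp
     (ex_ord (ex_ord (Conj [sup_fm 1 3, sup_fm 0 2, less 1 0])))
     (Rel Less [enc 1, enc 0])))"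

definition SC :: "sc_fm set" where
  "SC = SC_minus \<union> {limitlessness_ax}"

definition SC_plus :: "sc_fm set" where
  "SC_plus = SC_minus \<union> {uniform_boundedness_ax}"

definition SC_reg :: "sc_fm set" where
  "SC_reg = SC_minus \<union> {regularity_ax}"

end

theory Submission
  imports Defs "HOL-Library.Countable" "HOL-Library.Infinite_Set"
begin

text \<open>
  By the completeness theorem, all provability conditions may be checked in structures with universe
  \<open>\<nat>\<close>. In a model of \<open>SC\<^sup>-\<close>, the encoding \<open>e\<close> identifies bounded sets with ordinals, so such a
  model is the same thing as the single-sorted structure \<open>(Ord, E, <)\<close>, and \<open>SC\<^sup>-\<close> and \<open>ZFGC\<^sup>-\<close> have the
  same structures as models: Collection is Replacement for the \<open><\<close>-least bounds, and Bounded
  Comprehension is Separation since initial segments of \<open><\<close> are sets. This gives (1), where Uniform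
  Boundedness becomes Power Set, and (2).

  In (3) the order has to be changed: the supremum in Regularity is the non-strict one, so that
  \<open>{a}\<close> and \<open>{a, b}\<close> with \<open>a < b\<close> are compared through \<open>a < b\<close> although they may have equal rank, and
  neither class of orders contains the other. Over a fixed universe of \<open>ZFC\<close>, each class embeds
  definably into the other: the sets \<open>{x, {x, y}}\<close> and \<open>{y, {x, y}}\<close> have equal rank, and the recursion
  \<open>L u v \<longleftrightarrow> (\<exists>b \<in> v. \<forall>a \<in> u. a < b)\<close> that produces regular orders does not distinguish them either, so
  that their order is free to code whether \<open>x\<close> precedes \<open>y\<close> in an arbitrary given order. A definable
  version of the Cantor-Schroeder-Bernstein argument turns the two embeddings into a bijection. It has
  to quantify over the chain of iterated preimages of an order, which is a sequence of proper classes;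
  the embedding into regular orders therefore codes all entries of the chain at once.
\<close>

section \<open>Substitution\<close>

text \<open>Interpretations are parameter-free here, so each new order must come from one formula
  that serves all structures at once, whereas the axiom schemas speak of one structure and allow
  parameters; definability below covers both. Universe and membership never change, only the order
  does. A class definable from a definable order is definable from the original one, so Separation
  and Collection survive a change of order, and a new order only has to be shown to be a set-like
  well-order that respects membership. Models may be nonstandard: the length of a chain of preimages
  is a natural number of the model, and statements about chains are proved by induction inside the
  model over definable classes. An order is a proper class and cannot be a value of a sequence, but
  a formula can speak of the relation that an order codes at a tag \<open>n\<close>, with
  \<open>n\<close> an ordinary variable. What is found at a tag need not be an order, hence the
  coding is set up for tournaments, that is, for arbitrary decisions between any two distinct
  elements.\<close>

lemma subst_trm_subst_trm: "subst_trm \<eta> (subst_trm \<zeta> t) = subst_trm (\<lambda>i. subst_trm \<eta> (\<zeta> i)) t"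
  by (induction t) auto

lemma subst_trm_Var [simp]: "subst_trm Var t = t"
  by (induction t) (auto simp: map_idI)

lemma up_0 [simp]: "up \<eta> 0 = Var 0"
  and up_Suc [simp]: "up \<eta> (Suc i) = subst_trm (\<lambda>j. Var (Suc j)) (\<eta> i)"
  by (auto simp: up_def)

lemma up_Var [simp]: "up Var = Var"
  by (rule ext) (auto simp: up_def split: nat.split)

lemma subst_Var [simp]: "subst Var p = p"
  by (induction p) (auto simp: map_idI)

lemma up_comp: "(\<lambda>i. subst_trm (up \<eta>) (up \<zeta> i)) = up (\<lambda>i. subst_trm \<eta> (\<zeta> i))"
  by (rule ext, case_tac i) (auto simp: subst_trm_subst_trm)

lemma subst_subst: "subst \<eta> (subst \<zeta> p) = subst (\<lambda>i. subst_trm \<eta> (\<zeta> i)) p"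
  by (induction p arbitrary: \<eta> \<zeta>) (auto simp: subst_trm_subst_trm up_comp)

definition sorted_subst ::
  "('s, 'f, 'r) signature \<Rightarrow> 's list \<Rightarrow> 's list \<Rightarrow> (nat \<Rightarrow> 'f trm) \<Rightarrow> bool" where
  "sorted_subst \<sigma> \<Gamma> \<Delta> \<eta> \<longleftrightarrow> (\<forall>i<length \<Gamma>. has_sort \<sigma> \<Delta> (\<eta> i) (\<Gamma> ! i))"

lemma has_sort_subst:
  "has_sort \<sigma> \<Gamma> t s \<Longrightarrow> sorted_subst \<sigma> \<Gamma> \<Delta> \<eta> \<Longrightarrow> has_sort \<sigma> \<Delta> (subst_trm \<eta> t) s"
proof (induction rule: has_sort.induct)
  case (2 f ss s ts)
  then have "list_all2 (has_sort \<sigma> \<Delta>) (map (subst_trm \<eta>) ts) ss"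
    by (auto simp: list_all2_conv_all_nth)
  with 2 show ?case by (auto intro: has_sort.intros)
qed (auto simp: sorted_subst_def)

lemma has_sort_Var: "i < length \<Gamma> \<Longrightarrow> \<Gamma> ! i = s \<Longrightarrow> has_sort \<sigma> \<Gamma> (Var i) s"
  using has_sort.intros(1) by blast

lemma has_sort_Var_iff [simp]: "has_sort \<sigma> \<Gamma> (Var i) s \<longleftrightarrow> i < length \<Gamma> \<and> \<Gamma> ! i = s"
  by (auto intro: has_sort_Var elim: has_sort.cases)

lemma has_sort_Fn_iff [simp]:
  "has_sort \<sigma> \<Gamma> (Fn f ts) s \<longleftrightarrow> (\<exists>ss. fun_ar \<sigma> f = Some (ss, s) \<and> list_all2 (has_sort \<sigma> \<Gamma>) ts ss)"
  by (auto intro: has_sort.intros elim: has_sort.cases)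

lemma has_sort_lift: "has_sort \<sigma> \<Gamma> t s \<Longrightarrow> has_sort \<sigma> (s' # \<Gamma>) (subst_trm (\<lambda>j. Var (Suc j)) t) s"
  by (rule has_sort_subst) (auto simp: sorted_subst_def)

lemma sorted_subst_up: "sorted_subst \<sigma> \<Gamma> \<Delta> \<eta> \<Longrightarrow> sorted_subst \<sigma> (s # \<Gamma>) (s # \<Delta>) (up \<eta>)"
  unfolding sorted_subst_def
  by (auto simp: less_Suc_eq_0_disj has_sort_lift)

lemma wff_subst: "wff \<sigma> \<Gamma> p \<Longrightarrow> sorted_subst \<sigma> \<Gamma> \<Delta> \<eta> \<Longrightarrow> wff \<sigma> \<Delta> (subst \<eta> p)"
proof (induction p arbitrary: \<Gamma> \<Delta> \<eta>)
  case (Rel r ts)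
  then show ?case by (auto simp: list_all2_conv_all_nth intro: has_sort_subst)
next
  case (Forall s p)
  show ?case using Forall.IH[OF _ sorted_subst_up[OF Forall.prems(2)]] Forall.prems(1) by simp
qed (auto intro: has_sort_subst)

lemma subst_trm_agree:
  "has_sort \<sigma> \<Gamma> t s \<Longrightarrow> (\<And>i. i < length \<Gamma> \<Longrightarrow> \<eta> i = \<zeta> i) \<Longrightarrow> subst_trm \<eta> t = subst_trm \<zeta> t"
proof (induction rule: has_sort.induct)
  case (2 f ss s ts)
  then show ?case by (auto simp: list_all2_conv_all_nth in_set_conv_nth)
qed auto

lemma subst_agree:
  "wff \<sigma> \<Gamma> p \<Longrightarrow> (\<And>i. i < length \<Gamma> \<Longrightarrow> \<eta> i = \<zeta> i) \<Longrightarrow> subst \<eta> p = subst \<zeta> p"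
proof (induction p arbitrary: \<Gamma> \<eta> \<zeta>)
  case (Eq s t u)
  have "has_sort \<sigma> \<Gamma> t s \<Longrightarrow> subst_trm \<eta> t = subst_trm \<zeta> t" for t
    by (rule subst_trm_agree[OF _ Eq.prems(2)])
  then show ?case using Eq.prems(1) by auto
next
  case (Rel r ts)
  have *: "has_sort \<sigma> \<Gamma> t s \<Longrightarrow> subst_trm \<eta> t = subst_trm \<zeta> t" for t s
    by (rule subst_trm_agree[OF _ Rel.prems(2)])
  from Rel.prems(1)
  have "\<forall>t\<in>set ts. \<exists>s. has_sort \<sigma> \<Gamma> t s"
    by (auto simp: list_all2_conv_all_nth in_set_conv_nth) blast
  then have "map (subst_trm \<eta>) ts = map (subst_trm \<zeta>) ts"
    using * by (intro map_cong refl) blast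
  then show ?case by simp
next
  case (Forall s p)
  have "subst (up \<eta>) p = subst (up \<zeta>) p"
    by (rule Forall.IH[of "s # \<Gamma>"]) (use Forall.prems in \<open>auto simp: less_Suc_eq_0_disj\<close>)
  then show ?case by simp
next
  case (Imp p q)
  have "subst \<eta> p = subst \<zeta> p" "subst \<eta> q = subst \<zeta> q"
    using Imp.prems(1) by (intro Imp.IH[OF _ Imp.prems(2)]; simp)+
  then show ?case by simp
qed simp

lemma subst_closed: "wff \<sigma> [] p \<Longrightarrow> subst \<eta> p = p"
  using subst_agree[of \<sigma> "[]" p \<eta> Var] by simp

lemma wff_closed: "wff \<sigma> [] p \<Longrightarrow> wff \<sigma> \<Gamma> p"
  using wff_subst[of \<sigma> "[]" p \<Gamma> Var] by (simp add: sorted_subst_def)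

lemma subst_lift: "subst (up \<eta>) (lift p) = lift (subst \<eta> p)"
  by (auto simp: lift_def subst_subst)

lemma subst_subst0: "subst \<eta> (subst0 t p) = subst0 (subst_trm \<eta> t) (subst (up \<eta>) p)"
proof -
  have "(\<lambda>i. subst_trm \<eta> (case_nat t Var i)) =
      (\<lambda>i. subst_trm (case_nat (subst_trm \<eta> t) Var) (up \<eta> i))"
    by (rule ext) (auto simp: up_def subst_trm_subst_trm split: nat.split)
  then show ?thesis by (simp add: subst0_def subst_subst)
qed

lemma subst_Neg [simp]: "subst \<eta> (Neg p) = Neg (subst \<eta> p)"
  by (simp add: Neg_def)

lemma wff_Neg [simp]: "wff \<sigma> \<Gamma> (Neg p) \<longleftrightarrow> wff \<sigma> \<Gamma> p"
  by (simp add: Neg_def)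

text \<open>With \<open>Var\<close> it enlarges the context of a derivation; with a renaming it
  turns a fresh variable into a bound one in the Henkin construction. The substitution stays
  arbitrary in the induction because \<open>forallI\<close> and \<open>nonempty\<close> continue
  with \<open>up \<eta>\<close>.\<close>

lemma deriv_subst:
  "deriv \<sigma> T \<Gamma> H p \<Longrightarrow> sorted_subst \<sigma> \<Gamma> \<Delta> \<eta> \<Longrightarrow> deriv \<sigma> T \<Delta> (map (subst \<eta>) H) (subst \<eta> p)"
proof (induction arbitrary: \<Delta> \<eta> rule: deriv.induct)
  case (ax p \<Gamma> H)
  then show ?case by (simp add: subst_closed deriv.ax)
next
  case (hyp p H \<Gamma>)
  then show ?case by (intro deriv.hyp wff_subst[OF hyp.hyps(2) hyp.prems]) auto
next
  case (impI \<Gamma> p H q)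
  show ?case
    using deriv.impI[OF wff_subst[OF impI.hyps(1) impI.prems]] impI.IH[OF impI.prems] by simp
next
  case (impE \<Gamma> H p q)
  show ?case by (rule deriv.impE[OF impE.IH(1)[OF impE.prems, simplified] impE.IH(2)[OF impE.prems]])
next
  case (raa \<Gamma> p H)
  show ?case
    by (rule deriv.raa[OF wff_subst[OF raa.hyps(1) raa.prems]]) (use raa.IH[OF raa.prems] in simp)
next
  case (forallI s \<Gamma> H p)
  have eq: "map (subst (up \<eta>)) (map lift H) = map lift (map (subst \<eta>) H)"
    by (simp add: subst_lift)
  show ?case
    using deriv.forallI[OF forallI.IH[OF sorted_subst_up[OF forallI.prems], unfolded eq]] by simp
next
  case (forallE \<Gamma> H s p t)
  show ?case unfolding subst_subst0
    by (rule deriv.forallE[OF forallE.IH[OF forallE.prems, simplified]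
          has_sort_subst[OF forallE.hyps(2) forallE.prems]])
next
  case (nonempty \<Gamma> p s H)
  have eq: "map (subst (up \<eta>)) (map lift H) = map lift (map (subst \<eta>) H)"
    by (simp add: subst_lift)
  show ?case
    by (rule deriv.nonempty[OF wff_subst[OF nonempty.hyps(1) nonempty.prems]
          nonempty.IH[OF sorted_subst_up[OF nonempty.prems], unfolded eq subst_lift]])
next
  case (eqI \<Gamma> t s H)
  then show ?case using deriv.eqI[OF has_sort_subst] by fastforce
next
  case (eqE \<Gamma> H s t u p)
  show ?case unfolding subst_subst0
    by (rule deriv.eqE[OF eqE.IH(1)[OF eqE.prems, simplified]
          wff_subst[OF eqE.hyps(2) sorted_subst_up[OF eqE.prems]]
          eqE.IH(2)[OF eqE.prems, unfolded subst_subst0]])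
qed

lemma deriv_weaken:
  "deriv \<sigma> T \<Gamma> H p \<Longrightarrow> set H \<subseteq> set H' \<Longrightarrow> deriv \<sigma> T \<Gamma> H' p"
proof (induction arbitrary: H' rule: deriv.induct)
  case (impI \<Gamma> p H q)
  show ?case by (rule deriv.impI[OF impI.hyps(1) impI.IH]) (use impI.prems in auto)
next
  case (raa \<Gamma> p H)
  show ?case by (rule deriv.raa[OF raa.hyps(1) raa.IH]) (use raa.prems in auto)
next
  case (forallI s \<Gamma> H p)
  show ?case by (rule deriv.forallI[OF forallI.IH]) (use forallI.prems in auto)
next
  case (nonempty \<Gamma> p s H)
  show ?case by (rule deriv.nonempty[OF nonempty.hyps(1) nonempty.IH]) (use nonempty.prems in auto)
next
  case (eqE \<Gamma> H s t u p)
  show ?case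
    by (rule deriv.eqE[OF eqE.IH(1)[OF eqE.prems] eqE.hyps(2) eqE.IH(2)[OF eqE.prems]])
next
  case (impE \<Gamma> H p q)
  show ?case by (rule deriv.impE[OF impE.IH(1)[OF impE.prems] impE.IH(2)[OF impE.prems]])
next
  case (forallE \<Gamma> H s p t)
  show ?case by (rule deriv.forallE[OF forallE.IH[OF forallE.prems] forallE.hyps(2)])
next
  case (hyp p H \<Gamma>)
  then show ?case by (intro deriv.hyp) auto
qed (simp_all add: deriv.ax deriv.eqI)

section \<open>Structures\<close>

text \<open>All sorts share one element type, so that environments are plain functions on indices;
  only the quantifiers look at the carriers.\<close>

record ('s, 'f, 'r, 'a) model =
  car :: "'s \<Rightarrow> 'a set"
  fn :: "'f \<Rightarrow> 'a list \<Rightarrow> 'a"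
  rl :: "'r \<Rightarrow> 'a list \<Rightarrow> bool"

primrec teval :: "('s, 'f, 'r, 'a) model \<Rightarrow> (nat \<Rightarrow> 'a) \<Rightarrow> 'f trm \<Rightarrow> 'a" where
  "teval M e (Var i) = e i"
| "teval M e (Fn f ts) = fn M f (map (teval M e) ts)"

primrec sat :: "('s, 'f, 'r, 'a) model \<Rightarrow> (nat \<Rightarrow> 'a) \<Rightarrow> ('s, 'f, 'r) fm \<Rightarrow> bool" where
  "sat M e Falsum \<longleftrightarrow> False"
| "sat M e (Eq s t u) \<longleftrightarrow> teval M e t = teval M e u"
| "sat M e (Rel r ts) \<longleftrightarrow> rl M r (map (teval M e) ts)"
| "sat M e (Imp p q) \<longleftrightarrow> (sat M e p \<longrightarrow> sat M e q)"
| "sat M e (Forall s p) \<longleftrightarrow> (\<forall>a\<in>car M s. sat M (case_nat a e) p)"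

lemma sat_Neg [simp]: "sat M e (Neg p) \<longleftrightarrow> \<not> sat M e p"
  and sat_Top [simp]: "sat M e Top"
  and sat_Or [simp]: "sat M e (Or p q) \<longleftrightarrow> sat M e p \<or> sat M e q"
  and sat_And [simp]: "sat M e (And p q) \<longleftrightarrow> sat M e p \<and> sat M e q"
  and sat_Iff [simp]: "sat M e (Iff p q) \<longleftrightarrow> (sat M e p \<longleftrightarrow> sat M e q)"
  and sat_Exists [simp]: "sat M e (Exists s p) \<longleftrightarrow> (\<exists>a\<in>car M s. sat M (case_nat a e) p)"
  by (auto simp: Neg_def Top_def Or_def And_def Iff_def Exists_def)

lemma wff_Top [simp]: "wff \<sigma> \<Gamma> Top"
  and wff_Or [simp]: "wff \<sigma> \<Gamma> (Or p q) \<longleftrightarrow> wff \<sigma> \<Gamma> p \<and> wff \<sigma> \<Gamma> q"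
  and wff_And [simp]: "wff \<sigma> \<Gamma> (And p q) \<longleftrightarrow> wff \<sigma> \<Gamma> p \<and> wff \<sigma> \<Gamma> q"
  and wff_Iff [simp]: "wff \<sigma> \<Gamma> (Iff p q) \<longleftrightarrow> wff \<sigma> \<Gamma> p \<and> wff \<sigma> \<Gamma> q"
  and wff_Exists [simp]: "wff \<sigma> \<Gamma> (Exists s p) \<longleftrightarrow> wff \<sigma> (s # \<Gamma>) p"
  by (auto simp: Neg_def Top_def Or_def And_def Iff_def Exists_def)

lemma sat_Conj [simp]: "sat M e (Conj ps) \<longleftrightarrow> (\<forall>p\<in>set ps. sat M e p)"
  by (induction ps) (auto simp: Conj_def)

lemma wff_Conj [simp]: "wff \<sigma> \<Gamma> (Conj ps) \<longleftrightarrow> (\<forall>p\<in>set ps. wff \<sigma> \<Gamma> p)"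
  by (induction ps) (auto simp: Conj_def)

lemma teval_subst: "teval M e (subst_trm \<eta> t) = teval M (\<lambda>i. teval M e (\<eta> i)) t"
  by (induction t) (auto simp: comp_def cong: map_cong)

lemma teval_lift [simp]: "teval M (case_nat a e) (subst_trm (\<lambda>j. Var (Suc j)) t) = teval M e t"
  by (simp add: teval_subst)

lemma up_env: "(\<lambda>i. teval M (case_nat a e) (up \<eta> i)) = case_nat a (\<lambda>i. teval M e (\<eta> i))"
  by (rule ext) (auto simp: up_def split: nat.split)

lemma sat_subst: "sat M e (subst \<eta> p) \<longleftrightarrow> sat M (\<lambda>i. teval M e (\<eta> i)) p"
  by (induction p arbitrary: e \<eta>) (auto simp: teval_subst up_env comp_def)

lemma teval_agree:
  "has_sort \<sigma> \<Gamma> t s \<Longrightarrow> (\<And>i. i < length \<Gamma> \<Longrightarrow> e i = e' i) \<Longrightarrow> teval M e t = teval M e' t"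
proof (induction rule: has_sort.induct)
  case (2 f ss s ts)
  then have "map (teval M e) ts = map (teval M e') ts"
    by (auto simp: list_all2_conv_all_nth in_set_conv_nth)
  then show ?case by (metis teval.simps(2))
qed auto

lemma sat_agree:
  "wff \<sigma> \<Gamma> p \<Longrightarrow> (\<And>i. i < length \<Gamma> \<Longrightarrow> e i = e' i) \<Longrightarrow> sat M e p \<longleftrightarrow> sat M e' p"
proof (induction p arbitrary: \<Gamma> e e')
  case (Eq s t u)
  have "has_sort \<sigma> \<Gamma> t s \<Longrightarrow> teval M e t = teval M e' t" for t
    by (rule teval_agree[OF _ Eq.prems(2)])
  then show ?case using Eq.prems(1) by auto
next
  case (Rel r ts)
  have *: "has_sort \<sigma> \<Gamma> t s \<Longrightarrow> teval M e t = teval M e' t" for t s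
    by (rule teval_agree[OF _ Rel.prems(2)])
  from Rel.prems(1)
  have "\<forall>t\<in>set ts. \<exists>s. has_sort \<sigma> \<Gamma> t s"
    by (auto simp: list_all2_conv_all_nth in_set_conv_nth) blast
  then have "map (teval M e) ts = map (teval M e') ts"
    using * by (intro map_cong refl) blast
  then show ?case by (metis sat.simps(3))
next
  case (Imp p q)
  have "sat M e p \<longleftrightarrow> sat M e' p" "sat M e q \<longleftrightarrow> sat M e' q"
    using Imp.prems(1) by (intro Imp.IH[OF _ Imp.prems(2)]; simp)+
  then show ?case by simp
next
  case (Forall s p)
  have "sat M (case_nat a e) p \<longleftrightarrow> sat M (case_nat a e') p" for a
    by (rule Forall.IH[of "s # \<Gamma>"]) (use Forall.prems in \<open>auto simp: less_Suc_eq_0_disj\<close>)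
  then show ?case by simp
qed simp_all

lemma sat_inst: "sat M e (inst p is) \<longleftrightarrow> sat M (\<lambda>i. e (is ! i)) p"
  by (simp add: inst_def sat_subst)

lemma sat_ins [simp]: "sat M e (ins k m p) \<longleftrightarrow> sat M (\<lambda>i. e (if i < k then i else i + m)) p"
  by (simp add: ins_def sat_subst)

lemma wff_inst:
  "wff \<sigma> \<Delta> p \<Longrightarrow> (\<And>i. i < length \<Delta> \<Longrightarrow> is ! i < length \<Gamma> \<and> \<Gamma> ! (is ! i) = \<Delta> ! i) \<Longrightarrow> wff \<sigma> \<Gamma> (inst p is)"
  unfolding inst_def by (erule wff_subst) (auto simp: sorted_subst_def)

section \<open>Completeness\<close>

instance trm :: (countable) countable
  by countable_datatype

instance fm :: (countable, countable, countable) countable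
  by countable_datatype

text \<open>The rule \<open>nonempty\<close> discharges the variables of the context one by one, as
  a closed formula mentions none of them. Hence underivability without context gives underivability
  in every context.\<close>

lemma deriv_empty_context: "deriv \<sigma> T \<Gamma> [] p \<Longrightarrow> wff \<sigma> [] p \<Longrightarrow> deriv \<sigma> T [] [] p"
proof (induction \<Gamma>)
  case (Cons s \<Gamma>)
  have "deriv \<sigma> T \<Gamma> [] p"
    by (rule deriv.nonempty[where s = s])
      (use Cons.prems in \<open>simp_all add: wff_closed lift_def subst_closed\<close>)
  then show ?case using Cons by blast
qed simp

text \<open>
  The Henkin constants are variables: \<open>\<Delta>\<close> is an infinite context, of which a derivation sees only
  an initial segment.
\<close>

locale henkin =
  fixes \<sigma> :: "('s::countable, 'f::countable, 'r::countable) signature"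
    and T :: "('s, 'f, 'r) fm set" and \<Delta> :: "nat \<Rightarrow> 's" and p0 :: "('s, 'f, 'r) fm"
  assumes inf_sort: "\<exists>m\<ge>n. \<Delta> m = s"
    and p0_wff: "wff \<sigma> [] p0"
    and unprovable: "\<not> deriv \<sigma> T [] [] p0"
begin

section \<open>Derivability in initial segments of the infinite context\<close>

definition G :: "nat \<Rightarrow> 's list" where "G n = map \<Delta> [0..<n]"

lemma length_G [simp]: "length (G n) = n"
  and nth_G [simp]: "i < n \<Longrightarrow> G n ! i = \<Delta> i"
  by (auto simp: G_def)

definition D where "D H p \<longleftrightarrow> (\<exists>n. deriv \<sigma> T (G n) H p)"
definition wf where "wf p \<longleftrightarrow> (\<exists>n. wff \<sigma> (G n) p)"
definition st where "st t s \<longleftrightarrow> (\<exists>n. has_sort \<sigma> (G n) t s)"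

lemma sorted_subst_case:
  "has_sort \<sigma> \<Gamma>' t s \<Longrightarrow> sorted_subst \<sigma> \<Gamma> \<Gamma>' \<eta> \<Longrightarrow> sorted_subst \<sigma> (s # \<Gamma>) \<Gamma>' (case_nat t \<eta>)"
  unfolding sorted_subst_def by (auto simp: less_Suc_eq_0_disj)

lemma sorted_G: "n \<le> m \<Longrightarrow> sorted_subst \<sigma> (G n) (G m) Var"
  by (simp add: sorted_subst_def)

lemma deriv_mono: "deriv \<sigma> T (G n) H p \<Longrightarrow> n \<le> m \<Longrightarrow> deriv \<sigma> T (G m) H p"
  using deriv_subst[OF _ sorted_G] by (fastforce simp: map_idI)

lemma wff_mono: "wff \<sigma> (G n) p \<Longrightarrow> n \<le> m \<Longrightarrow> wff \<sigma> (G m) p"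
  using wff_subst[OF _ sorted_G] by fastforce

lemma wff_mono_Cons: "wff \<sigma> (s # G n) p \<Longrightarrow> n \<le> m \<Longrightarrow> wff \<sigma> (s # G m) p"
  using wff_subst[OF _ sorted_subst_up[OF sorted_G]] by fastforce

lemma wff_subst0: "wff \<sigma> (s # G n) p \<Longrightarrow> has_sort \<sigma> (G m) t s \<Longrightarrow> n \<le> m \<Longrightarrow> wff \<sigma> (G m) (subst0 t p)"
  unfolding subst0_def by (rule wff_subst[OF _ sorted_subst_case[OF _ sorted_G]])

lemma sort_mono: "has_sort \<sigma> (G n) t s \<Longrightarrow> n \<le> m \<Longrightarrow> has_sort \<sigma> (G m) t s"
  using has_sort_subst[OF _ sorted_G] by fastforce

lemma D_weaken: "D H p \<Longrightarrow> set H \<subseteq> set H' \<Longrightarrow> D H' p"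
  unfolding D_def using deriv_weaken by blast

lemma D_hyp: "p \<in> set H \<Longrightarrow> wf p \<Longrightarrow> D H p"
  unfolding D_def wf_def using deriv.hyp by blast

lemma D_ax: "p \<in> T \<Longrightarrow> wff \<sigma> [] p \<Longrightarrow> D H p"
  unfolding D_def using deriv.ax by blast

lemma D_impI:
  assumes "wf p" "D (p # H) q"
  shows "D H (Imp p q)"
proof -
  obtain n m where n: "wff \<sigma> (G n) p" and m: "deriv \<sigma> T (G m) (p # H) q"
    using assms by (auto simp: D_def wf_def)
  have "deriv \<sigma> T (G (max n m)) H (Imp p q)"
    by (intro deriv.impI wff_mono[OF n] deriv_mono[OF m]) auto
  then show ?thesis by (auto simp: D_def)
qed

lemma D_impE:
  assumes "D H (Imp p q)" "D H p"
  shows "D H q"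
proof -
  obtain n m where n: "deriv \<sigma> T (G n) H (Imp p q)" and m: "deriv \<sigma> T (G m) H p"
    using assms by (auto simp: D_def)
  have "deriv \<sigma> T (G (max n m)) H q"
    by (rule deriv.impE[OF deriv_mono[OF n] deriv_mono[OF m]]) auto
  then show ?thesis by (auto simp: D_def)
qed

lemma D_raa:
  assumes "wf p" "D (Neg p # H) Falsum"
  shows "D H p"
proof -
  obtain n m where n: "wff \<sigma> (G n) p" and m: "deriv \<sigma> T (G m) (Neg p # H) Falsum"
    using assms by (auto simp: D_def wf_def)
  have "deriv \<sigma> T (G (max n m)) H p"
    by (rule deriv.raa[OF wff_mono[OF n] deriv_mono[OF m]]) auto
  then show ?thesis by (auto simp: D_def)
qed

lemma D_forallE:
  assumes "D H (Forall s p)" "st t s"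
  shows "D H (subst0 t p)"
proof -
  obtain n m where n: "deriv \<sigma> T (G n) H (Forall s p)" and m: "has_sort \<sigma> (G m) t s"
    using assms by (auto simp: D_def st_def)
  have "deriv \<sigma> T (G (max n m)) H (subst0 t p)"
    by (rule deriv.forallE[OF deriv_mono[OF n] sort_mono[OF m]]) auto
  then show ?thesis by (auto simp: D_def)
qed

lemma D_eqI: "st t s \<Longrightarrow> D H (Eq s t t)"
  unfolding D_def st_def by (blast intro: deriv.eqI)

lemma D_eqE:
  assumes "D H (Eq s t u)" "wff \<sigma> (s # G k) p" "D H (subst0 t p)"
  shows "D H (subst0 u p)"
proof -
  obtain n m where n: "deriv \<sigma> T (G n) H (Eq s t u)" and m: "deriv \<sigma> T (G m) H (subst0 t p)"
    using assms by (auto simp: D_def)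
  have "deriv \<sigma> T (G (max (max n m) k)) H (subst0 u p)"
    by (rule deriv.eqE[OF deriv_mono[OF n] wff_mono_Cons[OF assms(2)] deriv_mono[OF m]]) auto
  then show ?thesis by (auto simp: D_def)
qed

text \<open>Renaming the fresh variable \<open>m\<close> to \<open>0\<close> turns it into the bound variable of the rule \<open>forallI\<close>.\<close>

lemma D_generalize:
  assumes H: "\<forall>h\<in>set H. wff \<sigma> (G n) h" and q: "wff \<sigma> (s # G n) q" and "n \<le> m" "\<Delta> m = s"
    and D: "D (Neg (subst0 (Var m) q) # H) Falsum"
  shows "D H (Forall s q)"
proof -
  obtain k' where k': "deriv \<sigma> T (G k') (Neg (subst0 (Var m) q) # H) Falsum"
    using D by (auto simp: D_def)
  define k where "k = max k' (Suc m)"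
  define \<eta> :: "nat \<Rightarrow> 'f trm" where "\<eta> i = Var (if i = m then 0 else Suc i)" for i
  have k: "deriv \<sigma> T (G k) (Neg (subst0 (Var m) q) # H) Falsum"
    by (rule deriv_mono[OF k']) (simp add: k_def)
  have s: "sorted_subst \<sigma> (G k) (s # G k) \<eta>"
    using assms by (auto simp: sorted_subst_def \<eta>_def)
  have 1: "map (subst \<eta>) H = map lift H"
  proof (rule map_cong[OF refl])
    fix h assume "h \<in> set H"
    then have "wff \<sigma> (G n) h" using H by blast
    then show "subst \<eta> h = lift h" unfolding lift_def
      by (rule subst_agree) (use \<open>n \<le> m\<close> in \<open>simp add: \<eta>_def\<close>)
  qed
  have "subst \<eta> (subst0 (Var m) q) = subst Var q"
    unfolding subst0_def subst_subst
    by (rule subst_agree[OF q]) (use \<open>n \<le> m\<close> in \<open>auto simp: \<eta>_def less_Suc_eq_0_disj\<close>)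
  then have 2: "subst \<eta> (subst0 (Var m) q) = q" by simp
  have "deriv \<sigma> T (s # G k) (Neg q # map lift H) Falsum"
    using deriv_subst[OF k s] by (simp add: 1 2)
  moreover have "wff \<sigma> (s # G k) q"
    by (rule wff_mono_Cons[OF q]) (use \<open>n \<le> m\<close> in \<open>simp add: k_def\<close>)
  ultimately have "deriv \<sigma> T (G k) H (Forall s q)"
    by (metis deriv.forallI deriv.raa)
  then show ?thesis by (auto simp: D_def)
qed

section \<open>The maximal consistent set with witnesses\<close>

definition con where "con H \<longleftrightarrow> \<not> D H Falsum"

lemma wf_Neg [simp]: "wf (Neg p) \<longleftrightarrow> wf p"
  by (simp add: wf_def)

lemma wf_common: "\<forall>p\<in>set H. wf p \<Longrightarrow> \<exists>n. \<forall>p\<in>set H. wff \<sigma> (G n) p"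
proof (induction H)
  case (Cons p H)
  then obtain n m where n: "wff \<sigma> (G n) p" and m: "\<forall>p\<in>set H. wff \<sigma> (G m) p"
    by (auto simp: wf_def)
  have "\<forall>p\<in>set (p # H). wff \<sigma> (G (max n m)) p"
    using wff_mono[OF n, of "max n m"] wff_mono[of m _ "max n m"] m by auto
  then show ?case by blast
qed simp

text \<open>Well-formedness in the first \<open>m\<close> variables is what makes variable
  \<open>m\<close> new.\<close>

definition fresh where
  "fresh s H = (SOME m. \<Delta> m = s \<and> (\<forall>p\<in>set H. wff \<sigma> (G m) p))"

lemma fresh:
  assumes "\<forall>p\<in>set H. wf p"
  shows "\<Delta> (fresh s H) = s \<and> (\<forall>p\<in>set H. wff \<sigma> (G (fresh s H)) p)"
  unfolding fresh_def
proof (rule someI_ex)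
  obtain n where n: "\<forall>p\<in>set H. wff \<sigma> (G n) p" using wf_common[OF assms] by blast
  obtain m where "m \<ge> n" "\<Delta> m = s" using inf_sort by blast
  then show "\<exists>m. \<Delta> m = s \<and> (\<forall>p\<in>set H. wff \<sigma> (G m) p)" using n wff_mono by blast
qed

text \<open>Existential statements are negated universal ones in this syntax, so only these call for
  an example, namely a counterexample to the universal formula.\<close>

definition witness where
  "witness H p = (case p of Imp (Forall s q) Falsum \<Rightarrow> [Neg (subst0 (Var (fresh s H)) q)] | _ \<Rightarrow> [])"

text \<open>Formulas are considered in the order of their codes; \<open>X_complete\<close> and
  \<open>X_Forall\<close> look at the stage \<open>to_nat p\<close> at which \<open>p\<close> has
  its turn.\<close>

primrec S :: "nat \<Rightarrow> ('s, 'f, 'r) fm list" where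
  "S 0 = [Neg p0]"
| "S (Suc k) = (let p = from_nat k; H = p # S k in if wf p \<and> con H then witness H p @ H else S k)"

lemma witness_cases:
  obtains "witness H p = []"
  | s q where "p = Neg (Forall s q)" "witness H p = [Neg (subst0 (Var (fresh s H)) q)]"
proof -
  have "witness H p = [] \<or> (\<exists>s q. p = Neg (Forall s q))"
    unfolding witness_def Neg_def by (cases p) (auto split: fm.splits)
  then show thesis using that by (auto simp: witness_def Neg_def)
qed

lemma witness_Neg_Forall: "witness H (Neg (Forall s q)) = [Neg (subst0 (Var (fresh s H)) q)]"
  by (simp add: witness_def Neg_def)

text \<open>Were the counterexample inconsistent, generalisation over the fresh variable would
  derive the universal formula that \<open>p\<close> negates.\<close>

lemma con_witness:
  assumes "con (p # H)" "\<forall>q\<in>set (p # H). wf q"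
  shows "con (witness (p # H) p @ p # H) \<and> (\<forall>q\<in>set (witness (p # H) p). wf q)"
proof (cases rule: witness_cases[of "p # H" p])
  case (2 s q)
  define m where "m = fresh s (p # H)"
  have m: "\<Delta> m = s" "\<forall>q\<in>set (p # H). wff \<sigma> (G m) q"
    using fresh[OF assms(2), of s] by (auto simp: m_def)
  then have q: "wff \<sigma> (s # G m) q" using 2 by simp
  have "con (Neg (subst0 (Var m) q) # p # H)"
    unfolding con_def
  proof
    assume "D (Neg (subst0 (Var m) q) # p # H) Falsum"
    then have "D (p # H) (Forall s q)" using D_generalize m q by blast
    moreover have "D (p # H) p" using assms(2) by (intro D_hyp) auto
    ultimately have "D (p # H) Falsum" using 2 D_impE unfolding Neg_def by blast
    then show False using assms(1) by (simp add: con_def)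
  qed
  moreover have "wff \<sigma> (G (Suc m)) (subst0 (Var m) q)"
    using m by (intro wff_subst0[OF q]) auto
  ultimately show ?thesis using 2 by (auto simp: m_def wf_def)
qed (use assms in auto)

lemma S_inv: "con (S k) \<and> (\<forall>p\<in>set (S k). wf p)"
proof (induction k)
  case 0
  have "wf p0" using wff_closed[OF p0_wff] by (auto simp: wf_def)
  moreover have "\<not> D [] p0"
    using unprovable deriv_empty_context[OF _ p0_wff] by (auto simp: D_def)
  ultimately show ?case using D_raa by (auto simp: con_def)
next
  case (Suc k)
  then show ?case using con_witness[of "from_nat k" "S k"] by (auto simp: Let_def)
qed

definition X where "X = (\<Union>k. set (S k))"

lemma S_mono: "k \<le> l \<Longrightarrow> set (S k) \<subseteq> set (S l)"
  by (rule lift_Suc_mono_le[of "\<lambda>k. set (S k)"]) (auto simp: Let_def)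

lemma X_finite: "set H \<subseteq> X \<Longrightarrow> \<exists>k. set H \<subseteq> set (S k)"
proof (induction H)
  case (Cons p H)
  then obtain k l where "set H \<subseteq> set (S k)" "p \<in> set (S l)" by (auto simp: X_def)
  then have "set (p # H) \<subseteq> set (S (max k l))"
    using S_mono[of k "max k l"] S_mono[of l "max k l"] by auto
  then show ?case by blast
qed simp

lemma X_con: "set H \<subseteq> X \<Longrightarrow> \<not> D H Falsum"
  using X_finite[of H] S_inv D_weaken unfolding con_def by blast

lemma X_complete:
  assumes "wf p"
  shows "p \<in> X \<or> Neg p \<in> X"
proof (rule ccontr)
  assume *: "\<not> ?thesis"
  have D: "D (q # S (to_nat q)) Falsum" if "q \<notin> X" "wf q" for q
  proof (rule ccontr)
    assume "\<not> D (q # S (to_nat q)) Falsum"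
    then have "q \<in> set (S (Suc (to_nat q)))" using that by (simp add: con_def Let_def)
    then show False using that(1) by (auto simp: X_def simp del: S.simps)
  qed
  \<comment> \<open>Each candidate is refuted at its own stage; at the later of the two stages both
    refutations apply and refute that stage itself.\<close>
  define k where "k = max (to_nat p) (to_nat (Neg p))"
  have "D (p # S k) Falsum" "D (Neg p # S k) Falsum"
    using D[of p] D[of "Neg p"] * assms S_mono[of "to_nat p" k] S_mono[of "to_nat (Neg p)" k]
      D_weaken[of "p # S (to_nat p)" Falsum "p # S k"]
      D_weaken[of "Neg p # S (to_nat (Neg p))" Falsum "Neg p # S k"]
    by (auto simp: k_def)
  then have "D (S k) Falsum"
    using D_raa[OF assms] D_impI[OF assms] D_impE unfolding Neg_def by blast
  then show False using S_inv by (auto simp: con_def)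
qed

lemma X_wf: "p \<in> X \<Longrightarrow> wf p"
  using S_inv by (auto simp: X_def)

lemma X_D: "D H p \<Longrightarrow> set H \<subseteq> X \<Longrightarrow> wf p \<Longrightarrow> p \<in> X"
proof (rule ccontr)
  assume p: "D H p" "set H \<subseteq> X" "wf p" "p \<notin> X"
  then have n: "Neg p \<in> X" using X_complete by blast
  have "D (Neg p # H) p" by (rule D_weaken[OF p(1)]) auto
  moreover have "D (Neg p # H) (Neg p)" using p(3) by (intro D_hyp) auto
  ultimately have "D (Neg p # H) Falsum" using D_impE unfolding Neg_def by blast
  then show False using X_con[of "Neg p # H"] n p(2) by auto
qed

lemma X_Falsum: "Falsum \<notin> X"
  using X_con[of "[Falsum]"] D_hyp[of Falsum "[Falsum]"] by (auto simp: wf_def)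

lemma X_Neg: "wf p \<Longrightarrow> Neg p \<in> X \<longleftrightarrow> p \<notin> X"
proof
  assume "wf p" "Neg p \<in> X"
  then show "p \<notin> X"
    using X_con[of "[Neg p, p]"] D_hyp[of p "[Neg p, p]"] D_hyp[of "Neg p" "[Neg p, p]"] D_impE
    unfolding Neg_def wf_def by fastforce
qed (use X_complete in blast)

lemma X_Imp:
  assumes "wf (Imp p q)"
  shows "Imp p q \<in> X \<longleftrightarrow> (p \<in> X \<longrightarrow> q \<in> X)"
proof -
  have wf: "wf p" "wf q" using assms by (auto simp: wf_def)
  have "q \<in> X" if "Imp p q \<in> X" "p \<in> X"
    by (rule X_D[OF D_impE[OF D_hyp D_hyp], of p q "[Imp p q, p]"]) (use that assms wf in auto)
  moreover have "Imp p q \<in> X" if "q \<in> X"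
    by (rule X_D[OF D_impI[OF _ D_hyp], of p q "[q]"]) (use that assms wf in auto)
  moreover have "Imp p q \<in> X" if "p \<notin> X"
  proof (rule X_D[OF D_impI, of p "[Neg p]" q])
    have "D [Neg q, p, Neg p] Falsum"
      using D_hyp[of p "[Neg q, p, Neg p]"] D_hyp[of "Neg p" "[Neg q, p, Neg p]"] D_impE wf(1) wf_Neg[of p]
      unfolding Neg_def by fastforce
    then show "D [p, Neg p] q" using D_raa wf(2) by blast
  qed (use that assms wf X_Neg in auto)
  ultimately show ?thesis by blast
qed

lemma X_Forall:
  assumes "wf (Forall s q)"
  shows "Forall s q \<in> X \<longleftrightarrow> (\<forall>t. st t s \<longrightarrow> subst0 t q \<in> X)"
proof -
  obtain n where n: "wff \<sigma> (s # G n) q" using assms by (auto simp: wf_def)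
  have wf: "wf (subst0 t q)" if t: "st t s" for t
  proof -
    obtain m where "has_sort \<sigma> (G m) t s" using t by (auto simp: st_def)
    then have "wff \<sigma> (G (max n m)) (subst0 t q)"
      by (intro wff_subst0[OF n sort_mono]) auto
    then show ?thesis by (auto simp: wf_def)
  qed
  show ?thesis
  proof
    assume "Forall s q \<in> X"
    moreover from this have "D [Forall s q] (subst0 t q)" if "st t s" for t
      by (intro D_forallE[OF D_hyp that] assms) simp
    ultimately show "\<forall>t. st t s \<longrightarrow> subst0 t q \<in> X"
      using wf X_D[of "[Forall s q]"] by simp
  next
    assume *: "\<forall>t. st t s \<longrightarrow> subst0 t q \<in> X"
    show "Forall s q \<in> X"
    proof (rule ccontr)
      let ?p = "Neg (Forall s q)" let ?k = "to_nat (Neg (Forall s q))"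
      assume "Forall s q \<notin> X"
      then have p: "?p \<in> X" using X_complete[OF assms] by blast
      obtain l where "?p \<in> set (S l)" using p by (auto simp: X_def)
      then have "set (?p # S ?k) \<subseteq> set (S (max l ?k))"
        using S_mono[of l "max l ?k"] S_mono[of ?k "max l ?k"] by auto
      then have "con (?p # S ?k)" using S_inv D_weaken unfolding con_def by blast
      \<comment> \<open>At the stage of its code, the negated universal formula is consistent with
        what has been collected, so a counterexample enters along with it.\<close>
      then have "Neg (subst0 (Var (fresh s (?p # S ?k))) q) \<in> set (S (Suc ?k))"
        using X_wf[OF p] by (simp add: Let_def witness_Neg_Forall)
      then have "Neg (subst0 (Var (fresh s (?p # S ?k))) q) \<in> X" unfolding X_def by blast
      moreover have "\<Delta> (fresh s (?p # S ?k)) = s"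
        using fresh[of "?p # S ?k"] S_inv[of ?k] X_wf[OF p] by auto
      then have "st (Var (fresh s (?p # S ?k))) s"
        by (auto simp: st_def)
      ultimately show False using * X_Neg wf by blast
    qed
  qed
qed

section \<open>Equality in the maximal set and the term model\<close>

lemma X_eqE:
  assumes "Eq s t u \<in> X" "wff \<sigma> (s # G k) p" "subst0 t p \<in> X" "st u s"
  shows "subst0 u p \<in> X"
proof (rule X_D)
  show "D [Eq s t u, subst0 t p] (subst0 u p)"
    by (rule D_eqE[OF D_hyp assms(2) D_hyp]) (use assms X_wf in auto)
  obtain m where "has_sort \<sigma> (G m) u s" using assms(4) by (auto simp: st_def)
  then have "wff \<sigma> (G (max k m)) (subst0 u p)"
    by (intro wff_subst0[OF assms(2) sort_mono]) auto
  then show "wf (subst0 u p)" by (auto simp: wf_def)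
qed (use assms in auto)

lemma X_eqI: "st t s \<Longrightarrow> Eq s t t \<in> X"
  by (rule X_D[OF D_eqI, of _ _ "[]"]) (auto simp: wf_def st_def)


lemma st_common: "\<forall>i<k::nat. st (\<eta> i) (f i) \<Longrightarrow> \<exists>n. \<forall>i<k. has_sort \<sigma> (G n) (\<eta> i) (f i)"
proof (induction k)
  case (Suc k)
  then obtain n m where n: "\<forall>i<k. has_sort \<sigma> (G n) (\<eta> i) (f i)" and m: "has_sort \<sigma> (G m) (\<eta> k) (f k)"
    by (auto simp: st_def)
  have "\<forall>i<Suc k. has_sort \<sigma> (G (max n m)) (\<eta> i) (f i)"
    using sort_mono[OF m, of "max n m"] sort_mono[of n _ _ "max n m"] n by (auto simp: less_Suc_eq)
  then show ?case by blast
qed simp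

lemma wf_subst:
  assumes "wff \<sigma> \<Gamma> p" "\<forall>i<length \<Gamma>. st (\<eta> i) (\<Gamma> ! i)"
  shows "wf (subst \<eta> p)"
proof -
  obtain n where "sorted_subst \<sigma> \<Gamma> (G n) \<eta>"
    using st_common[OF assms(2)] by (auto simp: sorted_subst_def)
  then show ?thesis using wff_subst[OF assms(1)] by (auto simp: wf_def)
qed

text \<open>The rule \<open>eqE\<close> replaces one variable only, so \<eta> is turned into \<zeta>
  one position after the other.\<close>

lemma X_subst_eq:
  assumes p: "wff \<sigma> \<Gamma> p"
    and eq: "\<forall>i<length \<Gamma>. st (\<eta> i) (\<Gamma> ! i) \<and> st (\<zeta> i) (\<Gamma> ! i) \<and> Eq (\<Gamma> ! i) (\<eta> i) (\<zeta> i) \<in> X"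
    and "subst \<eta> p \<in> X"
  shows "subst \<zeta> p \<in> X"
proof -
  have "subst (\<lambda>i. if i < k then \<zeta> i else \<eta> i) p \<in> X" if "k \<le> length \<Gamma>" for k
    using that
  proof (induction k)
    case 0
    then show ?case using assms(3) by simp
  next
    case (Suc k)
    define \<theta> where "\<theta> i = (if i < k then \<zeta> i else \<eta> i)" for i
    \<comment> \<open>Position \<open>k\<close> is opened as the variable that \<open>eqE\<close>
      replaces; the terms at the other positions are shifted past it.\<close>
    define \<theta>' where "\<theta>' i = (if i = k then Var 0 else subst_trm (\<lambda>j. Var (Suc j)) (\<theta> i))" for i
    have k: "k < length \<Gamma>" using Suc.prems by simp
    have "\<forall>i<length \<Gamma>. st (\<theta> i) (\<Gamma> ! i)" using eq by (auto simp: \<theta>_def)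
    then obtain n where "\<forall>i<length \<Gamma>. has_sort \<sigma> (G n) (\<theta> i) (\<Gamma> ! i)" using st_common by blast
    then have "sorted_subst \<sigma> \<Gamma> (\<Gamma> ! k # G n) \<theta>'"
      by (auto simp: sorted_subst_def \<theta>'_def has_sort_lift)
    then have wff: "wff \<sigma> (\<Gamma> ! k # G n) (subst \<theta>' p)" by (rule wff_subst[OF p])
    have *: "subst0 t (subst \<theta>' p) = subst (\<lambda>i. if i = k then t else \<theta> i) p" for t
    proof -
      have "(\<lambda>i. subst_trm (case_nat t Var) (\<theta>' i)) = (\<lambda>i. if i = k then t else \<theta> i)"
        by (rule ext) (simp add: \<theta>'_def subst_trm_subst_trm)
      then show ?thesis by (simp add: subst0_def subst_subst)
    qed
    have "(\<lambda>i. if i = k then \<eta> k else \<theta> i) = \<theta>" by (rule ext) (simp add: \<theta>_def)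
    moreover have "subst \<theta> p \<in> X" using Suc unfolding \<theta>_def by simp
    ultimately have "subst0 (\<eta> k) (subst \<theta>' p) \<in> X" using * by simp
    then have "subst0 (\<zeta> k) (subst \<theta>' p) \<in> X"
      using X_eqE[OF _ wff, of "\<eta> k" "\<zeta> k"] eq k by blast
    moreover have "(\<lambda>i. if i = k then \<zeta> k else \<theta> i) = (\<lambda>i. if i < Suc k then \<zeta> i else \<eta> i)"
      by (rule ext) (auto simp: \<theta>_def less_Suc_eq)
    ultimately show ?case using * by simp
  qed
  then have "subst (\<lambda>i. if i < length \<Gamma> then \<zeta> i else \<eta> i) p \<in> X" by blast
  moreover have "subst (\<lambda>i. if i < length \<Gamma> then \<zeta> i else \<eta> i) p = subst \<zeta> p"
    by (rule subst_agree[OF p]) simp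
  ultimately show ?thesis by simp
qed

lemma X_sym:
  assumes "Eq s t u \<in> X" "st t s" "st u s"
  shows "Eq s u t \<in> X"
proof -
  have "subst (case_nat u (\<lambda>_. t)) (Eq s (Var 0) (Var 1)) \<in> X"
    by (rule X_subst_eq[of "[s, s]" _ "\<lambda>_. t"])
      (use assms in \<open>auto simp: X_eqI less_Suc_eq numeral_2_eq_2\<close>)
  then show ?thesis by simp
qed

lemma X_trans:
  assumes "Eq s t u \<in> X" "Eq s u v \<in> X" "st t s" "st u s" "st v s"
  shows "Eq s t v \<in> X"
proof -
  have "subst (case_nat t (\<lambda>_. v)) (Eq s (Var 0) (Var 1)) \<in> X"
    by (rule X_subst_eq[of "[s, s]" _ "case_nat t (\<lambda>_. u)"])
      (use assms in \<open>auto simp: X_eqI less_Suc_eq numeral_2_eq_2\<close>)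
  then show ?thesis by simp
qed

lemma map_nth_append: "length xs = n \<Longrightarrow> map ((!) (xs @ ys)) [0..<n] = xs"
    "length xs = n \<Longrightarrow> length ys = n \<Longrightarrow> map ((!) (xs @ ys)) [n..<n + n] = ys"
  by (auto simp: list_eq_iff_nth_eq nth_append)

text \<open>Congruence is the formula f(x) = f(y) in a doubled context: it holds by reflexivity when
  both halves are \<open>ts\<close>, and then the second half is replaced by
  \<open>us\<close>.\<close>

lemma X_Fn:
  assumes f: "fun_ar \<sigma> f = Some (ss, s)" and "list_all2 st ts ss" "list_all2 st us ss"
    and eq: "\<forall>i<length ss. Eq (ss ! i) (ts ! i) (us ! i) \<in> X"
  shows "Eq s (Fn f ts) (Fn f us) \<in> X"
proof -
  let ?n = "length ss"
  let ?p = "Eq s (Fn f (map Var [0..<?n])) (Fn f (map Var [?n..<?n + ?n]))"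
  have l: "length ts = ?n" "length us = ?n" and st: "\<forall>i<?n. st (ts ! i) (ss ! i) \<and> st (us ! i) (ss ! i)"
    using assms by (auto simp: list_all2_conv_all_nth)
  have wff: "wff \<sigma> (ss @ ss) ?p"
    using f by (auto simp: list_all2_conv_all_nth nth_append)
  have "subst (\<lambda>i. (ts @ us) ! i) ?p \<in> X"
  proof (rule X_subst_eq[OF wff, of "\<lambda>i. (ts @ ts) ! i"])
    show "\<forall>i<length (ss @ ss). st ((ts @ ts) ! i) ((ss @ ss) ! i) \<and>
        st ((ts @ us) ! i) ((ss @ ss) ! i) \<and> Eq ((ss @ ss) ! i) ((ts @ ts) ! i) ((ts @ us) ! i) \<in> X"
      using st eq l by (auto simp: nth_append X_eqI)
    obtain n where "\<forall>i<?n. has_sort \<sigma> (G n) (ts ! i) (ss ! i)" using st st_common by blast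
    then have "st (Fn f ts) s" using f l by (auto simp: st_def list_all2_conv_all_nth)
    then show "subst (\<lambda>i. (ts @ ts) ! i) ?p \<in> X"
      using l by (simp add: X_eqI comp_def map_nth_append)
  qed
  then show ?thesis using l by (simp add: comp_def map_nth_append)
qed

lemma X_Rel:
  assumes r: "rel_ar \<sigma> r = Some ss" and "list_all2 st ts ss" "list_all2 st us ss"
    and eq: "\<forall>i<length ss. Eq (ss ! i) (ts ! i) (us ! i) \<in> X" and "Rel r ts \<in> X"
  shows "Rel r us \<in> X"
proof -
  let ?p = "Rel r (map Var [0..<length ss])"
  have l: "length ts = length ss" "length us = length ss"
    and st: "\<forall>i<length ss. st (ts ! i) (ss ! i) \<and> st (us ! i) (ss ! i)"
    using assms by (auto simp: list_all2_conv_all_nth)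
  have wff: "wff \<sigma> ss ?p"
    using r by (auto simp: list_all2_conv_all_nth)
  have "subst (\<lambda>i. us ! i) ?p \<in> X"
    by (rule X_subst_eq[OF wff, of "\<lambda>i. ts ! i"])
      (use st eq l assms(5) map_nth[of ts] in \<open>auto simp: comp_def\<close>)
  then show ?thesis using l map_nth[of us] by (simp add: comp_def)
qed

text \<open>The least code of a term that \<open>X\<close> equates with \<open>t\<close> serves as
  the element. Thus equality of elements is true equality, and the elements are natural
  numbers.\<close>

definition rep :: "'s \<Rightarrow> 'f trm \<Rightarrow> nat" where
  "rep s t = (LEAST n. st (from_nat n) s \<and> Eq s t (from_nat n) \<in> X)"

abbreviation tm :: "nat \<Rightarrow> 'f trm" where "tm \<equiv> from_nat"

lemma rep: "st t s \<Longrightarrow> st (tm (rep s t)) s \<and> Eq s t (tm (rep s t)) \<in> X"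
  unfolding rep_def by (rule LeastI[of _ "to_nat t"]) (simp add: X_eqI)

lemma rep_eq:
  assumes "st t s" "st u s"
  shows "rep s t = rep s u \<longleftrightarrow> Eq s t u \<in> X"
proof
  assume "rep s t = rep s u"
  then show "Eq s t u \<in> X" using rep[OF assms(1)] rep[OF assms(2)] X_sym X_trans assms by metis
next
  assume *: "Eq s t u \<in> X"
  have "st v s \<and> Eq s t v \<in> X \<longleftrightarrow> st v s \<and> Eq s u v \<in> X" for v
    using * X_sym X_trans assms by blast
  then show "rep s t = rep s u" unfolding rep_def by presburger
qed

definition M :: "('s, 'f, 'r, nat) model" where
  "M = \<lparr>car = (\<lambda>s. {rep s t |t. st t s}),
        fn = (\<lambda>f ns. rep (snd (the (fun_ar \<sigma> f))) (Fn f (map tm ns))),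
        rl = (\<lambda>r ns. Rel r (map tm ns) \<in> X)\<rparr>"

lemma st_Fn:
  assumes "fun_ar \<sigma> f = Some (ss, s)" "list_all2 st ts ss"
  shows "st (Fn f ts) s"
proof -
  obtain n where "\<forall>i<length ss. has_sort \<sigma> (G n) (ts ! i) (ss ! i)"
    using assms(2) st_common[of "length ss" "\<lambda>i. ts ! i" "\<lambda>i. ss ! i"] by (auto simp: list_all2_conv_all_nth)
  then show ?thesis using assms by (auto simp: st_def list_all2_conv_all_nth)
qed

lemma teval_M:
  "has_sort \<sigma> \<Gamma> t s \<Longrightarrow> (\<forall>i<length \<Gamma>. st (\<eta> i) (\<Gamma> ! i) \<and> e i = rep (\<Gamma> ! i) (\<eta> i)) \<Longrightarrow>
    st (subst_trm \<eta> t) s \<and> teval M e t = rep s (subst_trm \<eta> t)"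
proof (induction rule: has_sort.induct)
  case (2 f ss s ts)
  let ?us = "map (subst_trm \<eta>) ts"
  have us: "list_all2 st ?us ss" and ns: "map (teval M e) ts = map2 rep ss ?us"
    using 2 by (auto simp: list_all2_conv_all_nth list_eq_iff_nth_eq)
  have st: "st (Fn f ?us) s" by (rule st_Fn[OF 2(1) us])
  have l: "length ts = length ss" using us by (auto simp: list_all2_conv_all_nth)
  have 1: "list_all2 st (map tm (map2 rep ss ?us)) ss"
    using us rep by (auto simp: list_all2_conv_all_nth)
  have "Eq s (Fn f ?us) (Fn f (map tm (map2 rep ss ?us))) \<in> X"
    by (rule X_Fn[OF 2(1) us 1]) (use us rep l in \<open>auto simp: list_all2_conv_all_nth\<close>)
  then have "rep s (Fn f (map tm (map2 rep ss ?us))) = rep s (Fn f ?us)"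
    using rep_eq[OF st st_Fn[OF 2(1) 1]] by simp
  then have "teval M e (Fn f ts) = rep s (Fn f ?us)"
    using 2(1) by (simp only: teval.simps ns) (simp add: M_def)
  then show ?case using st by simp
qed simp

text \<open>The truth lemma. Variables are evaluated at arbitrary terms \<eta>, because the carriers
  consist of the values of all terms.\<close>

lemma sat_M:
  "wff \<sigma> \<Gamma> p \<Longrightarrow> (\<forall>i<length \<Gamma>. st (\<eta> i) (\<Gamma> ! i) \<and> e i = rep (\<Gamma> ! i) (\<eta> i)) \<Longrightarrow>
    sat M e p \<longleftrightarrow> subst \<eta> p \<in> X"
proof (induction p arbitrary: \<Gamma> \<eta> e)
  case Falsum
  then show ?case by (simp add: X_Falsum)
next
  case (Eq s t u)
  then show ?case using teval_M[of \<Gamma> _ s \<eta> e] rep_eq[of _ s] by simp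
next
  case (Rel r ts)
  then obtain ss where r: "rel_ar \<sigma> r = Some ss" and ts: "list_all2 (has_sort \<sigma> \<Gamma>) ts ss" by auto
  let ?us = "map (subst_trm \<eta>) ts"
  have us: "list_all2 st ?us ss" and ns: "map (teval M e) ts = map2 rep ss ?us"
    using ts teval_M[OF _ Rel.prems(2)] by (auto simp: list_all2_conv_all_nth list_eq_iff_nth_eq)
  have l: "length ts = length ss" using us by (auto simp: list_all2_conv_all_nth)
  have 1: "list_all2 st (map tm (map2 rep ss ?us)) ss"
    using us rep by (auto simp: list_all2_conv_all_nth)
  have 2: "\<forall>i<length ss. Eq (ss ! i) (?us ! i) (map tm (map2 rep ss ?us) ! i) \<in> X"
    using us rep l by (auto simp: list_all2_conv_all_nth)
  then have 3: "\<forall>i<length ss. Eq (ss ! i) (map tm (map2 rep ss ?us) ! i) (?us ! i) \<in> X"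
    using us 1 X_sym by (auto simp: list_all2_conv_all_nth)
  have "sat M e (Rel r ts) \<longleftrightarrow> Rel r (map tm (map2 rep ss ?us)) \<in> X"
    by (simp only: sat.simps ns) (simp add: M_def)
  also have "\<dots> \<longleftrightarrow> Rel r ?us \<in> X"
    using X_Rel[OF r us 1 2] X_Rel[OF r 1 us 3] by blast
  finally show ?case by simp
next
  case (Imp p q)
  have "sat M e p \<longleftrightarrow> subst \<eta> p \<in> X" "sat M e q \<longleftrightarrow> subst \<eta> q \<in> X"
    using Imp.prems(1) by (intro Imp.IH[OF _ Imp.prems(2)]; simp)+
  moreover have "wf (subst \<eta> (Imp p q))" using Imp.prems by (intro wf_subst) auto
  ultimately show ?case by (simp add: X_Imp)
next
  case (Forall s p)
  have "sat M (case_nat (rep s t) e) p \<longleftrightarrow> subst0 t (subst (up \<eta>) p) \<in> X" if t: "st t s" for t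
  proof -
    have "(\<lambda>i. subst_trm (case_nat t Var) (up \<eta> i)) = case_nat t \<eta>"
      by (rule ext) (auto simp: up_def subst_trm_subst_trm split: nat.split)
    then have "subst0 t (subst (up \<eta>) p) = subst (case_nat t \<eta>) p"
      by (simp add: subst0_def subst_subst)
    moreover have "sat M (case_nat (rep s t) e) p \<longleftrightarrow> subst (case_nat t \<eta>) p \<in> X"
      by (rule Forall.IH[of "s # \<Gamma>"]) (use Forall.prems t in \<open>auto simp: less_Suc_eq_0_disj\<close>)
    ultimately show ?thesis by simp
  qed
  then have "sat M e (Forall s p) \<longleftrightarrow> (\<forall>t. st t s \<longrightarrow> subst0 t (subst (up \<eta>) p) \<in> X)"
    by (auto simp: M_def)
  moreover have "wf (subst \<eta> (Forall s p))" using Forall.prems by (intro wf_subst) auto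
  ultimately show ?case by (simp add: X_Forall)
qed

lemma sat_M_closed: "wff \<sigma> [] p \<Longrightarrow> sat M e p \<longleftrightarrow> p \<in> X"
  using sat_M[of "[]" p Var e] by simp

lemma M_axioms: "p \<in> T \<Longrightarrow> wff \<sigma> [] p \<Longrightarrow> sat M e p"
  using X_D[OF D_ax, of p "[]"] sat_M_closed wff_closed[of \<sigma> p "G 0"] by (auto simp: wf_def)

lemma M_not: "\<not> sat M e p0"
proof -
  have "Neg p0 \<in> X" unfolding X_def by (rule UN_I[of 0]) auto
  then show ?thesis using X_Neg[of p0] sat_M_closed[OF p0_wff] wff_closed[OF p0_wff] by (auto simp: wf_def)
qed

end

text \<open>Ill-formed members of \<open>T\<close> are ignored, in accordance with the rule
  \<open>ax\<close>, which cannot use them.\<close>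

definition is_model :: "('s, 'f, 'r) signature \<Rightarrow> ('s, 'f, 'r) fm set \<Rightarrow> ('s, 'f, 'r, 'a) model \<Rightarrow> bool" where
  "is_model \<sigma> T M \<longleftrightarrow> (\<forall>s. car M s \<noteq> {}) \<and>
    (\<forall>f ss s xs. fun_ar \<sigma> f = Some (ss, s) \<longrightarrow> list_all2 (\<lambda>x s. x \<in> car M s) xs ss \<longrightarrow> fn M f xs \<in> car M s) \<and>
    (\<forall>p\<in>T. wff \<sigma> [] p \<longrightarrow> (\<forall>e. sat M e p))"

lemma completeness:
  fixes \<sigma> :: "('s::countable, 'f::countable, 'r::countable) signature"
  assumes p: "wff \<sigma> [] p"
    and models: "\<And>M :: ('s, 'f, 'r, nat) model. is_model \<sigma> T M \<Longrightarrow> \<exists>e. sat M e p"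
  shows "proves \<sigma> T p"
proof (rule ccontr)
  \<comment> \<open>Decoding pairs lists every sort infinitely often, which yields fresh variables
    of each sort beyond any bound.\<close>
  define \<Delta> :: "nat \<Rightarrow> 's" where "\<Delta> n = from_nat (fst (prod_decode n))" for n
  assume "\<not> proves \<sigma> T p"
  moreover have "\<exists>m\<ge>n. \<Delta> m = s" for n s
  proof (intro exI conjI)
    show "n \<le> prod_encode (to_nat s, n)" by (rule le_prod_encode_2)
    show "\<Delta> (prod_encode (to_nat s, n)) = s" by (simp add: \<Delta>_def)
  qed
  ultimately interpret henkin \<sigma> T \<Delta> p
    using p by unfold_locales (auto simp: proves_def)
  have "car M s \<noteq> {}" for s
  proof -
    obtain m where "\<Delta> m = s" using inf_sort by blast
    then have "st (Var m) s" by (auto simp: st_def intro: exI[of _ "Suc m"])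
    then show ?thesis by (auto simp: M_def)
  qed
  moreover have "fn M f xs \<in> car M s"
    if f: "fun_ar \<sigma> f = Some (ss, s)" and xs: "list_all2 (\<lambda>x s. x \<in> car M s) xs ss" for f ss s xs
  proof -
    have "list_all2 st (map tm xs) ss"
      using xs rep by (auto simp: list_all2_conv_all_nth M_def)
    then have "st (Fn f (map tm xs)) s" by (rule st_Fn[OF f])
    then show ?thesis using f by (auto simp: M_def)
  qed
  ultimately have "is_model \<sigma> T M"
    unfolding is_model_def using M_axioms by blast
  then show False using models M_not by blast
qed

text \<open>The infinite carriers are enumerated sort by sort and the model is transported along the
  enumerations. Afterwards quantifiers are unrestricted and all sorts have the same
  elements.\<close>

lemma completeness_UNIV:
  fixes \<sigma> :: "('s::countable, 'f::countable, 'r::countable) signature"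
  assumes p: "wff \<sigma> [] p"
    and infinite: "\<And>(M :: ('s, 'f, 'r, nat) model) s. is_model \<sigma> T M \<Longrightarrow> infinite (car M s)"
    and models: "\<And>M :: ('s, 'f, 'r, nat) model. is_model \<sigma> T M \<Longrightarrow> (\<And>s. car M s = UNIV) \<Longrightarrow> \<exists>e. sat M e p"
  shows "proves \<sigma> T p"
proof (rule completeness[OF p])
  fix M :: "('s, 'f, 'r, nat) model"
  assume M: "is_model \<sigma> T M"
  define b where "b s = enumerate (car M s)" for s
  have b: "bij_betw (b s) UNIV (car M s)" for s
    unfolding b_def by (rule bij_enumerate[OF infinite[OF M]])
  define N :: "('s, 'f, 'r, nat) model" where
    "N = \<lparr>car = (\<lambda>_. UNIV),
      fn = (\<lambda>f xs. let (ss, s) = the (fun_ar \<sigma> f) in inv_into UNIV (b s) (fn M f (map2 b ss xs))),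
      rl = (\<lambda>r xs. rl M r (map2 b (the (rel_ar \<sigma> r)) xs))\<rparr>"
  have teval: "has_sort \<sigma> \<Gamma> t s \<Longrightarrow> \<forall>i<length \<Gamma>. e i = b (\<Gamma> ! i) (e' i) \<Longrightarrow> teval M e t = b s (teval N e' t)"
    for \<Gamma> t s e e'
  proof (induction rule: has_sort.induct)
    case (2 f ss s ts)
    then have *: "map (teval M e) ts = map2 b ss (map (teval N e') ts)"
      by (auto simp: list_all2_conv_all_nth list_eq_iff_nth_eq)
    have "list_all2 (\<lambda>x s. x \<in> car M s) (map2 b ss (map (teval N e') ts)) ss"
      using 2(2) b by (auto simp: list_all2_conv_all_nth bij_betw_def)
    then have "fn M f (map2 b ss (map (teval N e') ts)) \<in> car M s"
      using M 2(1) by (auto simp: is_model_def)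
    then have "b s (inv_into UNIV (b s) (fn M f (map2 b ss (map (teval N e') ts)))) =
        fn M f (map2 b ss (map (teval N e') ts))"
      using b[of s] by (auto simp: bij_betw_def f_inv_into_f)
    then show ?case using 2(1) by (simp only: teval.simps *) (simp add: N_def)
  qed simp
  have sat: "wff \<sigma> \<Gamma> p \<Longrightarrow> \<forall>i<length \<Gamma>. e i = b (\<Gamma> ! i) (e' i) \<Longrightarrow> sat M e p \<longleftrightarrow> sat N e' p"
    for \<Gamma> p e e'
  proof (induction p arbitrary: \<Gamma> e e')
    case (Eq s t u)
    then have "teval M e t = b s (teval N e' t)" "teval M e u = b s (teval N e' u)"
      using teval[of \<Gamma> _ s e e'] by auto
    then show ?case using b[of s] by (simp add: bij_betw_def inj_eq)
  next
    case (Rel r ts)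
    then obtain ss where r: "rel_ar \<sigma> r = Some ss" and ts: "list_all2 (has_sort \<sigma> \<Gamma>) ts ss" by auto
    have *: "map (teval M e) ts = map2 b ss (map (teval N e') ts)"
      using ts teval[OF _ Rel.prems(2)] by (auto simp: list_all2_conv_all_nth list_eq_iff_nth_eq)
    show ?case using r by (simp only: sat.simps *) (simp add: N_def)
  next
    case (Imp p q)
    have "sat M e p \<longleftrightarrow> sat N e' p" "sat M e q \<longleftrightarrow> sat N e' q"
      using Imp.prems(1) by (intro Imp.IH[OF _ Imp.prems(2)]; simp)+
    then show ?case by simp
  next
    case (Forall s p)
    have "sat M (case_nat (b s a) e) p \<longleftrightarrow> sat N (case_nat a e') p" for a
      by (rule Forall.IH[of "s # \<Gamma>"]) (use Forall.prems in \<open>auto simp: less_Suc_eq_0_disj\<close>)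
    moreover have "car M s = range (b s)" using b[of s] by (simp add: bij_betw_def)
    ultimately show ?case by (simp add: N_def)
  qed simp
  have closed: "wff \<sigma> [] q \<Longrightarrow> sat M e q \<longleftrightarrow> sat N e' q" for q e e'
    using sat[of "[]" q e e'] by simp
  have "is_model \<sigma> T N"
  proof -
    have "car N s = UNIV" for s by (simp add: N_def)
    moreover have "\<forall>p\<in>T. wff \<sigma> [] p \<longrightarrow> (\<forall>e. sat N e p)"
      using M closed unfolding is_model_def by blast
    ultimately show ?thesis by (simp add: is_model_def)
  qed
  then obtain e where "sat N e p" using models[of N] by (auto simp: N_def)
  then show "\<exists>e. sat M e p" using closed[OF p] by blast
qed

section \<open>One-dimensional interpretations with absolute equality\<close>

text \<open>\<open>Foralls\<close> binds the head of its list innermost, so a tuple of values goes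
  in front of the environment in its own order.\<close>

definition app_env :: "'a list \<Rightarrow> (nat \<Rightarrow> 'a) \<Rightarrow> nat \<Rightarrow> 'a" where
  "app_env xs e i = (if i < length xs then xs ! i else e (i - length xs))"

lemma app_env_Nil [simp]: "app_env [] e = e"
  by (rule ext) (simp add: app_env_def)

lemma app_env_Cons: "app_env (x # xs) e = case_nat x (app_env xs e)"
  by (rule ext) (auto simp: app_env_def nth_Cons split: nat.split)

lemma app_env_less [simp]: "i < length xs \<Longrightarrow> app_env xs e i = xs ! i"
  and app_env_add [simp]: "length xs = n \<Longrightarrow> app_env xs e (i + n) = e i"
  by (auto simp: app_env_def)

lemma all_length_1: "(\<forall>xs. length xs = Suc 0 \<longrightarrow> P xs) \<longleftrightarrow> (\<forall>x. P [x])"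
  by (auto simp: length_Suc_conv)

lemma ex_length_1: "(\<exists>xs. length xs = Suc 0 \<and> P xs) \<longleftrightarrow> (\<exists>x. P [x])"
  by (auto simp: length_Suc_conv)

definition univ :: "('s, 'f, 'r, 'a) model \<Rightarrow> bool" where
  "univ M \<longleftrightarrow> (\<forall>s. car M s = UNIV)"

lemma univ_car [simp]: "univ M \<Longrightarrow> car M s = UNIV"
  by (simp add: univ_def)

lemma sat_Foralls:
  "univ M \<Longrightarrow> sat M e (Foralls ss p) \<longleftrightarrow> (\<forall>xs. length xs = length ss \<longrightarrow> sat M (app_env xs e) p)"
proof (induction ss arbitrary: p)
  case (Cons s ss)
  have "sat M e (Foralls (s # ss) p) \<longleftrightarrow> sat M e (Foralls ss (Forall s p))"
    by (simp add: Foralls_def)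
  also have "\<dots> \<longleftrightarrow> (\<forall>xs. length xs = length ss \<longrightarrow> (\<forall>x. sat M (app_env (x # xs) e) p))"
    using Cons by (simp add: app_env_Cons)
  also have "\<dots> \<longleftrightarrow> (\<forall>xs. length xs = length (s # ss) \<longrightarrow> sat M (app_env xs e) p)"
    by (metis length_Cons length_Suc_conv)
  finally show ?case .
qed (simp add: Foralls_def)

lemma sat_Existss:
  "univ M \<Longrightarrow> sat M e (Existss ss p) \<longleftrightarrow> (\<exists>xs. length xs = length ss \<and> sat M (app_env xs e) p)"
proof (induction ss arbitrary: p)
  case (Cons s ss)
  have "sat M e (Existss (s # ss) p) \<longleftrightarrow> sat M e (Existss ss (Exists s p))"
    by (simp add: Existss_def)
  also have "\<dots> \<longleftrightarrow> (\<exists>xs. length xs = length ss \<and> (\<exists>x. sat M (app_env (x # xs) e) p))"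
    using Cons by (simp add: app_env_Cons)
  also have "\<dots> \<longleftrightarrow> (\<exists>xs. length xs = length (s # ss) \<and> sat M (app_env xs e) p)"
    by (metis length_Cons length_Suc_conv)
  finally show ?case .
qed (simp add: Existss_def)

lemma wff_Foralls [simp]: "wff \<sigma> \<Gamma> (Foralls ss p) \<longleftrightarrow> wff \<sigma> (ss @ \<Gamma>) p"
proof (induction ss arbitrary: p)
  case (Cons s ss)
  have "Foralls (s # ss) p = Foralls ss (Forall s p)" by (simp add: Foralls_def)
  then show ?case using Cons by simp
qed (simp add: Foralls_def)

lemma wff_Existss [simp]: "wff \<sigma> \<Gamma> (Existss ss p) \<longleftrightarrow> wff \<sigma> (ss @ \<Gamma>) p"
proof (induction ss arbitrary: p)
  case (Cons s ss)
  have "Existss (s # ss) p = Existss ss (Exists s p)" by (simp add: Existss_def)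
  then show ?case using Cons by simp
qed (simp add: Existss_def)

text \<open>The layout when every tuple has length one: block \<open>k\<close> is variable
  \<open>k\<close>.\<close>

definition sing :: "nat \<Rightarrow> nat list list" where
  "sing n = map (\<lambda>k. [k]) [0..<n]"

lemma length_sing [simp]: "length (sing n) = n"
  and nth_sing [simp]: "k < n \<Longrightarrow> sing n ! k = [k]"
  and concat_sing [simp]: "concat (sing n) = [0..<n]"
  by (auto simp: sing_def concat_map_singleton[of "\<lambda>k. k", simplified])

lemma shift_sing [simp]: "shift (sing n) ys = map (\<lambda>y. y + n) ys"
  by (simp add: shift_def)

definition flat :: "('s, 'f, 'r) domain list \<Rightarrow> bool" where
  "flat ds \<longleftrightarrow> (\<forall>d\<in>set ds. length (fst d) = 1)"

lemma blocks_ones: "(\<forall>k\<in>set ks. k = 1) \<Longrightarrow> blocks n ks = map (\<lambda>k. [k]) [n..<n + length ks]"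
proof (induction ks arbitrary: n)
  case (Cons k ks)
  have "[n..<n + length (k # ks)] = n # [Suc n..<Suc n + length ks]"
    by (subst upt_conv_Cons) auto
  then show ?case using Cons by simp
qed simp

lemma layout_flat: "flat ds \<Longrightarrow> layout ds = sing (length ds)"
  unfolding layout_def flat_def sing_def by (subst blocks_ones) auto

lemma concat_flat: "flat ds \<Longrightarrow> concat (map fst ds) = map (\<lambda>d. hd (fst d)) ds"
proof (induction ds)
  case (Cons d ds)
  then show ?case by (cases "fst d") (auto simp: flat_def)
qed simp

lemma length_concat_flat: "flat ds \<Longrightarrow> length (concat (map fst ds)) = length ds"
  by (simp add: concat_flat)

text \<open>Domain formulas that hold everywhere turn relativised quantifiers into plain
  ones.\<close>

definition true_doms :: "('s, 'f, 'r, 'a) model \<Rightarrow> ('s, 'f, 'r) domain list \<Rightarrow> bool" where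
  "true_doms N ds \<longleftrightarrow> (\<forall>d\<in>set ds. \<forall>e. sat N e (snd d))"

lemma sat_in_doms: "true_doms N ds \<Longrightarrow> sat N e (in_doms ds)"
  unfolding in_doms_def true_doms_def by (fastforce simp: sat_inst dest: set_zip_leftD)

lemma sat_all_in:
  "univ N \<Longrightarrow> flat ds \<Longrightarrow> true_doms N ds \<Longrightarrow>
    sat N e (all_in ds F) \<longleftrightarrow> (\<forall>xs. length xs = length ds \<longrightarrow> sat N (app_env xs e) (F (sing (length ds))))"
  by (simp add: all_in_def sat_Foralls sat_in_doms layout_flat length_concat_flat)

lemma sat_ex_in:
  "univ N \<Longrightarrow> flat ds \<Longrightarrow> true_doms N ds \<Longrightarrow>
    sat N e (ex_in ds F) \<longleftrightarrow> (\<exists>xs. length xs = length ds \<and> sat N (app_env xs e) (F (sing (length ds))))"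
  by (simp add: ex_in_def sat_Existss sat_in_doms layout_flat length_concat_flat)

definition wf_doms :: "('s, 'f, 'r) signature \<Rightarrow> ('s, 'f, 'r) domain list \<Rightarrow> bool" where
  "wf_doms \<sigma> ds \<longleftrightarrow> (\<forall>d\<in>set ds. wff \<sigma> (fst d) (snd d))"

lemma wff_in_doms:
  assumes "flat ds" "wf_doms \<sigma> ds"
  shows "wff \<sigma> (map (\<lambda>d. hd (fst d)) ds @ \<Gamma>) (in_doms ds)"
proof -
  have "wff \<sigma> (map (\<lambda>d. hd (fst d)) ds @ \<Gamma>) (inst (snd (ds ! k)) [k])" if k: "k < length ds" for k
  proof (rule wff_inst)
    have "ds ! k \<in> set ds" using k by simp
    then have "wff \<sigma> (fst (ds ! k)) (snd (ds ! k))" "length (fst (ds ! k)) = 1"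
      using assms by (auto simp: flat_def wf_doms_def)
    then show "wff \<sigma> [hd (fst (ds ! k))] (snd (ds ! k))"
      by (cases "fst (ds ! k)") auto
  qed (use k in \<open>auto simp: nth_append\<close>)
  then show ?thesis
    using assms by (auto simp: in_doms_def layout_flat set_zip) (metis snd_conv)
qed

lemma wff_all_in:
  "flat ds \<Longrightarrow> wf_doms \<sigma> ds \<Longrightarrow> wff \<sigma> \<Gamma> (all_in ds F) \<longleftrightarrow> wff \<sigma> (map (\<lambda>d. hd (fst d)) ds @ \<Gamma>) (F (sing (length ds)))"
  by (simp add: all_in_def layout_flat concat_flat wff_in_doms)

lemma wff_ex_in:
  "flat ds \<Longrightarrow> wf_doms \<sigma> ds \<Longrightarrow> wff \<sigma> \<Gamma> (ex_in ds F) \<longleftrightarrow> wff \<sigma> (map (\<lambda>d. hd (fst d)) ds @ \<Gamma>) (F (sing (length ds)))"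
  by (simp add: ex_in_def layout_flat concat_flat wff_in_doms)

subsection \<open>Semantics of the translation\<close>

definition flat_interp ::
  "('s1, 'f1, 'r1) signature \<Rightarrow> ('s2, 'f2, 'r2) signature \<Rightarrow> ('s1, 'f1, 'r1, 's2, 'f2, 'r2) interp \<Rightarrow> bool" where
  "flat_interp \<sigma>1 \<sigma>2 I \<longleftrightarrow> wf_interp \<sigma>1 \<sigma>2 I \<and> (\<forall>s. length (dims I s) = 1)"

abbreviation dim :: "('s1, 'f1, 'r1, 's2, 'f2, 'r2) interp \<Rightarrow> 's1 \<Rightarrow> 's2" where
  "dim I s \<equiv> hd (dims I s)"

lemma dims_flat: "flat_interp \<sigma>1 \<sigma>2 I \<Longrightarrow> dims I s = [dim I s]"
proof -
  assume "flat_interp \<sigma>1 \<sigma>2 I"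
  then have "length (dims I s) = 1" by (simp add: flat_interp_def)
  then show ?thesis by (cases "dims I s") auto
qed

lemma ctx_flat: "flat_interp \<sigma>1 \<sigma>2 I \<Longrightarrow> ctx I ss = map (dim I) ss"
proof (induction ss)
  case (Cons s ss)
  have "ctx I (s # ss) = dims I s @ ctx I ss" by (simp add: ctx_def)
  then show ?case using Cons dims_flat[OF Cons.prems, of s] by (metis append_Cons append_Nil list.map(2))
qed (simp add: ctx_def)

lemma flat_dm [simp]: "flat_interp \<sigma>1 \<sigma>2 I \<Longrightarrow> flat (map (dm I) ss)"
  by (auto simp: flat_def dm_def flat_interp_def)

lemma wf_doms_dm [simp]: "flat_interp \<sigma>1 \<sigma>2 I \<Longrightarrow> wf_doms \<sigma>2 (map (dm I) ss)"
  by (auto simp: wf_doms_def dm_def flat_interp_def wf_interp_def ctx_def)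

lemma map_hd_dm [simp]: "map (\<lambda>d. hd (fst d)) (map (dm I) ss) = map (dim I) ss"
  by (simp add: dm_def)

text \<open>\<open>interp_sem \<sigma>1 I N M\<close>: inside \<open>N\<close>, the interpretation \<open>I\<close> defines the structure \<open>M\<close>.\<close>

definition interp_sem ::
  "('s1, 'f1, 'r1) signature \<Rightarrow> ('s1, 'f1, 'r1, 's2, 'f2, 'r2) interp \<Rightarrow> ('s2, 'f2, 'r2, 'a) model
    \<Rightarrow> ('s1, 'f1, 'r1, 'a) model \<Rightarrow> bool" where
  "interp_sem \<sigma>1 I N M \<longleftrightarrow> univ N \<and> univ M \<and>
    (\<forall>s e. sat N e (dom I s)) \<and> (\<forall>s e. sat N e (eqv I s) \<longleftrightarrow> e 0 = e 1) \<and>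
    (\<forall>f ss s e. fun_ar \<sigma>1 f = Some (ss, s) \<longrightarrow>
      (sat N e (fun_int I f) \<longleftrightarrow> e (length ss) = fn M f (map e [0..<length ss]))) \<and>
    (\<forall>r ss e. rel_ar \<sigma>1 r = Some ss \<longrightarrow> (sat N e (rel_int I r) \<longleftrightarrow> rl M r (map e [0..<length ss])))"

lemma true_doms_dm: "interp_sem \<sigma>1 I N M \<Longrightarrow> true_doms N (map (dm I) ss)"
  by (auto simp: true_doms_def dm_def interp_sem_def)

context
  fixes \<sigma>1 :: "('s1, 'f1, 'r1) signature" and \<sigma>2 :: "('s2, 'f2, 'r2) signature"
    and I :: "('s1, 'f1, 'r1, 's2, 'f2, 'r2) interp"
  assumes I: "flat_interp \<sigma>1 \<sigma>2 I"
begin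

text \<open>By \<open>g\<close>, the formula \<open>gs ! k\<close> pins its tuple down to the value
  \<open>w k\<close>, so the existential quantifiers have exactly one witness and can be
  evaluated.\<close>

lemma sat_unnest:
  assumes NM: "interp_sem \<sigma>1 I N M" and l: "length gs = length ss" and n: "n = length ss"
    and g: "\<And>k xs. k < n \<Longrightarrow> length xs = n \<Longrightarrow>
      sat N (app_env xs e) ((gs ! k) (ss ! k) (\<lambda>i. map (\<lambda>y. y + n) (\<rho> i)) [k]) \<longleftrightarrow> xs ! k = w k"
  shows "sat N e (unnest I ss gs \<rho> F) \<longleftrightarrow> sat N (app_env (map w [0..<n]) e) (F (sing n))"
proof -
  have N: "univ N" using NM by (simp add: interp_sem_def)
  have *: "(\<forall>p\<in>set (map (\<lambda>(g, s, zs). g s (\<lambda>i. shift (sing n) (\<rho> i)) zs) (zip gs (zip ss (sing n)))). sat N e' p) \<longleftrightarrow>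
      (\<forall>k<n. sat N e' ((gs ! k) (ss ! k) (\<lambda>i. map (\<lambda>y. y + n) (\<rho> i)) [k]))" for e'
    by (simp add: all_set_conv_all_nth l n)
  have "sat N e (unnest I ss gs \<rho> F) \<longleftrightarrow> (\<exists>xs. length xs = n \<and>
      (\<forall>k<n. sat N (app_env xs e) ((gs ! k) (ss ! k) (\<lambda>i. map (\<lambda>y. y + n) (\<rho> i)) [k])) \<and>
      sat N (app_env xs e) (F (sing n)))"
    unfolding unnest_def sat_ex_in[OF N flat_dm[OF I] true_doms_dm[OF NM]]
    by (simp only: length_map sat_And sat_Conj * n[symmetric] conj_assoc)
  also have "\<dots> \<longleftrightarrow> (\<exists>xs. length xs = n \<and> (\<forall>k<n. xs ! k = w k) \<and> sat N (app_env xs e) (F (sing n)))"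
    using g by blast
  also have "\<dots> \<longleftrightarrow> (\<exists>xs. xs = map w [0..<n] \<and> sat N (app_env xs e) (F (sing n)))"
  proof (rule ex_cong1)
    fix xs
    have "xs = map w [0..<n] \<longleftrightarrow> length xs = n \<and> (\<forall>k<n. xs ! k = w k)"
      by (auto intro: nth_equalityI)
    then show "length xs = n \<and> (\<forall>k<n. xs ! k = w k) \<and> sat N (app_env xs e) (F (sing n)) \<longleftrightarrow>
        xs = map w [0..<n] \<and> sat N (app_env xs e) (F (sing n))"
      by blast
  qed
  finally show ?thesis by simp
qed

lemma sat_tr_trm:
  assumes NM: "interp_sem \<sigma>1 I N M"
  shows "has_sort \<sigma>1 \<Gamma> t s \<Longrightarrow> (\<forall>i<length \<Gamma>. \<rho> i = [v i]) \<Longrightarrow>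
    sat N e (tr_trm \<sigma>1 I t s \<rho> [y]) \<longleftrightarrow> e y = teval M (\<lambda>i. e (v i)) t"
proof (induction arbitrary: \<rho> v e y rule: has_sort.induct)
  case (1 i)
  then show ?case using NM by (auto simp: sat_inst interp_sem_def)
next
  case (2 f ss s ts)
  let ?n = "length ss"
  let ?w = "\<lambda>k. teval M (\<lambda>i. e (v i)) (ts ! k)"
  have l: "length ts = ?n" using 2 by (auto simp: list_all2_conv_all_nth)
  have "sat N e (tr_trm \<sigma>1 I (Fn f ts) s \<rho> [y]) \<longleftrightarrow>
      sat N (app_env (map ?w [0..<?n]) e) (inst (fun_int I f) ([0..<?n] @ [y + ?n]))"
    unfolding tr_trm.simps 2(1) option.sel fst_conv
  proof (subst sat_unnest[OF NM _ refl, of _ _ _ _ ?w])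
    fix k :: nat and xs :: "'a list"
    assume k: "k < ?n" "length xs = ?n"
    have "sat N (app_env xs e) (tr_trm \<sigma>1 I (ts ! k) (ss ! k) (\<lambda>i. map (\<lambda>y. y + ?n) (\<rho> i)) [k]) \<longleftrightarrow>
      app_env xs e k = teval M (\<lambda>i. app_env xs e (v i + ?n)) (ts ! k)"
      by (rule 2(2)[THEN list_all2_nthD, THEN conjunct2, rule_format]) (use 2(3) k l in auto)
    then show "sat N (app_env xs e) ((map (tr_trm \<sigma>1 I) ts ! k) (ss ! k) (\<lambda>i. map (\<lambda>y. y + ?n) (\<rho> i)) [k]) \<longleftrightarrow> xs ! k = ?w k"
      using k l by simp
  qed (use l in simp_all)
  also have "\<dots> \<longleftrightarrow> e y = fn M f (map ?w [0..<?n])"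
  proof -
    let ?e = "\<lambda>i. app_env (map ?w [0..<?n]) e (([0..<?n] @ [y + ?n]) ! i)"
    have "map ?e [0..<?n] = map ?w [0..<?n]" by (auto simp: nth_append)
    moreover have "?e ?n = e y" by (simp add: nth_append)
    moreover have "sat N ?e (fun_int I f) \<longleftrightarrow> ?e ?n = fn M f (map ?e [0..<?n])"
      using NM 2(1) by (auto simp: interp_sem_def)
    ultimately show ?thesis by (simp only: sat_inst)
  qed
  also have "map ?w [0..<?n] = map (teval M (\<lambda>i. e (v i))) ts"
    by (rule nth_equalityI) (use l in auto)
  finally show ?case by simp
qed

text \<open>The blocks given by \<rho> are singletons \<open>[v i]\<close>, so translating a formula
  amounts to composing the semantic environment with \<open>v\<close>.\<close>

lemma sat_tr:
  assumes NM: "interp_sem \<sigma>1 I N M"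
  shows "wff \<sigma>1 \<Gamma> p \<Longrightarrow> (\<forall>i<length \<Gamma>. \<rho> i = [v i]) \<Longrightarrow>
    sat N e (tr \<sigma>1 I p \<rho>) \<longleftrightarrow> sat M (\<lambda>i. e (v i)) p"
proof (induction p arbitrary: \<Gamma> \<rho> v e)
  case (Eq s t u)
  let ?w = "\<lambda>k. teval M (\<lambda>i. e (v i)) ([t, u] ! k)"
  have "sat N e (tr \<sigma>1 I (Eq s t u) \<rho>) \<longleftrightarrow>
      sat N (app_env (map ?w [0..<2]) e) (inst (eqv I s) [0..<2])"
    unfolding tr.simps
  proof (subst sat_unnest[OF NM, of _ _ 2 _ _ ?w])
    fix k :: nat and xs :: "'a list"
    assume k: "k < 2" "length xs = 2"
    have "sat N (app_env xs e) (tr_trm \<sigma>1 I ([t, u] ! k) s (\<lambda>i. map (\<lambda>y. y + 2) (\<rho> i)) [k]) \<longleftrightarrow>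
      app_env xs e k = teval M (\<lambda>i. app_env xs e (v i + 2)) ([t, u] ! k)"
      by (rule sat_tr_trm[OF NM, of \<Gamma>]) (use Eq k in \<open>auto simp: less_2_cases_iff\<close>)
    then show "sat N (app_env xs e) (([tr_trm \<sigma>1 I t, tr_trm \<sigma>1 I u] ! k) ([s, s] ! k) (\<lambda>i. map (\<lambda>y. y + 2) (\<rho> i)) [k]) \<longleftrightarrow> xs ! k = ?w k"
      using k by (auto simp: less_2_cases_iff app_env_def)
  qed simp_all
  also have "\<dots> \<longleftrightarrow> ?w 0 = ?w 1"
    using NM by (auto simp: sat_inst interp_sem_def)
  finally show ?case by simp
next
  case (Rel r ts)
  then obtain ss where r: "rel_ar \<sigma>1 r = Some ss" and ts: "list_all2 (has_sort \<sigma>1 \<Gamma>) ts ss" by auto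
  let ?n = "length ss"
  let ?w = "\<lambda>k. teval M (\<lambda>i. e (v i)) (ts ! k)"
  have l: "length ts = ?n" using ts by (auto simp: list_all2_conv_all_nth)
  have "sat N e (tr \<sigma>1 I (Rel r ts) \<rho>) \<longleftrightarrow>
      sat N (app_env (map ?w [0..<?n]) e) (inst (rel_int I r) [0..<?n])"
    unfolding tr.simps r option.sel
  proof (subst sat_unnest[OF NM _ refl, of _ _ _ _ ?w])
    fix k :: nat and xs :: "'a list"
    assume k: "k < ?n" "length xs = ?n"
    have "sat N (app_env xs e) (tr_trm \<sigma>1 I (ts ! k) (ss ! k) (\<lambda>i. map (\<lambda>y. y + ?n) (\<rho> i)) [k]) \<longleftrightarrow>
      app_env xs e k = teval M (\<lambda>i. app_env xs e (v i + ?n)) (ts ! k)"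
      by (rule sat_tr_trm[OF NM list_all2_nthD[OF ts]]) (use Rel.prems(2) k l in auto)
    then show "sat N (app_env xs e) ((map (tr_trm \<sigma>1 I) ts ! k) (ss ! k) (\<lambda>i. map (\<lambda>y. y + ?n) (\<rho> i)) [k]) \<longleftrightarrow> xs ! k = ?w k"
      using k l by simp
  qed (use l in simp_all)
  also have "\<dots> \<longleftrightarrow> rl M r (map ?w [0..<?n])"
  proof -
    let ?e = "\<lambda>i. app_env (map ?w [0..<?n]) e ([0..<?n] ! i)"
    have "map ?e [0..<?n] = map ?w [0..<?n]" by auto
    moreover have "sat N ?e (rel_int I r) \<longleftrightarrow> rl M r (map ?e [0..<?n])"
      using NM r by (auto simp: interp_sem_def)
    ultimately show ?thesis by (simp only: sat_inst)
  qed
  also have "map ?w [0..<?n] = map (teval M (\<lambda>i. e (v i))) ts"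
    by (rule nth_equalityI) (use l in auto)
  finally show ?case by simp
next
  case (Imp p q)
  have "sat N e (tr \<sigma>1 I p \<rho>) \<longleftrightarrow> sat M (\<lambda>i. e (v i)) p" "sat N e (tr \<sigma>1 I q \<rho>) \<longleftrightarrow> sat M (\<lambda>i. e (v i)) q"
    using Imp.prems(1) by (intro Imp.IH[OF _ Imp.prems(2)]; simp)+
  then show ?case by simp
next
  case (Forall s p)
  have N: "univ N" "univ M" using NM by (auto simp: interp_sem_def)
  have "sat N (case_nat x e) (tr \<sigma>1 I p (case_nat [0] (\<lambda>i. map (\<lambda>y. y + 1) (\<rho> i)))) \<longleftrightarrow>
      sat M (case_nat x (\<lambda>i. e (v i))) p" for x
  proof -
    have "sat N (case_nat x e) (tr \<sigma>1 I p (case_nat [0] (\<lambda>i. map (\<lambda>y. y + 1) (\<rho> i)))) \<longleftrightarrow>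
      sat M (\<lambda>i. case_nat x e (case_nat 0 (\<lambda>i. v i + 1) i)) p"
      by (rule Forall.IH[of "s # \<Gamma>"]) (use Forall.prems in \<open>auto simp: less_Suc_eq_0_disj\<close>)
    also have "(\<lambda>i. case_nat x e (case_nat 0 (\<lambda>i. v i + 1) i)) = case_nat x (\<lambda>i. e (v i))"
      by (rule ext) (auto split: nat.split)
    finally show ?thesis .
  qed
  then show ?case
    using N sat_all_in[OF N(1) flat_dm[OF I, of "[s]"] true_doms_dm[OF NM, of "[s]"]]
    by (simp add: all_length_1 app_env_Cons)
qed simp

lemma layout_dm: "layout (map (dm I) ss) = sing (length ss)"
  by (simp add: layout_flat[OF flat_dm[OF I]])

lemma sat_tr_ctx:
  assumes "interp_sem \<sigma>1 I N M" "wff \<sigma>1 ss p"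
  shows "sat N e (tr_ctx \<sigma>1 I ss p) \<longleftrightarrow> sat M e p"
  unfolding tr_ctx_def layout_dm
  by (subst sat_tr[OF assms, of _ "\<lambda>i. i"]) simp_all

lemma wff_unnest:
  assumes l: "length gs = length ss" and n: "n = length ss"
    and g: "\<And>k. k < n \<Longrightarrow> wff \<sigma>2 (map (dim I) ss @ \<Delta>) ((gs ! k) (ss ! k) (\<lambda>i. map (\<lambda>y. y + n) (\<rho> i)) [k])"
    and F: "wff \<sigma>2 (map (dim I) ss @ \<Delta>) (F (sing n))"
  shows "wff \<sigma>2 \<Delta> (unnest I ss gs \<rho> F)"
  unfolding unnest_def wff_ex_in[OF flat_dm[OF I] wf_doms_dm[OF I]] map_hd_dm
  using F g by (auto simp: set_zip l n)

lemma wff_tr_trm: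
  "has_sort \<sigma>1 \<Gamma> t s \<Longrightarrow> (\<forall>i<length \<Gamma>. \<rho> i = [v i] \<and> v i < length \<Delta> \<and> \<Delta> ! v i = dim I (\<Gamma> ! i)) \<Longrightarrow>
    y < length \<Delta> \<and> \<Delta> ! y = dim I s \<Longrightarrow> wff \<sigma>2 \<Delta> (tr_trm \<sigma>1 I t s \<rho> [y])"
proof (induction arbitrary: \<rho> v y \<Delta> rule: has_sort.induct)
  case (1 i)
  have "wff \<sigma>2 (map (dim I) [\<Gamma> ! i, \<Gamma> ! i]) (eqv I (\<Gamma> ! i))"
    using I ctx_flat[OF I] by (metis flat_interp_def wf_interp_def)
  then show ?case unfolding tr_trm.simps
  proof (rule wff_inst)
    fix j assume "j < length (map (dim I) [\<Gamma> ! i, \<Gamma> ! i])"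
    then have "j = 0 \<or> j = 1" by auto
    then show "(\<rho> i @ [y]) ! j < length \<Delta> \<and>
        \<Delta> ! ((\<rho> i @ [y]) ! j) = map (dim I) [\<Gamma> ! i, \<Gamma> ! i] ! j"
      using 1 by auto
  qed
next
  case (2 f ss s ts)
  have l: "length ts = length ss" using 2 by (auto simp: list_all2_conv_all_nth)
  show ?case unfolding tr_trm.simps 2(1) option.sel fst_conv
  proof (rule wff_unnest[OF _ refl])
    fix k assume k: "k < length ss"
    have "wff \<sigma>2 (map (dim I) ss @ \<Delta>) (tr_trm \<sigma>1 I (ts ! k) (ss ! k) (\<lambda>i. map (\<lambda>y. y + length ss) (\<rho> i)) [k])"
      by (rule 2(2)[THEN list_all2_nthD, THEN conjunct2, rule_format, of k _ "\<lambda>i. v i + length ss"])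
        (use 2(3) k l in \<open>auto simp: nth_append\<close>)
    then show "wff \<sigma>2 (map (dim I) ss @ \<Delta>) ((map (tr_trm \<sigma>1 I) ts ! k) (ss ! k) (\<lambda>i. map (\<lambda>y. y + length ss) (\<rho> i)) [k])"
      using k l by simp
  next
    have "wff \<sigma>2 (map (dim I) (ss @ [s])) (fun_int I f)"
      using I ctx_flat[OF I] 2(1) by (metis flat_interp_def wf_interp_def)
    then show "wff \<sigma>2 (map (dim I) ss @ \<Delta>) (inst (fun_int I f) (concat (sing (length ss)) @ shift (sing (length ss)) [y]))"
      by (rule wff_inst) (use 2(4) in \<open>auto simp: nth_append less_Suc_eq\<close>)
  qed (use l in simp)
qed

lemma wff_tr:
  "wff \<sigma>1 \<Gamma> p \<Longrightarrow> (\<forall>i<length \<Gamma>. \<rho> i = [v i] \<and> v i < length \<Delta> \<and> \<Delta> ! v i = dim I (\<Gamma> ! i)) \<Longrightarrow>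
    wff \<sigma>2 \<Delta> (tr \<sigma>1 I p \<rho>)"
proof (induction p arbitrary: \<Gamma> \<rho> v \<Delta>)
  case (Eq s t u)
  show ?case unfolding tr.simps
  proof (rule wff_unnest[of _ _ 2])
    fix k :: nat assume k: "k < 2"
    have "wff \<sigma>2 (map (dim I) [s, s] @ \<Delta>) (tr_trm \<sigma>1 I ([t, u] ! k) s (\<lambda>i. map (\<lambda>y. y + 2) (\<rho> i)) [k])"
      by (rule wff_tr_trm[of \<Gamma> _ _ _ "\<lambda>i. v i + 2"]) (use Eq k in \<open>auto simp: less_2_cases_iff\<close>)
    then show "wff \<sigma>2 (map (dim I) [s, s] @ \<Delta>) (([tr_trm \<sigma>1 I t, tr_trm \<sigma>1 I u] ! k) ([s, s] ! k) (\<lambda>i. map (\<lambda>y. y + 2) (\<rho> i)) [k])"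
      using k by (auto simp: less_2_cases_iff)
  next
    have "wff \<sigma>2 (map (dim I) [s, s]) (eqv I s)"
      using I ctx_flat[OF I] by (metis flat_interp_def wf_interp_def)
    then show "wff \<sigma>2 (map (dim I) [s, s] @ \<Delta>) (inst (eqv I s) (concat (sing 2)))"
      by (rule wff_inst) (auto simp: nth_append nth_Cons')
  qed simp_all
next
  case (Rel r ts)
  then obtain ss where r: "rel_ar \<sigma>1 r = Some ss" and ts: "list_all2 (has_sort \<sigma>1 \<Gamma>) ts ss" by auto
  have l: "length ts = length ss" using ts by (auto simp: list_all2_conv_all_nth)
  show ?case unfolding tr.simps r option.sel
  proof (rule wff_unnest[OF _ refl])
    fix k assume k: "k < length ss"
    have "wff \<sigma>2 (map (dim I) ss @ \<Delta>) (tr_trm \<sigma>1 I (ts ! k) (ss ! k) (\<lambda>i. map (\<lambda>y. y + length ss) (\<rho> i)) [k])"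
      by (rule wff_tr_trm[OF list_all2_nthD[OF ts], of _ _ "\<lambda>i. v i + length ss"])
        (use Rel.prems(2) k l in \<open>auto simp: nth_append\<close>)
    then show "wff \<sigma>2 (map (dim I) ss @ \<Delta>) ((map (tr_trm \<sigma>1 I) ts ! k) (ss ! k) (\<lambda>i. map (\<lambda>y. y + length ss) (\<rho> i)) [k])"
      using k l by simp
  next
    have "wff \<sigma>2 (map (dim I) ss) (rel_int I r)"
      using I ctx_flat[OF I] r by (metis flat_interp_def wf_interp_def)
    then show "wff \<sigma>2 (map (dim I) ss @ \<Delta>) (inst (rel_int I r) (concat (sing (length ss))))"
      by (rule wff_inst) (auto simp: nth_append)
  qed (use l in simp)
next
  case (Imp p q)
  have "wff \<sigma>2 \<Delta> (tr \<sigma>1 I p \<rho>)" "wff \<sigma>2 \<Delta> (tr \<sigma>1 I q \<rho>)"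
    using Imp.prems(1) by (intro Imp.IH[OF _ Imp.prems(2)]; simp)+
  then show ?case by simp
next
  case (Forall s p)
  have "wff \<sigma>2 (dim I s # \<Delta>) (tr \<sigma>1 I p (case_nat [0] (\<lambda>i. map (\<lambda>y. y + 1) (\<rho> i))))"
    by (rule Forall.IH[of "s # \<Gamma>" _ "case_nat 0 (\<lambda>i. v i + 1)"])
      (use Forall.prems in \<open>auto simp: less_Suc_eq_0_disj\<close>)
  then show ?case
    using wff_all_in[OF flat_dm[OF I, of "[s]"] wf_doms_dm[OF I, of "[s]"]] by (simp add: dm_def)
qed simp

lemma wff_tr_ctx: "wff \<sigma>1 ss p \<Longrightarrow> wff \<sigma>2 (map (dim I) ss) (tr_ctx \<sigma>1 I ss p)"
  unfolding tr_ctx_def layout_dm by (rule wff_tr[of ss _ _ "\<lambda>i. i"]) auto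



lemma sat_all_dm:
  "interp_sem \<sigma>1 I N M \<Longrightarrow> sat N e (all_in (map (dm I) ss) F) \<longleftrightarrow>
    (\<forall>xs. length xs = length ss \<longrightarrow> sat N (app_env xs e) (F (sing (length ss))))"
  using sat_all_in[OF _ flat_dm[OF I] true_doms_dm, of N \<sigma>1 M] by (simp add: interp_sem_def)

lemma sat_ex_dm:
  "interp_sem \<sigma>1 I N M \<Longrightarrow> sat N e (ex_in (map (dm I) ss) F) \<longleftrightarrow>
    (\<exists>xs. length xs = length ss \<and> sat N (app_env xs e) (F (sing (length ss))))"
  using sat_ex_in[OF _ flat_dm[OF I] true_doms_dm, of N \<sigma>1 M] by (simp add: interp_sem_def)

lemmas wff_all_dm = wff_all_in[OF flat_dm[OF I] wf_doms_dm[OF I], unfolded map_hd_dm length_map]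
lemmas wff_ex_dm = wff_ex_in[OF flat_dm[OF I] wf_doms_dm[OF I], unfolded map_hd_dm length_map]

lemma wff_eqv:
  assumes "i < length \<Delta>" "\<Delta> ! i = dim I s" "j < length \<Delta>" "\<Delta> ! j = dim I s"
  shows "wff \<sigma>2 \<Delta> (inst (eqv I s) [i, j])"
proof (rule wff_inst)
  show "wff \<sigma>2 (map (dim I) [s, s]) (eqv I s)"
    using I ctx_flat[OF I] by (metis flat_interp_def wf_interp_def)
  fix k assume "k < length (map (dim I) [s, s])"
  then have "k = 0 \<or> k = 1" by auto
  then show "[i, j] ! k < length \<Delta> \<and> \<Delta> ! ([i, j] ! k) = map (dim I) [s, s] ! k"
    using assms by auto
qed

lemma wff_fun_int:
  assumes "fun_ar \<sigma>1 f = Some (ss, s)"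
  shows "wff \<sigma>2 (map (dim I) (ss @ [s])) (fun_int I f)"
  using I assms ctx_flat[OF I] by (metis flat_interp_def wf_interp_def)

lemma wff_rel_int:
  assumes "rel_ar \<sigma>1 r = Some ss"
  shows "wff \<sigma>2 (map (dim I) ss) (rel_int I r)"
  using I assms ctx_flat[OF I] by (metis flat_interp_def wf_interp_def)

lemma wff_eqv_int: "wff \<sigma>2 (map (dim I) [s, s]) (eqv I s)"
  using I ctx_flat[OF I] by (metis flat_interp_def wf_interp_def)

end

section \<open>From provability conditions to conditions on structures\<close>

lemma sat_eqv: "interp_sem \<sigma>1 I N M \<Longrightarrow> sat N e (inst (eqv I s) [i, j]) \<longleftrightarrow> e i = e j"
  by (simp add: sat_inst interp_sem_def)

lemma take_sing: "take n (sing (n + m)) = sing n"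
  and drop_sing: "drop n (sing (n + m)) = map (\<lambda>k. [k]) [n..<n + m]"
  by (simp_all add: sing_def take_map drop_map)

lemma concat_map_sing: "concat (map (\<lambda>k. [k]) xs) = xs"
  by (induction xs) auto

text \<open>The relation \<open>B\<close> is arbitrary: equality gives the congruence conditions of
  an interpretation, the graph of a bijection those of a definable isomorphism.\<close>

lemma sat_preserves:
  fixes N :: "('s2, 'f2, 'r2, 'a) model"
  assumes K: "flat_interp \<sigma>1 \<sigma>2 K" "interp_sem \<sigma>1 K N M"
    and K': "flat_interp \<sigma>1 \<sigma>2 K'" "interp_sem \<sigma>1 K' N M'"
    and n: "n = length ss"
    and p: "\<And>e. sat N e p \<longleftrightarrow> P (map e [0..<n])" "\<And>e. sat N e p' \<longleftrightarrow> P' (map e [0..<n])"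
    and \<iota>: "\<And>s e. sat N e (\<iota> s) \<longleftrightarrow> B s (e 0) (e 1)"
    and pres: "\<And>xs ys. length xs = n \<Longrightarrow> length ys = n \<Longrightarrow>
      (\<And>k. k < n \<Longrightarrow> B (ss ! k) (xs ! k) (ys ! k)) \<Longrightarrow> P xs \<longleftrightarrow> P' ys"
  shows "sat N e (preserves K K' \<iota> ss p p')"
proof -
  let ?ds = "map (dm K) ss @ map (dm K') ss"
  have flat: "flat ?ds" using flat_dm[OF K(1)] flat_dm[OF K'(1)] by (auto simp: flat_def)
  have dom: "true_doms N ?ds"
    using true_doms_dm[OF K(2)] true_doms_dm[OF K'(2)] by (auto simp: true_doms_def)
  have N: "univ N" using K(2) by (simp add: interp_sem_def)
  have "sat N (app_env zs e)
      (Imp (Conj (map (\<lambda>(s, xs, ys). inst (\<iota> s) (xs @ ys)) (zip ss (zip (sing n) (map (\<lambda>k. [k]) [n..<n + n])))))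
        (Iff (inst p [0..<n]) (inst p' [n..<n + n])))"
    if l: "length zs = n + n" for zs
  proof -
    let ?e = "app_env zs e"
    have 1: "map (\<lambda>i. ?e ([0..<n] ! i)) [0..<n] = take n zs"
      by (rule nth_equalityI) (use l in auto)
    have 2: "map (\<lambda>i. ?e ([n..<n + n] ! i)) [0..<n] = drop n zs"
      by (rule nth_equalityI) (use l in auto)
    have "(\<forall>k<n. B (ss ! k) (zs ! k) (zs ! (n + k))) \<Longrightarrow> P (take n zs) \<longleftrightarrow> P' (drop n zs)"
      by (rule pres) (use l in auto)
    moreover have "sat N ?e (Conj (map (\<lambda>(s, xs, ys). inst (\<iota> s) (xs @ ys))
        (zip ss (zip (sing n) (map (\<lambda>k. [k]) [n..<n + n]))))) \<longleftrightarrow>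
        (\<forall>k<n. B (ss ! k) (zs ! k) (zs ! (n + k)))"
      using l by (simp add: sat_Conj all_set_conv_all_nth n[symmetric] sat_inst \<iota> ball_simps)
    ultimately show ?thesis
      by (simp only: sat.simps sat_Iff sat_inst p 1 2) blast
  qed
  moreover have "length ?ds = n + n" by (simp add: n)
  ultimately show ?thesis
    unfolding preserves_def sat_all_in[OF N flat dom] Let_def
    by (simp only: n[symmetric] take_sing drop_sing concat_sing concat_map_sing) blast
qed

lemma wff_preserves:
  assumes K: "flat_interp \<sigma>1 \<sigma>2 K" and K': "flat_interp \<sigma>1 \<sigma>2 K'"
    and p: "wff \<sigma>2 (map (dim K) ss) p" "wff \<sigma>2 (map (dim K') ss) p'"
    and \<iota>: "\<And>s. wff \<sigma>2 [dim K s, dim K' s] (\<iota> s)"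
  shows "wff \<sigma>2 [] (preserves K K' \<iota> ss p p')"
proof -
  let ?ds = "map (dm K) ss @ map (dm K') ss" let ?n = "length ss"
  let ?\<Gamma> = "map (dim K) ss @ map (dim K') ss"
  have flat: "flat ?ds" using flat_dm[OF K] flat_dm[OF K'] by (auto simp: flat_def)
  have wf: "wf_doms \<sigma>2 ?ds"
    using wf_doms_dm[OF K] wf_doms_dm[OF K'] by (auto simp: wf_doms_def)
  have l: "length ?ds = ?n + ?n" by simp
  have 1: "wff \<sigma>2 ?\<Gamma> (inst p [0..<?n])"
    by (rule wff_inst[OF p(1)]) (auto simp: nth_append)
  have 2: "wff \<sigma>2 ?\<Gamma> (inst p' [?n..<?n + ?n])"
    by (rule wff_inst[OF p(2)]) (auto simp: nth_append)
  have 3: "wff \<sigma>2 ?\<Gamma> (inst (\<iota> (ss ! k)) [k, ?n + k])" if "k < ?n" for k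
  proof (rule wff_inst[OF \<iota>])
    fix i assume "i < length [dim K (ss ! k), dim K' (ss ! k)]"
    then have "i = 0 \<or> i = 1" by auto
    then show "[k, ?n + k] ! i < length ?\<Gamma> \<and> ?\<Gamma> ! ([k, ?n + k] ! i) = [dim K (ss ! k), dim K' (ss ! k)] ! i"
      using that by (auto simp: nth_append)
  qed
  show ?thesis
    unfolding preserves_def wff_all_in[OF flat wf] Let_def l take_sing drop_sing concat_map_sing concat_sing
    using 1 2 3 by (simp add: dm_def comp_def all_set_conv_all_nth)
qed

text \<open>By \<open>compl\<close> each provability condition may be checked in structures, where
  equality, congruence and totality are automatic because \<open>I\<close> defines a genuine
  structure. What remains is that this structure satisfies \<open>T1\<close>.\<close>

lemma interprets_flatI:
  assumes I: "flat_interp \<sigma>1 \<sigma>2 I"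
    and compl: "\<And>p. wff \<sigma>2 [] p \<Longrightarrow> (\<And>N :: ('s2, 'f2, 'r2, nat) model. is_model \<sigma>2 T2 N \<Longrightarrow> univ N \<Longrightarrow> \<exists>e. sat N e p) \<Longrightarrow> proves \<sigma>2 T2 p"
    and T1: "\<And>p. p \<in> T1 \<Longrightarrow> wff \<sigma>1 [] p"
    and models: "\<And>N :: ('s2, 'f2, 'r2, nat) model. is_model \<sigma>2 T2 N \<Longrightarrow> univ N \<Longrightarrow>
      \<exists>M. interp_sem \<sigma>1 I N M \<and> (\<forall>p\<in>T1. \<forall>e. sat M e p)"
  shows "interprets \<sigma>1 T1 \<sigma>2 T2 I"
proof -
  have wf: "wf_interp \<sigma>1 \<sigma>2 I" using I by (simp add: flat_interp_def)
  have prove: "proves \<sigma>2 T2 p"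
    if wff: "wff \<sigma>2 [] p" and "\<And>(N :: ('s2, 'f2, 'r2, nat) model) M e. interp_sem \<sigma>1 I N M \<Longrightarrow>
      (\<forall>p\<in>T1. \<forall>e. sat M e p) \<Longrightarrow> sat N e p" for p
  proof (rule compl[OF wff])
    fix N :: "('s2, 'f2, 'r2, nat) model"
    assume "is_model \<sigma>2 T2 N" "univ N"
    then show "\<exists>e. sat N e p" using models that(2) by blast
  qed
  note wffs = wff_all_dm[OF I, where ss = "[_]", simplified] wff_ex_dm[OF I, where ss = "[_]", simplified]
    wff_all_dm[OF I, where ss = "[_, _]", simplified] wff_all_dm[OF I, where ss = "[_, _, _]", simplified]
  note sats = sat_all_dm[OF I, where ss = "[_]", simplified] sat_ex_dm[OF I, where ss = "[_]", simplified]
    sat_all_dm[OF I, where ss = "[_, _]", simplified] sat_all_dm[OF I, where ss = "[_, _, _]", simplified]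
  have eqv: "(\<And>s e. sat N e (eqv I s) \<longleftrightarrow> e 0 = e 1)" if "interp_sem \<sigma>1 I N M" for N M
    using that by (simp add: interp_sem_def)
  have fn_sem: "sat N e (fun_int I f) \<longleftrightarrow> e (length ss) = fn M f (map e [0..<length ss])"
    if "interp_sem \<sigma>1 I N M" "fun_ar \<sigma>1 f = Some (ss, s)" for f ss s N M e
    using that by (auto simp: interp_sem_def)
  have rl_sem: "sat N e (rel_int I r) \<longleftrightarrow> rl M r (map e [0..<length ss])"
    if "interp_sem \<sigma>1 I N M" "rel_ar \<sigma>1 r = Some ss" for r ss N M e
    using that by (auto simp: interp_sem_def)
  show ?thesis
    unfolding interprets_def
  proof (intro conjI allI HOL.impI ballI wf)
    fix s
    show "proves \<sigma>2 T2 (ex_in [dm I s] (\<lambda>_. Top))"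
      by (rule prove) (auto simp: wffs sats length_Suc_conv)
    show "proves \<sigma>2 T2 (all_in [dm I s] (\<lambda>bs. inst (eqv I s) (bs ! 0 @ bs ! 0)))"
      by (rule prove) (auto simp: wffs sats sat_eqv wff_eqv[OF I])
    show "proves \<sigma>2 T2 (all_in [dm I s, dm I s] (\<lambda>bs.
            Imp (inst (eqv I s) (bs ! 0 @ bs ! 1)) (inst (eqv I s) (bs ! 1 @ bs ! 0))))"
      by (rule prove) (auto simp: wffs sats sat_eqv wff_eqv[OF I])
    show "proves \<sigma>2 T2 (all_in [dm I s, dm I s, dm I s] (\<lambda>bs.
            Imp (And (inst (eqv I s) (bs ! 0 @ bs ! 1)) (inst (eqv I s) (bs ! 1 @ bs ! 2)))
              (inst (eqv I s) (bs ! 0 @ bs ! 2))))"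
      by (rule prove) (auto simp: wffs sats sat_eqv wff_eqv[OF I])
  next
    fix r ss assume r: "rel_ar \<sigma>1 r = Some ss"
    have pres: "sat N e (preserves I I (eqv I) ss (rel_int I r) (rel_int I r))"
      if NM: "interp_sem \<sigma>1 I (N :: ('s2, 'f2, 'r2, nat) model) M" for N M e
    proof (rule sat_preserves[OF I NM I NM refl, where P = "rl M r" and P' = "rl M r" and B = "\<lambda>_. (=)"])
      fix xs ys :: "nat list"
      assume "length xs = length ss" "length ys = length ss"
        "\<And>k. k < length ss \<Longrightarrow> xs ! k = ys ! k"
      then have "xs = ys" by (intro nth_equalityI) auto
      then show "rl M r xs \<longleftrightarrow> rl M r ys" by simp
    qed (simp_all add: eqv[OF NM] rl_sem[OF NM r])
    show "proves \<sigma>2 T2 (preserves I I (eqv I) ss (rel_int I r) (rel_int I r))"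
      by (rule prove[OF _ pres])
        (intro wff_preserves[OF I I] wff_rel_int[OF I r] wff_eqv_int[OF I, simplified])
  next
    fix f ss s assume f: "fun_ar \<sigma>1 f = Some (ss, s)"
    have pres: "sat N e (preserves I I (eqv I) (ss @ [s]) (fun_int I f) (fun_int I f))"
      if NM: "interp_sem \<sigma>1 I (N :: ('s2, 'f2, 'r2, nat) model) M" for N M e
    proof (rule sat_preserves[OF I NM I NM refl, where P = "\<lambda>xs. xs ! length ss = fn M f (take (length ss) xs)"
        and P' = "\<lambda>xs. xs ! length ss = fn M f (take (length ss) xs)" and B = "\<lambda>_. (=)"])
      fix xs ys :: "nat list"
      assume "length xs = length (ss @ [s])" "length ys = length (ss @ [s])"
        "\<And>k. k < length (ss @ [s]) \<Longrightarrow> xs ! k = ys ! k"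
      then have "xs = ys" by (intro nth_equalityI) auto
      then show "xs ! length ss = fn M f (take (length ss) xs) \<longleftrightarrow> ys ! length ss = fn M f (take (length ss) ys)"
        by simp
    qed (simp_all add: eqv[OF NM] fn_sem[OF NM f] take_map nth_append)
    show "proves \<sigma>2 T2 (preserves I I (eqv I) (ss @ [s]) (fun_int I f) (fun_int I f))"
      by (rule prove[OF _ pres])
        (intro wff_preserves[OF I I] wff_fun_int[OF I f] wff_eqv_int[OF I, simplified])
    show "proves \<sigma>2 T2 (all_in (map (dm I) ss) (\<lambda>bs.
            ex_in [dm I s] (\<lambda>cs. inst (fun_int I f) (shift cs (concat bs) @ cs ! 0))))"
    proof (rule prove)
      show "wff \<sigma>2 [] (all_in (map (dm I) ss) (\<lambda>bs.
            ex_in [dm I s] (\<lambda>cs. inst (fun_int I f) (shift cs (concat bs) @ cs ! 0))))"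
        unfolding wff_all_dm[OF I] wffs
        by (rule wff_inst[OF wff_fun_int[OF I f]]) (auto simp: nth_append less_Suc_eq)
      fix N M e assume NM: "interp_sem \<sigma>1 I (N :: ('s2, 'f2, 'r2, nat) model) M"
      show "sat N e (all_in (map (dm I) ss) (\<lambda>bs.
            ex_in [dm I s] (\<lambda>cs. inst (fun_int I f) (shift cs (concat bs) @ cs ! 0))))"
        unfolding sat_all_dm[OF I NM] sats(2)[OF NM]
      proof (intro allI HOL.impI)
        fix xs :: "nat list" assume xs: "length xs = length ss"
        have "map (\<lambda>i. (map (\<lambda>y. y + 1) [0..<length ss] @ [0]) ! i) [0..<length ss] = map Suc [0..<length ss]"
          by (auto simp: nth_append)
        then have "sat N (app_env [fn M f xs] (app_env xs e)) (inst (fun_int I f) (map Suc [0..<length ss] @ [0]))"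
          unfolding sat_inst fn_sem[OF NM f]
          using xs by (auto simp: nth_append app_env_Cons intro!: arg_cong[of _ _ "fn M f"] nth_equalityI)
        then show "\<exists>ys. length ys = Suc 0 \<and> sat N (app_env ys (app_env xs e))
          (inst (fun_int I f) (shift (sing (Suc 0)) (concat (sing (length ss))) @ sing (Suc 0) ! 0))"
          by (intro exI[of _ "[fn M f xs]"]) simp
      qed
    qed
    show "proves \<sigma>2 T2 (all_in (map (dm I) ([s, s] @ ss)) (\<lambda>bs.
            Imp (And (inst (fun_int I f) (concat (drop 2 bs) @ bs ! 0))
                     (inst (fun_int I f) (concat (drop 2 bs) @ bs ! 1)))
              (inst (eqv I s) (bs ! 0 @ bs ! 1))))"
    proof (rule prove)
      have drop: "concat (drop 2 (sing (length ([s, s] @ ss)))) = [2..<2 + length ss]"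
        using drop_sing[of 2 "length ss"] by (simp add: concat_map_sing del: upt_Suc)
      note simps = drop nth_sing[of 0 "length ([s, s] @ ss)"] nth_sing[of 1 "length ([s, s] @ ss)"]
      have "wff \<sigma>2 (map (dim I) ([s, s] @ ss) @ []) (inst (fun_int I f) ([2..<2 + length ss] @ [i]))" if "i < 2" for i
      proof (rule wff_inst[OF wff_fun_int[OF I f]])
        fix j assume "j < length (map (dim I) (ss @ [s]))"
        then consider "j < length ss" | "j = length ss" by fastforce
        then show "([2..<2 + length ss] @ [i]) ! j < length (map (dim I) ([s, s] @ ss) @ []) \<and>
          (map (dim I) ([s, s] @ ss) @ []) ! (([2..<2 + length ss] @ [i]) ! j) = map (dim I) (ss @ [s]) ! j"
          using that by cases (auto simp: nth_append less_2_cases_iff simp del: upt_Suc)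
      qed
      then show "wff \<sigma>2 [] (all_in (map (dm I) ([s, s] @ ss)) (\<lambda>bs.
            Imp (And (inst (fun_int I f) (concat (drop 2 bs) @ bs ! 0))
                     (inst (fun_int I f) (concat (drop 2 bs) @ bs ! 1)))
              (inst (eqv I s) (bs ! 0 @ bs ! 1))))"
        unfolding wff_all_dm[OF I] drop by (simp add: wff_eqv[OF I] del: upt_Suc)
      fix N M e assume NM: "interp_sem \<sigma>1 I (N :: ('s2, 'f2, 'r2, nat) model) M"
      have *: "sat N (app_env zs e) (inst (fun_int I f) ([2..<2 + length ss] @ [i])) \<longleftrightarrow>
          zs ! i = fn M f (drop 2 zs)" if "length zs = 2 + length ss" "i < 2" for zs i
      proof -
        have "map (\<lambda>j. app_env zs e (([2..<2 + length ss] @ [i]) ! j)) [0..<length ss] = drop 2 zs"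
          by (rule nth_equalityI) (use that in \<open>auto simp: nth_append simp del: upt_Suc\<close>)
        then show ?thesis
          unfolding sat_inst fn_sem[OF NM f] using that by (simp add: nth_append del: upt_Suc)
      qed
      show "sat N e (all_in (map (dm I) ([s, s] @ ss)) (\<lambda>bs.
            Imp (And (inst (fun_int I f) (concat (drop 2 bs) @ bs ! 0))
                     (inst (fun_int I f) (concat (drop 2 bs) @ bs ! 1)))
              (inst (eqv I s) (bs ! 0 @ bs ! 1))))"
        unfolding sat_all_dm[OF I NM] drop using *[of _ 0] *[of _ 1]
        by (auto simp: sat_eqv[OF NM] simp del: upt_Suc)
    qed
  next
    fix p assume p: "p \<in> T1"
    show "proves \<sigma>2 T2 (tr_ctx \<sigma>1 I [] p)"
    proof (rule prove)
      show "wff \<sigma>2 [] (tr_ctx \<sigma>1 I [] p)" using wff_tr_ctx[OF I T1[OF p]] by simp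
      fix N M e assume "interp_sem \<sigma>1 I (N :: ('s2, 'f2, 'r2, nat) model) M" "\<forall>p\<in>T1. \<forall>e. sat M e p"
      then show "sat N e (tr_ctx \<sigma>1 I [] p)" using sat_tr_ctx[OF I _ T1[OF p]] p by blast
    qed
  qed
qed


section \<open>Definable isomorphisms and bi-interpretability by flat interpretations\<close>

definition iso ::
  "('s, 'f, 'r) signature \<Rightarrow> ('s, 'f, 'r, 'a) model \<Rightarrow> ('s, 'f, 'r, 'a) model \<Rightarrow> ('s \<Rightarrow> 'a \<Rightarrow> 'a) \<Rightarrow> bool" where
  "iso \<sigma> M M' \<beta> \<longleftrightarrow> (\<forall>s. bij (\<beta> s)) \<and>
    (\<forall>r ss xs. rel_ar \<sigma> r = Some ss \<longrightarrow> length xs = length ss \<longrightarrow> (rl M r xs \<longleftrightarrow> rl M' r (map2 \<beta> ss xs))) \<and>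
    (\<forall>f ss s xs. fun_ar \<sigma> f = Some (ss, s) \<longrightarrow> length xs = length ss \<longrightarrow>
      fn M' f (map2 \<beta> ss xs) = \<beta> s (fn M f xs))"

lemma definable_iso_flatI:
  fixes \<sigma> :: "('s, 'f, 'r) signature"
  assumes K: "flat_interp \<sigma>1 \<sigma> K" and K': "flat_interp \<sigma>1 \<sigma> K'"
    and compl: "\<And>p. wff \<sigma> [] p \<Longrightarrow> (\<And>N :: ('s, 'f, 'r, nat) model. is_model \<sigma> T N \<Longrightarrow> univ N \<Longrightarrow> \<exists>e. sat N e p) \<Longrightarrow> proves \<sigma> T p"
    and \<iota>: "\<And>s. wff \<sigma> [dim K s, dim K' s] (\<iota> s)"
    and models: "\<And>N :: ('s, 'f, 'r, nat) model. is_model \<sigma> T N \<Longrightarrow> univ N \<Longrightarrow>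
      \<exists>M M' \<beta>. interp_sem \<sigma>1 K N M \<and> interp_sem \<sigma>1 K' N M' \<and> iso \<sigma>1 M M' \<beta> \<and>
        (\<forall>s e. sat N e (\<iota> s) \<longleftrightarrow> e 1 = \<beta> s (e 0))"
  shows "definable_iso \<sigma> T \<sigma>1 K K' \<iota>"
proof -
  have prove: "proves \<sigma> T p"
    if wff: "wff \<sigma> [] p" and "\<And>(N :: ('s, 'f, 'r, nat) model) M M' \<beta> e. interp_sem \<sigma>1 K N M \<Longrightarrow>
      interp_sem \<sigma>1 K' N M' \<Longrightarrow> iso \<sigma>1 M M' \<beta> \<Longrightarrow> (\<And>s e. sat N e (\<iota> s) \<longleftrightarrow> e 1 = \<beta> s (e 0)) \<Longrightarrow> sat N e p" for p
  proof (rule compl[OF wff])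
    fix N :: "('s, 'f, 'r, nat) model"
    assume "is_model \<sigma> T N" "univ N"
    then show "\<exists>e. sat N e p" using models that(2) by metis
  qed
  note wffs = wff_all_dm[OF K, where ss = "[_]", simplified] wff_ex_dm[OF K, where ss = "[_]", simplified]
    wff_all_dm[OF K', where ss = "[_]", simplified] wff_ex_dm[OF K', where ss = "[_]", simplified]
  note sats = sat_all_dm[OF K, where ss = "[_]", simplified] sat_ex_dm[OF K, where ss = "[_]", simplified]
    sat_all_dm[OF K', where ss = "[_]", simplified] sat_ex_dm[OF K', where ss = "[_]", simplified]
  have eqv: "(\<And>s e. sat N e (eqv I s) \<longleftrightarrow> e 0 = e 1)" if "interp_sem \<sigma>1 I N M" for N M I
    using that by (simp add: interp_sem_def)
  have fn_sem: "sat N e (fun_int I f) \<longleftrightarrow> e (length ss) = fn M f (map e [0..<length ss])"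
    if "interp_sem \<sigma>1 I N M" "fun_ar \<sigma>1 f = Some (ss, s)" for f ss s N M e I
    using that by (auto simp: interp_sem_def)
  have rl_sem: "sat N e (rel_int I r) \<longleftrightarrow> rl M r (map e [0..<length ss])"
    if "interp_sem \<sigma>1 I N M" "rel_ar \<sigma>1 r = Some ss" for r ss N M e I
    using that by (auto simp: interp_sem_def)
  have wff2: "wff \<sigma> \<Delta> (inst (\<iota> s) [i, j])"
    if "i < length \<Delta>" "\<Delta> ! i = dim K s" "j < length \<Delta>" "\<Delta> ! j = dim K' s" for \<Delta> i j s
  proof (rule wff_inst[OF \<iota>])
    fix k assume "k < length [dim K s, dim K' s]"
    then have "k = 0 \<or> k = 1" by auto
    then show "[i, j] ! k < length \<Delta> \<and> \<Delta> ! ([i, j] ! k) = [dim K s, dim K' s] ! k"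
      using that by auto
  qed
  show ?thesis
    unfolding definable_iso_def
  proof (intro conjI allI HOL.impI)
    fix s
    show "wff \<sigma> (ctx K [s] @ ctx K' [s]) (\<iota> s)" using \<iota> by (simp add: ctx_flat[OF K] ctx_flat[OF K'])
    show "proves \<sigma> T (all_in [dm K s] (\<lambda>bs. ex_in [dm K' s] (\<lambda>cs. inst (\<iota> s) (shift cs (bs ! 0) @ cs ! 0))))"
    proof (rule prove)
      fix N M M' \<beta> e
      assume "interp_sem \<sigma>1 K (N :: ('s, 'f, 'r, nat) model) M" "interp_sem \<sigma>1 K' N M'"
        "\<And>s e. sat N e (\<iota> s) \<longleftrightarrow> e 1 = \<beta> s (e 0)"
      then show "sat N e (all_in [dm K s] (\<lambda>bs. ex_in [dm K' s] (\<lambda>cs. inst (\<iota> s) (shift cs (bs ! 0) @ cs ! 0))))"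
        by (simp add: sats sat_inst all_length_1 ex_length_1 app_env_Cons)
    qed (simp add: wffs wff2)
    show "proves \<sigma> T (all_in [dm K' s] (\<lambda>cs. ex_in [dm K s] (\<lambda>bs. inst (\<iota> s) (bs ! 0 @ shift bs (cs ! 0)))))"
    proof (rule prove)
      fix N M M' \<beta> e
      assume *: "interp_sem \<sigma>1 K (N :: ('s, 'f, 'r, nat) model) M" "interp_sem \<sigma>1 K' N M'" "iso \<sigma>1 M M' \<beta>"
        "\<And>s e. sat N e (\<iota> s) \<longleftrightarrow> e 1 = \<beta> s (e 0)"
      have "\<exists>x. y = \<beta> s x" for y using *(3) by (metis iso_def bij_pointE)
      then show "sat N e (all_in [dm K' s] (\<lambda>cs. ex_in [dm K s] (\<lambda>bs. inst (\<iota> s) (bs ! 0 @ shift bs (cs ! 0)))))"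
        using * by (simp add: sats sat_inst all_length_1 ex_length_1 app_env_Cons)
    qed (simp add: wffs wff2)
    have pres: "sat N e (preserves K K' \<iota> [s, s] (eqv K s) (eqv K' s))"
      if N: "interp_sem \<sigma>1 K (N :: ('s, 'f, 'r, nat) model) M" "interp_sem \<sigma>1 K' N M'" "iso \<sigma>1 M M' \<beta>"
        "\<And>s e. sat N e (\<iota> s) \<longleftrightarrow> e 1 = \<beta> s (e 0)" for N M M' \<beta> e
    proof (rule sat_preserves[OF K N(1) K' N(2) refl, where P = "\<lambda>xs. xs ! 0 = xs ! 1" and P' = "\<lambda>xs. xs ! 0 = xs ! 1"
          and B = "\<lambda>s x y. y = \<beta> s x"])
      fix xs ys :: "nat list"
      assume "\<And>k. k < length [s, s] \<Longrightarrow> ys ! k = \<beta> ([s, s] ! k) (xs ! k)"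
      from this[of 0] this[of 1] have "ys ! 0 = \<beta> s (xs ! 0)" "ys ! 1 = \<beta> s (xs ! 1)" by auto
      then show "xs ! 0 = xs ! 1 \<longleftrightarrow> ys ! 0 = ys ! 1"
        using N(3) by (auto simp: iso_def bij_def inj_eq)
    qed (simp_all add: eqv[OF N(1)] eqv[OF N(2)] N(4))
    show "proves \<sigma> T (preserves K K' \<iota> [s, s] (eqv K s) (eqv K' s))"
      by (rule prove[OF _ pres])
        (intro wff_preserves[OF K K'] wff_eqv_int[OF K] wff_eqv_int[OF K'] \<iota>)
  next
    fix r ss assume r: "rel_ar \<sigma>1 r = Some ss"
    have pres: "sat N e (preserves K K' \<iota> ss (rel_int K r) (rel_int K' r))"
      if N: "interp_sem \<sigma>1 K (N :: ('s, 'f, 'r, nat) model) M" "interp_sem \<sigma>1 K' N M'" "iso \<sigma>1 M M' \<beta>"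
        "\<And>s e. sat N e (\<iota> s) \<longleftrightarrow> e 1 = \<beta> s (e 0)" for N M M' \<beta> e
    proof (rule sat_preserves[OF K N(1) K' N(2) refl, where P = "rl M r" and P' = "rl M' r"
          and B = "\<lambda>s x y. y = \<beta> s x"])
      fix xs ys :: "nat list"
      assume l: "length xs = length ss" "length ys = length ss"
        and "\<And>k. k < length ss \<Longrightarrow> ys ! k = \<beta> (ss ! k) (xs ! k)"
      then have "ys = map2 \<beta> ss xs" by (intro nth_equalityI) auto
      then show "rl M r xs \<longleftrightarrow> rl M' r ys" using N(3) r l by (auto simp: iso_def)
    qed (simp_all add: rl_sem[OF N(1) r] rl_sem[OF N(2) r] N(4))
    show "proves \<sigma> T (preserves K K' \<iota> ss (rel_int K r) (rel_int K' r))"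
      by (rule prove[OF _ pres])
        (intro wff_preserves[OF K K'] wff_rel_int[OF K r] wff_rel_int[OF K' r] \<iota>)
  next
    fix f ss s assume f: "fun_ar \<sigma>1 f = Some (ss, s)"
    have pres: "sat N e (preserves K K' \<iota> (ss @ [s]) (fun_int K f) (fun_int K' f))"
      if N: "interp_sem \<sigma>1 K (N :: ('s, 'f, 'r, nat) model) M" "interp_sem \<sigma>1 K' N M'" "iso \<sigma>1 M M' \<beta>"
        "\<And>s e. sat N e (\<iota> s) \<longleftrightarrow> e 1 = \<beta> s (e 0)" for N M M' \<beta> e
    proof (rule sat_preserves[OF K N(1) K' N(2) refl, where P = "\<lambda>xs. xs ! length ss = fn M f (take (length ss) xs)"
          and P' = "\<lambda>xs. xs ! length ss = fn M' f (take (length ss) xs)" and B = "\<lambda>s x y. y = \<beta> s x"])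
      fix xs ys :: "nat list"
      assume l: "length xs = length (ss @ [s])" "length ys = length (ss @ [s])"
        and ys: "\<And>k. k < length (ss @ [s]) \<Longrightarrow> ys ! k = \<beta> ((ss @ [s]) ! k) (xs ! k)"
      have "take (length ss) ys = map2 \<beta> ss (take (length ss) xs)"
        using l ys by (intro nth_equalityI) (auto simp: nth_append)
      then have "fn M' f (take (length ss) ys) = \<beta> s (fn M f (take (length ss) xs))"
        using N(3) f l by (simp add: iso_def)
      moreover have "ys ! length ss = \<beta> s (xs ! length ss)" using ys[of "length ss"] by simp
      moreover have "inj (\<beta> s)" using N(3) by (simp add: iso_def bij_def)
      ultimately show "xs ! length ss = fn M f (take (length ss) xs) \<longleftrightarrow> ys ! length ss = fn M' f (take (length ss) ys)"
        by (simp add: inj_eq)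
    qed (simp_all add: fn_sem[OF N(1) f] fn_sem[OF N(2) f] N(4) take_map nth_append)
    show "proves \<sigma> T (preserves K K' \<iota> (ss @ [s]) (fun_int K f) (fun_int K' f))"
      by (rule prove[OF _ pres])
        (intro wff_preserves[OF K K'] wff_fun_int[OF K f] wff_fun_int[OF K' f] \<iota>)
  qed
qed

lemma flat_id: "flat_interp \<sigma> \<sigma> (id_interp \<sigma>)"
  by (auto simp: flat_interp_def wf_interp_def id_interp_def ctx_def list_all2_conv_all_nth nth_append Let_def)

lemma sem_id: "univ N \<Longrightarrow> interp_sem \<sigma> (id_interp \<sigma>) N N"
  by (auto simp: interp_sem_def id_interp_def comp_def Let_def)

lemma flat_comp:
  assumes I: "flat_interp \<sigma>1 \<sigma>2 I" and J: "flat_interp \<sigma>2 \<sigma>3 J"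
  shows "flat_interp \<sigma>1 \<sigma>3 (comp_interp \<sigma>1 \<sigma>2 I J)"
    and "dims (comp_interp \<sigma>1 \<sigma>2 I J) s = [dim J (dim I s)]"
proof -
  let ?K = "comp_interp \<sigma>1 \<sigma>2 I J"
  show d: "dims ?K s = [dim J (dim I s)]" for s
  proof -
    have "dims ?K s = map (dim J) (dims I s)" using ctx_flat[OF J] by (simp add: comp_interp_def)
    then show ?thesis by (metis dims_flat[OF I] list.map)
  qed
  then have ctx: "ctx ?K ss = map (dim J) (map (dim I) ss)" for ss
    by (induction ss) (simp_all add: ctx_def)
  have dom: "wff \<sigma>2 (dims I s) (dom I s)" for s
    using I by (simp add: flat_interp_def wf_interp_def ctx_def)
  show "flat_interp \<sigma>1 \<sigma>3 ?K"
    unfolding flat_interp_def wf_interp_def ctx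
  proof (intro conjI allI HOL.impI)
    fix s
    have "wff \<sigma>3 (map (dim J) (dims I s) @ []) (in_doms (map (dm J) (dims I s)))"
      using wff_in_doms[OF flat_dm[OF J] wf_doms_dm[OF J]] unfolding map_hd_dm .
    then have "wff \<sigma>3 (map (dim J) (dims I s)) (dom ?K s)"
      using wff_tr_ctx[OF J dom[of s]] by (simp add: comp_interp_def)
    then show "wff \<sigma>3 (map (dim J) (map (dim I) [s])) (dom ?K s)"
      by (metis dims_flat[OF I] list.map)
    show "wff \<sigma>3 (map (dim J) (map (dim I) [s, s])) (eqv ?K s)"
      using wff_tr_ctx[OF J wff_eqv_int[OF I, of s]] ctx_flat[OF I, of "[s, s]"] by (simp add: comp_interp_def)
    show "length (dims ?K s) = 1" by (simp add: d)
  next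
    fix f ss s assume f: "fun_ar \<sigma>1 f = Some (ss, s)"
    show "wff \<sigma>3 (map (dim J) (map (dim I) (ss @ [s]))) (fun_int ?K f)"
      using wff_tr_ctx[OF J wff_fun_int[OF I f]] f ctx_flat[OF I, of "ss @ [s]"] by (simp add: comp_interp_def)
  next
    fix r ss assume r: "rel_ar \<sigma>1 r = Some ss"
    show "wff \<sigma>3 (map (dim J) (map (dim I) ss)) (rel_int ?K r)"
      using wff_tr_ctx[OF J wff_rel_int[OF I r]] r ctx_flat[OF I, of ss] by (simp add: comp_interp_def)
  qed
qed

lemma sem_comp:
  assumes I: "flat_interp \<sigma>1 \<sigma>2 I" and J: "flat_interp \<sigma>2 \<sigma>3 J"
    and BC: "interp_sem \<sigma>1 I B C" and NB: "interp_sem \<sigma>2 J N B"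
  shows "interp_sem \<sigma>1 (comp_interp \<sigma>1 \<sigma>2 I J) N C"
proof -
  have dom: "wff \<sigma>2 (dims I s) (dom I s)" for s
    using I by (simp add: flat_interp_def wf_interp_def ctx_def)
  have "sat N e (in_doms (map (dm J) (dims I s)))" for e s
    by (rule sat_in_doms[OF true_doms_dm[OF NB]])
  moreover have "sat N e (tr_ctx \<sigma>2 J (dims I s) (dom I s))" for e s
    using sat_tr_ctx[OF J NB dom] BC by (simp add: interp_sem_def)
  moreover have "sat N e (tr_ctx \<sigma>2 J (ctx I [s, s]) (eqv I s)) \<longleftrightarrow> e 0 = e 1" for e s
    using sat_tr_ctx[OF J NB wff_eqv_int[OF I]] BC ctx_flat[OF I, of "[s, s]"] by (simp add: interp_sem_def)
  moreover have "sat N e (tr_ctx \<sigma>2 J (ctx I (ss @ [s])) (fun_int I f)) \<longleftrightarrow>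
      e (length ss) = fn C f (map e [0..<length ss])" if f: "fun_ar \<sigma>1 f = Some (ss, s)" for f ss s e
    using sat_tr_ctx[OF J NB wff_fun_int[OF I f]] BC ctx_flat[OF I, of "ss @ [s]"] f by (simp add: interp_sem_def)
  moreover have "sat N e (tr_ctx \<sigma>2 J (ctx I ss) (rel_int I r)) \<longleftrightarrow>
      rl C r (map e [0..<length ss])" if r: "rel_ar \<sigma>1 r = Some ss" for r ss e
    using sat_tr_ctx[OF J NB wff_rel_int[OF I r]] BC ctx_flat[OF I, of ss] r by (simp add: interp_sem_def)
  ultimately show ?thesis
    using BC NB by (simp add: interp_sem_def comp_interp_def)
qed

text \<open>The isomorphisms lead from the identity interpretation to the round trip. On each side
  one starts from a model, passes to the other language and back, and compares the result with the
  start by \<beta>.\<close>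

lemma flat_bi_interpretable:
  fixes \<sigma>1 :: "('s1, 'f1, 'r1) signature" and \<sigma>2 :: "('s2, 'f2, 'r2) signature"
  assumes I: "flat_interp \<sigma>1 \<sigma>2 I" and J: "flat_interp \<sigma>2 \<sigma>1 J"
    and compl1: "\<And>p. wff \<sigma>1 [] p \<Longrightarrow> (\<And>M :: ('s1, 'f1, 'r1, nat) model. is_model \<sigma>1 T1 M \<Longrightarrow> univ M \<Longrightarrow> \<exists>e. sat M e p) \<Longrightarrow> proves \<sigma>1 T1 p"
    and compl2: "\<And>p. wff \<sigma>2 [] p \<Longrightarrow> (\<And>N :: ('s2, 'f2, 'r2, nat) model. is_model \<sigma>2 T2 N \<Longrightarrow> univ N \<Longrightarrow> \<exists>e. sat N e p) \<Longrightarrow> proves \<sigma>2 T2 p"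
    and T1: "\<And>p. p \<in> T1 \<Longrightarrow> wff \<sigma>1 [] p" and T2: "\<And>p. p \<in> T2 \<Longrightarrow> wff \<sigma>2 [] p"
    and \<iota>: "\<And>s. wff \<sigma>1 [s, dim J (dim I s)] (\<iota> s)" and \<kappa>: "\<And>s. wff \<sigma>2 [s, dim I (dim J s)] (\<kappa> s)"
    and models1: "\<And>M :: ('s1, 'f1, 'r1, nat) model. is_model \<sigma>1 T1 M \<Longrightarrow> univ M \<Longrightarrow>
      \<exists>N M' \<beta>. interp_sem \<sigma>2 J M N \<and> (\<forall>p\<in>T2. \<forall>e. sat N e p) \<and> interp_sem \<sigma>1 I N M' \<and>
        iso \<sigma>1 M M' \<beta> \<and> (\<forall>s e. sat M e (\<iota> s) \<longleftrightarrow> e 1 = \<beta> s (e 0))"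
    and models2: "\<And>N :: ('s2, 'f2, 'r2, nat) model. is_model \<sigma>2 T2 N \<Longrightarrow> univ N \<Longrightarrow>
      \<exists>M N' \<beta>. interp_sem \<sigma>1 I N M \<and> (\<forall>p\<in>T1. \<forall>e. sat M e p) \<and> interp_sem \<sigma>2 J M N' \<and>
        iso \<sigma>2 N N' \<beta> \<and> (\<forall>s e. sat N e (\<kappa> s) \<longleftrightarrow> e 1 = \<beta> s (e 0))"
  shows "bi_interpretable \<sigma>1 T1 \<sigma>2 T2"
  unfolding bi_interpretable_def
proof (intro exI conjI)
  show "interprets \<sigma>1 T1 \<sigma>2 T2 I"
    by (rule interprets_flatI[OF I compl2 T1]) (use models2 in blast)+
  show "interprets \<sigma>2 T2 \<sigma>1 T1 J"
    by (rule interprets_flatI[OF J compl1 T2]) (use models1 in blast)+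
  have d: "dims (id_interp \<sigma>) s = [s]" for \<sigma> :: "('s, 'f, 'r) signature" and s
    by (simp add: id_interp_def)
  show "definable_iso \<sigma>1 T1 \<sigma>1 (id_interp \<sigma>1) (comp_interp \<sigma>1 \<sigma>2 I J) \<iota>"
  proof (rule definable_iso_flatI[OF flat_id flat_comp(1)[OF I J] compl1])
    fix M :: "('s1, 'f1, 'r1, nat) model" assume M: "is_model \<sigma>1 T1 M" "univ M"
    then show "\<exists>M' M'' \<beta>. interp_sem \<sigma>1 (id_interp \<sigma>1) M M' \<and> interp_sem \<sigma>1 (comp_interp \<sigma>1 \<sigma>2 I J) M M'' \<and>
        iso \<sigma>1 M' M'' \<beta> \<and> (\<forall>s e. sat M e (\<iota> s) \<longleftrightarrow> e 1 = \<beta> s (e 0))"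
      using models1[OF M] sem_id[OF M(2)] sem_comp[OF I J] by blast
  qed (simp_all add: d flat_comp(2)[OF I J] \<iota>)
  show "definable_iso \<sigma>2 T2 \<sigma>2 (id_interp \<sigma>2) (comp_interp \<sigma>2 \<sigma>1 J I) \<kappa>"
  proof (rule definable_iso_flatI[OF flat_id flat_comp(1)[OF J I] compl2])
    fix M :: "('s2, 'f2, 'r2, nat) model" assume M: "is_model \<sigma>2 T2 M" "univ M"
    then show "\<exists>M' M'' \<beta>. interp_sem \<sigma>2 (id_interp \<sigma>2) M M' \<and> interp_sem \<sigma>2 (comp_interp \<sigma>2 \<sigma>1 J I) M M'' \<and>
        iso \<sigma>2 M' M'' \<beta> \<and> (\<forall>s e. sat M e (\<kappa> s) \<longleftrightarrow> e 1 = \<beta> s (e 0))"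
      using models2[OF M] sem_id[OF M(2)] sem_comp[OF J I] by blast
  qed (simp_all add: d flat_comp(2)[OF J I] \<kappa>)
qed

section \<open>Structures for the two languages\<close>

instance sc_sort :: countable by countable_datatype
instance sc_fun :: countable by countable_datatype
instance sc_rel :: countable by countable_datatype
instance set_rel :: countable by countable_datatype

type_synonym 'a rel2 = "'a \<Rightarrow> 'a \<Rightarrow> bool"

definition set_str :: "'a rel2 \<Rightarrow> 'a rel2 \<Rightarrow> (unit, unit, set_rel, 'a) model" where
  "set_str m r = \<lparr>car = (\<lambda>_. UNIV), fn = (\<lambda>_ xs. hd xs),
    rl = (\<lambda>q xs. case q of Mem \<Rightarrow> m (xs ! 0) (xs ! 1) | Prec \<Rightarrow> r (xs ! 0) (xs ! 1))\<rparr>"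

definition sc_str :: "'a rel2 \<Rightarrow> 'a rel2 \<Rightarrow> ('a \<Rightarrow> 'a) \<Rightarrow> (sc_sort, sc_fun, sc_rel, 'a) model" where
  "sc_str l i c = \<lparr>car = (\<lambda>_. UNIV), fn = (\<lambda>_ xs. c (xs ! 0)),
    rl = (\<lambda>q xs. case q of Less \<Rightarrow> l (xs ! 0) (xs ! 1) | In \<Rightarrow> i (xs ! 0) (xs ! 1))\<rparr>"

lemma set_str_simps [simp]:
  "univ (set_str m r)" "car (set_str m r) s = UNIV"
  "rl (set_str m r) Mem [x, y] = m x y" "rl (set_str m r) Prec [x, y] = r x y"
  by (auto simp: set_str_def univ_def)

lemma sc_str_simps [simp]:
  "univ (sc_str l i c)" "car (sc_str l i c) s = UNIV" "fn (sc_str l i c) f [x] = c x"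
  "rl (sc_str l i c) Less [x, y] = l x y" "rl (sc_str l i c) In [x, y] = i x y"
  by (auto simp: sc_str_def univ_def)

lemma set_sig_simps [simp]: "fun_ar set_sig f = None" "rel_ar set_sig q = Some [(), ()]"
  by (simp_all add: set_sig_def)

lemma sc_sig_simps [simp]:
  "fun_ar sc_sig f = Some ([BSet], Ordinal)"
  "rel_ar sc_sig Less = Some [Ordinal, Ordinal]" "rel_ar sc_sig In = Some [Ordinal, BSet]"
  by (simp_all add: sc_sig_def)

lemma length_2: "length xs = Suc (Suc 0) \<longleftrightarrow> (\<exists>x y. xs = [x, y])"
  by (auto simp: length_Suc_conv)

lemma set_sig_term: "has_sort set_sig \<Gamma> t s \<Longrightarrow> \<exists>j<length \<Gamma>. t = Var j"
  by (erule has_sort.cases) auto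

text \<open>A model may interpret its symbols arbitrarily on lists of the wrong length. Well-formed
  formulas cannot see this, so two binary relations determine their truth.\<close>

lemma set_str_model:
  assumes "univ N" "wff set_sig \<Gamma> p"
  shows "sat N e p \<longleftrightarrow> sat (set_str (\<lambda>x y. rl N Mem [x, y]) (\<lambda>x y. rl N Prec [x, y])) e p"
  using assms(2)
proof (induction p arbitrary: \<Gamma> e)
  case (Eq s t u)
  then obtain j k where "t = Var j" "u = Var k" using set_sig_term by (metis wff.simps(2))
  then show ?case by simp
next
  case (Rel q ts)
  then have ts: "list_all2 (has_sort set_sig \<Gamma>) ts [(), ()]" by simp
  then obtain t u where "ts = [t, u]" by (auto simp: list_all2_Cons2)
  then obtain j k where "ts = [Var j, Var k]" using ts set_sig_term by (metis list_all2_Cons)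
  then show ?case by (cases q) simp_all
next
  case (Imp p q)
  then show ?case by auto
next
  case (Forall s p)
  then show ?case using assms(1) by simp
qed simp

lemma sc_str_model:
  assumes "univ N" "wff sc_sig \<Gamma> p"
  shows "sat N e p \<longleftrightarrow> sat (sc_str (\<lambda>x y. rl N Less [x, y]) (\<lambda>x y. rl N In [x, y]) (\<lambda>x. fn N Enc [x])) e p"
    (is "_ \<longleftrightarrow> sat ?N e p")
proof -
  have teval: "teval N e t = teval ?N e t" if "has_sort sc_sig \<Gamma> t s" for t s \<Gamma> e
    using that
  proof (induction rule: has_sort.induct)
    case (2 f ss s ts)
    moreover have "f = Enc" by (cases f) simp
    ultimately show ?case by (auto simp: list_all2_Cons2)
  qed simp
  show ?thesis using assms(2)
  proof (induction p arbitrary: \<Gamma> e)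
    case (Eq s t u)
    then show ?case using teval[of \<Gamma> t s e] teval[of \<Gamma> u s e] by simp
  next
    case (Rel q ts)
    then show ?case using teval by (cases q) (auto simp: list_all2_Cons2)
  next
    case (Imp p q)
    then show ?case by auto
  next
    case (Forall s p)
    then show ?case using assms(1) by simp
  qed simp
qed

section \<open>Definability\<close>

text \<open>
  \<open>df b M R \<Phi>\<close>: the predicate \<open>\<Phi> i\<close> of environments is defined, uniformly in \<open>i\<close>, by a formula over
  the structure with membership \<open>M i\<close> and order \<open>R i\<close>, with parameters \<open>c\<close> if \<open>b\<close> holds. The rules
  below let quantified variables be read off the environment, so that definability of a concrete
  predicate is proved by following its syntax.
\<close>

definition df :: "bool \<Rightarrow> ('i \<Rightarrow> 'a rel2) \<Rightarrow> ('i \<Rightarrow> 'a rel2) \<Rightarrow> ('i \<Rightarrow> (nat \<Rightarrow> 'a) \<Rightarrow> bool) \<Rightarrow> bool" where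
  "df b M R \<Phi> \<longleftrightarrow> (\<exists>p k d c. wff set_sig (replicate (k + d) ()) p \<and> (b \<or> d = 0) \<and>
    (\<forall>i e. \<Phi> i e \<longleftrightarrow> sat (set_str (M i) (R i)) (\<lambda>j. if j < k then e j else c (j - k)) p))"

definition vr :: "bool \<Rightarrow> ('i \<Rightarrow> (nat \<Rightarrow> 'a) \<Rightarrow> 'a) \<Rightarrow> bool" where
  "vr b t \<longleftrightarrow> (\<exists>j. t = (\<lambda>i e. e j)) \<or> b \<and> (\<exists>c. t = (\<lambda>i e. c))"

lemma vr_var: "vr b (\<lambda>i e. e j)"
  and vr_const: "vr True (\<lambda>i e. c)"
  by (auto simp: vr_def)

lemma set_sorted_subst:
  "(\<And>j. j < n \<Longrightarrow> \<exists>x<m. \<eta> j = Var x) \<Longrightarrow> sorted_subst set_sig (replicate n ()) (replicate m ()) \<eta>"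
  unfolding sorted_subst_def by fastforce

text \<open>A renaming may identify variables, and it may put fixed elements for variables if
  parameters are allowed; in the second case at most \<open>k\<close> parameters are added to the
  \<open>d\<close> present ones.\<close>

lemma df_rename:
  assumes "df b M R \<Phi>" and \<tau>: "\<And>j. vr b (\<tau> j)"
  shows "df b M R (\<lambda>i e. \<Phi> i (\<lambda>j. \<tau> j i e))"
proof -
  obtain p k d c where p: "wff set_sig (replicate (k + d) ()) p" and d: "b \<or> d = 0"
    and sat: "\<And>i e. \<Phi> i e \<longleftrightarrow> sat (set_str (M i) (R i)) (\<lambda>j. if j < k then e j else c (j - k)) p"
    using assms(1) unfolding df_def by blast
  obtain v x a where v: "\<And>j. v j \<Longrightarrow> \<tau> j = (\<lambda>i e. e (x j))" and a: "\<And>j. \<not> v j \<Longrightarrow> b \<and> \<tau> j = (\<lambda>i e. a j)"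
  proof -
    have "\<forall>j. \<exists>v x a. (v \<longrightarrow> \<tau> j = (\<lambda>i e. e x)) \<and> (\<not> v \<longrightarrow> b \<and> \<tau> j = (\<lambda>i e. a))"
      using \<tau> unfolding vr_def by meson
    then show ?thesis using that by metis
  qed
  define K where "K = Suc (\<Sum>j<k. x j)"
  have x: "x j < K" if "j < k" for j
    using member_le_sum[of j "{..<k}" x] that by (simp add: K_def)
  define d' where "d' = (if b then d + k else 0)"
  define c' where "c' n = (if n < d then c n else a (n - d))" for n
  \<comment> \<open>Slots below \<open>K\<close> hold variables, the next \<open>d\<close> the old
    parameters, and the last \<open>k\<close> the elements put for variables.\<close>
  define \<eta> where "\<eta> j = (Var (if j < k then if v j then x j else K + d + j else K + (j - k)) :: unit trm)" for j
  have "wff set_sig (replicate (K + d') ()) (subst \<eta> p)"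
  proof (rule wff_subst[OF p set_sorted_subst])
    fix j assume "j < k + d"
    then show "\<exists>x<K + d'. \<eta> j = Var x"
      using x[of j] a[of j] d by (auto simp: \<eta>_def d'_def)
  qed
  moreover have "\<Phi> i (\<lambda>j. \<tau> j i e) \<longleftrightarrow>
      sat (set_str (M i) (R i)) (\<lambda>j. if j < K then e j else c' (j - K)) (subst \<eta> p)" for i e
    unfolding sat_subst sat
  proof (rule sat_agree[OF p])
    fix j assume j: "j < length (replicate (k + d) ())"
    show "(if j < k then \<tau> j i e else c (j - k)) =
        teval (set_str (M i) (R i)) (\<lambda>j. if j < K then e j else c' (j - K)) (\<eta> j)"
    proof (cases "j < k")
      case True
      then show ?thesis using x[OF True] v[of j] a[of j] by (cases "v j") (auto simp: \<eta>_def c'_def)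
    next
      case False
      then show ?thesis using j by (auto simp: \<eta>_def c'_def)
    qed
  qed
  moreover have "b \<or> d' = 0" by (simp add: d'_def)
  ultimately show ?thesis unfolding df_def by blast
qed

text \<open>Two definitions can be combined only over a common number of variables and a common list
  of parameters; \<open>off\<close> moves the parameters of one past those of the other.\<close>

lemma df_norm:
  assumes "df b M R \<Phi>"
  obtains k0 d c where "b \<or> d = 0"
    "\<And>k off. k0 \<le> k \<Longrightarrow> \<exists>p. wff set_sig (replicate (k + off + d) ()) p \<and>
      (\<forall>i e c'. (\<forall>j<d. c' (off + j) = c j) \<longrightarrow>
        (\<Phi> i e \<longleftrightarrow> sat (set_str (M i) (R i)) (\<lambda>j. if j < k then e j else c' (j - k)) p))"
proof -
  obtain p k0 d c where p: "wff set_sig (replicate (k0 + d) ()) p" and d: "b \<or> d = 0"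
    and sat: "\<And>i e. \<Phi> i e \<longleftrightarrow> sat (set_str (M i) (R i)) (\<lambda>j. if j < k0 then e j else c (j - k0)) p"
    using assms unfolding df_def by blast
  have "\<exists>p. wff set_sig (replicate (k + off + d) ()) p \<and>
      (\<forall>i e c'. (\<forall>j<d. c' (off + j) = c j) \<longrightarrow>
        (\<Phi> i e \<longleftrightarrow> sat (set_str (M i) (R i)) (\<lambda>j. if j < k then e j else c' (j - k)) p))"
    if k: "k0 \<le> k" for k off
  proof -
    define \<eta> where "\<eta> j = (Var (if j < k0 then j else k + off + (j - k0)) :: unit trm)" for j
    have "wff set_sig (replicate (k + off + d) ()) (subst \<eta> p)"
      by (rule wff_subst[OF p set_sorted_subst]) (use k in \<open>auto simp: \<eta>_def\<close>)
    moreover have "\<Phi> i e \<longleftrightarrow> sat (set_str (M i) (R i)) (\<lambda>j. if j < k then e j else c' (j - k)) (subst \<eta> p)"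
      if "\<forall>j<d. c' (off + j) = c j" for i e c'
      unfolding sat_subst sat
    proof (rule sat_agree[OF p])
      fix j assume j: "j < length (replicate (k0 + d) ())"
      show "(if j < k0 then e j else c (j - k0)) =
          teval (set_str (M i) (R i)) (\<lambda>j. if j < k then e j else c' (j - k)) (\<eta> j)"
        using that[rule_format, of "j - k0"] j k by (auto simp: \<eta>_def)
    qed
    ultimately show ?thesis by blast
  qed
  then show thesis using that d by blast
qed

lemma df_Imp:
  assumes "df b M R \<Phi>" "df b M R \<Psi>"
  shows "df b M R (\<lambda>i e. \<Phi> i e \<longrightarrow> \<Psi> i e)"
proof -
  obtain k1 d1 c1 where d1: "b \<or> d1 = 0" and 1: "\<And>k off. k1 \<le> k \<Longrightarrow> \<exists>p. wff set_sig (replicate (k + off + d1) ()) p \<and>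
      (\<forall>i e c'. (\<forall>j<d1. c' (off + j) = c1 j) \<longrightarrow>
        (\<Phi> i e \<longleftrightarrow> sat (set_str (M i) (R i)) (\<lambda>j. if j < k then e j else c' (j - k)) p))"
    by (rule df_norm[OF assms(1)], rule that, assumption+)
  obtain k2 d2 c2 where d2: "b \<or> d2 = 0" and 2: "\<And>k off. k2 \<le> k \<Longrightarrow> \<exists>p. wff set_sig (replicate (k + off + d2) ()) p \<and>
      (\<forall>i e c'. (\<forall>j<d2. c' (off + j) = c2 j) \<longrightarrow>
        (\<Psi> i e \<longleftrightarrow> sat (set_str (M i) (R i)) (\<lambda>j. if j < k then e j else c' (j - k)) p))"
    by (rule df_norm[OF assms(2)], rule that, assumption+)
  define k where "k = max k1 k2"
  define c where "c n = (if n < d1 then c1 n else c2 (n - d1))" for n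
  obtain p where p: "wff set_sig (replicate (k + 0 + d1) ()) p"
    "\<And>i e. \<Phi> i e \<longleftrightarrow> sat (set_str (M i) (R i)) (\<lambda>j. if j < k then e j else c (j - k)) p"
    using 1[of k 0] by (auto simp: c_def k_def)
  obtain q where q: "wff set_sig (replicate (k + d1 + d2) ()) q"
    "\<And>i e. \<Psi> i e \<longleftrightarrow> sat (set_str (M i) (R i)) (\<lambda>j. if j < k then e j else c (j - k)) q"
    using 2[of k d1] by (auto simp: c_def k_def)
  have "wff set_sig (replicate (k + d1 + d2) ()) p"
    using wff_subst[OF p(1) set_sorted_subst, of "k + d1 + d2" Var] by simp
  then show ?thesis
    unfolding df_def using p(2) q d1 d2
    by (intro exI[of _ "Imp p q"] exI[of _ k] exI[of _ "d1 + d2"] exI[of _ c]) (auto simp: add.assoc)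
qed

lemma df_False: "df b M R (\<lambda>i e. False)"
  unfolding df_def by (intro exI[of _ Falsum] exI[of _ 0]) simp

lemma df_all_case:
  assumes "df b M R \<Phi>"
  shows "df b M R (\<lambda>i e. \<forall>a. \<Phi> i (case_nat a e))"
proof -
  obtain k1 d c where d: "b \<or> d = 0" and 1: "\<And>k off. k1 \<le> k \<Longrightarrow> \<exists>p. wff set_sig (replicate (k + off + d) ()) p \<and>
      (\<forall>i e c'. (\<forall>j<d. c' (off + j) = c j) \<longrightarrow>
        (\<Phi> i e \<longleftrightarrow> sat (set_str (M i) (R i)) (\<lambda>j. if j < k then e j else c' (j - k)) p))"
    by (rule df_norm[OF assms(1)], rule that, assumption+)
  obtain p where p: "wff set_sig (replicate (Suc k1 + d) ()) p"
    "\<And>i e. \<Phi> i e \<longleftrightarrow> sat (set_str (M i) (R i)) (\<lambda>j. if j < Suc k1 then e j else c (j - Suc k1)) p"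
    using 1[of "Suc k1" 0] by auto
  have "(\<lambda>j. if j < Suc k1 then case_nat a e j else c (j - Suc k1)) =
      case_nat a (\<lambda>j. if j < k1 then e j else c (j - k1))" for a e
    by (rule ext) (auto split: nat.split)
  then show ?thesis
    unfolding df_def using p d by (intro exI[of _ "all p"] exI[of _ k1] exI[of _ d] exI[of _ c]) auto
qed

lemma df_all:
  assumes "df b M R (\<lambda>i e. P (e 0) i (\<lambda>j. e (Suc j)))"
  shows "df b M R (\<lambda>i e. \<forall>a. P a i e)"
  using df_all_case[OF assms] by simp

lemma df_Not: "df b M R \<Phi> \<Longrightarrow> df b M R (\<lambda>i e. \<not> \<Phi> i e)"
  using df_Imp[OF _ df_False] by simp

lemma df_disj: "df b M R \<Phi> \<Longrightarrow> df b M R \<Psi> \<Longrightarrow> df b M R (\<lambda>i e. \<Phi> i e \<or> \<Psi> i e)"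
  unfolding disj_imp by (rule df_Imp[OF df_Not])

lemma df_conj: "df b M R \<Phi> \<Longrightarrow> df b M R \<Psi> \<Longrightarrow> df b M R (\<lambda>i e. \<Phi> i e \<and> \<Psi> i e)"
  using df_Not[OF df_Imp[OF _ df_Not]] by fastforce

lemma df_iff: "df b M R \<Phi> \<Longrightarrow> df b M R \<Psi> \<Longrightarrow> df b M R (\<lambda>i e. \<Phi> i e \<longleftrightarrow> \<Psi> i e)"
  using df_conj[OF df_Imp df_Imp, of b M R \<Phi> \<Psi> \<Psi> \<Phi>] by (simp add: iff_conv_conj_imp)

lemma df_ex:
  assumes "df b M R (\<lambda>i e. P (e 0) i (\<lambda>j. e (Suc j)))"
  shows "df b M R (\<lambda>i e. \<exists>a. P a i e)"
  using df_Not[OF df_all[OF df_Not[OF assms]]] by simp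

lemma df_atom:
  assumes "wff set_sig [(), ()] p" "\<And>i x y. A i x y \<longleftrightarrow> sat (set_str (M i) (R i)) (case_nat x (\<lambda>_. y)) p"
    and "vr b t" "vr b u"
  shows "df b M R (\<lambda>i e. A i (t i e) (u i e))"
proof -
  have "df b M R (\<lambda>i e. A i (e 0) (e 1))"
    unfolding df_def
  proof (rule exI[of _ p], rule exI[of _ 2], rule exI[of _ 0], rule exI[of _ "\<lambda>_. undefined"], intro conjI allI)
    show "wff set_sig (replicate (2 + 0) ()) p" using assms(1) by (simp add: numeral_2_eq_2)
    fix i e
    show "A i (e 0) (e 1) \<longleftrightarrow> sat (set_str (M i) (R i)) (\<lambda>j. if j < 2 then e j else undefined) p"
      unfolding assms(2) by (rule sat_agree[OF assms(1)]) (auto simp: less_Suc_eq)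
  qed simp
  from df_rename[OF this, of "\<lambda>j. if j = 0 then t else u"] show ?thesis using assms by simp
qed

lemma df_mem: "vr b t \<Longrightarrow> vr b u \<Longrightarrow> df b M R (\<lambda>i e. M i (t i e) (u i e))"
  by (rule df_atom[of "mem 0 1"]) auto

lemma df_prec: "vr b t \<Longrightarrow> vr b u \<Longrightarrow> df b M R (\<lambda>i e. R i (t i e) (u i e))"
  by (rule df_atom[of "prec 0 1"]) auto

lemma df_eq: "vr b t \<Longrightarrow> vr b u \<Longrightarrow> df b M R (\<lambda>i e. t i e = u i e)"
  by (rule df_atom[of "eq 0 1"]) auto

lemmas df_intros = df_False df_Imp df_Not df_disj df_conj df_iff df_all df_ex df_mem df_eq vr_var

text \<open>The function \<open>f\<close> stands for the shifts that enclosing quantifiers make, so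
  that a relation which itself depends on the environment can be used at any depth.\<close>

definition df0 :: "bool \<Rightarrow> ('i \<Rightarrow> 'a rel2) \<Rightarrow> ('i \<Rightarrow> 'a rel2) \<Rightarrow> ('i \<Rightarrow> (nat \<Rightarrow> 'a) \<Rightarrow> bool) \<Rightarrow> bool" where
  "df0 b M R P \<longleftrightarrow> (\<forall>f. df b M R (\<lambda>i e. P i (\<lambda>j. e (f j))))"
definition df1 :: "bool \<Rightarrow> ('i \<Rightarrow> 'a rel2) \<Rightarrow> ('i \<Rightarrow> 'a rel2) \<Rightarrow> ('i \<Rightarrow> (nat \<Rightarrow> 'a) \<Rightarrow> 'a \<Rightarrow> bool) \<Rightarrow> bool" where
  "df1 b M R P \<longleftrightarrow> (\<forall>f t. vr b t \<longrightarrow> df b M R (\<lambda>i e. P i (\<lambda>j. e (f j)) (t i e)))"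
definition df2 :: "bool \<Rightarrow> ('i \<Rightarrow> 'a rel2) \<Rightarrow> ('i \<Rightarrow> 'a rel2) \<Rightarrow> ('i \<Rightarrow> (nat \<Rightarrow> 'a) \<Rightarrow> 'a \<Rightarrow> 'a \<Rightarrow> bool) \<Rightarrow> bool" where
  "df2 b M R P \<longleftrightarrow> (\<forall>f t u. vr b t \<longrightarrow> vr b u \<longrightarrow> df b M R (\<lambda>i e. P i (\<lambda>j. e (f j)) (t i e) (u i e)))"
definition df3 :: "bool \<Rightarrow> ('i \<Rightarrow> 'a rel2) \<Rightarrow> ('i \<Rightarrow> 'a rel2) \<Rightarrow> ('i \<Rightarrow> (nat \<Rightarrow> 'a) \<Rightarrow> 'a \<Rightarrow> 'a \<Rightarrow> 'a \<Rightarrow> bool) \<Rightarrow> bool" where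
  "df3 b M R P \<longleftrightarrow> (\<forall>f t u v. vr b t \<longrightarrow> vr b u \<longrightarrow> vr b v \<longrightarrow>
    df b M R (\<lambda>i e. P i (\<lambda>j. e (f j)) (t i e) (u i e) (v i e)))"

lemma df0D: "df0 b M R P \<Longrightarrow> df b M R (\<lambda>i e. P i (\<lambda>j. e (f j)))"
  and df1D: "df1 b M R P1 \<Longrightarrow> vr b t \<Longrightarrow> df b M R (\<lambda>i e. P1 i (\<lambda>j. e (f j)) (t i e))"
  and df2D: "df2 b M R P2 \<Longrightarrow> vr b t \<Longrightarrow> vr b u \<Longrightarrow> df b M R (\<lambda>i e. P2 i (\<lambda>j. e (f j)) (t i e) (u i e))"
  and df3D: "df3 b M R P3 \<Longrightarrow> vr b t \<Longrightarrow> vr b u \<Longrightarrow> vr b v \<Longrightarrow>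
    df b M R (\<lambda>i e. P3 i (\<lambda>j. e (f j)) (t i e) (u i e) (v i e))"
  by (simp_all add: df0_def df1_def df2_def df3_def)

lemma df0I: "df b M R P \<Longrightarrow> df0 b M R P"
  unfolding df0_def using df_rename[of b M R P "\<lambda>j i e. e (f j)" for f] vr_var by blast

lemma df1I:
  assumes "df b M R (\<lambda>i e. P i (\<lambda>j. e (Suc j)) (e 0))"
  shows "df1 b M R P"
  unfolding df1_def
proof (intro allI HOL.impI)
  fix f :: "nat \<Rightarrow> nat" and t :: "'a \<Rightarrow> (nat \<Rightarrow> 'b) \<Rightarrow> 'b" assume "vr b t"
  from df_rename[OF assms, of "case_nat t (\<lambda>j i e. e (f j))"] this
  show "df b M R (\<lambda>i e. P i (\<lambda>j. e (f j)) (t i e))" by (simp add: vr_var split: nat.split)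
qed

lemma df2I:
  assumes "df b M R (\<lambda>i e. P i (\<lambda>j. e (Suc (Suc j))) (e 0) (e (Suc 0)))"
  shows "df2 b M R P"
  unfolding df2_def
proof (intro allI HOL.impI)
  fix f :: "nat \<Rightarrow> nat" and t u :: "'a \<Rightarrow> (nat \<Rightarrow> 'b) \<Rightarrow> 'b" assume "vr b t" "vr b u"
  with df_rename[OF assms, of "case_nat t (case_nat u (\<lambda>j i e. e (f j)))"]
  show "df b M R (\<lambda>i e. P i (\<lambda>j. e (f j)) (t i e) (u i e))" by (simp add: vr_var split: nat.split)
qed

lemma df3I:
  assumes "df b M R (\<lambda>i e. P i (\<lambda>j. e (Suc (Suc (Suc j)))) (e 0) (e (Suc 0)) (e (Suc (Suc 0))))"
  shows "df3 b M R P"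
  unfolding df3_def
proof (intro allI HOL.impI)
  fix f :: "nat \<Rightarrow> nat" and t u v :: "'a \<Rightarrow> (nat \<Rightarrow> 'b) \<Rightarrow> 'b" assume "vr b t" "vr b u" "vr b v"
  with df_rename[OF assms, of "case_nat t (case_nat u (case_nat v (\<lambda>j i e. e (f j))))"]
  show "df b M R (\<lambda>i e. P i (\<lambda>j. e (f j)) (t i e) (u i e) (v i e))" by (simp add: vr_var split: nat.split)
qed

abbreviation cls :: "'a rel2 \<Rightarrow> 'a rel2 \<Rightarrow> ('a \<Rightarrow> bool) \<Rightarrow> bool" where
  "cls m r X \<equiv> df True (\<lambda>_ :: unit. m) (\<lambda>_. r) (\<lambda>_ e. X (e 0))"

abbreviation cls2 :: "'a rel2 \<Rightarrow> 'a rel2 \<Rightarrow> 'a rel2 \<Rightarrow> bool" where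
  "cls2 m r X \<equiv> df2 True (\<lambda>_ :: unit. m) (\<lambda>_. r) (\<lambda>_ _. X)"

text \<open>Brings a definable predicate into the shape of the axiom schemas: \<open>w\<close>
  variables to be bound, followed by parameters over which the axiom is closed universally.\<close>

lemma df_formula:
  assumes "df True (\<lambda>_ :: unit. m) (\<lambda>_. r) \<Phi>"
  obtains p xs where "wff set_sig (replicate w () @ replicate (length xs) ()) p"
    "\<And>ys e. length ys = w \<Longrightarrow> \<Phi> () (app_env ys (\<lambda>_. undefined)) \<longleftrightarrow> sat (set_str m r) (app_env ys (app_env xs e)) p"
proof -
  obtain k1 d c where 1: "\<And>k off. k1 \<le> k \<Longrightarrow> \<exists>p. wff set_sig (replicate (k + off + d) ()) p \<and>
      (\<forall>i e c'. (\<forall>j<d. c' (off + j) = c j) \<longrightarrow>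
        (\<Phi> i e \<longleftrightarrow> sat (set_str m r) (\<lambda>j. if j < k then e j else c' (j - k)) p))"
    by (rule df_norm[OF assms(1)], rule that, assumption+)
  define k where "k = max k1 w"
  obtain p where p: "wff set_sig (replicate (k + d) ()) p"
    "\<And>e. \<Phi> () e \<longleftrightarrow> sat (set_str m r) (\<lambda>j. if j < k then e j else c (j - k)) p"
    using 1[of k 0] by (auto simp: k_def)
  define xs where "xs = replicate (k - w) undefined @ map c [0..<d]"
  have l: "w + length xs = k + d" by (simp add: xs_def k_def)
  show thesis
  proof (rule that)
    show "wff set_sig (replicate w () @ replicate (length xs) ()) p"
      using p(1) l by (simp add: replicate_add[symmetric])
    fix ys :: "'a list" and e assume ys: "length ys = w"
    show "\<Phi> () (app_env ys (\<lambda>_. undefined)) \<longleftrightarrow> sat (set_str m r) (app_env ys (app_env xs e)) p"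
      unfolding p(2)
    proof (rule sat_agree[OF p(1)])
      fix j assume "j < length (replicate (k + d) ())"
      then show "(if j < k then app_env ys (\<lambda>_. undefined) j else c (j - k)) = app_env ys (app_env xs e) j"
        using ys l by (auto simp: app_env_def xs_def nth_append k_def max_def)
    qed
  qed
qed

lemma df_env:
  assumes "wff set_sig (replicate w () @ \<Gamma>) p" "length xs = length \<Gamma>"
  shows "df True (\<lambda>_ :: unit. m) (\<lambda>_. r) (\<lambda>_ e. sat (set_str m r) (app_env (map e [0..<w]) (app_env xs e')) p)"
proof -
  have "\<Gamma> = replicate (length \<Gamma>) ()" by (simp add: list_eq_iff_nth_eq)
  then have p: "wff set_sig (replicate (w + length \<Gamma>) ()) p"
    using assms by (simp add: replicate_add)
  have "sat (set_str m r) (app_env (map e [0..<w]) (app_env xs e')) p \<longleftrightarrow>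
      sat (set_str m r) (\<lambda>j. if j < w then e j else xs ! (j - w)) p" for e
    by (rule sat_agree[OF p]) (auto simp: app_env_def assms(2))
  then show ?thesis using p unfolding df_def
    by (intro exI[of _ p] exI[of _ w] exI[of _ "length \<Gamma>"] exI[of _ "\<lambda>j. xs ! j"]) simp
qed

text \<open>With the pair of relations as the index, uniformity in the index yields one formula for
  all structures over the type, and the absence of parameters makes it fit for an
  interpretation.\<close>

lemma df_uniform:
  assumes "df False (fst :: 'a rel2 \<times> 'a rel2 \<Rightarrow> _) snd (\<lambda>i e. h (fst i) (snd i) (e 0) (e (Suc 0)))"
  obtains p where "wff set_sig [(), ()] p"
    "\<And>m r x y. sat (set_str m r) (case_nat x (\<lambda>_. y)) p \<longleftrightarrow> h m r x y"
proof -
  obtain p k where p: "wff set_sig (replicate k ()) p"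
    and sat: "\<And>i e. h (fst i) (snd i) (e 0) (e (Suc 0)) \<longleftrightarrow>
      sat (set_str (fst i) (snd i)) (\<lambda>j. if j < k then e j else undefined) p"
  proof -
    obtain p k c where p: "wff set_sig (replicate k ()) p"
      and sat: "\<And>i e. h (fst i) (snd i) (e 0) (e (Suc 0)) \<longleftrightarrow>
        sat (set_str (fst i) (snd i)) (\<lambda>j. if j < k then e j else c (j - k)) p"
      using assms unfolding df_def by auto
    have "sat N (\<lambda>j. if j < k then e j else c (j - k)) p \<longleftrightarrow> sat N (\<lambda>j. if j < k then e j else undefined) p" for N e
      by (rule sat_agree[OF p]) simp
    then show thesis using that p sat by blast
  qed
  define \<eta> where "\<eta> j = (Var (if j = 0 then 0 else 1) :: unit trm)" for j :: nat
  show thesis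
  proof (rule that)
    have "wff set_sig (replicate 2 ()) (subst \<eta> p)"
      by (rule wff_subst[OF p set_sorted_subst]) (auto simp: \<eta>_def)
    then show "wff set_sig [(), ()] (subst \<eta> p)" by (simp add: numeral_2_eq_2)
    fix m r :: "'a rel2" and x y
    have "sat (set_str m r) (case_nat x (\<lambda>_. y)) (subst \<eta> p) \<longleftrightarrow>
        sat (set_str m r) (\<lambda>j. if j < k then case_nat x (\<lambda>_. y) j else undefined) p"
      unfolding sat_subst by (rule sat_agree[OF p]) (auto simp: \<eta>_def split: nat.split)
    then show "sat (set_str m r) (case_nat x (\<lambda>_. y)) (subst \<eta> p) \<longleftrightarrow> h m r x y"
      using sat[of "(m, r)" "case_nat x (\<lambda>_. y)"] by simp
  qed
qed

text \<open>Replacing order atoms by the definition of \<open>L\<close> turns formulas about the new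
  order into definitions over the old one.\<close>

lemma df_set_str:
  assumes L: "df2 b M R (\<lambda>i _. L i)"
  shows "wff set_sig \<Gamma> p \<Longrightarrow> df b M R (\<lambda>i e. sat (set_str (M i) (L i)) e p)"
proof (induction p arbitrary: \<Gamma>)
  case (Eq s t u)
  then obtain j k where "t = Var j" "u = Var k" using set_sig_term by (metis wff.simps(2))
  then show ?case by (simp add: df_intros)
next
  case (Rel q ts)
  then have ts: "list_all2 (has_sort set_sig \<Gamma>) ts [(), ()]" by simp
  then obtain t u where "ts = [t, u]" by (auto simp: list_all2_Cons2)
  then obtain j k where "ts = [Var j, Var k]" using ts set_sig_term by (metis list_all2_Cons)
  then show ?case by (cases q) (auto intro!: df_mem df2D[OF L] vr_var)
next
  case (Forall s p)
  then show ?case using df_all_case[OF Forall.IH[of "() # \<Gamma>"]] by simp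
qed (auto intro: df_intros)

text \<open>When each set encodes itself, the value of a term is that of its variable.\<close>

lemma sc_teval:
  "has_sort sc_sig \<Gamma> t s \<Longrightarrow> \<exists>j. \<forall>(l :: 'a rel2) i e. teval (sc_str l i (\<lambda>x. x)) e t = e j"
proof (induction rule: has_sort.induct)
  case (2 f ss s ts)
  then show ?case by (auto simp: list_all2_Cons2) blast
qed auto

lemma df_sc_str:
  assumes L: "df2 b M R (\<lambda>i _. L i)"
  shows "wff sc_sig \<Gamma> p \<Longrightarrow> df b M R (\<lambda>i e. sat (sc_str (L i) (M i) (\<lambda>x. x)) e p)"
proof (induction p arbitrary: \<Gamma>)
  case (Eq s t u)
  obtain j k where "\<forall>(l :: 'b rel2) i e. teval (sc_str l i (\<lambda>x. x)) e t = e j"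
    "\<forall>(l :: 'b rel2) i e. teval (sc_str l i (\<lambda>x. x)) e u = e k"
    using Eq sc_teval by (metis wff.simps(2))
  then show ?case by (simp add: df_intros)
next
  case (Rel q ts)
  then obtain t u s s' where ts: "ts = [t, u]" "has_sort sc_sig \<Gamma> t s" "has_sort sc_sig \<Gamma> u s'"
    by (cases q) (auto simp: list_all2_Cons2)
  obtain j k where "\<forall>(l :: 'b rel2) i e. teval (sc_str l i (\<lambda>x. x)) e t = e j"
    "\<forall>(l :: 'b rel2) i e. teval (sc_str l i (\<lambda>x. x)) e u = e k"
    using ts sc_teval by metis
  then show ?case using ts by (cases q) (auto intro!: df_mem df2D[OF L] vr_var)
next
  case (Forall s p)
  then show ?case using df_all_case[OF Forall.IH[of "s # \<Gamma>"]] by simp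
qed (auto intro: df_intros)

section \<open>The two interpretations\<close>

text \<open>
  The universe serves both as the ordinals, ordered by \<open>\<psi>\<close>, and as the bounded sets, each of which
  encodes itself.
\<close>

definition V_interp :: "set_fm \<Rightarrow> (sc_sort, sc_fun, sc_rel, unit, unit, set_rel) interp" where
  "V_interp \<psi> = \<lparr>dims = (\<lambda>_. [()]), dom = (\<lambda>_. Top), eqv = (\<lambda>_. eq 0 1), fun_int = (\<lambda>_. eq 0 1),
    rel_int = case_sc_rel \<psi> (mem 0 1)\<rparr>"

text \<open>Membership is always that of (Ord, E, <); only the order varies with \<theta>, for the
  sake of part (3).\<close>

definition O_interp :: "set_fm \<Rightarrow> (unit, unit, set_rel, sc_sort, sc_fun, sc_rel) interp" where
  "O_interp \<theta> = E_interp\<lparr>rel_int :=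
    case_set_rel (rel_int E_interp Mem) (tr_ctx set_sig E_interp [(), ()] \<theta>)\<rparr>"

definition Emem :: "'a rel2 \<Rightarrow> ('a \<Rightarrow> 'a) \<Rightarrow> 'a rel2" where
  "Emem i c = (\<lambda>a b. \<exists>x. i a x \<and> b = c x)"

definition ev :: "set_fm \<Rightarrow> 'a rel2 \<Rightarrow> 'a rel2 \<Rightarrow> 'a rel2" where
  "ev \<theta> m r = (\<lambda>x y. sat (set_str m r) (case_nat x (\<lambda>_. y)) \<theta>)"

lemma ev_prec [simp]: "ev (prec 0 1) m r = r"
  by (simp add: ev_def)

lemma Emem_id [simp]: "Emem m (\<lambda>x. x) = m"
  by (simp add: Emem_def)

lemma sat_ev: "wff set_sig [(), ()] \<theta> \<Longrightarrow> sat (set_str m r) e \<theta> \<longleftrightarrow> ev \<theta> m r (e 0) (e 1)"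
  unfolding ev_def by (erule sat_agree) (auto simp: less_Suc_eq)

lemma flat_E: "flat_interp set_sig sc_sig E_interp"
  by (auto simp: flat_interp_def wf_interp_def E_interp_def ctx_def split: set_rel.splits)

lemma sem_E: "interp_sem set_sig E_interp (sc_str l i c) (set_str (Emem i c) l)"
  by (auto simp: interp_sem_def E_interp_def Emem_def split: set_rel.splits)

lemma flat_O: "wff set_sig [(), ()] \<theta> \<Longrightarrow> flat_interp set_sig sc_sig (O_interp \<theta>)"
  using flat_E wff_tr_ctx[OF flat_E, of "[(), ()]" \<theta>]
  by (auto simp: flat_interp_def wf_interp_def O_interp_def E_interp_def ctx_def split: set_rel.splits)

lemma sem_O:
  assumes "wff set_sig [(), ()] \<theta>"
  shows "interp_sem set_sig (O_interp \<theta>) (sc_str l i c) (set_str (Emem i c) (ev \<theta> (Emem i c) l))"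
proof -
  have "sat (sc_str l i c) e (tr_ctx set_sig E_interp [(), ()] \<theta>) \<longleftrightarrow> ev \<theta> (Emem i c) l (e 0) (e 1)" for e
    using sat_tr_ctx[OF flat_E sem_E assms] sat_ev[OF assms] by metis
  then show ?thesis
    using sem_E[of l i c] by (auto simp: interp_sem_def O_interp_def split: set_rel.splits)
qed

lemma flat_V: "wff set_sig [(), ()] \<psi> \<Longrightarrow> flat_interp sc_sig set_sig (V_interp \<psi>)"
  by (auto simp: flat_interp_def wf_interp_def V_interp_def ctx_def split: sc_rel.splits)

lemma sem_V:
  "wff set_sig [(), ()] \<psi> \<Longrightarrow> interp_sem sc_sig (V_interp \<psi>) (set_str m r) (sc_str (ev \<psi> m r) m (\<lambda>x. x))"
  unfolding interp_sem_def
proof (intro conjI allI HOL.impI)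
  fix q ss e
  assume "wff set_sig [(), ()] \<psi>" "rel_ar sc_sig q = Some ss"
  then show "sat (set_str m r) e (rel_int (V_interp \<psi>) q) \<longleftrightarrow>
      rl (sc_str (ev \<psi> m r) m (\<lambda>x. x)) q (map e [0..<length ss])"
    by (cases q) (auto simp: V_interp_def sat_ev)
qed (auto simp: V_interp_def)

lemma interp_sem_transfer:
  assumes I: "flat_interp \<sigma>1 \<sigma>2 I" and "univ N" "interp_sem \<sigma>1 I N' M"
    and sat: "\<And>\<Gamma> p e. wff \<sigma>2 \<Gamma> p \<Longrightarrow> sat N e p \<longleftrightarrow> sat N' e p"
  shows "interp_sem \<sigma>1 I N M"
  using assms(2,3) sat wff_fun_int[OF I] wff_rel_int[OF I] wff_eqv_int[OF I] I
  unfolding interp_sem_def flat_interp_def wf_interp_def by metis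

abbreviation models :: "('s, 'f, 'r, 'a) model \<Rightarrow> ('s, 'f, 'r) fm set \<Rightarrow> bool" (infix "\<Turnstile>" 50) where
  "M \<Turnstile> T \<equiv> \<forall>p\<in>T. \<forall>e. sat M e p"

text \<open>The round trip from the ordinals replaces each bounded set by its code, so its
  isomorphism is the identity on ordinals and the encoding on bounded sets; the round trip from the
  sets is the identity. Both rest on \<theta> and \<psi> undoing each other.\<close>

lemma bi_interpretableI:
  assumes \<psi>: "wff set_sig [(), ()] \<psi>" and \<theta>: "wff set_sig [(), ()] \<theta>"
    and compl1: "\<And>p. wff sc_sig [] p \<Longrightarrow> (\<And>M :: (sc_sort, sc_fun, sc_rel, nat) model. is_model sc_sig T1 M \<Longrightarrow> univ M \<Longrightarrow> \<exists>e. sat M e p) \<Longrightarrow> proves sc_sig T1 p"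
    and compl2: "\<And>p. wff set_sig [] p \<Longrightarrow> (\<And>N :: (unit, unit, set_rel, nat) model. is_model set_sig T2 N \<Longrightarrow> univ N \<Longrightarrow> \<exists>e. sat N e p) \<Longrightarrow> proves set_sig T2 p"
    and T1: "\<And>p. p \<in> T1 \<Longrightarrow> wff sc_sig [] p" and T2: "\<And>p. p \<in> T2 \<Longrightarrow> wff set_sig [] p"
    and models1: "\<And>(l :: nat rel2) i c. sc_str l i c \<Turnstile> T1 \<Longrightarrow> bij c \<and>
      set_str (Emem i c) (ev \<theta> (Emem i c) l) \<Turnstile> T2 \<and> ev \<psi> (Emem i c) (ev \<theta> (Emem i c) l) = l"
    and models2: "\<And>(m :: nat rel2) r. set_str m r \<Turnstile> T2 \<Longrightarrow>
      sc_str (ev \<psi> m r) m (\<lambda>x. x) \<Turnstile> T1 \<and> ev \<theta> m (ev \<psi> m r) = r"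
  shows "bi_interpretable sc_sig T1 set_sig T2"
proof (rule flat_bi_interpretable[OF flat_V[OF \<psi>] flat_O[OF \<theta>] compl1 compl2 T1 T2])
  let ?\<iota> = "case_sc_sort (Eq Ordinal (Var 1) (Var 0)) (Eq Ordinal (Var 1) (enc 0)) :: sc_sort \<Rightarrow> sc_fm"
  let ?\<kappa> = "\<lambda>_ :: unit. eq 1 0"
  show "wff sc_sig [s, dim (O_interp \<theta>) (dim (V_interp \<psi>) s)] (?\<iota> s)" for s
    by (auto simp: O_interp_def V_interp_def E_interp_def split: sc_sort.splits)
  show "wff set_sig [s, dim (V_interp \<psi>) (dim (O_interp \<theta>) s)] (?\<kappa> s)" for s
    by simp
  fix M :: "(sc_sort, sc_fun, sc_rel, nat) model"
  assume M: "is_model sc_sig T1 M" "univ M"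
  define l i c where "l = (\<lambda>x y. rl M Less [x, y])" and "i = (\<lambda>x y. rl M In [x, y])" and "c = (\<lambda>x. fn M Enc [x])"
  have sat: "sat M e p \<longleftrightarrow> sat (sc_str l i c) e p" if "wff sc_sig \<Gamma> p" for \<Gamma> p e
    using sc_str_model[OF M(2) that] by (simp add: l_def i_def c_def)
  then have "sc_str l i c \<Turnstile> T1" using M(1) T1 sat unfolding is_model_def by blast
  note m = models1[OF this]
  let ?N = "set_str (Emem i c) (ev \<theta> (Emem i c) l)"
  have 1: "interp_sem set_sig (O_interp \<theta>) M ?N"
    by (rule interp_sem_transfer[OF flat_O[OF \<theta>] M(2) sem_O[OF \<theta>] sat])
  have 2: "interp_sem sc_sig (V_interp \<psi>) ?N (sc_str l (Emem i c) (\<lambda>x. x))"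
    using sem_V[OF \<psi>, of "Emem i c" "ev \<theta> (Emem i c) l"] m by simp
  have 3: "iso sc_sig M (sc_str l (Emem i c) (\<lambda>x. x)) (case_sc_sort (\<lambda>x. x) c)"
    unfolding iso_def
  proof (intro conjI allI HOL.impI)
    show "bij (case_sc_sort (\<lambda>x. x) c s)" for s
      using m by (cases s) (auto simp: bij_def inj_def)
    fix q ss and xs :: "nat list"
    assume "rel_ar sc_sig q = Some ss" "length xs = length ss"
    moreover have "rl M In [x, y] \<longleftrightarrow> Emem i c x (c y)" for x y
      using m by (auto simp: Emem_def bij_def inj_eq i_def)
    moreover have "rl M Less [x, y] \<longleftrightarrow> l x y" for x y by (simp add: l_def)
    ultimately show "rl M q xs \<longleftrightarrow> rl (sc_str l (Emem i c) (\<lambda>x. x)) q (map2 (case_sc_sort (\<lambda>x. x) c) ss xs)"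
      by (cases q) (auto simp: length_2)
  next
    fix f ss s and xs :: "nat list"
    assume "fun_ar sc_sig f = Some (ss, s)" "length xs = length ss"
    then show "fn (sc_str l (Emem i c) (\<lambda>x. x)) f (map2 (case_sc_sort (\<lambda>x. x) c) ss xs) = case_sc_sort (\<lambda>x. x) c s (fn M f xs)"
      by (cases f) (auto simp: length_Suc_conv c_def)
  qed
  have 4: "sat M e (?\<iota> s) \<longleftrightarrow> e 1 = case_sc_sort (\<lambda>x. x) c s (e 0)" for s e
    by (cases s) (auto simp: c_def)
  show "\<exists>N M' \<beta>. interp_sem set_sig (O_interp \<theta>) M N \<and> N \<Turnstile> T2 \<and> interp_sem sc_sig (V_interp \<psi>) N M' \<and>
      iso sc_sig M M' \<beta> \<and> (\<forall>s e. sat M e (?\<iota> s) \<longleftrightarrow> e 1 = \<beta> s (e 0))"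
    using 1 2 3 4 m by blast
next
  fix N :: "(unit, unit, set_rel, nat) model"
  assume N: "is_model set_sig T2 N" "univ N"
  define m r where "m = (\<lambda>x y. rl N Mem [x, y])" and "r = (\<lambda>x y. rl N Prec [x, y])"
  have sat: "sat N e p \<longleftrightarrow> sat (set_str m r) e p" if "wff set_sig \<Gamma> p" for \<Gamma> p e
    using set_str_model[OF N(2) that] by (simp add: m_def r_def)
  then have "set_str m r \<Turnstile> T2" using N(1) T2 sat unfolding is_model_def by blast
  note mr = models2[OF this]
  let ?M = "sc_str (ev \<psi> m r) m (\<lambda>x. x)"
  have 1: "interp_sem sc_sig (V_interp \<psi>) N ?M"
    by (rule interp_sem_transfer[OF flat_V[OF \<psi>] N(2) sem_V[OF \<psi>] sat])
  have 2: "interp_sem set_sig (O_interp \<theta>) ?M (set_str m r)"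
    using sem_O[OF \<theta>, of "ev \<psi> m r" m "\<lambda>x. x"] mr by simp
  have 3: "iso set_sig N (set_str m r) (\<lambda>_ x. x)"
    unfolding iso_def
  proof (intro conjI allI HOL.impI)
    show "bij (\<lambda>x :: nat. x)" by (auto simp: bij_def inj_def)
    fix q ss and xs :: "nat list"
    assume "rel_ar set_sig q = Some ss" "length xs = length ss"
    then show "rl N q xs \<longleftrightarrow> rl (set_str m r) q (map2 (\<lambda>_ x. x) ss xs)"
      by (cases q) (auto simp: length_2 m_def r_def)
  qed simp
  show "\<exists>M N' \<beta>. interp_sem sc_sig (V_interp \<psi>) N M \<and> M \<Turnstile> T1 \<and> interp_sem set_sig (O_interp \<theta>) M N' \<and>
      iso set_sig N N' \<beta> \<and> (\<forall>s e. sat N e (eq 1 0) \<longleftrightarrow> e 1 = \<beta> s (e 0))"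
    by (intro exI[of _ ?M] exI[of _ "set_str m r"] exI[of _ "\<lambda>_ x. x"] conjI 1 2 3) (use mr in auto)
qed

section \<open>The axioms\<close>

lemma wff_ins:
  assumes "wff \<sigma> (\<Gamma>1 @ \<Gamma>2) p" "k = length \<Gamma>1" "n = length \<Delta>"
  shows "wff \<sigma> (\<Gamma>1 @ \<Delta> @ \<Gamma>2) (ins k n p)"
  unfolding ins_def
  by (rule wff_subst[OF assms(1)]) (auto simp: sorted_subst_def nth_append assms(2,3))

lemma wff_ins_simps:
  "wff \<sigma> (s # \<Gamma>) p \<Longrightarrow> wff \<sigma> (s # t # \<Gamma>) (ins (Suc 0) (Suc 0) p)"
  "wff \<sigma> (s # \<Gamma>) p \<Longrightarrow> wff \<sigma> (s # t # u # \<Gamma>) (ins (Suc 0) 2 p)"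
  "wff \<sigma> (s # s' # \<Gamma>) p \<Longrightarrow> wff \<sigma> (s # s' # t # \<Gamma>) (ins 2 (Suc 0) p)"
  "wff \<sigma> (s # s' # \<Gamma>) p \<Longrightarrow> wff \<sigma> (s # s' # t # u # \<Gamma>) (ins 2 2 p)"
  using wff_ins[of \<sigma> "[s]" \<Gamma> p 1 1 "[t]"] wff_ins[of \<sigma> "[s]" \<Gamma> p 1 2 "[t, u]"]
    wff_ins[of \<sigma> "[s, s']" \<Gamma> p 2 1 "[t]"] wff_ins[of \<sigma> "[s, s']" \<Gamma> p 2 2 "[t, u]"]
  by simp_all

lemma wff_Exists1: "wff \<sigma> \<Gamma> (Exists1 s p) \<longleftrightarrow> wff \<sigma> (s # \<Gamma>) (And p (Forall s (Imp (ins 1 1 p) (Eq s (Var 0) (Var 1)))))"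
  by (simp add: Exists1_def)

lemmas set_fm_defs = subset_fm_def upair_fm_def opair_fm_def app_fm_def function_fm_def bijection_fm_def
  ordinal_fm_def cardinal_fm_def rank_fm_def

lemmas set_ax_defs = extensionality_ax_def foundation_ax_def pairing_ax_def union_ax_def infinity_ax_def
  choice_ax_def power_set_ax_def

lemma wff_ZFGC_minus: "p \<in> ZFGC_minus \<Longrightarrow> wff set_sig [] p"
  unfolding ZFGC_minus_def ZFC_minus_def global_wellorder_axs_def separation_schema_def collection_schema_def
  by (auto simp: set_ax_defs set_fm_defs separation_ax_def collection_ax_def wff_Exists1 wff_ins_simps)

lemma wff_power_set: "wff set_sig [] power_set_ax"
  and wff_rank_ax: "wff set_sig [] rank_ax"
  and wff_successor_cardinals: "wff set_sig [] successor_cardinals_ax"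
  by (auto simp: power_set_ax_def rank_ax_def successor_cardinals_ax_def set_fm_defs)

lemma wff_SC_minus: "p \<in> SC_minus \<Longrightarrow> wff sc_sig [] p"
  unfolding SC_minus_def wellorder_axs_def replacement_schema_def comprehension_schema_def encoding_axs_def
  by (auto simp: set_extensionality_ax_def boundedness_ax_def order_preservation_ax_def ord_infinity_ax_def
      replacement_ax_def comprehension_ax_def wff_Exists1 wff_ins_simps)

lemma wff_SC_axs: "wff sc_sig [] uniform_boundedness_ax" "wff sc_sig [] regularity_ax"
    "wff sc_sig [] limitlessness_ax"
  using wff_tr_ctx[OF flat_E wff_successor_cardinals]
  by (auto simp: uniform_boundedness_ax_def regularity_ax_def limitlessness_ax_def upper_bound_fm_def sup_fm_def)

lemma sat_ins_simps:
  "sat M (case_nat z (case_nat y e)) (ins (Suc 0) (Suc 0) p) \<longleftrightarrow> sat M (case_nat z e) p"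
  "sat M (case_nat z (case_nat y (case_nat x e))) (ins (Suc 0) 2 p) \<longleftrightarrow> sat M (case_nat z e) p"
  "sat M (case_nat z (case_nat y (case_nat x e))) (ins 2 (Suc 0) p) \<longleftrightarrow> sat M (case_nat z (case_nat y e)) p"
  "sat M (case_nat z (case_nat y (case_nat x (case_nat w e)))) (ins 2 2 p) \<longleftrightarrow> sat M (case_nat z (case_nat y e)) p"
  unfolding sat_ins
  by (rule arg_cong[of _ _ "\<lambda>e. sat M e p"]; rule ext; auto split: nat.split simp: numeral_2_eq_2)+

lemma sat_Exists1: "sat M e (Exists1 s p) \<longleftrightarrow> (\<exists>a\<in>car M s. sat M (case_nat a e) p \<and> (\<forall>b\<in>car M s. sat M (case_nat b e) p \<longrightarrow> b = a))"
  by (simp add: Exists1_def sat_ins_simps del: sat_ins)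

text \<open>In a finite set, an element with the fewest \<open>P\<close>-successors would have a
  successor with still fewer.\<close>

lemma infinite_no_max:
  assumes "A \<noteq> {}" "\<And>x. x \<in> A \<Longrightarrow> \<exists>y\<in>A. P x y" "\<And>x. x \<in> A \<Longrightarrow> \<not> P x x"
    "\<And>x y z. x \<in> A \<Longrightarrow> y \<in> A \<Longrightarrow> z \<in> A \<Longrightarrow> P x y \<Longrightarrow> P y z \<Longrightarrow> P x z"
  shows "infinite A"
proof
  assume fin: "finite A"
  obtain x where x: "x \<in> A" "\<And>y. y \<in> A \<Longrightarrow> card {z \<in> A. P x z} \<le> card {z \<in> A. P y z}"
    using ex_has_least_nat[of "\<lambda>x. x \<in> A" _ "\<lambda>x. card {z \<in> A. P x z}"] assms(1) by blast
  obtain y where y: "y \<in> A" "P x y" using assms(2) x by blast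
  then have "{z \<in> A. P y z} \<subset> {z \<in> A. P x z}" using assms(3,4) x(1) by blast
  then have "card {z \<in> A. P y z} < card {z \<in> A. P x z}" using fin by (intro psubset_card_mono) auto
  then show False using x(2) y(1) by fastforce
qed

lemma set_completeness:
  assumes T: "ZFGC_minus \<subseteq> T" and p: "wff set_sig [] p"
    and models: "\<And>N :: (unit, unit, set_rel, nat) model. is_model set_sig T N \<Longrightarrow> univ N \<Longrightarrow> \<exists>e. sat N e p"
  shows "proves set_sig T p"
proof (rule completeness_UNIV[OF p])
  fix M :: "(unit, unit, set_rel, nat) model" and s :: unit
  assume M: "is_model set_sig T M"
  then have ax: "sat M undefined p" if "p \<in> ZFGC_minus" for p
    using that T wff_ZFGC_minus unfolding is_model_def by blast
  let ?P = "\<lambda>x y. rl M Prec [x, y]"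
  \<comment> \<open>Pairing gives a set containing \<open>x\<close>, and the order puts it above
    \<open>x\<close>.\<close>
  have "sat M undefined pairing_ax" by (rule ax) (simp add: ZFGC_minus_def ZFC_minus_def)
  then have 1: "\<forall>x\<in>car M (). \<exists>y\<in>car M (). rl M Mem [x, y]"
    by (simp add: pairing_ax_def upair_fm_def) blast
  have "sat M undefined (all (all (Imp (mem 1 0) (prec 1 0))))"
    "sat M undefined (all (Neg (prec 0 0)))"
    "sat M undefined (all (all (all (Imp (And (prec 2 1) (prec 1 0)) (prec 2 0)))))"
    by (rule ax; simp add: ZFGC_minus_def global_wellorder_axs_def)+
  moreover have
    "sat M undefined (all (all (Imp (mem 1 0) (prec 1 0)))) \<longleftrightarrow> (\<forall>x\<in>car M (). \<forall>y\<in>car M (). rl M Mem [x, y] \<longrightarrow> ?P x y)"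
    "sat M undefined (all (Neg (prec 0 0))) \<longleftrightarrow> (\<forall>x\<in>car M (). \<not> ?P x x)"
    "sat M undefined (all (all (all (Imp (And (prec 2 1) (prec 1 0)) (prec 2 0))))) \<longleftrightarrow>
      (\<forall>x\<in>car M (). \<forall>y\<in>car M (). \<forall>z\<in>car M (). ?P x y \<and> ?P y z \<longrightarrow> ?P x z)"
    by simp_all
  ultimately have 2: "\<forall>x\<in>car M (). \<forall>y\<in>car M (). rl M Mem [x, y] \<longrightarrow> ?P x y" "\<forall>x\<in>car M (). \<not> ?P x x"
    "\<forall>x\<in>car M (). \<forall>y\<in>car M (). \<forall>z\<in>car M (). ?P x y \<and> ?P y z \<longrightarrow> ?P x z"
    by blast+
  have "infinite (car M ())"
  proof (rule infinite_no_max[of _ ?P])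
    show "car M () \<noteq> {}" using M by (simp add: is_model_def)
  qed (use 1 2 in blast)+
  then show "infinite (car M s)" by simp
qed (use models in \<open>auto simp: univ_def\<close>)

lemma sc_completeness:
  assumes T: "SC_minus \<subseteq> T" and p: "wff sc_sig [] p"
    and models: "\<And>N :: (sc_sort, sc_fun, sc_rel, nat) model. is_model sc_sig T N \<Longrightarrow> univ N \<Longrightarrow> \<exists>e. sat N e p"
  shows "proves sc_sig T p"
proof (rule completeness_UNIV[OF p])
  fix M :: "(sc_sort, sc_fun, sc_rel, nat) model" and s :: sc_sort
  assume M: "is_model sc_sig T M"
  then have ax: "sat M undefined p" if "p \<in> SC_minus" for p
    using that T wff_SC_minus unfolding is_model_def by blast
  let ?P = "\<lambda>x y. rl M Less [x, y]" and ?O = "car M Ordinal"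
  have "sat M undefined ord_infinity_ax" by (rule ax) (simp add: SC_minus_def)
  then obtain a z where a: "a \<in> ?O" "z \<in> ?O" "?P z a" "\<forall>x\<in>?O. ?P x a \<longrightarrow> (\<exists>y\<in>?O. ?P y a \<and> ?P x y)"
    by (auto simp: ord_infinity_ax_def)
  have "sat M undefined (all_ord (Neg (less 0 0)))"
    "sat M undefined (all_ord (all_ord (all_ord (Imp (And (less 2 1) (less 1 0)) (less 2 0)))))"
    "sat M undefined (all_ord (ex_set (Eq Ordinal (Var 1) (enc 0))))"
    by (rule ax; simp add: SC_minus_def wellorder_axs_def encoding_axs_def)+
  moreover have "sat M undefined (all_ord (Neg (less 0 0))) \<longleftrightarrow> (\<forall>x\<in>?O. \<not> ?P x x)"
    "sat M undefined (all_ord (all_ord (all_ord (Imp (And (less 2 1) (less 1 0)) (less 2 0))))) \<longleftrightarrow>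
      (\<forall>x\<in>?O. \<forall>y\<in>?O. \<forall>z\<in>?O. ?P x y \<and> ?P y z \<longrightarrow> ?P x z)"
    "sat M undefined (all_ord (ex_set (Eq Ordinal (Var 1) (enc 0)))) \<longleftrightarrow> (\<forall>a\<in>?O. \<exists>x\<in>car M BSet. a = fn M Enc [x])"
    by simp_all
  ultimately have 2: "\<forall>x\<in>?O. \<not> ?P x x" "\<forall>x\<in>?O. \<forall>y\<in>?O. \<forall>z\<in>?O. ?P x y \<and> ?P y z \<longrightarrow> ?P x z"
    and 3: "\<forall>a\<in>?O. \<exists>x\<in>car M BSet. a = fn M Enc [x]"
    by blast+
  \<comment> \<open>There is no greatest ordinal below a limit. The bounded sets are then infinitely
    many as well, since the encoding maps them onto the ordinals.\<close>
  have "infinite {x \<in> ?O. ?P x a}"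
    by (rule infinite_no_max[of _ ?P]) (use a 2 in blast)+
  then have 1: "infinite ?O" by (auto intro: infinite_super[rotated])
  have "?O \<subseteq> (\<lambda>x. fn M Enc [x]) ` car M BSet" using 3 by blast
  then have "infinite (car M BSet)" using 1 finite_surj by blast
  then show "infinite (car M s)" using 1 by (cases s) auto
qed (use models in \<open>auto simp: univ_def\<close>)

lemma app_env_1: "app_env [x] e = case_nat x e"
  and app_env_2: "app_env [x, y] e = case_nat x (case_nat y e)"
  by (simp_all add: app_env_Cons)

lemma df_push:
  assumes "df True M R \<Phi>"
  shows "df True M R (\<lambda>i e. \<Phi> i (case_nat (e 0) E))"
    and "df True M R (\<lambda>i e. \<Phi> i (case_nat (e (Suc 0)) (case_nat (e 0) E)))"
proof -
  have "vr True (\<lambda>i e. case_nat (e 0) E j)" for j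
    by (cases j) (simp_all add: vr_var vr_const)
  then show "df True M R (\<lambda>i e. \<Phi> i (case_nat (e 0) E))" by (rule df_rename[OF assms])
  have "vr True (\<lambda>i e. case_nat (e (Suc 0)) (case_nat (e 0) E) j)" for j
  proof (cases j)
    case (Suc k)
    then show ?thesis by (cases k) (simp_all add: vr_var vr_const)
  qed (simp add: vr_var)
  then show "df True M R (\<lambda>i e. \<Phi> i (case_nat (e (Suc 0)) (case_nat (e 0) E)))" by (rule df_rename[OF assms])
qed

lemma df_const: "df True M R (\<lambda>i e. C)"
proof -
  have "df True M R (\<lambda>i e. \<not> False)" "df True M R (\<lambda>i e. False)" by (intro df_intros)+
  then show ?thesis by (cases C) simp_all
qed

lemma cls2D: "cls2 m r P \<Longrightarrow> vr True t \<Longrightarrow> vr True u \<Longrightarrow> df True (\<lambda>_ :: unit. m) (\<lambda>_. r) (\<lambda>i e. P (t i e) (u i e))"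
  using df2D[of True "\<lambda>_ :: unit. m" "\<lambda>_. r" "\<lambda>_ _. P"] by simp

lemma cls2I: "df True (\<lambda>_ :: unit. m) (\<lambda>_. r) (\<lambda>_ e. P (e 0) (e (Suc 0))) \<Longrightarrow> cls2 m r P"
  by (rule df2I)

lemma df_base_change:
  assumes "df True (\<lambda>_ :: unit. m) (\<lambda>_. l) \<Phi>" and l: "cls2 m r l"
  shows "df True (\<lambda>_ :: unit. m) (\<lambda>_. r) \<Phi>"
proof -
  obtain p k d c where p: "wff set_sig (replicate (k + d) ()) p"
    and sat: "\<And>i e. \<Phi> i e \<longleftrightarrow> sat (set_str m l) (\<lambda>j. if j < k then e j else c (j - k)) p"
    using assms(1) unfolding df_def by blast
  have "df True (\<lambda>_ :: unit. m) (\<lambda>_. r) (\<lambda>_ e. sat (set_str m l) e p)"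
    by (rule df_set_str[OF l p])
  moreover have "vr True (\<lambda>(i :: unit) e. if j < k then e j else c (j - k))" for j
    by (cases "j < k") (simp_all add: vr_var vr_const)
  ultimately have "df True (\<lambda>_ :: unit. m) (\<lambda>_. r) (\<lambda>_ e. sat (set_str m l) (\<lambda>j. if j < k then e j else c (j - k)) p)"
    by (rule df_rename[of _ _ _ _ "\<lambda>j i e. if j < k then e j else c (j - k)"])
  moreover have "\<Phi> = (\<lambda>_ e. sat (set_str m l) (\<lambda>j. if j < k then e j else c (j - k)) p)"
    by (intro ext) (simp add: sat)
  ultimately show ?thesis by simp
qed

section \<open>The axioms as statements about definable classes\<close>

definition gwo :: "'a rel2 \<Rightarrow> 'a rel2 \<Rightarrow> bool" where
  "gwo m r \<longleftrightarrow> (\<forall>x. \<not> r x x) \<and> (\<forall>x y z. r x y \<and> r y z \<longrightarrow> r x z) \<and> (\<forall>x y. r x y \<or> x = y \<or> r y x) \<and>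
    (\<forall>x. (\<exists>y. m y x) \<longrightarrow> (\<exists>y. m y x \<and> (\<forall>z. m z x \<longrightarrow> y = z \<or> r y z))) \<and>
    (\<forall>x. \<exists>y. \<forall>z. m z y \<longleftrightarrow> r z x) \<and> (\<forall>x y. m x y \<longrightarrow> r x y)"

definition sep_schema :: "'a rel2 \<Rightarrow> 'a rel2 \<Rightarrow> bool" where
  "sep_schema m r \<longleftrightarrow> (\<forall>X. cls m r X \<longrightarrow> (\<forall>x. \<exists>y. \<forall>z. m z y \<longleftrightarrow> m z x \<and> X z))"

definition coll_schema :: "'a rel2 \<Rightarrow> 'a rel2 \<Rightarrow> bool" where
  "coll_schema m r \<longleftrightarrow> (\<forall>P. cls2 m r P \<longrightarrow> (\<forall>x. (\<forall>u. m u x \<longrightarrow> (\<exists>v. P u v)) \<longrightarrow>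
    (\<exists>y. \<forall>u. m u x \<longrightarrow> (\<exists>v. m v y \<and> P u v))))"

definition zf_finite :: "'a rel2 \<Rightarrow> bool" where
  "zf_finite m \<longleftrightarrow> (\<forall>x y. (\<forall>z. m z x \<longleftrightarrow> m z y) \<longrightarrow> x = y) \<and>
    (\<forall>x. (\<exists>y. m y x) \<longrightarrow> (\<exists>y. m y x \<and> (\<forall>z. m z y \<longrightarrow> \<not> m z x))) \<and>
    (\<forall>a b. \<exists>z. \<forall>x. m x z \<longleftrightarrow> x = a \<or> x = b) \<and>
    (\<forall>x. \<exists>u. \<forall>z. m z u \<longleftrightarrow> (\<exists>y. m y x \<and> m z y)) \<and>
    (\<exists>w. (\<exists>z. (\<forall>x. \<not> m x z) \<and> m z w) \<and> (\<forall>y. m y w \<longrightarrow> (\<exists>s. m s w \<and> (\<forall>u. m u s \<longleftrightarrow> m u y \<or> u = y)))) \<and>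
    (\<forall>x. (\<forall>y. m y x \<longrightarrow> (\<exists>z. m z y)) \<and> (\<forall>y z. m y x \<and> m z x \<and> (\<exists>w. m w y \<and> m w z) \<longrightarrow> y = z) \<longrightarrow>
      (\<exists>c. \<forall>y. m y x \<longrightarrow> (\<exists>z. m z y \<and> m z c \<and> (\<forall>z'. m z' y \<and> m z' c \<longrightarrow> z' = z))))"

lemma zf_finiteD:
  assumes "zf_finite m"
  shows "\<forall>x y. (\<forall>z. m z x \<longleftrightarrow> m z y) \<longrightarrow> x = y"
    "\<forall>x. (\<exists>y. m y x) \<longrightarrow> (\<exists>y. m y x \<and> (\<forall>z. m z y \<longrightarrow> \<not> m z x))"
    "\<forall>a b. \<exists>z. \<forall>x. m x z \<longleftrightarrow> x = a \<or> x = b"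
    "\<forall>x. \<exists>u. \<forall>z. m z u \<longleftrightarrow> (\<exists>y. m y x \<and> m z y)"
    "\<exists>w. (\<exists>z. (\<forall>x. \<not> m x z) \<and> m z w) \<and> (\<forall>y. m y w \<longrightarrow> (\<exists>s. m s w \<and> (\<forall>u. m u s \<longleftrightarrow> m u y \<or> u = y)))"
  using assms unfolding zf_finite_def by - ((elim conjE, assumption)+)

lemma sat_gwo: "set_str m r \<Turnstile> global_wellorder_axs \<longleftrightarrow> gwo m r"
proof -
  have "sat (set_str m r) e (all (Neg (prec 0 0))) \<longleftrightarrow> (\<forall>x. \<not> r x x)"
    "sat (set_str m r) e (all (all (all (Imp (And (prec 2 1) (prec 1 0)) (prec 2 0))))) \<longleftrightarrow> (\<forall>x y z. r x y \<and> r y z \<longrightarrow> r x z)"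
    "sat (set_str m r) e (all (all (Or (prec 1 0) (Or (eq 1 0) (prec 0 1))))) \<longleftrightarrow> (\<forall>x y. r x y \<or> x = y \<or> r y x)"
    "sat (set_str m r) e (all (Imp (ex (mem 0 1)) (ex (And (mem 0 1) (all (Imp (mem 0 2) (Or (eq 1 0) (prec 1 0)))))))) \<longleftrightarrow>
      (\<forall>x. (\<exists>y. m y x) \<longrightarrow> (\<exists>y. m y x \<and> (\<forall>z. m z x \<longrightarrow> y = z \<or> r y z)))"
    "sat (set_str m r) e (all (ex (all (Iff (mem 0 1) (prec 0 2))))) \<longleftrightarrow> (\<forall>x. \<exists>y. \<forall>z. m z y \<longleftrightarrow> r z x)"
    "sat (set_str m r) e (all (all (Imp (mem 1 0) (prec 1 0)))) \<longleftrightarrow> (\<forall>x y. m x y \<longrightarrow> r x y)" for e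
    by simp_all
  then show ?thesis unfolding global_wellorder_axs_def gwo_def by (simp only: ball_simps simp_thms)
qed

lemma sat_zf_finite:
  "set_str m r \<Turnstile> {extensionality_ax, foundation_ax, pairing_ax, union_ax, infinity_ax, choice_ax} \<longleftrightarrow> zf_finite m"
proof -
  have "sat (set_str m r) e extensionality_ax \<longleftrightarrow> (\<forall>x y. (\<forall>z. m z x \<longleftrightarrow> m z y) \<longrightarrow> x = y)"
    "sat (set_str m r) e foundation_ax \<longleftrightarrow> (\<forall>x. (\<exists>y. m y x) \<longrightarrow> (\<exists>y. m y x \<and> (\<forall>z. m z y \<longrightarrow> \<not> m z x)))"
    "sat (set_str m r) e pairing_ax \<longleftrightarrow> (\<forall>a b. \<exists>z. \<forall>x. m x z \<longleftrightarrow> x = a \<or> x = b)"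
    "sat (set_str m r) e union_ax \<longleftrightarrow> (\<forall>x. \<exists>u. \<forall>z. m z u \<longleftrightarrow> (\<exists>y. m y x \<and> m z y))"
    "sat (set_str m r) e infinity_ax \<longleftrightarrow> (\<exists>w. (\<exists>z. (\<forall>x. \<not> m x z) \<and> m z w) \<and>
      (\<forall>y. m y w \<longrightarrow> (\<exists>s. m s w \<and> (\<forall>u. m u s \<longleftrightarrow> m u y \<or> u = y))))"
    "sat (set_str m r) e choice_ax \<longleftrightarrow> (\<forall>x. (\<forall>y. m y x \<longrightarrow> (\<exists>z. m z y)) \<and>
        (\<forall>y z. m y x \<and> m z x \<and> (\<exists>w. m w y \<and> m w z) \<longrightarrow> y = z) \<longrightarrow>
      (\<exists>c. \<forall>y. m y x \<longrightarrow> (\<exists>z. m z y \<and> m z c \<and> (\<forall>z'. m z' y \<and> m z' c \<longrightarrow> z' = z))))" for e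
    by (simp_all add: set_ax_defs set_fm_defs sat_Exists1)
  then show ?thesis unfolding zf_finite_def by (simp only: ball_simps simp_thms)
qed

text \<open>A formula together with values of its parameters is the same thing as a definable class,
  by \<open>df_formula\<close> in one direction and \<open>df_env\<close> in the other.\<close>

lemma sat_separation: "set_str m r \<Turnstile> separation_schema \<longleftrightarrow> sep_schema m r"
proof
  assume *: "set_str m r \<Turnstile> separation_schema"
  show "sep_schema m r" unfolding sep_schema_def
  proof (intro allI HOL.impI)
    fix X x assume X: "cls m r X"
    obtain p xs where p: "wff set_sig (replicate 1 () @ replicate (length xs) ()) p"
      "\<And>ys e. length ys = 1 \<Longrightarrow> X (app_env ys (\<lambda>_. undefined) 0) \<longleftrightarrow> sat (set_str m r) (app_env ys (app_env xs e)) p"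
      by (rule df_formula[OF X, of 1], rule that, assumption+)
    have "Foralls (replicate (length xs) ()) (separation_ax p) \<in> separation_schema"
      unfolding separation_schema_def using p(1) by auto
    then have "sat (set_str m r) e (Foralls (replicate (length xs) ()) (separation_ax p))" for e
      using * by blast
    then have "\<exists>y. \<forall>z. m z y \<longleftrightarrow> m z x \<and> sat (set_str m r) (case_nat z (app_env xs e)) p" for e
      by (simp add: sat_Foralls separation_ax_def sat_ins_simps del: sat_ins)
    then show "\<exists>y. \<forall>z. m z y \<longleftrightarrow> m z x \<and> X z"
      using p(2)[of "[_]"] by (simp add: app_env_1)
  qed
next
  assume *: "sep_schema m r"
  show "set_str m r \<Turnstile> separation_schema"
  proof (intro ballI allI)
    fix p e assume "p \<in> separation_schema"
    then obtain \<Gamma> q where p: "p = Foralls \<Gamma> (separation_ax q)" and q: "wff set_sig (() # \<Gamma>) q"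
      by (auto simp: separation_schema_def)
    have cl: "cls m r (\<lambda>z. sat (set_str m r) (case_nat z (app_env xs e)) q)" if "length xs = length \<Gamma>" for xs
      using df_env[of 1 \<Gamma> q xs m r e] q that by (simp add: app_env_1)
    have "\<forall>x. \<exists>y. \<forall>z. m z y \<longleftrightarrow> m z x \<and> sat (set_str m r) (case_nat z (app_env xs e)) q"
      if "length xs = length \<Gamma>" for xs
      using *[unfolded sep_schema_def, rule_format, OF cl[OF that]] by blast
    then show "sat (set_str m r) e p"
      unfolding p by (simp add: sat_Foralls separation_ax_def sat_ins_simps del: sat_ins)
  qed
qed

lemma sat_collection: "set_str m r \<Turnstile> collection_schema \<longleftrightarrow> coll_schema m r"
proof
  assume *: "set_str m r \<Turnstile> collection_schema"
  show "coll_schema m r" unfolding coll_schema_def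
  proof (intro allI HOL.impI)
    fix P x assume P: "cls2 m r P" and x: "\<forall>u. m u x \<longrightarrow> (\<exists>v. P u v)"
    have d: "df True (\<lambda>_ :: unit. m) (\<lambda>_. r) (\<lambda>_ e. P (e (Suc 0)) (e 0))"
      by (rule cls2D[OF P vr_var vr_var])
    obtain p xs where p: "wff set_sig (replicate 2 () @ replicate (length xs) ()) p"
      "\<And>ys e. length ys = 2 \<Longrightarrow> P (app_env ys (\<lambda>_. undefined) (Suc 0)) (app_env ys (\<lambda>_. undefined) 0) \<longleftrightarrow>
        sat (set_str m r) (app_env ys (app_env xs e)) p"
      by (rule df_formula[OF d, of 2], rule that, assumption+)
    have "Foralls (replicate (length xs) ()) (collection_ax p) \<in> collection_schema"
      unfolding collection_schema_def using p(1) by (auto simp: numeral_2_eq_2)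
    then have "sat (set_str m r) e (Foralls (replicate (length xs) ()) (collection_ax p))" for e
      using * by blast
    then have "(\<forall>u. m u x \<longrightarrow> (\<exists>v. sat (set_str m r) (case_nat v (case_nat u (app_env xs e))) p)) \<longrightarrow>
      (\<exists>y. \<forall>u. m u x \<longrightarrow> (\<exists>v. m v y \<and> sat (set_str m r) (case_nat v (case_nat u (app_env xs e))) p))" for e
      by (simp add: sat_Foralls collection_ax_def sat_ins_simps del: sat_ins)
    then show "\<exists>y. \<forall>u. m u x \<longrightarrow> (\<exists>v. m v y \<and> P u v)"
      using p(2)[of "[_, _]"] x by (simp add: app_env_2)
  qed
next
  assume *: "coll_schema m r"
  show "set_str m r \<Turnstile> collection_schema"
  proof (intro ballI allI)
    fix p e assume "p \<in> collection_schema"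
    then obtain \<Gamma> q where p: "p = Foralls \<Gamma> (collection_ax q)" and q: "wff set_sig (() # () # \<Gamma>) q"
      by (auto simp: collection_schema_def)
    have cl: "cls2 m r (\<lambda>u v. sat (set_str m r) (case_nat v (case_nat u (app_env xs e))) q)" if l: "length xs = length \<Gamma>" for xs
    proof (rule cls2I)
      have "df True (\<lambda>_ :: unit. m) (\<lambda>_. r) (\<lambda>_ e'. sat (set_str m r) (app_env [e' 0, e' (Suc 0)] (app_env xs e)) q)"
        using df_env[of 2 \<Gamma> q xs m r e] q l by (simp add: numeral_2_eq_2)
      from df_rename[OF this, of "\<lambda>j i e'. e' (if j = 0 then 1 else 0)"]
      show "df True (\<lambda>_ :: unit. m) (\<lambda>_. r) (\<lambda>_ e'. sat (set_str m r) (case_nat (e' (Suc 0)) (case_nat (e' 0) (app_env xs e))) q)"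
        by (simp add: app_env_2 vr_var)
    qed
    have "\<forall>x. (\<forall>u. m u x \<longrightarrow> (\<exists>v. sat (set_str m r) (case_nat v (case_nat u (app_env xs e))) q)) \<longrightarrow>
      (\<exists>y. \<forall>u. m u x \<longrightarrow> (\<exists>v. m v y \<and> sat (set_str m r) (case_nat v (case_nat u (app_env xs e))) q))"
      if "length xs = length \<Gamma>" for xs
      using *[unfolded coll_schema_def, rule_format, OF cl[OF that]] by blast
    then show "sat (set_str m r) e p"
      unfolding p by (simp add: sat_Foralls collection_ax_def sat_ins_simps del: sat_ins)
  qed
qed

definition zf :: "'a rel2 \<Rightarrow> 'a rel2 \<Rightarrow> bool" where
  "zf m r \<longleftrightarrow> zf_finite m \<and> sep_schema m r \<and> coll_schema m r \<and> gwo m r"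

lemma sat_ZFGC_minus: "set_str m r \<Turnstile> ZFGC_minus \<longleftrightarrow> zf m r"
  unfolding zf_def ZFGC_minus_def ZFC_minus_def sat_zf_finite[symmetric, of m r] sat_separation[symmetric]
    sat_collection[symmetric] sat_gwo[symmetric] by blast

text \<open>Classes definable from \<open>l\<close> are definable from \<open>r\<close>, so the
  schemas carry over; the axioms in \<open>zf_finite\<close> do not mention the order at
  all.\<close>

lemma zf_change_order:
  assumes "zf m r" "cls2 m r l" "gwo m l"
  shows "zf m l"
proof -
  have "cls m r X" if "cls m l X" for X using df_base_change[OF that assms(2)] .
  moreover have "cls2 m r P" if "cls2 m l P" for P
    by (rule cls2I, rule df_base_change[OF _ assms(2)], rule cls2D[OF that vr_var vr_var])
  ultimately show ?thesis
    using assms unfolding zf_def sep_schema_def coll_schema_def by blast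
qed

text \<open>The counterpart of \<open>SC\<^sup>-\<close> for the single-sorted structure \<open>(Ord, E, <)\<close>.\<close>

definition so :: "'a rel2 \<Rightarrow> 'a rel2 \<Rightarrow> bool" where
  "so m l \<longleftrightarrow> (\<forall>x. \<not> l x x) \<and> (\<forall>x y z. l x y \<and> l y z \<longrightarrow> l x z) \<and> (\<forall>x y. l x y \<or> x = y \<or> l y x) \<and>
    (\<forall>x. (\<exists>y. m y x) \<longrightarrow> (\<exists>y. m y x \<and> (\<forall>z. m z x \<longrightarrow> y = z \<or> l y z))) \<and>
    (\<forall>x y. m x y \<longrightarrow> l x y) \<and> (\<forall>x y. (\<forall>z. m z x \<longleftrightarrow> m z y) \<longrightarrow> x = y) \<and>
    (\<forall>X. cls m l X \<longrightarrow> (\<forall>a. \<exists>x. \<forall>b. m b x \<longleftrightarrow> l b a \<and> X b)) \<and>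
    (\<forall>P. cls2 m l P \<longrightarrow> (\<forall>a. (\<forall>c. l c a \<longrightarrow> (\<exists>!d. P c d)) \<longrightarrow> (\<exists>b. \<forall>c. l c a \<longrightarrow> (\<exists>d. l d b \<and> P c d)))) \<and>
    (\<exists>a. (\<exists>z. (\<forall>y. z = y \<or> l z y) \<and> l z a) \<and> (\<forall>b. l b a \<longrightarrow> (\<exists>c. l c a \<and> l b c)))"

section \<open>Models of \<open>SC_minus\<close> and the structure (Ord, E, <)\<close>

lemma tr_E:
  assumes "wff set_sig (replicate n ()) p"
  shows "wff sc_sig (replicate n Ordinal) (tr_ctx set_sig E_interp (replicate n ()) p)"
    and "sat (sc_str l i c) e (tr_ctx set_sig E_interp (replicate n ()) p) \<longleftrightarrow> sat (set_str (Emem i c) l) e p"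
  using wff_tr_ctx[OF flat_E assms] sat_tr_ctx[OF flat_E sem_E assms] by (simp_all add: E_interp_def)

text \<open>The bijection \<open>c\<close> carries statements about bounded sets over to ordinals,
  and the schemas of \<open>SC_minus\<close> are applied to the translations of set-theoretic
  formulas.\<close>

lemma sc_so:
  assumes "sc_str l i c \<Turnstile> SC_minus"
  shows "bij c \<and> so (Emem i c) l"
proof -
  let ?M = "sc_str l i c" let ?E = "Emem i c"
  have ax: "sat ?M e p" if "p \<in> SC_minus" for p e
    using assms that by blast
  have enc: "sat ?M undefined (all_ord (ex_set (Eq Ordinal (Var 1) (enc 0))))"
    "sat ?M undefined (all_set (all_set (Imp (Eq Ordinal (enc 1) (enc 0)) (Eq BSet (Var 1) (Var 0)))))"
    by (rule ax; simp add: SC_minus_def encoding_axs_def)+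
  have surj: "\<forall>a. \<exists>x. a = c x" using enc(1) by simp
  have inj: "c x = c y \<longleftrightarrow> x = y" for x y using enc(2) by auto
  have E: "?E a (c x) \<longleftrightarrow> i a x" for a x using inj by (auto simp: Emem_def)
  have Ex: "(\<exists>x. Q x) \<longleftrightarrow> (\<exists>x. Q (c x))" "(\<forall>x. Q x) \<longleftrightarrow> (\<forall>x. Q (c x))" for Q using surj by metis+
  have 1: "(\<forall>x. \<not> l x x)"
    using ax[of "all_ord (Neg (less 0 0))" undefined] by (simp add: SC_minus_def wellorder_axs_def)
  have "sat ?M undefined (all_ord (all_ord (all_ord (Imp (And (less 2 1) (less 1 0)) (less 2 0)))))"
    by (rule ax) (simp add: SC_minus_def wellorder_axs_def)
  moreover have "sat ?M undefined (all_ord (all_ord (all_ord (Imp (And (less 2 1) (less 1 0)) (less 2 0))))) \<longleftrightarrow>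
      (\<forall>x y z. l x y \<and> l y z \<longrightarrow> l x z)" by simp
  ultimately have 2: "\<forall>x y z. l x y \<and> l y z \<longrightarrow> l x z" by blast
  have 3: "\<forall>x y. l x y \<or> x = y \<or> l y x"
    using ax[of "all_ord (all_ord (Or (less 1 0) (Or (oeq 1 0) (less 0 1))))" undefined]
    by (simp add: SC_minus_def wellorder_axs_def)
  have "sat ?M undefined (all_set (Imp (ex_ord (elem 0 1))
       (ex_ord (And (elem 0 1) (all_ord (Imp (elem 0 2) (Or (oeq 1 0) (less 1 0))))))))"
    by (rule ax) (simp add: SC_minus_def wellorder_axs_def)
  then have 4: "\<forall>x. (\<exists>y. ?E y x) \<longrightarrow> (\<exists>y. ?E y x \<and> (\<forall>z. ?E z x \<longrightarrow> y = z \<or> l y z))"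
    unfolding Ex(2)[of "\<lambda>x. (\<exists>y. ?E y x) \<longrightarrow> _ x"] E by simp
  have "sat ?M undefined order_preservation_ax" by (rule ax) (simp add: SC_minus_def)
  then have 5: "\<forall>x y. ?E x y \<longrightarrow> l x y"
    by (auto simp: order_preservation_ax_def Emem_def)
  have "sat ?M undefined set_extensionality_ax" by (rule ax) (simp add: SC_minus_def)
  then have ext: "\<forall>x y. (\<forall>z. i z x \<longleftrightarrow> i z y) \<longrightarrow> x = y" by (simp add: set_extensionality_ax_def)
  have 6: "\<forall>x y. (\<forall>z. ?E z x \<longleftrightarrow> ?E z y) \<longrightarrow> x = y"
  proof (intro allI HOL.impI)
    fix x y assume *: "\<forall>z. ?E z x \<longleftrightarrow> ?E z y"
    obtain a b where "x = c a" "y = c b" using surj by blast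
    then show "x = y" using * ext E by metis
  qed
  have 7: "\<exists>x. \<forall>b. ?E b x \<longleftrightarrow> l b a \<and> X b" if X: "cls ?E l X" for X a
  proof -
    obtain p xs where p: "wff set_sig (replicate 1 () @ replicate (length xs) ()) p"
      "\<And>ys e. length ys = 1 \<Longrightarrow> X (app_env ys (\<lambda>_. undefined) 0) \<longleftrightarrow> sat (set_str ?E l) (app_env ys (app_env xs e)) p"
      by (rule df_formula[OF X, of 1], rule that, assumption+)
    let ?q = "tr_ctx set_sig E_interp (replicate (1 + length xs) ()) p"
    have w: "wff set_sig (replicate (1 + length xs) ()) p" using p(1) by (simp add: replicate_add)
    have "Foralls (replicate (length xs) Ordinal) (comprehension_ax ?q) \<in> comprehension_schema"
      unfolding comprehension_schema_def using tr_E(1)[OF w] by auto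
    then have "sat ?M e (Foralls (replicate (length xs) Ordinal) (comprehension_ax ?q))" for e
      using ax unfolding SC_minus_def by blast
    then have "\<exists>y. \<forall>z. i z y \<longleftrightarrow> l z a \<and> sat ?M (case_nat z (app_env xs e)) ?q" for e
      by (simp add: sat_Foralls comprehension_ax_def sat_ins_simps del: sat_ins)
    then have "\<exists>y. \<forall>z. ?E z (c y) \<longleftrightarrow> l z a \<and> X z"
      using p(2)[of "[_]"] unfolding tr_E(2)[OF w] E by (simp add: app_env_1)
    then show ?thesis by blast
  qed
  have 8: "\<exists>b. \<forall>c. l c a \<longrightarrow> (\<exists>d. l d b \<and> P c d)" if P: "cls2 ?E l P" and a: "\<forall>c. l c a \<longrightarrow> (\<exists>!d. P c d)" for P a
  proof -
    have d: "df True (\<lambda>_ :: unit. ?E) (\<lambda>_. l) (\<lambda>_ e. P (e (Suc 0)) (e 0))"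
      by (rule cls2D[OF P vr_var vr_var])
    obtain p xs where p: "wff set_sig (replicate 2 () @ replicate (length xs) ()) p"
      "\<And>ys e. length ys = 2 \<Longrightarrow> P (app_env ys (\<lambda>_. undefined) (Suc 0)) (app_env ys (\<lambda>_. undefined) 0) \<longleftrightarrow>
        sat (set_str ?E l) (app_env ys (app_env xs e)) p"
      by (rule df_formula[OF d, of 2], rule that, assumption+)
    let ?q = "tr_ctx set_sig E_interp (replicate (2 + length xs) ()) p"
    have w: "wff set_sig (replicate (2 + length xs) ()) p" using p(1) by (simp add: numeral_2_eq_2)
    have "Foralls (replicate (length xs) Ordinal) (replacement_ax ?q) \<in> replacement_schema"
      unfolding replacement_schema_def using tr_E(1)[OF w] by auto
    then have "sat ?M e (Foralls (replicate (length xs) Ordinal) (replacement_ax ?q))" for e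
      using ax unfolding SC_minus_def by blast
    then have "(\<forall>u. l u a \<longrightarrow> (\<exists>v. sat ?M (case_nat v (case_nat u (app_env xs e))) ?q \<and>
        (\<forall>v'. sat ?M (case_nat v' (case_nat u (app_env xs e))) ?q \<longrightarrow> v' = v))) \<longrightarrow>
      (\<exists>b. \<forall>u. l u a \<longrightarrow> (\<exists>v. l v b \<and> sat ?M (case_nat v (case_nat u (app_env xs e))) ?q))" for e
      by (simp add: sat_Foralls replacement_ax_def sat_ins_simps sat_Exists1 del: sat_ins)
    moreover have "sat ?M (case_nat v (case_nat u (app_env xs e))) ?q \<longleftrightarrow> P u v" for u v e
      unfolding tr_E(2)[OF w] using p(2)[of "[v, u]"] by (simp add: app_env_2)
    ultimately show ?thesis using a unfolding Ex1_def by simp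
  qed
  have "sat ?M undefined ord_infinity_ax" by (rule ax) (simp add: SC_minus_def)
  then have 9: "\<exists>a. (\<exists>z. (\<forall>y. z = y \<or> l z y) \<and> l z a) \<and> (\<forall>b. l b a \<longrightarrow> (\<exists>c. l c a \<and> l b c))"
    by (simp add: ord_infinity_ax_def)
  have "bij c" using inj surj by (auto simp: bij_def inj_def surj_def)
  moreover have c7: "\<forall>X. cls ?E l X \<longrightarrow> (\<forall>a. \<exists>x. \<forall>b. ?E b x \<longleftrightarrow> l b a \<and> X b)"
    by (intro allI HOL.impI 7)
  have c8: "\<forall>P. cls2 ?E l P \<longrightarrow> (\<forall>a. (\<forall>c. l c a \<longrightarrow> (\<exists>!d. P c d)) \<longrightarrow> (\<exists>b. \<forall>c. l c a \<longrightarrow> (\<exists>d. l d b \<and> P c d)))"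
    by (intro allI HOL.impI) (rule 8, assumption+)
  have "so ?E l"
    unfolding so_def by (intro conjI) (fact 1 2 3 4 5 6 c7 c8 9)+
  ultimately show ?thesis by blast
qed


lemma zf_sc:
  assumes zf: "zf m r"
  shows "sc_str r m (\<lambda>x. x) \<Turnstile> SC_minus"
proof -
  let ?M = "sc_str r m (\<lambda>x. x)"
  have gwo: "gwo m r" and fin: "zf_finite m" and sep: "sep_schema m r" and coll: "coll_schema m r"
    using zf by (auto simp: zf_def)
  have irr: "\<not> r x x" and tr: "r x y \<Longrightarrow> r y z \<Longrightarrow> r x z" and tot: "r x y \<or> x = y \<or> r y x"
    and resp: "m x y \<Longrightarrow> r x y" for x y z
    using gwo unfolding gwo_def by blast+
  have least: "(\<exists>y. m y x) \<Longrightarrow> (\<exists>y. m y x \<and> (\<forall>z. m z x \<longrightarrow> y = z \<or> r y z))"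
    and seg: "\<exists>y. \<forall>z. m z y \<longleftrightarrow> r z x" for x
    using gwo unfolding gwo_def by blast+
  have ext: "\<forall>x y. (\<forall>z. m z x \<longleftrightarrow> m z y) \<longrightarrow> x = y" using fin by (simp add: zf_finite_def)
  have wo: "?M \<Turnstile> wellorder_axs"
  proof -
    have "sat ?M e (all_ord (Neg (less 0 0))) \<longleftrightarrow> (\<forall>x. \<not> r x x)"
      "sat ?M e (all_ord (all_ord (all_ord (Imp (And (less 2 1) (less 1 0)) (less 2 0))))) \<longleftrightarrow> (\<forall>x y z. r x y \<and> r y z \<longrightarrow> r x z)"
      "sat ?M e (all_ord (all_ord (Or (less 1 0) (Or (oeq 1 0) (less 0 1))))) \<longleftrightarrow> (\<forall>x y. r x y \<or> x = y \<or> r y x)"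
      "sat ?M e (all_set (Imp (ex_ord (elem 0 1)) (ex_ord (And (elem 0 1) (all_ord (Imp (elem 0 2) (Or (oeq 1 0) (less 1 0)))))))) \<longleftrightarrow>
        (\<forall>x. (\<exists>y. m y x) \<longrightarrow> (\<exists>y. m y x \<and> (\<forall>z. m z x \<longrightarrow> y = z \<or> r y z)))" for e
      by simp_all
    then show ?thesis unfolding wellorder_axs_def using irr tr tot least
      by (simp only: ball_simps simp_thms) blast
  qed
  have c2: "cls2 m r r" by (rule cls2I) (intro df_prec vr_var)
  have dfM: "df True (\<lambda>_ :: unit. m) (\<lambda>_. r) (\<lambda>_ e. sat ?M e p)" if "wff sc_sig \<Gamma> p" for \<Gamma> p
    by (rule df_sc_str[OF c2 that])
  have repl: "?M \<Turnstile> replacement_schema"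
  proof (intro ballI allI)
    fix p e assume "p \<in> replacement_schema"
    then obtain \<Gamma> q where p: "p = Foralls \<Gamma> (replacement_ax q)" and q: "wff sc_sig (Ordinal # Ordinal # \<Gamma>) q"
      by (auto simp: replacement_schema_def)
    have "\<exists>b. \<forall>u. r u a \<longrightarrow> (\<exists>v. r v b \<and> sat ?M (case_nat v (case_nat u (app_env xs e))) q)"
      if "\<forall>u. r u a \<longrightarrow> (\<exists>v. sat ?M (case_nat v (case_nat u (app_env xs e))) q \<and>
        (\<forall>v'. sat ?M (case_nat v' (case_nat u (app_env xs e))) q \<longrightarrow> v' = v))" for xs a
    proof -
      let ?P = "\<lambda>u v. sat ?M (case_nat v (case_nat u (app_env xs e))) q"
      have "cls2 m r ?P" by (rule cls2I, rule df_push(2)[OF dfM[OF q]])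
      then have "(\<forall>u. m u x \<longrightarrow> (\<exists>v. ?P u v)) \<longrightarrow> (\<exists>y. \<forall>u. m u x \<longrightarrow> (\<exists>v. m v y \<and> ?P u v))" for x
        using coll unfolding coll_schema_def by blast
      moreover have "\<forall>u. r u a \<longrightarrow> (\<exists>v. ?P u v)" using that by blast
      \<comment> \<open>The set of values given by Collection is itself an upper bound of its
        members, because the order respects membership.\<close>
      ultimately show ?thesis using seg[of a] resp by metis
    qed
    then show "sat ?M e p"
      unfolding p by (simp add: sat_Foralls replacement_ax_def sat_ins_simps sat_Exists1 del: sat_ins)
  qed
  have compr: "?M \<Turnstile> comprehension_schema"
  proof (intro ballI allI)
    fix p e assume "p \<in> comprehension_schema"
    then obtain \<Gamma> q where p: "p = Foralls \<Gamma> (comprehension_ax q)" and q: "wff sc_sig (Ordinal # \<Gamma>) q"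
      by (auto simp: comprehension_schema_def)
    have "\<exists>y. \<forall>z. m z y \<longleftrightarrow> r z a \<and> sat ?M (case_nat z (app_env xs e)) q" for xs a
    proof -
      let ?X = "\<lambda>z. sat ?M (case_nat z (app_env xs e)) q"
      have "cls m r ?X" by (rule df_push(1)[OF dfM[OF q]])
      then have "\<exists>y. \<forall>z. m z y \<longleftrightarrow> m z x \<and> ?X z" for x
        by (rule sep[unfolded sep_schema_def, rule_format])
      then show ?thesis using seg[of a] by metis
    qed
    then show "sat ?M e p"
      unfolding p by (simp add: sat_Foralls comprehension_ax_def sat_ins_simps del: sat_ins)
  qed
  have inf: "\<exists>a. (\<exists>z. (\<forall>y. z = y \<or> r z y) \<and> r z a) \<and> (\<forall>b. r b a \<longrightarrow> (\<exists>c. r c a \<and> r b c))"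
  proof -
    obtain w z where z: "\<forall>x. \<not> m x z" "m z w" and w: "\<And>y. m y w \<Longrightarrow> \<exists>s. m s w \<and> (\<forall>u. m u s \<longleftrightarrow> m u y \<or> u = y)"
      using zf_finiteD(5)[OF fin] by blast
    \<comment> \<open>The elements below some member of the inductive set \<open>w\<close>. They
      form an initial segment without a greatest element that omits \<open>w\<close>, so the least
      element outside it is the required limit.\<close>
    let ?A = "\<lambda>b. \<exists>y. m y w \<and> r b y"
    have step: "\<exists>s. m s w \<and> r y s" if "m y w" for y using w[OF that] resp by metis
    have "cls m r (\<lambda>b. \<not> ?A b)" by (intro df_intros df_prec vr_const)
    moreover have "\<not> ?A w" using irr tr resp by blast
    moreover obtain s where "\<forall>z. m z s \<longleftrightarrow> r z w" using seg by blast
    ultimately obtain a where a: "\<not> ?A a" "\<And>b. \<not> ?A b \<Longrightarrow> a = b \<or> r a b"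
    proof -
      assume c: "cls m r (\<lambda>b. \<not> ?A b)" and s: "\<forall>z. m z s \<longleftrightarrow> r z w" and w: "\<not> ?A w"
      obtain t where t: "\<forall>z. m z t \<longleftrightarrow> m z s \<and> \<not> ?A z" using sep[unfolded sep_schema_def, rule_format, OF c] by blast
      show thesis
      proof (cases "\<exists>y. m y t")
        case True
        then obtain y where "m y t" "\<forall>z. m z t \<longrightarrow> y = z \<or> r y z" using least by blast
        then show thesis using that[of y] t s tot tr by metis
      next
        case False
        then show thesis using that[of w] t s w tot by metis
      qed
    qed
    obtain x0 where x0: "\<forall>y. x0 = y \<or> r x0 y"
    proof -
      obtain t where t: "\<forall>z. m z t \<longleftrightarrow> r z w" using seg by blast
      then have "m z t" using z resp by blast
      then obtain y where "m y t" "\<forall>z. m z t \<longrightarrow> y = z \<or> r y z" using least by blast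
      then show thesis using that[of y] t tot tr by metis
    qed
    have *: "?A b \<longleftrightarrow> r b a" for b
      using a tr tot irr by metis
    have "?A x0" using x0 step[OF z(2)] z tr by metis
    moreover have "\<exists>c. ?A c \<and> r b c" if "?A b" for b
      using that step by blast
    ultimately show ?thesis using x0 * by metis
  qed
  have bnd: "\<forall>x. \<exists>a. \<forall>b. m b x \<longrightarrow> r b a" using resp by blast
  have "sat ?M e set_extensionality_ax" "sat ?M e boundedness_ax" "sat ?M e order_preservation_ax"
    "sat ?M e ord_infinity_ax" for e
    using ext resp inf bnd by (auto simp: set_extensionality_ax_def boundedness_ax_def order_preservation_ax_def ord_infinity_ax_def)
  moreover have "?M \<Turnstile> encoding_axs" by (auto simp: encoding_axs_def)
  ultimately show ?thesis
    using wo repl compr unfolding SC_minus_def by blast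
qed

lemma soD:
  assumes "so m l"
  shows "\<forall>x. \<not> l x x" "\<forall>x y z. l x y \<and> l y z \<longrightarrow> l x z" "\<forall>x y. l x y \<or> x = y \<or> l y x"
    "\<forall>x. (\<exists>y. m y x) \<longrightarrow> (\<exists>y. m y x \<and> (\<forall>z. m z x \<longrightarrow> y = z \<or> l y z))"
    "\<forall>x y. m x y \<longrightarrow> l x y" "\<forall>x y. (\<forall>z. m z x \<longleftrightarrow> m z y) \<longrightarrow> x = y"
    "\<forall>X. cls m l X \<longrightarrow> (\<forall>a. \<exists>x. \<forall>b. m b x \<longleftrightarrow> l b a \<and> X b)"
    "\<forall>P. cls2 m l P \<longrightarrow> (\<forall>a. (\<forall>c. l c a \<longrightarrow> (\<exists>!d. P c d)) \<longrightarrow> (\<exists>b. \<forall>c. l c a \<longrightarrow> (\<exists>d. l d b \<and> P c d)))"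
    "\<exists>a. (\<exists>z. (\<forall>y. z = y \<or> l z y) \<and> l z a) \<and> (\<forall>b. l b a \<longrightarrow> (\<exists>c. l c a \<and> l b c))"
  using assms unfolding so_def by - ((elim conjE, assumption)+)

section \<open>From (Ord, E, <) to set theory\<close>

definition is_sp :: "'a rel2 \<Rightarrow> 'a \<Rightarrow> 'a \<Rightarrow> 'a \<Rightarrow> bool" where
  "is_sp m p a b \<longleftrightarrow> (\<forall>w. m w p \<longleftrightarrow> w = a \<or> (\<forall>v. m v w \<longleftrightarrow> v = a \<or> v = b))"

text \<open>Foundation makes \<open>{a, {a, b}}\<close> a correct ordered pair.\<close>

lemma is_sp_inject:
  assumes ext: "\<forall>x y. (\<forall>z. m z x \<longleftrightarrow> m z y) \<longrightarrow> x = y" and resp: "\<forall>x y. m x y \<longrightarrow> l x y"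
    and irr: "\<forall>x. \<not> l x x" and tr: "\<forall>x y z. l x y \<and> l y z \<longrightarrow> l x z"
    and pair: "\<forall>a b. \<exists>z. \<forall>x. m x z \<longleftrightarrow> x = a \<or> x = b"
    and p: "is_sp m p a b" "is_sp m p a' b'"
  shows "a = a' \<and> b = b'"
proof -
  obtain c c' where c: "\<forall>x. m x c \<longleftrightarrow> x = a \<or> x = b" and c': "\<forall>x. m x c' \<longleftrightarrow> x = a' \<or> x = b'"
    using pair by metis
  have "(\<forall>v. m v w \<longleftrightarrow> v = a \<or> v = b) \<longleftrightarrow> w = c" "(\<forall>v. m v w \<longleftrightarrow> v = a' \<or> v = b') \<longleftrightarrow> w = c'" for w
    using ext c c' by blast+
  then have m: "m w p \<longleftrightarrow> w = a \<or> w = c" "m w p \<longleftrightarrow> w = a' \<or> w = c'" for w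
    using p unfolding is_sp_def by auto
  have l: "l a c" "l a' c'" using c c' resp by blast+
  have "a = a'"
  proof (rule ccontr)
    assume "a \<noteq> a'"
    then have "a = c'" "a' = c" using m by metis+
    then show False using l irr tr by blast
  qed
  moreover from this have "c = c'" using m l irr by metis
  then have "b = b'" using c c' \<open>a = a'\<close> by metis
  ultimately show ?thesis by blast
qed

lemma ex_sp:
  assumes pair: "\<forall>a b. \<exists>z. \<forall>x. m x z \<longleftrightarrow> x = a \<or> x = b"
    and ext: "\<forall>x y. (\<forall>z. m z x \<longleftrightarrow> m z y) \<longrightarrow> x = y"
  shows "\<exists>p. is_sp m p a b"
proof -
  obtain c where c: "\<forall>x. m x c \<longleftrightarrow> x = a \<or> x = b" using pair by blast
  obtain p where p: "\<forall>x. m x p \<longleftrightarrow> x = a \<or> x = c" using pair by blast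
  have "(\<forall>v. m v w \<longleftrightarrow> v = a \<or> v = b) \<longleftrightarrow> w = c" for w using ext c by blast
  then show ?thesis unfolding is_sp_def using p by auto
qed

text \<open>The members of a good set are pairs \<open>(\<gamma>, S\<^sup>\<gamma> 0)\<close>, where \<open>S y = y \<union> {y}\<close>.\<close>

definition good :: "'a rel2 \<Rightarrow> 'a rel2 \<Rightarrow> 'a \<Rightarrow> bool" where
  "good m l f \<longleftrightarrow> (\<forall>p g y. m p f \<and> is_sp m p g y \<longrightarrow>
    ((\<forall>d. \<not> l d g) \<and> (\<forall>u. \<not> m u y)) \<or>
    (\<exists>d y' q. l d g \<and> (\<forall>c. l c g \<longrightarrow> c = d \<or> l c d) \<and> m q f \<and> is_sp m q d y' \<and> (\<forall>u. m u y \<longleftrightarrow> m u y' \<or> u = y')))"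

definition iter :: "'a rel2 \<Rightarrow> 'a rel2 \<Rightarrow> 'a \<Rightarrow> 'a \<Rightarrow> bool" where
  "iter m l g y \<longleftrightarrow> (\<exists>f p. good m l f \<and> m p f \<and> is_sp m p g y)"

text \<open>The infinity clause of \<open>so\<close> provides a limit of the order, not an inductive
  set. Below the least limit, every element but the first has an immediate predecessor, so the
  successor operation on sets can be iterated along it; Replacement bounds the values and
  Comprehension collects them.\<close>

lemma so_infinity:
  assumes so: "so m l" and pair: "\<forall>a b. \<exists>z. \<forall>x. m x z \<longleftrightarrow> x = a \<or> x = b"
    and union: "\<forall>x. \<exists>u. \<forall>z. m z u \<longleftrightarrow> (\<exists>y. m y x \<and> m z y)"
    and least': "\<forall>X a. cls m l X \<longrightarrow> X a \<longrightarrow> (\<exists>a. X a \<and> (\<forall>b. X b \<longrightarrow> a = b \<or> l a b))"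
  shows "\<exists>w. (\<exists>z. (\<forall>x. \<not> m x z) \<and> m z w) \<and>
      (\<forall>y. m y w \<longrightarrow> (\<exists>s. m s w \<and> (\<forall>u. m u s \<longleftrightarrow> m u y \<or> u = y)))"
proof -
  note D = soD[OF so]
  have irr: "\<not> l x x" and tr: "l x y \<Longrightarrow> l y z \<Longrightarrow> l x z" and tot: "l x y \<or> x = y \<or> l y x"
    and resp: "m x y \<Longrightarrow> l x y" for x y z
    using D(1,2,3,5) by blast+
  note ext = D(6)
  note sp_inj = is_sp_inject[OF ext D(5,1,2) pair] and least = least'[rule_format]
  let ?suc = "\<lambda>d g. l d g \<and> (\<forall>c. l c g \<longrightarrow> c = d \<or> l c d)"
  let ?S = "\<lambda>s y. \<forall>u. m u s \<longleftrightarrow> m u y \<or> u = y"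
  have suc_inj: "?suc d g \<Longrightarrow> ?suc d' g \<Longrightarrow> d = d'" for d d' g using irr tr by blast
  have exS: "\<exists>s. ?S s y" for y
  proof -
    obtain a where a: "\<forall>x. m x a \<longleftrightarrow> x = y \<or> x = y" using pair by blast
    obtain b where b: "\<forall>x. m x b \<longleftrightarrow> x = y \<or> x = a" using pair by blast
    obtain s where s: "\<forall>z. m z s \<longleftrightarrow> (\<exists>y. m y b \<and> m z y)" using union by blast
    show ?thesis by (rule exI[of _ s]) (auto simp: s b a)
  qed
  have adjoin: "\<exists>f'. \<forall>z. m z f' \<longleftrightarrow> m z f \<or> z = p" for f p
  proof -
    obtain a where a: "\<forall>x. m x a \<longleftrightarrow> x = p \<or> x = p" using pair by blast
    obtain b where b: "\<forall>x. m x b \<longleftrightarrow> x = f \<or> x = a" using pair by blast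
    obtain s where s: "\<forall>z. m z s \<longleftrightarrow> (\<exists>y. m y b \<and> m z y)" using union by blast
    show ?thesis by (rule exI[of _ s]) (auto simp: s b a)
  qed
  have iterE: "((\<forall>d. \<not> l d g) \<and> (\<forall>u. \<not> m u y)) \<or> (\<exists>d y'. ?suc d g \<and> iter m l d y' \<and> ?S y y')"
    if gy: "iter m l g y" for g y
  proof -
    obtain f p where f: "good m l f" "m p f" "is_sp m p g y" using gy unfolding iter_def by blast
    show ?thesis using f(1)[unfolded good_def, rule_format, OF conjI[OF f(2,3)]] f(1) unfolding iter_def by blast
  qed
  have dfi: "df True (\<lambda>_ :: unit. m) (\<lambda>_. l) (\<lambda>i e. iter m l (t i e) (u i e))" if "vr True t" "vr True u" for t u
  proof -
    have "cls2 m l (iter m l)"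
      unfolding iter_def good_def is_sp_def by (rule cls2I) (intro df_intros df_prec)
    then show ?thesis by (rule cls2D[OF _ that])
  qed
  have unique: "y = y'" if y: "iter m l g y" "iter m l g y'" for g y y'
  proof (rule ccontr)
    assume "y \<noteq> y'"
    let ?X = "\<lambda>g. \<exists>y y'. iter m l g y \<and> iter m l g y' \<and> y \<noteq> y'"
    have c: "cls m l ?X" by (intro df_intros dfi)
    have "?X g" using y \<open>y \<noteq> y'\<close> by blast
    from least[of ?X, OF c this]
    obtain g where g: "?X g" and min: "\<And>b. ?X b \<Longrightarrow> g = b \<or> l g b" by blast
    obtain y y' where y: "iter m l g y" "iter m l g y'" "y \<noteq> y'" using g by blast
    have IH: "z = z'" if "l d g" "iter m l d z" "iter m l d z'" for d z z' using min[of d] that irr tr by blast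
    show False
      using iterE[OF y(1)]
    proof
      assume "(\<forall>d. \<not> l d g) \<and> (\<forall>u. \<not> m u y)"
      then show False using iterE[OF y(2)] ext y(3) by blast
    next
      assume "\<exists>d z. ?suc d g \<and> iter m l d z \<and> ?S y z"
      then obtain d z where d: "?suc d g" "iter m l d z" "?S y z" by blast
      then obtain d' z' where d': "?suc d' g" "iter m l d' z'" "?S y' z'" using iterE[OF y(2)] by blast
      have "d = d'" using suc_inj d(1) d'(1) by blast
      then have "z = z'" using IH d d' by blast
      then show False using ext d(3) d'(3) y(3) by blast
    qed
  qed
  obtain a1 z0 where z0: "\<And>y. z0 = y \<or> l z0 y" "l z0 a1" and a1: "\<And>b. l b a1 \<Longrightarrow> \<exists>c. l c a1 \<and> l b c"
    using D(9) by blast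
  let ?Lim = "\<lambda>a. l z0 a \<and> (\<forall>b. l b a \<longrightarrow> (\<exists>c. l c a \<and> l b c))"
  have c: "cls m l ?Lim" by (intro df_intros df_prec vr_const)
  have "?Lim a1" using z0 a1 by blast
  from least[of ?Lim, OF c this]
  obtain w where w: "?Lim w" and wmin: "\<And>b. ?Lim b \<Longrightarrow> w = b \<or> l w b" by blast
  have z0min: "\<not> l u z0" for u using z0(1)[of u] irr tr by blast
  obtain e0 where e0: "\<forall>u. \<not> m u e0"
  proof -
    obtain x where x: "\<forall>b. m b x \<longleftrightarrow> l b z0 \<and> True" using D(7)[rule_format, OF df_const] by blast
    then show thesis using that[of x] z0min by blast
  qed
  have iter0: "iter m l z0 e0"
  proof -
    obtain p where p: "is_sp m p z0 e0" using ex_sp[OF pair ext] by blast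
    obtain f where f: "\<forall>x. m x f \<longleftrightarrow> x = p \<or> x = p" using pair by blast
    have "good m l f" unfolding good_def
    proof (intro allI HOL.impI disjI1)
      fix p' g y assume "m p' f \<and> is_sp m p' g y"
      then have "p' = p" "is_sp m p' g y" using f by blast+
      then have "is_sp m p g y" by simp
      then have "z0 = g" "e0 = y" using sp_inj[OF p] by blast+
      then show "(\<forall>d. \<not> l d g) \<and> (\<forall>u. \<not> m u y)" using z0min e0 by blast
    qed
    then show ?thesis unfolding iter_def using p f by blast
  qed
  have iterS: "iter m l g s" if dy: "iter m l d y" "?suc d g" "?S s y" for d g y s
  proof -
    obtain f q where f: "good m l f" "m q f" "is_sp m q d y" using dy(1) unfolding iter_def by blast
    obtain p where p: "is_sp m p g s" using ex_sp[OF pair ext] by blast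
    obtain f' where f': "\<forall>x. m x f' \<longleftrightarrow> m x f \<or> x = p" using adjoin by blast
    have "good m l f'" unfolding good_def
    proof (intro allI HOL.impI)
      fix p' g' y' assume *: "m p' f' \<and> is_sp m p' g' y'"
      show "((\<forall>d. \<not> l d g') \<and> (\<forall>u. \<not> m u y')) \<or>
        (\<exists>d z q. l d g' \<and> (\<forall>c. l c g' \<longrightarrow> c = d \<or> l c d) \<and> m q f' \<and> is_sp m q d z \<and> (\<forall>u. m u y' \<longleftrightarrow> m u z \<or> u = z))"
      proof (cases "p' = p")
        case True
        then have "is_sp m p g' y'" using * by simp
        then have "g = g'" "s = y'" using sp_inj[OF p] by blast+
        then show ?thesis using dy f f' by blast
      next
        case False
        then have "m p' f \<and> is_sp m p' g' y'" using * f' by blast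
        from f(1)[unfolded good_def, rule_format, OF this] show ?thesis using f' by blast
      qed
    qed
    then show ?thesis unfolding iter_def using p f' by blast
  qed
  have exists: "\<exists>y. iter m l g y" if "l g w" for g
  proof (rule ccontr)
    assume "\<nexists>y. iter m l g y"
    let ?X = "\<lambda>g. l g w \<and> (\<nexists>y. iter m l g y)"
    have c: "cls m l ?X" by (intro df_intros df_prec vr_const dfi)
    have "?X g" using that \<open>\<nexists>y. iter m l g y\<close> by blast
    from least[of ?X, OF c this]
    obtain g where g: "?X g" and min: "\<And>b. ?X b \<Longrightarrow> g = b \<or> l g b" by blast
    have IH: "\<exists>y. iter m l d y" if "l d g" for d using min[of d] that g irr tr by blast
    have "z0 \<noteq> g" using iter0 g by blast
    then have "l z0 g" using z0 by blast
    moreover have "\<not> ?Lim g" using wmin g irr tr by blast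
    ultimately obtain d where d: "l d g" "\<forall>c. \<not> (l c g \<and> l d c)" by blast
    then have "?suc d g" using tot by blast
    moreover obtain y where "iter m l d y" using IH d by blast
    moreover obtain s where "?S s y" using exS by blast
    ultimately show False using iterS g by blast
  qed
  have "cls2 m l (iter m l)" by (rule cls2I) (intro dfi vr_var)
  moreover have "\<forall>c. l c w \<longrightarrow> (\<exists>!d. iter m l c d)" using exists unique by blast
  ultimately have "\<exists>b. \<forall>c. l c w \<longrightarrow> (\<exists>d. l d b \<and> iter m l c d)"
    using D(8)[THEN spec, THEN mp, THEN spec, THEN mp] by blast
  then obtain b where b: "\<And>c. l c w \<Longrightarrow> \<exists>d. l d b \<and> iter m l c d" by blast
  have c: "cls m l (\<lambda>y. \<exists>g. l g w \<and> iter m l g y)" by (intro df_intros df_prec vr_const dfi)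
  obtain W where W: "\<forall>y. m y W \<longleftrightarrow> l y b \<and> (\<exists>g. l g w \<and> iter m l g y)"
    using D(7)[rule_format, OF c] by blast
  have W': "m y W" if "l g w" "iter m l g y" for g y
    using b[OF that(1)] unique that W by blast
  have "m e0 W" using W' iter0 w by blast
  moreover have "\<exists>s. m s W \<and> ?S s y" if "m y W" for y
  proof -
    obtain g where g: "l g w" "iter m l g y" using W \<open>m y W\<close> by blast
    obtain s where s: "?S s y" using exS by blast
    have cl: "cls m l (\<lambda>c. l g c)" by (intro df_prec vr_const vr_var)
    \<comment> \<open>The index after \<open>g\<close>: as \<open>w\<close> is a limit, the least
      element above \<open>g\<close> stays below \<open>w\<close>.\<close>
    obtain c where "l c w" "l g c" using w g by blast
    from least[of "\<lambda>c. l g c", OF cl this(2)]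
    obtain c' where c': "l g c'" "\<And>b. l g b \<Longrightarrow> c' = b \<or> l c' b" by blast
    have "?suc g c'" using c' tot irr tr by blast
    then have "iter m l c' s" using iterS g s by blast
    moreover have "l c' w" using c' \<open>l c w\<close> \<open>l g c\<close> tr by blast
    ultimately show ?thesis using W' s by blast
  qed
  ultimately show ?thesis using e0 by blast
qed

lemma so_zf:
  assumes so: "so m l"
  shows "zf m l"
proof -
  note D = soD[OF so]
  have irr: "\<not> l x x" and tr: "l x y \<Longrightarrow> l y z \<Longrightarrow> l x z" and tot: "l x y \<or> x = y \<or> l y x"
    and resp: "m x y \<Longrightarrow> l x y" for x y z
    using D(1,2,3,5) by blast+
  have ext: "\<forall>x y. (\<forall>z. m z x \<longleftrightarrow> m z y) \<longrightarrow> x = y" by (fact D(6))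
  have least_set: "(\<exists>y. m y x) \<Longrightarrow> (\<exists>y. m y x \<and> (\<forall>z. m z x \<longrightarrow> y = z \<or> l y z))" for x
    using D(4) by blast
  note compr = D(7)[rule_format]
  note repl = D(8)[rule_format]
  obtain a0 z0 where z0: "\<And>y. z0 = y \<or> l z0 y" "l z0 a0" and a0: "\<And>b. l b a0 \<Longrightarrow> \<exists>c. l c a0 \<and> l b c"
    using D(9) by blast
  have bounded: "\<exists>x. \<forall>b. m b x \<longleftrightarrow> X b" if "cls m l X" "\<And>b. X b \<Longrightarrow> l b a" for X a
    using compr[OF that(1), of a] that(2) by blast
  have least: "\<exists>a. X a \<and> (\<forall>b. X b \<longrightarrow> a = b \<or> l a b)" if X: "cls m l X" and a: "X a" for X a
  proof -
    obtain x where x: "\<forall>b. m b x \<longleftrightarrow> l b a \<and> X b" using compr[OF X] by blast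
    show ?thesis
    proof (cases "\<exists>b. m b x")
      case True
      then obtain y where "m y x" "\<forall>z. m z x \<longrightarrow> y = z \<or> l y z" using least_set by blast
      then show ?thesis using x a tot tr by metis
    next
      case False
      then show ?thesis using x a tot by metis
    qed
  qed
  \<comment> \<open>If \<open>a\<close> were greatest, the set of all elements below
    \<open>a\<close>, and the same set without the first element \<open>z0\<close>, would both equal
    \<open>a\<close>, since otherwise they would be members of themselves; for the second set this
    uses that it is non-empty and hence differs from \<open>z0\<close>.\<close>
  have no_max: "\<exists>b. l a b" for a
  proof (rule ccontr)
    assume "\<nexists>b. l a b"
    then have max: "l b a \<or> b = a" for b using tot by blast
    have "cls m l (\<lambda>_. True)" "cls m l (\<lambda>b. b \<noteq> z0)"
      by (rule df_const) (intro df_intros vr_const)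
    then obtain x1 x2 where x1: "\<forall>b. m b x1 \<longleftrightarrow> l b a" and x2: "\<forall>b. m b x2 \<longleftrightarrow> l b a \<and> b \<noteq> z0"
      using compr[of "\<lambda>_. True" a] compr[of "\<lambda>b. b \<noteq> z0" a] by auto
    have "x1 = a" using x1 max irr resp by metis
    obtain c where c: "l c a0" "l z0 c" using a0 z0 by blast
    have "l c a" using c max tr by blast
    then have "m c x2" using x2 c irr by blast
    then have "x2 \<noteq> z0" using resp c tr irr by blast
    then have "x2 = a" using x2 max irr resp by metis
    moreover have "l z0 a" using \<open>\<nexists>b. l a b\<close> z0 by metis
    ultimately show False using \<open>x1 = a\<close> x1 x2 by metis
  qed
  have bound2: "\<exists>c. l a c \<and> l b c" for a b using no_max tot tr by metis
  have pair: "\<exists>z. \<forall>x. m x z \<longleftrightarrow> x = a \<or> x = b" for a b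
  proof -
    obtain c where c: "l a c" "l b c" using bound2 by blast
    have "cls m l (\<lambda>x. x = a \<or> x = b)" by (intro df_intros vr_const)
    then show ?thesis by (rule bounded) (use c in blast)
  qed
  have union: "\<exists>u. \<forall>z. m z u \<longleftrightarrow> (\<exists>y. m y x \<and> m z y)" for x
  proof (rule bounded)
    show "cls m l (\<lambda>z. \<exists>y. m y x \<and> m z y)" by (intro df_intros vr_const)
  qed (use resp tr in blast)
  have found: "(\<exists>y. m y x) \<Longrightarrow> (\<exists>y. m y x \<and> (\<forall>z. m z y \<longrightarrow> \<not> m z x))" for x
    using least_set[of x] resp irr tr by metis
  have sep: "sep_schema m l"
    unfolding sep_schema_def
  proof (intro allI HOL.impI)
    fix X x assume X: "cls m l X"
    show "\<exists>y. \<forall>z. m z y \<longleftrightarrow> m z x \<and> X z"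
    proof (rule bounded)
      show "cls m l (\<lambda>z. m z x \<and> X z)" by (intro df_intros vr_const X)
    qed (use resp in blast)
  qed
  have coll: "coll_schema m l"
    unfolding coll_schema_def
  proof (intro allI HOL.impI)
    fix P x assume P: "cls2 m l P" and x: "\<forall>u. m u x \<longrightarrow> (\<exists>v. P u v)"
    \<comment> \<open>Replacement asks for a unique value at every argument below \<open>x\<close>:
      the least witness at members of \<open>x\<close>, the default \<open>z0\<close>
      elsewhere.\<close>
    let ?Q = "\<lambda>u v. (m u x \<and> P u v \<and> (\<forall>w. P u w \<longrightarrow> v = w \<or> l v w)) \<or> (\<not> m u x \<and> v = z0)"
    have Q: "cls2 m l ?Q"
      by (rule cls2I) (intro df_intros df_prec vr_const cls2D[OF P])
    have "\<exists>!v. ?Q u v" for u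
    proof (cases "m u x")
      case True
      then obtain a where a: "P u a" using x by blast
      have "cls m l (P u)" by (intro cls2D[OF P] vr_const vr_var)
      from least[of "P u", OF this a] obtain b where "P u b" "\<forall>w. P u w \<longrightarrow> b = w \<or> l b w" by blast
      then show ?thesis using True irr tr by (intro ex1I[of _ b]) blast+
    qed simp
    then have "\<exists>b. \<forall>u. l u x \<longrightarrow> (\<exists>v. l v b \<and> ?Q u v)" by (intro D(8)[THEN spec, THEN mp, OF Q, THEN spec, THEN mp] allI HOL.impI)
    then obtain b where b: "\<forall>u. l u x \<longrightarrow> (\<exists>v. l v b \<and> ?Q u v)" by blast
    obtain y where y: "\<forall>v. m v y \<longleftrightarrow> l v b" using compr[OF df_const, of b True] by auto
    show "\<exists>y. \<forall>u. m u x \<longrightarrow> (\<exists>v. m v y \<and> P u v)"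
    proof (rule exI[of _ y], intro allI HOL.impI)
      fix u assume u: "m u x"
      then obtain v where "l v b" "?Q u v" using b resp by blast
      then show "\<exists>v. m v y \<and> P u v" using u y by blast
    qed
  qed
  have choice: "\<exists>c. \<forall>y. m y x \<longrightarrow> (\<exists>z. m z y \<and> m z c \<and> (\<forall>z'. m z' y \<and> m z' c \<longrightarrow> z' = z))"
    if ne: "\<forall>y. m y x \<longrightarrow> (\<exists>z. m z y)" and disj: "\<forall>y z. m y x \<and> m z x \<and> (\<exists>w. m w y \<and> m w z) \<longrightarrow> y = z" for x
  proof -
    \<comment> \<open>The order supplies the transversal: the least element of each member of
      \<open>x\<close>.\<close>
    let ?C = "\<lambda>z. \<exists>y. m y x \<and> m z y \<and> (\<forall>z'. m z' y \<longrightarrow> z = z' \<or> l z z')"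
    have "cls m l ?C" by (intro df_intros df_prec vr_const)
    then have "\<exists>c. \<forall>z. m z c \<longleftrightarrow> ?C z" by (rule bounded[of _ x]) (use resp tr in blast)
    then obtain c where c: "\<forall>z. m z c \<longleftrightarrow> ?C z" by blast
    have "\<exists>z. m z y \<and> m z c \<and> (\<forall>z'. m z' y \<and> m z' c \<longrightarrow> z' = z)" if y: "m y x" for y
    proof -
      obtain z where z: "m z y" "\<forall>z'. m z' y \<longrightarrow> z = z' \<or> l z z'" using ne y least_set by blast
      have "z' = z" if z': "m z' y" "m z' c" for z'
      proof -
        obtain y' where "m y' x" "m z' y'" "\<forall>z''. m z'' y' \<longrightarrow> z' = z'' \<or> l z' z''" using z'(2) c[rule_format, of z'] by blast
        moreover from this have "y' = y" using disj y z'(1) by blast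
        ultimately show ?thesis using z z'(1) irr tr by blast
      qed
      then show ?thesis using z c y by blast
    qed
    then show ?thesis by blast
  qed
  have gwo: "gwo m l"
  proof -
    have "\<exists>y. \<forall>z. m z y \<longleftrightarrow> l z x" for x using compr[OF df_const, of x True] by auto
    then show ?thesis unfolding gwo_def using irr tr tot least_set resp by blast
  qed
  have infinity: "\<exists>w. (\<exists>z. (\<forall>x. \<not> m x z) \<and> m z w) \<and>
      (\<forall>y. m y w \<longrightarrow> (\<exists>s. m s w \<and> (\<forall>u. m u s \<longleftrightarrow> m u y \<or> u = y)))"
  proof (rule so_infinity[OF so])
    show "\<forall>a b. \<exists>z. \<forall>x. m x z \<longleftrightarrow> x = a \<or> x = b" using pair by blast
    show "\<forall>x. \<exists>u. \<forall>z. m z u \<longleftrightarrow> (\<exists>y. m y x \<and> m z y)" using union by blast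
    show "\<forall>X a. cls m l X \<longrightarrow> X a \<longrightarrow> (\<exists>a. X a \<and> (\<forall>b. X b \<longrightarrow> a = b \<or> l a b))"
      by (intro allI HOL.impI) (rule least, assumption+)
  qed
  show ?thesis
    unfolding zf_def zf_finite_def
    using ext found pair union infinity choice sep coll gwo by blast
qed

section \<open>Power sets and successor cardinals\<close>

definition pow :: "'a rel2 \<Rightarrow> bool" where
  "pow m \<longleftrightarrow> (\<forall>x. \<exists>y. \<forall>z. m z y \<longleftrightarrow> (\<forall>u. m u z \<longrightarrow> m u x))"

definition unif_bounded :: "'a rel2 \<Rightarrow> 'a rel2 \<Rightarrow> bool" where
  "unif_bounded m l \<longleftrightarrow> (\<forall>a. \<exists>b. \<forall>x. (\<forall>g. m g x \<longrightarrow> l g a) \<longrightarrow> l x b)"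

lemma sat_pow: "sat (set_str m r) e power_set_ax \<longleftrightarrow> pow m"
  by (simp add: power_set_ax_def subset_fm_def pow_def)

lemma sat_ZFGC: "set_str m r \<Turnstile> ZFGC \<longleftrightarrow> zf m r \<and> pow m"
  using sat_ZFGC_minus[of m r] sat_pow[of m r] unfolding ZFGC_def by blast

lemma Emem_inj: "bij c \<Longrightarrow> Emem i c a (c x) \<longleftrightarrow> i a x"
  by (auto simp: Emem_def bij_def inj_eq)

lemma bij_all: "bij c \<Longrightarrow> (\<forall>x. Q x) \<longleftrightarrow> (\<forall>x. Q (c x))"
  by (metis bij_pointE)

lemma bij_all2: "bij c \<Longrightarrow> (\<forall>x y. Q x y) \<longleftrightarrow> (\<forall>x y. Q (c x) (c y))"
  by (metis bij_pointE)

lemma sat_unif_bounded: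
  assumes "bij c"
  shows "sat (sc_str l i c) e uniform_boundedness_ax \<longleftrightarrow> unif_bounded (Emem i c) l"
  unfolding unif_bounded_def bij_all[OF assms, of "\<lambda>x. (\<forall>g. Emem i c g x \<longrightarrow> l g _) \<longrightarrow> l x _"] Emem_inj[OF assms]
  by (simp add: uniform_boundedness_ax_def)

lemma gwoD:
  assumes "gwo m r"
  shows "\<forall>x. \<not> r x x" "\<forall>x y z. r x y \<and> r y z \<longrightarrow> r x z" "\<forall>x y. r x y \<or> x = y \<or> r y x"
    "\<forall>x. (\<exists>y. m y x) \<longrightarrow> (\<exists>y. m y x \<and> (\<forall>z. m z x \<longrightarrow> y = z \<or> r y z))"
    "\<forall>x. \<exists>y. \<forall>z. m z y \<longleftrightarrow> r z x" "\<forall>x y. m x y \<longrightarrow> r x y"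
  using assms unfolding gwo_def by - ((elim conjE, assumption)+)

lemma zfD:
  assumes "zf m r"
  shows "zf_finite m" "gwo m r" "\<forall>X. cls m r X \<longrightarrow> (\<forall>x. \<exists>y. \<forall>z. m z y \<longleftrightarrow> m z x \<and> X z)"
    "\<forall>P. cls2 m r P \<longrightarrow> (\<forall>x. (\<forall>u. m u x \<longrightarrow> (\<exists>v. P u v)) \<longrightarrow> (\<exists>y. \<forall>u. m u x \<longrightarrow> (\<exists>v. m v y \<and> P u v)))"
  using assms unfolding zf_def sep_schema_def coll_schema_def by - ((elim conjE, assumption)+)

text \<open>Initial segments are sets, so the sets with all members below \<open>a\<close> are the
  subsets of one set, and the power set of that set is above them in the order. Conversely, a bound
  for the subsets of \<open>x\<close> lets Separation form the power set.\<close>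

lemma unif_bounded_pow:
  assumes "zf m r"
  shows "unif_bounded m r \<longleftrightarrow> pow m"
proof
  note G = gwoD[OF zfD(2)[OF assms]] and sep = zfD(3)[OF assms, rule_format]
  {
    assume ub: "unif_bounded m r"
    show "pow m" unfolding pow_def
    proof
      fix x
      obtain b where b: "\<forall>z. (\<forall>g. m g z \<longrightarrow> r g x) \<longrightarrow> r z b" using ub unfolding unif_bounded_def by blast
      obtain s where s: "\<forall>z. m z s \<longleftrightarrow> r z b" using G(5) by blast
      have "cls m r (\<lambda>z. \<forall>u. m u z \<longrightarrow> m u x)" by (intro df_intros vr_const)
      from sep[OF this, of s] obtain y where "\<forall>z. m z y \<longleftrightarrow> m z s \<and> (\<forall>u. m u z \<longrightarrow> m u x)" by blast
      then show "\<exists>y. \<forall>z. m z y \<longleftrightarrow> (\<forall>u. m u z \<longrightarrow> m u x)" using s b G(6) by metis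
    qed
  }
  {
    assume p: "pow m"
    show "unif_bounded m r" unfolding unif_bounded_def
    proof
      fix a
      obtain s where s: "\<forall>z. m z s \<longleftrightarrow> r z a" using G(5) by blast
      obtain y where "\<forall>z. m z y \<longleftrightarrow> (\<forall>u. m u z \<longrightarrow> m u s)" using p unfolding pow_def by blast
      then show "\<exists>b. \<forall>x. (\<forall>g. m g x \<longrightarrow> r g a) \<longrightarrow> r x b" using s G(6) by blast
    qed
  }
qed

lemma bi_interpretable_extI:
  assumes "wff set_sig [(), ()] \<psi>" "wff set_sig [(), ()] \<theta>" and S: "SC_minus \<subseteq> T1" and Z: "ZFGC_minus \<subseteq> T2"
    and "\<And>p. p \<in> T1 \<Longrightarrow> wff sc_sig [] p" "\<And>p. p \<in> T2 \<Longrightarrow> wff set_sig [] p"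
    and "\<And>(l :: nat rel2) i c. sc_str l i c \<Turnstile> T1 \<Longrightarrow> bij c \<and>
      set_str (Emem i c) (ev \<theta> (Emem i c) l) \<Turnstile> T2 \<and> ev \<psi> (Emem i c) (ev \<theta> (Emem i c) l) = l"
    and "\<And>(m :: nat rel2) r. set_str m r \<Turnstile> T2 \<Longrightarrow>
      sc_str (ev \<psi> m r) m (\<lambda>x. x) \<Turnstile> T1 \<and> ev \<theta> m (ev \<psi> m r) = r"
  shows "bi_interpretable sc_sig T1 set_sig T2"
  by (rule bi_interpretableI[OF assms(1,2) sc_completeness[OF S] set_completeness[OF Z] assms(5-8)])

text \<open>The order is kept in both directions, hence \<open>prec 0 1\<close> twice; only Uniform
  Boundedness and Power Set have to be matched.\<close>

lemma bi_interpretable_SC_plus: "bi_interpretable sc_sig SC_plus set_sig ZFGC"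
proof (rule bi_interpretable_extI[of "prec 0 1" "prec 0 1"])
  fix l i :: "nat rel2" and c
  assume M: "sc_str l i c \<Turnstile> SC_plus"
  then have c: "bij c" and so: "so (Emem i c) l" using sc_so[of l i c] unfolding SC_plus_def by blast+
  have "unif_bounded (Emem i c) l"
    using M sat_unif_bounded[OF c] unfolding SC_plus_def by blast
  then show "bij c \<and> set_str (Emem i c) (ev (prec 0 1) (Emem i c) l) \<Turnstile> ZFGC \<and>
      ev (prec 0 1) (Emem i c) (ev (prec 0 1) (Emem i c) l) = l"
    using c so_zf[OF so] unif_bounded_pow by (simp only: ev_prec sat_ZFGC) blast
next
  fix m r :: "nat rel2"
  assume "set_str m r \<Turnstile> ZFGC"
  then have zf: "zf m r" and "pow m" by (simp_all only: sat_ZFGC)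
  then have "unif_bounded m r" by (simp add: unif_bounded_pow)
  moreover have "bij (\<lambda>x :: nat. x)" by (auto simp: bij_def inj_def)
  ultimately have "sat (sc_str r m (\<lambda>x. x)) e uniform_boundedness_ax" for e
    using sat_unif_bounded[of "\<lambda>x. x" r m e] by simp
  then show "sc_str (ev (prec 0 1) m r) m (\<lambda>x. x) \<Turnstile> SC_plus \<and> ev (prec 0 1) m (ev (prec 0 1) m r) = r"
    using zf_sc[OF zf] unfolding SC_plus_def ev_prec by blast
next
  fix p assume "p \<in> SC_plus" then show "wff sc_sig [] p"
    using wff_SC_minus wff_SC_axs unfolding SC_plus_def by blast
next
  fix p assume "p \<in> ZFGC" then show "wff set_sig [] p"
    using wff_ZFGC_minus wff_power_set unfolding ZFGC_def by blast
qed (auto simp: SC_plus_def ZFGC_def)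

lemma sat_limitlessness:
  "sat (sc_str l i c) e limitlessness_ax \<longleftrightarrow> sat (set_str (Emem i c) l) e successor_cardinals_ax"
  unfolding limitlessness_ax_def by (rule sat_tr_ctx[OF flat_E sem_E wff_successor_cardinals])

lemma bi_interpretable_SC: "bi_interpretable sc_sig SC set_sig (ZFGC_minus \<union> {successor_cardinals_ax})"
proof (rule bi_interpretable_extI[of "prec 0 1" "prec 0 1"])
  fix l i :: "nat rel2" and c
  assume M: "sc_str l i c \<Turnstile> SC"
  then have c: "bij c" and so: "so (Emem i c) l" using sc_so[of l i c] unfolding SC_def by blast+
  have "sat (sc_str l i c) e limitlessness_ax" for e using M unfolding SC_def by blast
  then show "bij c \<and> set_str (Emem i c) (ev (prec 0 1) (Emem i c) l) \<Turnstile> ZFGC_minus \<union> {successor_cardinals_ax} \<and>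
      ev (prec 0 1) (Emem i c) (ev (prec 0 1) (Emem i c) l) = l"
    using c so_zf[OF so] sat_ZFGC_minus[of "Emem i c" l] by (simp only: ev_prec sat_limitlessness) blast
next
  fix m r :: "nat rel2"
  assume N: "set_str m r \<Turnstile> ZFGC_minus \<union> {successor_cardinals_ax}"
  then have "set_str m r \<Turnstile> ZFGC_minus" by blast
  then have zf: "zf m r" by (simp only: sat_ZFGC_minus)
  have "sat (sc_str r m (\<lambda>x. x)) e limitlessness_ax" for e
    using N by (simp add: sat_limitlessness)
  then show "sc_str (ev (prec 0 1) m r) m (\<lambda>x. x) \<Turnstile> SC \<and> ev (prec 0 1) m (ev (prec 0 1) m r) = r"
    using zf_sc[OF zf] unfolding SC_def ev_prec by blast
next
  fix p assume "p \<in> SC" then show "wff sc_sig [] p"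
    using wff_SC_minus wff_SC_axs unfolding SC_def by blast
next
  fix p assume "p \<in> ZFGC_minus \<union> {successor_cardinals_ax}" then show "wff set_sig [] p"
    using wff_ZFGC_minus wff_successor_cardinals by blast
qed (auto simp: SC_def)

section \<open>Regular orders and rank orders\<close>

definition lub :: "'a rel2 \<Rightarrow> 'a rel2 \<Rightarrow> 'a \<Rightarrow> 'a \<Rightarrow> bool" where
  "lub m l s x \<longleftrightarrow> (\<forall>a. m a x \<longrightarrow> a = s \<or> l a s) \<and> (\<forall>t. (\<forall>a. m a x \<longrightarrow> a = t \<or> l a t) \<longrightarrow> s = t \<or> l s t)"

definition regular :: "'a rel2 \<Rightarrow> 'a rel2 \<Rightarrow> bool" where
  "regular m l \<longleftrightarrow> (\<forall>x y. (\<exists>s t. lub m l s x \<and> lub m l t y \<and> l s t) \<longrightarrow> l x y)"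

lemma sat_regularity:
  assumes "bij c"
  shows "sat (sc_str l i c) e regularity_ax \<longleftrightarrow> regular (Emem i c) l"
proof -
  have "sat (sc_str l i c) e regularity_ax \<longleftrightarrow>
      (\<forall>x y. (\<exists>s t. lub (Emem i c) l s (c x) \<and> lub (Emem i c) l t (c y) \<and> l s t) \<longrightarrow> l (c x) (c y))"
    unfolding lub_def Emem_inj[OF assms] by (simp add: regularity_ax_def sup_fm_def upper_bound_fm_def)
  then show ?thesis unfolding regular_def using bij_all2[OF assms, of "\<lambda>x y. _ x y \<longrightarrow> l x y"] by simp
qed

definition upair :: "'a rel2 \<Rightarrow> 'a \<Rightarrow> 'a \<Rightarrow> 'a \<Rightarrow> bool" where
  "upair m z a b \<longleftrightarrow> (\<forall>x. m x z \<longleftrightarrow> x = a \<or> x = b)"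
definition opair :: "'a rel2 \<Rightarrow> 'a \<Rightarrow> 'a \<Rightarrow> 'a \<Rightarrow> bool" where
  "opair m p a b \<longleftrightarrow> (\<exists>u v. upair m u a a \<and> upair m v a b \<and> upair m p u v)"
definition app :: "'a rel2 \<Rightarrow> 'a \<Rightarrow> 'a \<Rightarrow> 'a \<Rightarrow> bool" where
  "app m f a b \<longleftrightarrow> (\<exists>p. m p f \<and> opair m p a b)"
definition funct :: "'a rel2 \<Rightarrow> 'a \<Rightarrow> bool" where
  "funct m f \<longleftrightarrow> (\<forall>p. m p f \<longrightarrow> (\<exists>a b. opair m p a b)) \<and> (\<forall>x y z. app m f x y \<and> app m f x z \<longrightarrow> y = z)"
definition ranking :: "'a rel2 \<Rightarrow> 'a \<Rightarrow> bool" where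
  "ranking m f \<longleftrightarrow> (\<forall>u v. app m f u v \<longrightarrow> (\<forall>w. m w u \<longrightarrow> (\<exists>v'. app m f w v')) \<and>
    (\<forall>w. m w v \<longleftrightarrow> (\<exists>a b. m a u \<and> app m f a b \<and> (m w b \<or> w = b))))"
definition rk :: "'a rel2 \<Rightarrow> 'a \<Rightarrow> 'a \<Rightarrow> bool" where
  "rk m x s \<longleftrightarrow> (\<exists>f. funct m f \<and> app m f x s \<and> ranking m f)"
definition rank_order :: "'a rel2 \<Rightarrow> 'a rel2 \<Rightarrow> bool" where
  "rank_order m l \<longleftrightarrow> (\<forall>x y. (\<exists>s t. rk m x s \<and> rk m y t \<and> m s t) \<longrightarrow> l x y)"

lemma sat_upair: "sat (set_str m r) e (upair_fm z a b) \<longleftrightarrow> upair m (e z) (e a) (e b)"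
  by (simp add: upair_fm_def upair_def)
lemma sat_opair: "sat (set_str m r) e (opair_fm z a b) \<longleftrightarrow> opair m (e z) (e a) (e b)"
  by (simp add: opair_fm_def opair_def sat_upair)
lemma sat_app: "sat (set_str m r) e (app_fm z a b) \<longleftrightarrow> app m (e z) (e a) (e b)"
  by (simp add: app_fm_def app_def sat_opair)
lemma sat_funct: "sat (set_str m r) e (function_fm f) \<longleftrightarrow> funct m (e f)"
  by (simp add: function_fm_def funct_def sat_opair sat_app numeral_3_eq_3)
lemma sat_rk: "sat (set_str m r) e (rank_fm x s) \<longleftrightarrow> rk m (e x) (e s)"
  by (simp add: rank_fm_def rk_def ranking_def sat_funct sat_app)
lemma sat_rank_ax: "sat (set_str m r) e rank_ax \<longleftrightarrow> rank_order m r"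
  by (simp add: rank_ax_def rank_order_def sat_rk)

lemma sat_ZFGC_plus: "set_str m r \<Turnstile> ZFGC_plus \<longleftrightarrow> zf m r \<and> pow m \<and> rank_order m r"
  using sat_ZFGC[of m r] sat_rank_ax[of m r] unfolding ZFGC_plus_def by blast

lemma least_cls:
  assumes "zf m r" "cls m r X" "X a"
  shows "\<exists>a. X a \<and> (\<forall>b. X b \<longrightarrow> a = b \<or> r a b)"
proof -
  note G = gwoD[OF zfD(2)[OF assms(1)]]
  obtain s where s: "\<forall>z. m z s \<longleftrightarrow> r z a" using G(5) by blast
  obtain t where t: "\<forall>z. m z t \<longleftrightarrow> m z s \<and> X z" using zfD(3)[OF assms(1), rule_format, OF assms(2)] by blast
  show ?thesis
  proof (cases "\<exists>y. m y t")
    case True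
    then obtain y where y: "m y t" "\<forall>z. m z t \<longrightarrow> y = z \<or> r y z" using G(4) by blast
    have "y = b \<or> r y b" if "X b" for b
      using y t s that G(2,3) by metis
    then show ?thesis using y t by blast
  next
    case False
    then have "a = b \<or> r a b" if "X b" for b using t s that G(3) by blast
    then show ?thesis using assms(3) by blast
  qed
qed

text \<open>Induction along the order covers induction along membership, and it also reaches
  statements about all sets up to a bound.\<close>

lemma zf_induct:
  assumes "zf m r" "cls m r X" "\<And>x. (\<And>y. r y x \<Longrightarrow> X y) \<Longrightarrow> X x"
  shows "X x"
proof (rule ccontr)
  assume *: "\<not> X x"
  have c: "cls m r (\<lambda>x. \<not> X x)" by (rule df_Not[OF assms(2)])
  obtain a where "\<not> X a" "\<forall>b. \<not> X b \<longrightarrow> a = b \<or> r a b"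
    using least_cls[OF assms(1), of "\<lambda>x. \<not> X x", OF c *] by blast
  then show False using assms(3)[of a] gwoD(1,2)[OF zfD(2)[OF assms(1)]] by blast
qed

text \<open>A set with all members below \<open>a\<close> has a supremum of at most
  \<open>a\<close>, which is below {a}. As {{a}} has the supremum {a}, regularity puts the set below
  {{a}}, which is therefore a uniform bound.\<close>

lemma regular_pow:
  assumes zf: "zf m r" and reg: "regular m r"
  shows "pow m"
proof -
  note G = gwoD[OF zfD(2)[OF zf]] and F = zf_finiteD[OF zfD(1)[OF zf]]
  have "unif_bounded m r" unfolding unif_bounded_def
  proof
    fix a
    obtain a' where a': "\<forall>x. m x a' \<longleftrightarrow> x = a \<or> x = a" using F(3) by blast
    obtain y where y: "\<forall>x. m x y \<longleftrightarrow> x = a' \<or> x = a'" using F(3) by blast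
    have "r a a'" using a' G(6) by blast
    have "lub m r a' y" unfolding lub_def using y by blast
    have "r x y" if x: "\<forall>g. m g x \<longrightarrow> r g a" for x
    proof -
      let ?X = "\<lambda>s. \<forall>g. m g x \<longrightarrow> g = s \<or> r g s"
      have c: "cls m r ?X" by (intro df_intros df_prec vr_const)
      have "?X a" using x by blast
      from least_cls[OF zf, of ?X, OF c this] obtain s where s: "?X s" "\<forall>b. ?X b \<longrightarrow> s = b \<or> r s b" by blast
      then have "lub m r s x" unfolding lub_def by blast
      moreover have "s = a \<or> r s a" using s \<open>?X a\<close> by blast
      then have "r s a'" using \<open>r a a'\<close> G(2) by blast
      ultimately show ?thesis using reg \<open>lub m r a' y\<close> unfolding regular_def by blast
    qed
    then show "\<exists>b. \<forall>x. (\<forall>g. m g x \<longrightarrow> r g a) \<longrightarrow> r x b" by blast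
  qed
  then show ?thesis using unif_bounded_pow[OF zf] by blast
qed

text \<open>
  \<open>rec m K\<close> is the relation \<open>L\<close> with \<open>L u v \<longleftrightarrow> (\<exists>b\<in>v. \<forall>a\<in>u. L a b \<or> (\<not> L b a \<and> K a b))\<close>: for empty \<open>K\<close>
  it compares ranks, and if \<open>K\<close> breaks ties, then it compares strict suprema in the resulting order.
\<close>

definition pair_in :: "'a rel2 \<Rightarrow> 'a \<Rightarrow> 'a \<Rightarrow> 'a \<Rightarrow> bool" where
  "pair_in m l u v \<longleftrightarrow> (\<exists>p. m p l \<and> is_sp m p u v)"

text \<open>A set-sized piece of the recursion. Transitivity of \<open>t\<close> ensures that the
  clause for elements of \<open>t\<close> consults pairs from \<open>t\<close> only.\<close>

definition attempt :: "'a rel2 \<Rightarrow> 'a rel2 \<Rightarrow> 'a \<Rightarrow> 'a \<Rightarrow> bool" where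
  "attempt m K t l \<longleftrightarrow> (\<forall>x y. m x t \<and> m y x \<longrightarrow> m y t) \<and>
    (\<forall>u v. m u t \<and> m v t \<longrightarrow> (pair_in m l u v \<longleftrightarrow>
      (\<exists>b. m b v \<and> (\<forall>a. m a u \<longrightarrow> pair_in m l a b \<or> (\<not> pair_in m l b a \<and> K a b)))))"

definition rec :: "'a rel2 \<Rightarrow> 'a rel2 \<Rightarrow> 'a rel2" where
  "rec m K u v \<longleftrightarrow> (\<exists>t l. attempt m K t l \<and> m u t \<and> m v t \<and> pair_in m l u v)"

lemma df_is_sp: "vr b t \<Longrightarrow> vr b u \<Longrightarrow> vr b v \<Longrightarrow> df b M R (\<lambda>i e. is_sp (M i) (t i e) (u i e) (v i e))"
proof -
  have "df3 b M R (\<lambda>i _. is_sp (M i))"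
    by (rule df3I) (unfold is_sp_def, intro df_intros)
  then show "vr b t \<Longrightarrow> vr b u \<Longrightarrow> vr b v \<Longrightarrow> df b M R (\<lambda>i e. is_sp (M i) (t i e) (u i e) (v i e))"
    by (rule df3D)
qed

lemma df_pair_in: "vr b t \<Longrightarrow> vr b u \<Longrightarrow> vr b v \<Longrightarrow> df b M R (\<lambda>i e. pair_in (M i) (t i e) (u i e) (v i e))"
proof -
  have "df3 b M R (\<lambda>i _. pair_in (M i))"
    by (rule df3I) (unfold pair_in_def, intro df_intros df_is_sp)
  then show "vr b t \<Longrightarrow> vr b u \<Longrightarrow> vr b v \<Longrightarrow> df b M R (\<lambda>i e. pair_in (M i) (t i e) (u i e) (v i e))"
    by (rule df3D)
qed

lemma df2_use: "df2 b M R P \<Longrightarrow> vr b t \<Longrightarrow> vr b u \<Longrightarrow> df b M R (\<lambda>i e. P i e (t i e) (u i e))"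
  using df2D[of b M R P t u "\<lambda>j. j"] by simp

lemma df2_shift:
  fixes P :: "'a \<Rightarrow> (nat \<Rightarrow> 'b) \<Rightarrow> 'b rel2"
  assumes "df2 b M R P"
  shows "df2 b M R (\<lambda>i e. P i (\<lambda>j. e (f j)))"
  unfolding df2_def
proof (intro allI HOL.impI)
  fix g :: "nat \<Rightarrow> nat" and t u :: "'a \<Rightarrow> (nat \<Rightarrow> 'b) \<Rightarrow> 'b" assume "vr b t" "vr b u"
  then show "df b M R (\<lambda>i e. P i (\<lambda>j. e (g (f j))) (t i e) (u i e))"
    using df2D[OF assms, of t u "\<lambda>j. g (f j)"] by simp
qed

lemma df2_attempt:
  assumes K: "df2 b M R K"
  shows "df2 b M R (\<lambda>i e. attempt (M i) (K i e))"
  by (rule df2I) (unfold attempt_def, intro df_intros df_pair_in df2D[OF K])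

lemma df2_rec:
  assumes K: "df2 b M R K"
  shows "df2 b M R (\<lambda>i e. rec (M i) (K i e))"
  by (rule df2I) (unfold rec_def, intro df_intros df_pair_in df2D[OF df2_attempt[OF K]])

section \<open>Existence of the recursively defined relation\<close>

locale zfp =
  fixes m r :: "'a rel2"
  assumes zf: "zf m r" and pow: "pow m"
begin

lemmas G = gwoD[OF zfD(2)[OF zf]]
lemmas F = zf_finiteD[OF zfD(1)[OF zf]]
lemmas sep = zfD(3)[OF zf, rule_format]
lemmas sp_inj = is_sp_inject[OF F(1) G(6,1,2) F(3)]
lemmas ex_sp' = ex_sp[OF F(3) F(1)]
lemmas induct = zf_induct[OF zf]

lemma seg: "\<exists>t. \<forall>y. m y t \<longleftrightarrow> y = s \<or> r y s"
proof -
  obtain a where a: "\<forall>y. m y a \<longleftrightarrow> r y s" using G(5) by blast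
  obtain c where c: "\<forall>x. m x c \<longleftrightarrow> x = s \<or> x = s" using F(3) by blast
  obtain d where d: "\<forall>x. m x d \<longleftrightarrow> x = c \<or> x = a" using F(3) by blast
  obtain t where t: "\<forall>z. m z t \<longleftrightarrow> (\<exists>y. m y d \<and> m z y)" using F(4) by blast
  show ?thesis by (rule exI[of _ t]) (auto simp: t d c a)
qed

text \<open>The pair {u, {u, v}} is a subset of the union of \<open>t\<close> and its power set,
  hence a member of the power set of that union.\<close>

lemma ex_pairs: "\<exists>w. \<forall>p u v. m u t \<longrightarrow> m v t \<longrightarrow> is_sp m p u v \<longrightarrow> m p w"
proof -
  obtain a where a: "\<forall>z. m z a \<longleftrightarrow> (\<forall>u. m u z \<longrightarrow> m u t)" using pow unfolding pow_def by blast
  obtain d where d: "\<forall>x. m x d \<longleftrightarrow> x = t \<or> x = a" using F(3) by blast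
  obtain c where c: "\<forall>z. m z c \<longleftrightarrow> (\<exists>y. m y d \<and> m z y)" using F(4) by blast
  obtain w where w: "\<forall>z. m z w \<longleftrightarrow> (\<forall>u. m u z \<longrightarrow> m u c)" using pow unfolding pow_def by blast
  have "m p w" if "m u t" "m v t" "is_sp m p u v" for p u v
    using that w c d a unfolding is_sp_def by metis
  then show ?thesis by blast
qed

end

locale zf_rec = zfp +
  fixes K :: "'a rel2"
  assumes K: "cls2 m r K"
begin

abbreviation "L \<equiv> rec m K"
abbreviation "Mr a b \<equiv> L a b \<or> (\<not> L b a \<and> K a b)"

lemma dfL: "vr True t \<Longrightarrow> vr True u \<Longrightarrow> df True (\<lambda>_ :: unit. m) (\<lambda>_. r) (\<lambda>i e. L (t i e) (u i e))"
  by (rule df2_use[OF df2_rec[OF K]])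

lemma dfK: "vr True t \<Longrightarrow> vr True u \<Longrightarrow> df True (\<lambda>_ :: unit. m) (\<lambda>_. r) (\<lambda>i e. K (t i e) (u i e))"
  by (rule cls2D[OF K])

lemma ex_all_cong:
  assumes "\<And>a b. A a \<Longrightarrow> B b \<Longrightarrow> P a b \<longleftrightarrow> P' a b"
  shows "(\<exists>b. B b \<and> (\<forall>a. A a \<longrightarrow> P a b)) \<longleftrightarrow> (\<exists>b. B b \<and> (\<forall>a. A a \<longrightarrow> P' a b))"
  using assms by blast

text \<open>The clause for (u, v) consults both (a, b) and (b, a) for a in u and b in v. The
  statement therefore treats both directions at once, and the induction runs on \<open>u\<close>
  alone with \<open>v\<close> arbitrary.\<close>

lemma attempt_unique:
  assumes a: "attempt m K t l" "attempt m K t' l'"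
  shows "\<forall>v. m u t \<longrightarrow> m u t' \<longrightarrow> m v t \<longrightarrow> m v t' \<longrightarrow>
    (pair_in m l u v \<longleftrightarrow> pair_in m l' u v) \<and> (pair_in m l v u \<longleftrightarrow> pair_in m l' v u)"
proof (rule induct[of _ u])
  show "cls m r (\<lambda>u. \<forall>v. m u t \<longrightarrow> m u t' \<longrightarrow> m v t \<longrightarrow> m v t' \<longrightarrow>
    (pair_in m l u v \<longleftrightarrow> pair_in m l' u v) \<and> (pair_in m l v u \<longleftrightarrow> pair_in m l' v u))"
    by (intro df_intros df_pair_in vr_const)
next
  fix u
  assume IH: "\<And>y. r y u \<Longrightarrow> \<forall>v. m y t \<longrightarrow> m y t' \<longrightarrow> m v t \<longrightarrow> m v t' \<longrightarrow>
    (pair_in m l y v \<longleftrightarrow> pair_in m l' y v) \<and> (pair_in m l v y \<longleftrightarrow> pair_in m l' v y)"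
  have tr: "m x t \<Longrightarrow> m y x \<Longrightarrow> m y t" "m x t' \<Longrightarrow> m y x \<Longrightarrow> m y t'" for x y
    using a unfolding attempt_def by blast+
  have cl: "m u t \<Longrightarrow> m v t \<Longrightarrow> pair_in m l u v \<longleftrightarrow>
      (\<exists>b. m b v \<and> (\<forall>a. m a u \<longrightarrow> pair_in m l a b \<or> (\<not> pair_in m l b a \<and> K a b)))" for u v
    using a(1) unfolding attempt_def by blast
  have cl': "m u t' \<Longrightarrow> m v t' \<Longrightarrow> pair_in m l' u v \<longleftrightarrow>
      (\<exists>b. m b v \<and> (\<forall>a. m a u \<longrightarrow> pair_in m l' a b \<or> (\<not> pair_in m l' b a \<and> K a b)))" for u v
    using a(2) unfolding attempt_def by blast
  show "\<forall>v. m u t \<longrightarrow> m u t' \<longrightarrow> m v t \<longrightarrow> m v t' \<longrightarrow>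
    (pair_in m l u v \<longleftrightarrow> pair_in m l' u v) \<and> (pair_in m l v u \<longleftrightarrow> pair_in m l' v u)"
  proof (intro allI HOL.impI)
    fix v assume t: "m u t" "m u t'" "m v t" "m v t'"
    have eq: "(pair_in m l x y \<longleftrightarrow> pair_in m l' x y) \<and> (pair_in m l y x \<longleftrightarrow> pair_in m l' y x)" if "m x u" "m y v" for x y
    proof -
      have "r x u" using that G(6) by blast
      moreover have "m x t" "m x t'" "m y t" "m y t'" using that t tr by blast+
      ultimately show ?thesis using IH by blast
    qed
    have "pair_in m l u v \<longleftrightarrow> pair_in m l' u v"
      unfolding cl[OF t(1,3)] cl'[OF t(2,4)] by (rule ex_all_cong) (simp add: eq)
    moreover have "pair_in m l v u \<longleftrightarrow> pair_in m l' v u"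
      unfolding cl[OF t(3,1)] cl'[OF t(4,2)] using eq by metis
    ultimately show "(pair_in m l u v \<longleftrightarrow> pair_in m l' u v) \<and> (pair_in m l v u \<longleftrightarrow> pair_in m l' v u)" by blast
  qed
qed

lemma L_attempt:
  assumes "attempt m K t l" "m u t" "m v t"
  shows "L u v \<longleftrightarrow> pair_in m l u v"
  unfolding rec_def using assms attempt_unique[OF _ assms(1)] by blast

lemma L_clause_attempt:
  assumes a: "attempt m K t l" "m u t" "m v t"
  shows "L u v \<longleftrightarrow> (\<exists>b. m b v \<and> (\<forall>a. m a u \<longrightarrow> Mr a b))"
proof -
  have "m x t" if "m x u \<or> m x v" for x using a that unfolding attempt_def by blast
  then have "L x y \<longleftrightarrow> pair_in m l x y" "L y x \<longleftrightarrow> pair_in m l y x" if "m x u" "m y v" for x y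
    using L_attempt[OF a(1)] that by blast+
  then have eq: "Mr x y \<longleftrightarrow> pair_in m l x y \<or> (\<not> pair_in m l y x \<and> K x y)" if "m x u" "m y v" for x y
    using that by simp
  have "pair_in m l u v \<longleftrightarrow>
      (\<exists>b. m b v \<and> (\<forall>a. m a u \<longrightarrow> pair_in m l a b \<or> (\<not> pair_in m l b a \<and> K a b)))"
    using a unfolding attempt_def by blast
  also have "\<dots> \<longleftrightarrow> (\<exists>b. m b v \<and> (\<forall>a. m a u \<longrightarrow> Mr a b))"
    by (rule ex_all_cong, rule eq[symmetric])
  finally show ?thesis using L_attempt[OF a] by simp
qed

text \<open>The clause itself, read with \<open>L\<close>, defines the new attempt: members of
  elements of \<open>t\<close> are strictly below \<open>s\<close>, where earlier attempts show that
  \<open>L\<close> satisfies its clause.\<close>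

lemma ex_attempt: "\<exists>t l. attempt m K t l \<and> (\<forall>y. m y t \<longleftrightarrow> y = s \<or> r y s)"
proof (rule induct[of _ s])
  show "cls m r (\<lambda>s. \<exists>t l. attempt m K t l \<and> (\<forall>y. m y t \<longleftrightarrow> y = s \<or> r y s))"
    by (intro df_intros df_prec vr_const df2_use[OF df2_attempt[OF K]])
next
  fix s assume IH: "\<And>y. r y s \<Longrightarrow> \<exists>t l. attempt m K t l \<and> (\<forall>x. m x t \<longleftrightarrow> x = y \<or> r x y)"
  let ?C = "\<lambda>u v. \<exists>b. m b v \<and> (\<forall>a. m a u \<longrightarrow> Mr a b)"
  have cl: "L u v \<longleftrightarrow> ?C u v" if uv: "r u s" "r v s" for u v
  proof -
    obtain x where x: "r x s" "u = x \<or> r u x" "v = x \<or> r v x" using uv G(3) by metis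
    obtain t l where "attempt m K t l" "\<forall>y. m y t \<longleftrightarrow> y = x \<or> r y x" using IH[OF x(1)] by blast
    then show ?thesis using L_clause_attempt x by blast
  qed
  obtain t where t: "\<forall>y. m y t \<longleftrightarrow> y = s \<or> r y s" using seg by blast
  obtain w where w: "\<forall>p u v. m u t \<longrightarrow> m v t \<longrightarrow> is_sp m p u v \<longrightarrow> m p w" using ex_pairs by blast
  have "cls m r (\<lambda>p. \<exists>u v. m u t \<and> m v t \<and> is_sp m p u v \<and> ?C u v)"
    by (intro df_intros df_is_sp vr_const dfL dfK)
  from sep[OF this, of w] obtain l where l: "\<forall>p. m p l \<longleftrightarrow> m p w \<and> (\<exists>u v. m u t \<and> m v t \<and> is_sp m p u v \<and> ?C u v)"
    by blast
  have in_l: "pair_in m l u v \<longleftrightarrow> ?C u v" if uv: "m u t" "m v t" for u v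
  proof
    assume "pair_in m l u v"
    then obtain p u' v' where p: "is_sp m p u v" "is_sp m p u' v'" "?C u' v'" unfolding pair_in_def l[rule_format] by blast
    then have "u = u' \<and> v = v'" using sp_inj by blast
    then show "?C u v" using p(3) by simp
  next
    assume C: "?C u v"
    obtain p where "is_sp m p u v" using ex_sp' by blast
    then show "pair_in m l u v" unfolding pair_in_def l[rule_format] using w uv C by blast
  qed
  have tr: "m y t" if xy: "m x t" "m y x" for x y
  proof -
    have "r y x" using xy G(6) by blast
    moreover have "x = s \<or> r x s" using xy t by blast
    ultimately have "r y s" using G(2) by blast
    then show ?thesis using t by blast
  qed
  have "attempt m K t l"
    unfolding attempt_def
  proof (intro conjI allI HOL.impI)
    show "m y t" if "m x t \<and> m y x" for x y using tr that by blast
    fix u v assume uv: "m u t \<and> m v t"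
    have "(pair_in m l x y \<longleftrightarrow> L x y) \<and> (pair_in m l y x \<longleftrightarrow> L y x)" if xy: "m x u" "m y v" for x y
    proof -
      have "r x u" "r y v" using xy G(6) by blast+
      moreover have "u = s \<or> r u s" "v = s \<or> r v s" using uv t by blast+
      ultimately have s: "r x s" "r y s" using G(2) by blast+
      then have t: "m x t" "m y t" using t by blast+
      show ?thesis unfolding in_l[OF t] in_l[OF t(2,1)] cl[OF s] cl[OF s(2,1)] by blast
    qed
    then show "pair_in m l u v \<longleftrightarrow> (\<exists>b. m b v \<and> (\<forall>a. m a u \<longrightarrow> pair_in m l a b \<or> (\<not> pair_in m l b a \<and> K a b)))"
      using in_l uv by metis
  qed
  then show "\<exists>t l. attempt m K t l \<and> (\<forall>y. m y t \<longleftrightarrow> y = s \<or> r y s)" using t by blast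
qed

lemma L_clause: "L u v \<longleftrightarrow> (\<exists>b. m b v \<and> (\<forall>a. m a u \<longrightarrow> Mr a b))"
proof -
  obtain x where x: "u = x \<or> r u x" "v = x \<or> r v x" using G(3) by metis
  obtain t l where "attempt m K t l" "\<forall>y. m y t \<longleftrightarrow> y = x \<or> r y x" using ex_attempt by blast
  then show ?thesis using L_clause_attempt x by blast
qed

text \<open>The required member of \<open>y\<close> is \<open>x\<close> itself, since the members of
  \<open>x\<close> are below \<open>x\<close> by the induction hypothesis.\<close>

lemma L_mem: "\<forall>y. m x y \<longrightarrow> L x y"
proof (rule induct[of _ x])
  show "cls m r (\<lambda>x. \<forall>y. m x y \<longrightarrow> L x y)" by (intro df_intros dfL vr_const)
  fix x assume "\<And>y. r y x \<Longrightarrow> \<forall>z. m y z \<longrightarrow> L y z"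
  then show "\<forall>y. m x y \<longrightarrow> L x y" using L_clause G(6) by blast
qed

end

section \<open>\<open>L\<close> as a well-founded, set-like strict weak order\<close>

lemma lex_asym:
  assumes "S a" "S b" "\<forall>a b. S a \<and> S b \<and> L a b \<longrightarrow> \<not> L b a" "\<forall>a b. K a b \<longrightarrow> \<not> K b a"
    and "L a b \<or> (\<not> L b a \<and> K a b)"
  shows "\<not> (L b a \<or> (\<not> L a b \<and> K b a))"
  using assms by blast

text \<open>Strict weak orders are described by asymmetry and negative transitivity because these
  pass to lexicographic combinations. The predicate \<open>S\<close> restricts the demand on
  \<open>L\<close> to elements that an induction has already reached.\<close>

lemma lex_ntrans:
  assumes "S a" "S b" "S c" "\<forall>a b c. S a \<and> S b \<and> S c \<and> L a b \<longrightarrow> L a c \<or> L c b"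
    and "\<forall>a b c. K a b \<longrightarrow> K a c \<or> K c b" and "L a b \<or> (\<not> L b a \<and> K a b)"
  shows "(L a c \<or> (\<not> L c a \<and> K a c)) \<or> (L c b \<or> (\<not> L b c \<and> K c b))"
proof (cases "L a b")
  case True
  then show ?thesis using assms(1-4) by blast
next
  case False
  then have n: "\<not> L b a" "K a b" using assms(6) by blast+
  then consider "K a c" | "K c b" using assms(5) by blast
  then show ?thesis
  proof cases
    case 1
    have "L c a \<longrightarrow> L c b \<or> L b a" using assms(1-4) by blast
    then show ?thesis using n 1 by blast
  next
    case 2
    have "L b c \<longrightarrow> L b a \<or> L a c" using assms(1-4) by blast
    then show ?thesis using n 2 by blast
  qed
qed

text \<open>The conditions on \<open>K\<close> hold both for the empty relation, which gives rank
  orders, and for a well-order, which gives regular ones.\<close>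

locale zf_wo = zf_rec +
  assumes K_asym: "\<forall>a b. K a b \<longrightarrow> \<not> K b a"
    and K_ntrans: "\<forall>a b c. K a b \<longrightarrow> K a c \<or> K c b"
    and K_min: "\<forall>z. (\<exists>x. m x z) \<longrightarrow> (\<exists>x. m x z \<and> (\<forall>y. m y z \<longrightarrow> \<not> K y x))"
begin

text \<open>For sets up to \<open>s\<close>, both properties follow from the corresponding
  properties of \<open>Mr\<close> on their members, which are strictly below \<open>s\<close>; hence
  a joint induction.\<close>

lemma L_weak:
  "\<forall>a b c. (a = s \<or> r a s) \<and> (b = s \<or> r b s) \<and> (c = s \<or> r c s) \<and> L a b \<longrightarrow> \<not> L b a \<and> (L a c \<or> L c b)"
proof (rule induct[of _ s])
  show "cls m r (\<lambda>s. \<forall>a b c. (a = s \<or> r a s) \<and> (b = s \<or> r b s) \<and> (c = s \<or> r c s) \<and> L a b \<longrightarrow>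
      \<not> L b a \<and> (L a c \<or> L c b))"
    by (intro df_intros df_prec dfL vr_const)
next
  fix s
  assume IH: "\<And>s'. r s' s \<Longrightarrow>
    \<forall>a b c. (a = s' \<or> r a s') \<and> (b = s' \<or> r b s') \<and> (c = s' \<or> r c s') \<and> L a b \<longrightarrow> \<not> L b a \<and> (L a c \<or> L c b)"
  have max: "\<exists>d. r d s \<and> (a = d \<or> r a d) \<and> (b = d \<or> r b d)" if "r a s" "r b s" for a b
    using that G(3) by metis
  have below: "\<not> L b a \<and> (L a c \<or> L c b)" if ab: "r a s" "r b s" "r c s" "L a b" for a b c
  proof -
    obtain d where d: "r d s" "a = d \<or> r a d" "b = d \<or> r b d" using max[OF ab(1,2)] by blast
    obtain d' where d': "r d' s" "d = d' \<or> r d d'" "c = d' \<or> r c d'" using max[OF d(1) ab(3)] by blast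
    have "a = d' \<or> r a d'" "b = d' \<or> r b d'" using d d' G(2) by blast+
    then show ?thesis using IH[OF d'(1)] d'(3) ab(4) by blast
  qed
  have M_asym: "\<not> Mr b a" if "r a s" "r b s" "Mr a b" for a b
    using lex_asym[of "\<lambda>a. r a s" a b L K] below K_asym that by blast
  have M_nt: "Mr a c \<or> Mr c b" if "r a s" "r b s" "r c s" "Mr a b" for a b c
    by (rule lex_ntrans[of "\<lambda>a. r a s" a b c L K]) (use below K_ntrans that in blast)+
  have el: "r x s" if "m x u" "u = s \<or> r u s" for x u using that G(2,6) by metis
  show "\<forall>a b c. (a = s \<or> r a s) \<and> (b = s \<or> r b s) \<and> (c = s \<or> r c s) \<and> L a b \<longrightarrow> \<not> L b a \<and> (L a c \<or> L c b)"
  proof (intro allI HOL.impI)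
    fix u v w assume uvw: "(u = s \<or> r u s) \<and> (v = s \<or> r v s) \<and> (w = s \<or> r w s) \<and> L u v"
    then obtain b where b: "m b v" "\<forall>a. m a u \<longrightarrow> Mr a b" using L_clause[of u v] by blast
    have bs: "r b s" using el b(1) uvw by blast
    have "\<not> L v u"
    proof
      assume "L v u"
      then obtain a where a: "m a u" "\<forall>b. m b v \<longrightarrow> Mr b a" using L_clause[of v u] by blast
      have "r a s" using el a(1) uvw by blast
      moreover have "Mr a b" "Mr b a" using a b by blast+
      ultimately show False using M_asym bs by blast
    qed
    moreover have "L u w \<or> L w v"
    \<comment> \<open>Either some member \<open>c\<close> of \<open>w\<close> is not below
      \<open>b\<close>, and then \<open>c\<close> exceeds all members of \<open>u\<close>, or
      \<open>b\<close> exceeds all members of \<open>w\<close>.\<close>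
    proof (cases "\<exists>c. m c w \<and> \<not> Mr c b")
      case True
      then obtain c where c: "m c w" "\<not> Mr c b" by blast
      have cs: "r c s" using el c(1) uvw by blast
      have "Mr a c" if a: "m a u" for a
      proof -
        have "r a s" using el a uvw by blast
        from M_nt[OF this bs cs] show ?thesis using b(2) a c(2) by blast
      qed
      then show ?thesis using c(1) L_clause[of u w] by blast
    next
      case False
      then show ?thesis using b(1) L_clause[of w v] by blast
    qed
    ultimately show "\<not> L v u \<and> (L u w \<or> L w v)" by blast
  qed
qed

lemma L_asym: "\<forall>a b. L a b \<longrightarrow> \<not> L b a" and L_ntrans: "\<forall>a b c. L a b \<longrightarrow> L a c \<or> L c b"
proof -
  have max: "\<exists>d. (a = d \<or> r a d) \<and> (b = d \<or> r b d)" for a b using G(3) by metis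
  have "\<not> L b a \<and> (L a c \<or> L c b)" if "L a b" for a b c
  proof -
    obtain d where d: "a = d \<or> r a d" "b = d \<or> r b d" using max by blast
    obtain d' where d': "d = d' \<or> r d d'" "c = d' \<or> r c d'" using max by blast
    have "a = d' \<or> r a d'" "b = d' \<or> r b d'" using d d' G(2) by blast+
    then show ?thesis using L_weak[of d'] d'(2) that by blast
  qed
  then show "\<forall>a b. L a b \<longrightarrow> \<not> L b a" "\<forall>a b c. L a b \<longrightarrow> L a c \<or> L c b" by blast+
qed

lemma M_asym: "Mr a b \<Longrightarrow> \<not> Mr b a"
  using lex_asym[of "\<lambda>_. True" a b L K] L_asym K_asym by blast

lemma M_ntrans: "Mr a b \<Longrightarrow> Mr a c \<or> Mr c b"
  by (rule lex_ntrans[of "\<lambda>_. True" a b c L K]) (use L_ntrans K_ntrans in blast)+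

lemma M_trans: "Mr a b \<Longrightarrow> Mr b c \<Longrightarrow> Mr a c"
  using M_ntrans[of a b c] M_asym[of b c] by blast

text \<open>First minimise \<open>L\<close>, then \<open>K'\<close> among the minimal elements. An
  element discarded in the first step is above some member of \<open>z\<close>, hence by negative
  transitivity above the chosen one.\<close>

lemma min_lex:
  assumes K': "cls2 m r K'" and K'_min: "\<forall>z. (\<exists>x. m x z) \<longrightarrow> (\<exists>x. m x z \<and> (\<forall>y. m y z \<longrightarrow> \<not> K' y x))"
    and min: "\<exists>x. m x z \<and> (\<forall>y. m y z \<longrightarrow> \<not> L y x)"
  shows "\<exists>x. m x z \<and> (\<forall>y. m y z \<longrightarrow> \<not> (L y x \<or> (\<not> L x y \<and> K' y x)))"
proof -
  have "cls m r (\<lambda>x. \<forall>y. m y z \<longrightarrow> \<not> L y x)" by (intro df_intros dfL vr_const)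
  from sep[OF this, of z] obtain z' where z': "\<forall>x. m x z' \<longleftrightarrow> m x z \<and> (\<forall>y. m y z \<longrightarrow> \<not> L y x)" by blast
  then obtain x where x: "m x z'" "\<forall>y. m y z' \<longrightarrow> \<not> K' y x" using min K'_min by metis
  have "\<not> (L y x \<or> (\<not> L x y \<and> K' y x))" if y: "m y z" for y
  proof (cases "m y z'")
    case True
    then show ?thesis using x z' y by blast
  next
    case False
    then obtain w where w: "m w z" "L w y" using z' y by blast
    then have "L w x \<or> L x y" using L_ntrans by blast
    then show ?thesis using x(1) z' w(1) L_asym by blast
  qed
  then show ?thesis using x z' by blast
qed

lemma min_M:
  assumes "\<exists>x. m x z \<and> (\<forall>y. m y z \<longrightarrow> \<not> L y x)"
  shows "\<exists>x. m x z \<and> (\<forall>y. m y z \<longrightarrow> \<not> Mr y x)"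
  by (rule min_lex[OF K K_min assms])

text \<open>
  Well-foundedness, by induction on a bound \<open>b\<close> of the set \<open>z\<close>: if some \<open>c \<in> b\<close> lies above all elements
  of a member of \<open>z\<close>, then the induction hypothesis for \<open>c\<close> yields a minimal set with this
  property, and a member of \<open>z\<close> below it is minimal; otherwise no two members of \<open>z\<close> are related by \<open>L\<close>.
\<close>

lemma acc: "\<forall>z. (\<exists>x. m x z) \<and> (\<forall>x. m x z \<longrightarrow> \<not> Mr b x) \<longrightarrow> (\<exists>x. m x z \<and> (\<forall>y. m y z \<longrightarrow> \<not> L y x))"
proof (rule induct[of _ b])
  show "cls m r (\<lambda>b. \<forall>z. (\<exists>x. m x z) \<and> (\<forall>x. m x z \<longrightarrow> \<not> Mr b x) \<longrightarrow> (\<exists>x. m x z \<and> (\<forall>y. m y z \<longrightarrow> \<not> L y x)))"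
    by (intro df_intros dfL dfK vr_const)
next
  fix b
  assume IH: "\<And>c. r c b \<Longrightarrow>
    \<forall>z. (\<exists>x. m x z) \<and> (\<forall>x. m x z \<longrightarrow> \<not> Mr c x) \<longrightarrow> (\<exists>x. m x z \<and> (\<forall>y. m y z \<longrightarrow> \<not> L y x))"
  show "\<forall>z. (\<exists>x. m x z) \<and> (\<forall>x. m x z \<longrightarrow> \<not> Mr b x) \<longrightarrow> (\<exists>x. m x z \<and> (\<forall>y. m y z \<longrightarrow> \<not> L y x))"
  proof (intro allI HOL.impI)
    fix z assume z: "(\<exists>x. m x z) \<and> (\<forall>x. m x z \<longrightarrow> \<not> Mr b x)"
    have low: "\<exists>c. m c b \<and> \<not> Mr c y" if "m x z" "m y x" for x y
      using z that L_clause[of b x] by blast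
    show "\<exists>x. m x z \<and> (\<forall>y. m y z \<longrightarrow> \<not> L y x)"
    proof (cases "\<exists>c u. m c b \<and> m u z \<and> (\<forall>a. m a u \<longrightarrow> Mr a c)")
      case True
      then obtain c0 u0 where c0: "m c0 b" "m u0 z" "\<forall>a. m a u0 \<longrightarrow> Mr a c0" by blast
      \<comment> \<open>The candidates are members of members of \<open>z\<close>, together with
        \<open>c0\<close>. Those above \<open>c0\<close> are left out so that \<open>c0\<close> is a
        bound of the candidates, as the induction hypothesis demands.\<close>
      let ?X = "\<lambda>c. (\<not> Mr c0 c) \<and> (\<exists>u. m u z \<and> (\<forall>a. m a u \<longrightarrow> Mr a c))"
      obtain U where U: "\<forall>y. m y U \<longleftrightarrow> (\<exists>x. m x z \<and> m y x)" using F(4) by blast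
      obtain C where C: "\<forall>x. m x C \<longleftrightarrow> x = c0 \<or> x = c0" using F(3) by blast
      obtain p where p: "\<forall>x. m x p \<longleftrightarrow> x = U \<or> x = C" using F(3) by blast
      obtain V where V: "\<forall>y. m y V \<longleftrightarrow> (\<exists>x. m x p \<and> m y x)" using F(4) by blast
      have "cls m r ?X" by (intro df_intros dfL dfK vr_const)
      from sep[OF this, of V] obtain W where W: "\<forall>c. m c W \<longleftrightarrow> m c V \<and> ?X c" by blast
      have V': "m y V \<longleftrightarrow> y = c0 \<or> (\<exists>x. m x z \<and> m y x)" for y using U C p V by metis
      have "\<not> Mr c0 c0" using M_asym by blast
      then have "m c0 W" using W V' c0 by blast
      moreover have "\<forall>x. m x W \<longrightarrow> \<not> Mr c0 x" using W by blast
      ultimately have "\<exists>x. m x W \<and> (\<forall>y. m y W \<longrightarrow> \<not> L y x)" using IH[of c0] c0(1) G(6) by blast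
      then obtain c1 where c1: "m c1 W" "\<forall>y. m y W \<longrightarrow> \<not> Mr y c1" using min_M by blast
      then obtain u1 where u1: "m u1 z" "\<forall>a. m a u1 \<longrightarrow> Mr a c1" using W by blast
      have "\<not> L u u1" if u: "m u z" for u
      proof
        assume "L u u1"
        then obtain y where y: "m y u1" "\<forall>a. m a u \<longrightarrow> Mr a y" using L_clause[of u u1] by blast
        have yc: "Mr y c1" using u1(2) y(1) by blast
        have "\<not> Mr c0 c1" using c1(1) W by blast
        then have "\<not> Mr c0 y" using M_trans[OF _ yc, of c0] by blast
        then have "m y W" using W V' u u1(1) y by blast
        then show False using c1(2) yc by blast
      qed
      then show ?thesis using u1(1) by blast
    next
      case False
      obtain u where u: "m u z" using z by blast
      have "\<not> L x u" if x: "m x z" for x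
      proof
        assume "L x u"
        then obtain y where y: "m y u" "\<forall>a. m a x \<longrightarrow> Mr a y" using L_clause[of x u] by blast
        obtain c where c: "m c b" "\<not> Mr c y" using low[OF u y(1)] by blast
        obtain a where a: "m a x" "\<not> Mr a c" using False c(1) x by blast
        have "Mr a y" using y(2) a(1) by blast
        from M_ntrans[OF this, of c] show False using a(2) c(2) by blast
      qed
      then show ?thesis using u by blast
    qed
  qed
qed

text \<open>Every set is a bound of itself in the sense of \<open>acc\<close>, because its members
  are \<open>L\<close>-below it.\<close>

lemma L_min:
  assumes "\<exists>x. m x z"
  shows "\<exists>x. m x z \<and> (\<forall>y. m y z \<longrightarrow> \<not> L y x)"
proof -
  have "\<not> Mr z x" if "m x z" for x
    using M_asym[of x z] L_mem[of x] that by blast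
  then show ?thesis using acc[of z] assms by blast
qed

text \<open>Set-likeness rests on Power Set: if \<open>L v u\<close> fails, each member of
  \<open>u\<close> fails to be above some \<open>c\<close> in \<open>v\<close>, so \<open>u\<close>
  is a subset of a set that Collection builds from the induction hypothesis.\<close>

lemma L_low: "\<exists>s. \<forall>u. \<not> L v u \<longrightarrow> m u s"
proof (rule induct[of _ v])
  show "cls m r (\<lambda>v. \<exists>s. \<forall>u. \<not> L v u \<longrightarrow> m u s)" by (intro df_intros dfL vr_const)
next
  fix v assume IH: "\<And>c. r c v \<Longrightarrow> \<exists>s. \<forall>u. \<not> L c u \<longrightarrow> m u s"
  let ?P = "\<lambda>c s. \<forall>u. \<not> L c u \<longrightarrow> m u s"
  have c: "cls2 m r ?P" by (rule cls2I) (intro df_intros dfL vr_const)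
  have "\<forall>c. m c v \<longrightarrow> (\<exists>s. ?P c s)" using IH G(6) by blast
  from zfD(4)[OF zf, rule_format, OF c this[rule_format]] obtain Y where
    Y: "\<forall>c. m c v \<longrightarrow> (\<exists>s. m s Y \<and> ?P c s)" by blast
  obtain U where U: "\<forall>y. m y U \<longleftrightarrow> (\<exists>x. m x Y \<and> m y x)" using F(4) by blast
  obtain s where s: "\<forall>z. m z s \<longleftrightarrow> (\<forall>u. m u z \<longrightarrow> m u U)" using pow unfolding pow_def by blast
  have "m u s" if u: "\<not> L v u" for u
  proof -
    have "m y U" if y: "m y u" for y
    proof -
      obtain c where c: "m c v" "\<not> Mr c y" using u L_clause[of v u] y by blast
      then obtain t where "m t Y" "m y t" using Y by blast
      then show ?thesis using U by blast
    qed
    then show ?thesis using s by blast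
  qed
  then show "\<exists>s. \<forall>u. \<not> L v u \<longrightarrow> m u s" by blast
qed

text \<open>The final order \<open>Q\<close> among incomparable sets may differ from the tie-breaker
  \<open>K\<close> inside the recursion: for rank orders \<open>K\<close> is empty.\<close>

lemma gwo_lex:
  assumes Q: "cls2 m r Q" and irr: "\<forall>x. \<not> Q x x" and tr: "\<forall>x y z. Q x y \<and> Q y z \<longrightarrow> Q x z"
    and lin: "\<forall>x y. Q x y \<or> x = y \<or> Q y x"
    and min: "\<forall>z. (\<exists>x. m x z) \<longrightarrow> (\<exists>x. m x z \<and> (\<forall>y. m y z \<longrightarrow> \<not> Q y x))"
  shows "gwo m (\<lambda>u v. L u v \<or> (\<not> L v u \<and> Q u v))"
proof -
  let ?N = "\<lambda>u v. L u v \<or> (\<not> L v u \<and> Q u v)"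
  have asy: "\<forall>a b. Q a b \<longrightarrow> \<not> Q b a" using irr tr by blast
  have Qnt: "\<forall>a b c. Q a b \<longrightarrow> Q a c \<or> Q c b" using tr lin by metis
  have N_asym: "\<not> ?N b a" if "?N a b" for a b
    using lex_asym[of "\<lambda>_. True" a b L Q] L_asym asy that by blast
  have N_nt: "?N a c \<or> ?N c b" if "?N a b" for a b c
    by (rule lex_ntrans[of "\<lambda>_. True" a b c L Q]) (use L_ntrans Qnt that in blast)+
  have N_lin: "?N a b \<or> a = b \<or> ?N b a" for a b using lin by blast
  show ?thesis unfolding gwo_def
  proof (intro conjI allI HOL.impI)
    show "\<not> ?N x x" for x using N_asym[of x x] by blast
    show "?N x z" if "?N x y \<and> ?N y z" for x y z
      using that N_nt[of x y z] N_asym[of y z] by blast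
    show "?N x y \<or> x = y \<or> ?N y x" for x y by (rule N_lin)
    show "\<exists>y. m y x \<and> (\<forall>z. m z x \<longrightarrow> y = z \<or> ?N y z)" if "\<exists>y. m y x" for x
      using min_lex[OF Q min L_min[OF that]] N_lin by blast
    show "?N x y" if "m x y" for x y using L_mem[of x] that by blast
    fix v
    obtain s where s: "\<forall>u. \<not> L v u \<longrightarrow> m u s" using L_low[of v] by blast
    have "cls m r (\<lambda>u. ?N u v)" by (intro df_intros dfL cls2D[OF Q] vr_const)
    from sep[OF this, of s] obtain y where "\<forall>z. m z y \<longleftrightarrow> m z s \<and> ?N z v" by blast
    moreover have "m z s" if "?N z v" for z using that s L_asym by blast
    ultimately show "\<exists>y. \<forall>z. m z y \<longleftrightarrow> ?N z v" by blast
  qed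
qed

text \<open>Both sets contain {x, y}, which is above \<open>x\<close> and above \<open>y\<close>. It
  is thus the greatest member of each set, and neither set can exceed the other.\<close>

lemma L_sp:
  assumes "is_sp m u x y" "is_sp m v y x"
  shows "\<not> L u v"
proof
  assume "L u v"
  obtain p where p: "\<forall>z. m z p \<longleftrightarrow> z = x \<or> z = y" using F(3) by blast
  have "(\<forall>z. m z w \<longleftrightarrow> z = x \<or> z = y) \<longleftrightarrow> w = p" "(\<forall>z. m z w \<longleftrightarrow> z = y \<or> z = x) \<longleftrightarrow> w = p" for w
    using F(1) p by blast+
  then have u: "m p u" and v: "\<forall>z. m z v \<longleftrightarrow> z = y \<or> z = p"
    using assms unfolding is_sp_def by simp_all
  obtain b where b: "m b v" "\<forall>a. m a u \<longrightarrow> Mr a b" using L_clause[of u v] \<open>L u v\<close> by blast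
  have "Mr p b" using b(2) u by blast
  moreover have "\<not> Mr p p" using M_asym by blast
  moreover have "\<not> Mr p y" using M_asym[of y p] L_mem[of y] p by blast
  moreover have "b = y \<or> b = p" using b(1) v by blast
  ultimately show False by metis
qed

end

text \<open>
  \<open>twist m P T\<close> exchanges \<open>{x, {x, y}}\<close> and \<open>{y, {x, y}}\<close> whenever \<open>P\<close> orders them differently from the
  way in which \<open>T\<close> orders \<open>x\<close> and \<open>y\<close>. Hence \<open>decode\<close> recovers \<open>T\<close> from \<open>reorder m b P T\<close>, which has rank as its
  primary criterion if \<open>b\<close> is false, and is regular if \<open>b\<close> is true.
\<close>

definition swapped :: "'a rel2 \<Rightarrow> 'a rel2 \<Rightarrow> 'a rel2 \<Rightarrow> 'a rel2" where
  "swapped m P T u v \<longleftrightarrow> (\<exists>x y. x \<noteq> y \<and> is_sp m u x y \<and> is_sp m v y x \<and> (T x y \<longleftrightarrow> \<not> P u v))"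

definition twist :: "'a rel2 \<Rightarrow> 'a rel2 \<Rightarrow> 'a rel2 \<Rightarrow> 'a rel2" where
  "twist m P T u w \<longleftrightarrow> swapped m P T u w \<or> (\<not> (\<exists>v. swapped m P T u v) \<and> w = u)"

definition twisted :: "'a rel2 \<Rightarrow> 'a rel2 \<Rightarrow> 'a rel2 \<Rightarrow> 'a rel2" where
  "twisted m P T u v \<longleftrightarrow> (\<exists>u' v'. twist m P T u u' \<and> twist m P T v v' \<and> P u' v')"

definition reorder :: "'a rel2 \<Rightarrow> bool \<Rightarrow> 'a rel2 \<Rightarrow> 'a rel2 \<Rightarrow> 'a rel2" where
  "reorder m b P T u v \<longleftrightarrow> rec m (\<lambda>x y. b \<and> twisted m P T x y) u v \<or>
    (\<not> rec m (\<lambda>x y. b \<and> twisted m P T x y) v u \<and> twisted m P T u v)"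

definition decode :: "'a rel2 \<Rightarrow> 'a rel2 \<Rightarrow> 'a rel2" where
  "decode m P x y \<longleftrightarrow> (\<exists>u v. is_sp m u x y \<and> is_sp m v y x \<and> P u v)"

section \<open>Coding a tournament into an order\<close>

lemma df_guard: "df B M R \<Phi> \<Longrightarrow> df B M R (\<lambda>i e. b \<and> \<Phi> i e)"
  by (cases b) (simp_all add: df_False)

context
  fixes B :: bool and M R :: "'i \<Rightarrow> 'a rel2" and P T :: "'i \<Rightarrow> (nat \<Rightarrow> 'a) \<Rightarrow> 'a rel2"
  assumes P: "df2 B M R P" and T: "df2 B M R T"
begin

lemma df2_swapped: "df2 B M R (\<lambda>i e. swapped (M i) (P i e) (T i e))"
  by (rule df2I) (unfold swapped_def, intro df_intros df_is_sp df2D[OF P] df2D[OF T])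

lemma df2_twist: "df2 B M R (\<lambda>i e. twist (M i) (P i e) (T i e))"
  by (rule df2I) (unfold twist_def, intro df_intros df2D[OF df2_swapped])

lemma df2_twisted: "df2 B M R (\<lambda>i e. twisted (M i) (P i e) (T i e))"
  by (rule df2I) (unfold twisted_def, intro df_intros df2D[OF P] df2D[OF df2_twist])

lemma df2_tie: "df2 B M R (\<lambda>i e x y. b \<and> twisted (M i) (P i e) (T i e) x y)"
  by (rule df2I) (intro df_guard df_intros df2D[OF df2_twisted])

lemma df2_reorder: "df2 B M R (\<lambda>i e. reorder (M i) b (P i e) (T i e))"
  by (rule df2I) (unfold reorder_def, intro df_intros df2D[OF df2_rec[OF df2_tie]] df2D[OF df2_twisted])

lemma df2_decode: "df2 B M R (\<lambda>i e. decode (M i) (P i e))"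
  by (rule df2I) (unfold decode_def, intro df_intros df_is_sp df2D[OF P])

end

lemma cls2_decode: "cls2 m r P \<Longrightarrow> cls2 m r (decode m P)"
  using df2_decode[of True "\<lambda>_ :: unit. m" "\<lambda>_. r" "\<lambda>_ _. P" "\<lambda>_ _. P"] by simp

lemma (in zfp) r: "cls2 m r r"
  by (rule cls2I) (intro df_prec vr_var)

lemma (in zfp) sp_ext: "is_sp m u x y \<Longrightarrow> is_sp m v x y \<Longrightarrow> u = v"
  using F(1) unfolding is_sp_def by simp

lemma (in zfp) r_neg: "u \<noteq> v \<Longrightarrow> r u v \<longleftrightarrow> \<not> r v u"
  using G(1-3) by metis

lemma (in zfp) sp_neq: "is_sp m u x y \<Longrightarrow> is_sp m v y x \<Longrightarrow> x \<noteq> y \<Longrightarrow> u \<noteq> v"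
  using sp_inj by blast

text \<open>The coded relation is only a tournament, because \<open>push\<close> assembles it from
  several relations and the result need not be transitive.\<close>

locale zf_tw = zfp +
  fixes T :: "'a rel2"
  assumes T: "cls2 m r T" and T_irr: "\<forall>x. \<not> T x x" and T_lin: "\<forall>x y. x \<noteq> y \<longrightarrow> (T x y \<longleftrightarrow> \<not> T y x)"
begin

lemma swapped_iff:
  assumes "is_sp m u x y" "is_sp m v y x" "x \<noteq> y"
  shows "swapped m r T u w \<longleftrightarrow> w = v \<and> (T x y \<longleftrightarrow> \<not> r u v)"
proof
  assume "swapped m r T u w"
  then obtain x' y' where w: "is_sp m u x' y'" "is_sp m w y' x'" "T x' y' \<longleftrightarrow> \<not> r u w" unfolding swapped_def by blast
  then have "x' = x \<and> y' = y" using sp_inj[OF assms(1) w(1)] by blast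
  then show "w = v \<and> (T x y \<longleftrightarrow> \<not> r u v)" using w sp_ext[OF assms(2)] by blast
next
  assume "w = v \<and> (T x y \<longleftrightarrow> \<not> r u v)"
  then show "swapped m r T u w" unfolding swapped_def using assms by blast
qed

lemma swapped_sym: "swapped m r T u v \<Longrightarrow> swapped m r T v u"
proof -
  assume "swapped m r T u v"
  then obtain x y where *: "x \<noteq> y" "is_sp m u x y" "is_sp m v y x" "T x y \<longleftrightarrow> \<not> r u v" unfolding swapped_def by blast
  then have "T y x \<longleftrightarrow> \<not> r v u" using T_lin r_neg[OF sp_neq] by blast
  then show ?thesis using * swapped_iff[of v y x u u] by blast
qed

lemma swapped_fun: "swapped m r T u v \<Longrightarrow> swapped m r T u w \<Longrightarrow> w = v"
proof -
  assume s: "swapped m r T u v" "swapped m r T u w"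
  then obtain x y where "x \<noteq> y" "is_sp m u x y" "is_sp m v y x" unfolding swapped_def by blast
  then show ?thesis using swapped_iff s(2) by blast
qed

text \<open>The exchange is an involution \<tau> of the universe, so the twisted order is the given
  one transported along a bijection and inherits its properties.\<close>

lemma ex_twist: "\<exists>\<tau>. (\<forall>u w. twist m r T u w \<longleftrightarrow> w = \<tau> u) \<and> (\<forall>u. \<tau> (\<tau> u) = u)"
proof -
  have "\<exists>w. \<forall>v. twist m r T u v \<longleftrightarrow> v = w" for u
  proof (cases "\<exists>v. swapped m r T u v")
    case True
    then show ?thesis unfolding twist_def using swapped_fun by blast
  next
    case False
    then show ?thesis unfolding twist_def by blast
  qed
  then obtain \<tau> where \<tau>: "\<forall>u w. twist m r T u w \<longleftrightarrow> w = \<tau> u" by metis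
  have "twist m r T w u" if "twist m r T u w" for u w
    using that swapped_sym[of u w] unfolding twist_def by blast
  then have "\<tau> (\<tau> u) = u" for u using \<tau> by metis
  then show ?thesis using \<tau> by blast
qed

lemma cls2_twisted: "cls2 m r (twisted m r T)"
  by (rule df2_twisted[OF r T])

lemma twisted_order: "\<forall>x. \<not> twisted m r T x x" "\<forall>x y z. twisted m r T x y \<and> twisted m r T y z \<longrightarrow> twisted m r T x z"
  "\<forall>x y. twisted m r T x y \<or> x = y \<or> twisted m r T y x"
  "\<forall>z. (\<exists>x. m x z) \<longrightarrow> (\<exists>x. m x z \<and> (\<forall>y. m y z \<longrightarrow> \<not> twisted m r T y x))"
proof -
  obtain \<tau> where tw: "\<forall>u w. twist m r T u w \<longleftrightarrow> w = \<tau> u" and inv: "\<forall>u. \<tau> (\<tau> u) = u" using ex_twist by blast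
  have eq: "twisted m r T u v \<longleftrightarrow> r (\<tau> u) (\<tau> v)" for u v unfolding twisted_def tw[rule_format] by blast
  show "\<forall>x. \<not> twisted m r T x x" "\<forall>x y z. twisted m r T x y \<and> twisted m r T y z \<longrightarrow> twisted m r T x z"
    unfolding eq using G(1,2) by blast+
  show "\<forall>x y. twisted m r T x y \<or> x = y \<or> twisted m r T y x"
    unfolding eq using G(3) inv by metis
  show "\<forall>z. (\<exists>x. m x z) \<longrightarrow> (\<exists>x. m x z \<and> (\<forall>y. m y z \<longrightarrow> \<not> twisted m r T y x))"
  proof (intro allI HOL.impI)
    fix z assume "\<exists>x. m x z"
    then obtain x where "m x z" by blast
    let ?X = "\<lambda>w. \<exists>u. m u z \<and> twist m r T u w"
    have c: "cls m r ?X" by (intro df_intros vr_const cls2D[OF df2_twist[OF r T]])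
    have "?X (\<tau> x)" using \<open>m x z\<close> tw by blast
    from least_cls[OF zf, of ?X, OF c this] obtain a where a: "?X a" "\<forall>b. ?X b \<longrightarrow> a = b \<or> r a b" by blast
    then obtain u where u: "m u z" "a = \<tau> u" using tw by blast
    have "\<not> r (\<tau> y) a" if y: "m y z" for y
    proof -
      have "a = \<tau> y \<or> r a (\<tau> y)" using a(2) y tw by blast
      then show ?thesis using G(1,2) by blast
    qed
    then show "\<exists>x. m x z \<and> (\<forall>y. m y z \<longrightarrow> \<not> twisted m r T y x)" unfolding eq using u by blast
  qed
qed

lemma twisted_sp:
  assumes "is_sp m u x y" "is_sp m v y x" "x \<noteq> y"
  shows "twisted m r T u v \<longleftrightarrow> T x y"
proof (cases "T x y \<longleftrightarrow> \<not> r u v")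
  case True
  then have s: "swapped m r T u v" using swapped_iff[OF assms] by blast
  have "twist m r T u w \<longleftrightarrow> w = v" for w unfolding twist_def using s swapped_fun by blast
  moreover have "twist m r T v w \<longleftrightarrow> w = u" for w unfolding twist_def using swapped_sym[OF s] swapped_fun by blast
  ultimately show ?thesis unfolding twisted_def using True r_neg[OF sp_neq[OF assms]] by simp
next
  case False
  then have n: "\<not> swapped m r T u w" for w using swapped_iff[OF assms] by blast
  have "\<not> swapped m r T v w" for w
  proof
    assume s: "swapped m r T v w"
    then have "w = u" using swapped_iff[OF assms(2,1) assms(3)[symmetric]] by blast
    then show False using swapped_sym[OF s] n by blast
  qed
  with n show ?thesis unfolding twisted_def twist_def using False by simp
qed

lemma wo: "zf_wo m r (\<lambda>x y. b \<and> twisted m r T x y)"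
proof
  show "cls2 m r (\<lambda>x y. b \<and> twisted m r T x y)" by (rule df2_tie[OF r T])
  show "\<forall>a c. b \<and> twisted m r T a c \<longrightarrow> \<not> (b \<and> twisted m r T c a)"
    using twisted_order(1,2) by blast
  show "\<forall>a c d. b \<and> twisted m r T a c \<longrightarrow> b \<and> twisted m r T a d \<or> b \<and> twisted m r T d c"
    using twisted_order(2,3) by metis
  show "\<forall>z. (\<exists>x. m x z) \<longrightarrow> (\<exists>x. m x z \<and> (\<forall>y. m y z \<longrightarrow> \<not> (b \<and> twisted m r T y x)))"
    using twisted_order(4) by blast
qed

lemma gwo_reorder: "gwo m (reorder m b r T)"
  using zf_wo.gwo_lex[OF wo cls2_twisted twisted_order] unfolding reorder_def[abs_def] .

text \<open>By \<open>L_sp\<close> the recursion does not separate the two coding sets, so the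
  twisted order decides between them.\<close>

lemma decode_reorder: "decode m (reorder m b r T) = T"
proof (intro ext)
  fix x y
  obtain u v where uv: "is_sp m u x y" "is_sp m v y x" using ex_sp' by metis
  have "decode m (reorder m b r T) x y \<longleftrightarrow> reorder m b r T u v"
    unfolding decode_def using uv sp_ext by blast
  also have "\<dots> \<longleftrightarrow> T x y"
  proof (cases "x = y")
    case True
    then have "u = v" using sp_ext uv by blast
    then show ?thesis using True T_irr gwoD(1)[OF gwo_reorder] by blast
  next
    case False
    then show ?thesis
      unfolding reorder_def using zf_wo.L_sp[OF wo uv] zf_wo.L_sp[OF wo uv(2,1)] twisted_sp[OF uv] by blast
  qed
  finally show "decode m (reorder m b r T) x y \<longleftrightarrow> T x y" .
qed

text \<open>With ties broken by the twisted order, the comparison of members inside the recursion is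
  the resulting order itself. If the supremum of \<open>x\<close> is below that of \<open>y\<close>,
  then some member of \<open>y\<close> is above the supremum of \<open>x\<close>, hence above all
  members of \<open>x\<close>, and the clause of the recursion applies.\<close>

lemma regular_reorder: "regular m (reorder m True r T)"
  unfolding regular_def
proof (intro allI HOL.impI)
  let ?N = "reorder m True r T"
  note N = gwoD[OF gwo_reorder[of True]]
  have cl: "rec m (twisted m r T) u v \<longleftrightarrow> (\<exists>b. m b v \<and> (\<forall>a. m a u \<longrightarrow> ?N a b))" for u v
    using zf_rec.L_clause[OF zf_wo.axioms(1)[OF wo[of True]], of u v] unfolding reorder_def by simp
  fix x y assume "\<exists>s t. lub m ?N s x \<and> lub m ?N t y \<and> ?N s t"
  then obtain s t where st: "lub m ?N s x" "lub m ?N t y" "?N s t" by blast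
  have "\<not> (t = s \<or> ?N t s)" using st(3) N(1,2) by blast
  then obtain b where b: "m b y" "\<not> (b = s \<or> ?N b s)" using st(2) unfolding lub_def by blast
  then have "?N s b" using N(3) by blast
  then have "?N a b" if "m a x" for a using st(1) that N(2) unfolding lub_def by blast
  then have "rec m (twisted m r T) x y" unfolding cl using b(1) by blast
  then show "?N x y" unfolding reorder_def by simp
qed

text \<open>The values are transitive sets, as ranks are ordinals; \<open>ranking_rec\<close> uses
  this to pass from members of \<open>s\<close> to members of a larger value.\<close>

lemma ranking_trans:
  assumes f: "ranking m f"
  shows "\<forall>v. app m f u v \<longrightarrow> (\<forall>a b. m a v \<and> m b a \<longrightarrow> m b v)"
proof (rule induct[of _ u])
  show "cls m r (\<lambda>u. \<forall>v. app m f u v \<longrightarrow> (\<forall>a b. m a v \<and> m b a \<longrightarrow> m b v))"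
    unfolding app_def opair_def upair_def by (intro df_intros vr_const)
next
  fix u assume IH: "\<And>u'. r u' u \<Longrightarrow> \<forall>v. app m f u' v \<longrightarrow> (\<forall>a b. m a v \<and> m b a \<longrightarrow> m b v)"
  show "\<forall>v. app m f u v \<longrightarrow> (\<forall>a b. m a v \<and> m b a \<longrightarrow> m b v)"
  proof (intro allI HOL.impI)
    fix v a b assume v: "app m f u v" and ab: "m a v \<and> m b a"
    have cl: "m w v \<longleftrightarrow> (\<exists>a b. m a u \<and> app m f a b \<and> (m w b \<or> w = b))" for w
      using f v unfolding ranking_def by blast
    obtain u' c where c: "m u' u" "app m f u' c" "m a c \<or> a = c" using cl ab by blast
    then have "m b c" using IH[of u'] G(6) ab by blast
    then show "m b v" using cl c by blast
  qed
qed

text \<open>The two sets may be ranked by different functions \<open>f\<close> and \<open>g\<close>.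
  If \<open>y\<close> has the larger rank, it has a member of rank at least \<open>s\<close>, and
  the members of \<open>x\<close> have ranks below \<open>s\<close>.\<close>

lemma ranking_rec:
  assumes f: "ranking m f" and g: "ranking m g"
    and cl: "\<And>u v. L u v \<longleftrightarrow> (\<exists>b. m b v \<and> (\<forall>a. m a u \<longrightarrow> L a b))" and L: "cls2 m r L"
  shows "\<forall>x s t. app m f x s \<and> app m g y t \<and> m s t \<longrightarrow> L x y"
proof (rule induct[of _ y])
  show "cls m r (\<lambda>y. \<forall>x s t. app m f x s \<and> app m g y t \<and> m s t \<longrightarrow> L x y)"
    unfolding app_def opair_def upair_def by (intro df_intros vr_const cls2D[OF L])
next
  fix y assume IH: "\<And>b. r b y \<Longrightarrow> \<forall>x s t. app m f x s \<and> app m g b t \<and> m s t \<longrightarrow> L x b"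
  show "\<forall>x s t. app m f x s \<and> app m g y t \<and> m s t \<longrightarrow> L x y"
  proof (intro allI HOL.impI)
    fix x s t assume st: "app m f x s \<and> app m g y t \<and> m s t"
    then obtain b \<beta> where b: "m b y" "app m g b \<beta>" "m s \<beta> \<or> s = \<beta>" using g unfolding ranking_def by blast
    have "L a b" if a: "m a x" for a
    proof -
      obtain \<alpha> where \<alpha>: "app m f a \<alpha>" using f st a unfolding ranking_def by blast
      then have "m \<alpha> s" using f st a unfolding ranking_def by blast
      then have "m \<alpha> \<beta>" using b(3) ranking_trans[OF g, of b] b(2) by blast
      then show ?thesis using IH[of b] b G(6) \<alpha> by blast
    qed
    then show "L x y" using cl b(1) by blast
  qed
qed

lemma rank_reorder: "rank_order m (reorder m False r T)"
  unfolding rank_order_def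
proof (intro allI HOL.impI)
  let ?L = "rec m (\<lambda>x y. False)"
  have rec: "zf_rec m r (\<lambda>x y. False)" using zf_wo.axioms(1)[OF wo[of False]] by simp
  have cl: "?L u v \<longleftrightarrow> (\<exists>b. m b v \<and> (\<forall>a. m a u \<longrightarrow> ?L a b))" for u v
    using zf_rec.L_clause[OF rec, of u v] by simp
  have c: "cls2 m r ?L" by (rule cls2I) (intro zf_rec.dfL[OF rec] vr_var)
  fix x y assume "\<exists>s t. rk m x s \<and> rk m y t \<and> m s t"
  then obtain s t f g where "app m f x s" "ranking m f" "app m g y t" "ranking m g" "m s t"
    unfolding rk_def by blast
  then have "?L x y" using ranking_rec[of f g ?L y, OF _ _ cl c] by blast
  then show "reorder m False r T x y" unfolding reorder_def by simp
qed

end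

section \<open>A definable bijection between regular orders and rank orders\<close>

definition is_empty :: "'a rel2 \<Rightarrow> 'a \<Rightarrow> bool" where
  "is_empty m z \<longleftrightarrow> (\<forall>x. \<not> m x z)"

definition is_suc :: "'a rel2 \<Rightarrow> 'a \<Rightarrow> 'a \<Rightarrow> bool" where
  "is_suc m s k \<longleftrightarrow> (\<forall>u. m u s \<longleftrightarrow> m u k \<or> u = k)"

text \<open>The natural numbers of the model, possibly nonstandard. Being transitive and being empty
  or a successor is asked of \<open>n\<close> and of all its members; Foundation does the
  rest.\<close>

definition natural :: "'a rel2 \<Rightarrow> 'a \<Rightarrow> bool" where
  "natural m n \<longleftrightarrow> (\<forall>k. k = n \<or> m k n \<longrightarrow>
    (\<forall>a b. m a k \<and> m b a \<longrightarrow> m b k) \<and> (is_empty m k \<or> (\<exists>j. is_suc m k j)))"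

text \<open>
  An order \<open>S\<close> of the form \<open>to_reg m P\<close> codes \<open>P\<close> at the tag \<open>0\<close>, and it codes at the tag \<open>k + 1\<close> the entry \<open>k\<close>
  of \<open>decode m P\<close>, where the entry \<open>0\<close> of any order is the order itself. So if \<open>S\<close> is the image of \<open>S'\<close>
  under \<open>to_reg m \<circ> to_rank m\<close>, then the entry \<open>k + 1\<close> of \<open>S\<close> is the entry \<open>k\<close> of \<open>S'\<close>.
\<close>

definition at_tag :: "'a rel2 \<Rightarrow> 'a rel2 \<Rightarrow> 'a \<Rightarrow> 'a rel2" where
  "at_tag m S n x y \<longleftrightarrow> (\<exists>z w. is_sp m z n x \<and> is_sp m w n y \<and> decode m S z w)"

definition entry :: "'a rel2 \<Rightarrow> 'a rel2 \<Rightarrow> 'a \<Rightarrow> 'a rel2" where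
  "entry m S n x y \<longleftrightarrow> (is_empty m n \<and> S x y) \<or> (\<not> is_empty m n \<and> at_tag m S n x y)"

definition push_at :: "'a rel2 \<Rightarrow> 'a rel2 \<Rightarrow> 'a \<Rightarrow> 'a rel2" where
  "push_at m P n x y \<longleftrightarrow> (\<exists>k. is_suc m n k \<and> entry m (decode m P) k x y) \<or>
    (\<not> (\<exists>k. is_suc m n k) \<and> P x y)"

text \<open>Where no tag prescribes a relation, \<open>P\<close> is the default, so that the result
  is a tournament and can be coded.\<close>

definition push :: "'a rel2 \<Rightarrow> 'a rel2 \<Rightarrow> 'a rel2" where
  "push m P z w \<longleftrightarrow> (\<exists>n x y. is_sp m z n x \<and> is_sp m w n y \<and> push_at m P n x y) \<or>
    (\<not> (\<exists>n x y. is_sp m z n x \<and> is_sp m w n y) \<and> P z w)"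

text \<open>Here \<open>S\<close> plays both parts: the order that is rearranged and the tournament
  that is coded.\<close>

definition to_rank :: "'a rel2 \<Rightarrow> 'a rel2 \<Rightarrow> 'a rel2" where
  "to_rank m S = reorder m False S S"

definition to_reg :: "'a rel2 \<Rightarrow> 'a rel2 \<Rightarrow> 'a rel2" where
  "to_reg m P = reorder m True P (push m P)"

definition of_reg :: "'a rel2 \<Rightarrow> 'a rel2 \<Rightarrow> 'a rel2" where
  "of_reg m S x y \<longleftrightarrow> (\<exists>n. is_empty m n \<and> at_tag m S n x y)"

definition reg_gwo :: "'a rel2 \<Rightarrow> 'a rel2 \<Rightarrow> bool" where
  "reg_gwo m S \<longleftrightarrow> gwo m S \<and> regular m S"

definition rank_gwo :: "'a rel2 \<Rightarrow> 'a rel2 \<Rightarrow> bool" where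
  "rank_gwo m P \<longleftrightarrow> gwo m P \<and> rank_order m P"

text \<open>The only possible preimage under \<open>to_reg m\<close> is \<open>of_reg m S\<close>,
  so no quantification over classes is involved.\<close>

definition in_range :: "'a rel2 \<Rightarrow> 'a rel2 \<Rightarrow> bool" where
  "in_range m S \<longleftrightarrow> rank_gwo m (of_reg m S) \<and> (\<forall>x y. S x y \<longleftrightarrow> to_reg m (of_reg m S) x y)"

definition link :: "'a rel2 \<Rightarrow> 'a rel2 \<Rightarrow> 'a rel2 \<Rightarrow> bool" where
  "link m S Y \<longleftrightarrow> reg_gwo m Y \<and> (\<forall>x y. S x y \<longleftrightarrow> to_reg m (to_rank m Y) x y)"

text \<open>
  The chain of iterated preimages of \<open>S\<close> under \<open>to_reg m \<circ> to_rank m\<close> ends with an order outside the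
  range of \<open>to_reg m\<close>. These are the orders to which the Cantor-Schroeder-Bernstein bijection applies \<open>to_rank m\<close>.
\<close>

definition stops :: "'a rel2 \<Rightarrow> 'a rel2 \<Rightarrow> bool" where
  "stops m S \<longleftrightarrow> (\<exists>n. natural m n \<and> \<not> in_range m (entry m S n) \<and>
    (\<forall>i s. m i n \<and> is_suc m s i \<longrightarrow> link m (entry m S i) (entry m S s)))"

definition csb :: "'a rel2 \<Rightarrow> 'a rel2 \<Rightarrow> 'a rel2" where
  "csb m S x y \<longleftrightarrow> (stops m S \<and> to_rank m S x y) \<or> (\<not> stops m S \<and> of_reg m S x y)"

text \<open>
  As \<open>to_reg m\<close> is injective, \<open>link\<close> says that \<open>P\<close> is the image of \<open>decode m P\<close> under \<open>to_rank m\<close>.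
\<close>

definition from_stop :: "'a rel2 \<Rightarrow> 'a rel2 \<Rightarrow> bool" where
  "from_stop m P \<longleftrightarrow> stops m (decode m P) \<and> link m (to_reg m P) (decode m P)"

definition csb_inv :: "'a rel2 \<Rightarrow> 'a rel2 \<Rightarrow> 'a rel2" where
  "csb_inv m P x y \<longleftrightarrow> (from_stop m P \<and> decode m P x y) \<or> (\<not> from_stop m P \<and> to_reg m P x y)"

section \<open>Uniform definability of the maps between orders\<close>

lemma vr_shift: "vr b t \<Longrightarrow> vr b (\<lambda>i e. t i (\<lambda>j. e (f j)))"
  unfolding vr_def by auto

lemma df_is_empty: "vr b t \<Longrightarrow> df b M R (\<lambda>i e. is_empty (M i) (t i e))"
proof -
  have "df1 b M R (\<lambda>i _. is_empty (M i))"
    by (rule df1I) (unfold is_empty_def, intro df_intros)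
  then show "vr b t \<Longrightarrow> df b M R (\<lambda>i e. is_empty (M i) (t i e))" by (rule df1D)
qed

lemma df_is_suc: "vr b t \<Longrightarrow> vr b u \<Longrightarrow> df b M R (\<lambda>i e. is_suc (M i) (t i e) (u i e))"
proof -
  have "df2 b M R (\<lambda>i _. is_suc (M i))"
    by (rule df2I) (unfold is_suc_def, intro df_intros)
  then show "vr b t \<Longrightarrow> vr b u \<Longrightarrow> df b M R (\<lambda>i e. is_suc (M i) (t i e) (u i e))" by (rule df2D)
qed

lemma df_natural: "vr b t \<Longrightarrow> df b M R (\<lambda>i e. natural (M i) (t i e))"
proof -
  have "df1 b M R (\<lambda>i _. natural (M i))"
    by (rule df1I) (unfold natural_def, intro df_intros df_is_empty df_is_suc)
  then show "vr b t \<Longrightarrow> df b M R (\<lambda>i e. natural (M i) (t i e))" by (rule df1D)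
qed

lemma df_app: "vr b t \<Longrightarrow> vr b u \<Longrightarrow> vr b v \<Longrightarrow> df b M R (\<lambda>i e. app (M i) (t i e) (u i e) (v i e))"
proof -
  have "df3 b M R (\<lambda>i _. app (M i))"
    by (rule df3I) (unfold app_def opair_def upair_def, intro df_intros)
  then show "vr b t \<Longrightarrow> vr b u \<Longrightarrow> vr b v \<Longrightarrow> df b M R (\<lambda>i e. app (M i) (t i e) (u i e) (v i e))"
    by (rule df3D)
qed

lemma df_rk: "vr b t \<Longrightarrow> vr b u \<Longrightarrow> df b M R (\<lambda>i e. rk (M i) (t i e) (u i e))"
proof -
  have "df2 b M R (\<lambda>i _. rk (M i))"
    by (rule df2I) (unfold rk_def ranking_def funct_def opair_def upair_def, intro df_intros df_app)
  then show "vr b t \<Longrightarrow> vr b u \<Longrightarrow> df b M R (\<lambda>i e. rk (M i) (t i e) (u i e))" by (rule df2D)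
qed


context
  fixes B :: bool and M R :: "'i \<Rightarrow> 'a rel2" and P :: "'i \<Rightarrow> (nat \<Rightarrow> 'a) \<Rightarrow> 'a rel2"
  assumes P: "df2 B M R P"
begin

lemma df_gwo: "df B M R (\<lambda>i e. gwo (M i) (P i e))"
  unfolding gwo_def by (intro df_intros df2D[OF P])

lemma df_regular: "df B M R (\<lambda>i e. regular (M i) (P i e))"
  unfolding regular_def lub_def by (intro df_intros df2D[OF P])

lemma df_reg_gwo: "df B M R (\<lambda>i e. reg_gwo (M i) (P i e))"
  unfolding reg_gwo_def by (intro df_intros df_gwo df_regular)

lemma df_rank_gwo: "df B M R (\<lambda>i e. rank_gwo (M i) (P i e))"
  unfolding rank_gwo_def rank_order_def by (intro df_intros df_gwo df_rk df2D[OF P])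

lemma df2_at_tag:
  assumes "vr B t"
  shows "df2 B M R (\<lambda>i e. at_tag (M i) (P i e) (t i e))"
  by (rule df2I) (unfold at_tag_def, intro df_intros df_is_sp df2D[OF df2_decode[OF P P]] vr_shift[OF assms])

lemma df2_entry:
  assumes "vr B t"
  shows "df2 B M R (\<lambda>i e. entry (M i) (P i e) (t i e))"
  by (rule df2I) (unfold entry_def, intro df_intros df_is_empty df2D[OF df2_at_tag[OF assms]] df2D[OF P] vr_shift[OF assms])

lemma df2_of_reg: "df2 B M R (\<lambda>i e. of_reg (M i) (P i e))"
  by (rule df2I) (unfold of_reg_def at_tag_def, intro df_intros df_is_empty df_is_sp df2D[OF df2_decode[OF P P]])

lemma df2_to_rank: "df2 B M R (\<lambda>i e. to_rank (M i) (P i e))"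
  unfolding to_rank_def by (rule df2_reorder[OF P P])

end

lemma df2_push:
  assumes P: "df2 B M R P"
  shows "df2 B M R (\<lambda>i e. push (M i) (P i e))"
proof -
  have D: "df2 B M R (\<lambda>i e. decode (M i) (P i e))" by (rule df2_decode[OF P P])
  have E: "df3 B M R (\<lambda>i e. entry (M i) (decode (M i) (P i e)))"
    by (rule df3I) (unfold entry_def at_tag_def, intro df_intros df_is_empty df_is_sp df2D[OF D] df2D[OF df2_decode[OF D D]])
  have "df3 B M R (\<lambda>i e. push_at (M i) (P i e))"
    by (rule df3I) (unfold push_at_def, intro df_intros df_is_suc df3D[OF E] df2D[OF P])
  note A = df3D[OF this]
  show ?thesis
    by (rule df2I) (unfold push_def, intro df_intros df_is_sp df2D[OF P] A)
qed

context
  fixes B :: bool and M R :: "'i \<Rightarrow> 'a rel2" and P :: "'i \<Rightarrow> (nat \<Rightarrow> 'a) \<Rightarrow> 'a rel2"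
  assumes P: "df2 B M R P"
begin

lemma df2_to_reg: "df2 B M R (\<lambda>i e. to_reg (M i) (P i e))"
  unfolding to_reg_def by (rule df2_reorder[OF P df2_push[OF P]])

end

lemma df_in_range:
  assumes P: "df2 B M R P"
  shows "df B M R (\<lambda>i e. in_range (M i) (P i e))"
  unfolding in_range_def
  by (intro df_intros df_rank_gwo df2_of_reg[OF P] df2D[OF P] df2D[OF df2_to_reg[OF df2_of_reg[OF P]]])

lemma df_link:
  assumes P: "df2 B M R P" and Q: "df2 B M R Q"
  shows "df B M R (\<lambda>i e. link (M i) (P i e) (Q i e))"
  unfolding link_def
  by (intro df_intros df_reg_gwo[OF Q] df2D[OF P] df2D[OF df2_to_reg[OF df2_to_rank[OF Q]]])

context
  fixes B :: bool and M R :: "'i \<Rightarrow> 'a rel2" and P :: "'i \<Rightarrow> (nat \<Rightarrow> 'a) \<Rightarrow> 'a rel2"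
  assumes P: "df2 B M R P"
begin

lemma df_stops: "df B M R (\<lambda>i e. stops (M i) (P i e))"
  unfolding stops_def
  by (intro df_intros df_natural df_is_suc df_in_range df_link df2_entry df2_shift[OF P])

lemma df2_csb: "df2 B M R (\<lambda>i e. csb (M i) (P i e))"
  \<comment> \<open>The variables \<open>x\<close> and \<open>y\<close> have shifted the
    environment, while \<open>stops\<close> still refers to the order given before them;
    \<open>df0D\<close> accounts for the shift.\<close>
  by (rule df2I) (unfold csb_def, intro df_intros df0D[OF df0I[OF df_stops]]
    df2D[OF df2_to_rank[OF P]] df2D[OF df2_of_reg[OF P]])

end

lemma df2_csb_inv:
  assumes P: "df2 B M R P"
  shows "df2 B M R (\<lambda>i e. csb_inv (M i) (P i e))"
proof -
  have D: "df2 B M R (\<lambda>i e. decode (M i) (P i e))" by (rule df2_decode[OF P P])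
  have "df B M R (\<lambda>i e. from_stop (M i) (P i e))"
    unfolding from_stop_def by (intro df_intros df_stops[OF D] df_link[OF df2_to_reg[OF P] D])
  note A = df0D[OF df0I[OF this]]
  show ?thesis
    by (rule df2I) (unfold csb_inv_def, intro df_intros A df2D[OF D] df2D[OF df2_to_reg[OF P]])
qed

text \<open>Reading an arbitrary order at an arbitrary tag need not yield an order. This is the
  weaker property that passes through \<open>decode\<close>, \<open>at_tag\<close>,
  \<open>entry\<close> and \<open>push\<close>.\<close>

definition tournament :: "'a rel2 \<Rightarrow> bool" where
  "tournament T \<longleftrightarrow> (\<forall>x. \<not> T x x) \<and> (\<forall>x y. x \<noteq> y \<longrightarrow> (T x y \<longleftrightarrow> \<not> T y x))"

lemma tournament_gwo: "gwo m S \<Longrightarrow> tournament S"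
  unfolding tournament_def using gwoD(1-3)[of m S] by metis

lemma entry_eq: "entry m S n = (if is_empty m n then S else at_tag m S n)"
  by (auto simp: fun_eq_iff entry_def)

lemma csb_eq: "csb m S = (if stops m S then to_rank m S else of_reg m S)"
  by (auto simp: fun_eq_iff csb_def)

lemma csb_inv_eq: "csb_inv m P = (if from_stop m P then decode m P else to_reg m P)"
  by (auto simp: fun_eq_iff csb_inv_def)

lemma link_eq: "link m S Y \<longleftrightarrow> reg_gwo m Y \<and> S = to_reg m (to_rank m Y)"
  by (auto simp: fun_eq_iff link_def)

lemma in_range_eq: "in_range m S \<longleftrightarrow> rank_gwo m (of_reg m S) \<and> S = to_reg m (of_reg m S)"
  by (auto simp: fun_eq_iff in_range_def)

section \<open>The Cantor-Schroeder-Bernstein argument inside a model\<close>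

context zfp
begin

lemma decode_iff: "is_sp m u x y \<Longrightarrow> is_sp m v y x \<Longrightarrow> decode m T x y \<longleftrightarrow> T u v"
  unfolding decode_def using sp_ext by blast

lemma tournament_decode:
  assumes T: "tournament T"
  shows "tournament (decode m T)"
  unfolding tournament_def
proof (intro conjI allI HOL.impI)
  fix x
  obtain u where "is_sp m u x x" using ex_sp' by blast
  then show "\<not> decode m T x x" using decode_iff[of u x x u] T unfolding tournament_def by blast
next
  fix x y :: 'a assume "x \<noteq> y"
  obtain u v where uv: "is_sp m u x y" "is_sp m v y x" using ex_sp' by metis
  then show "decode m T x y \<longleftrightarrow> \<not> decode m T y x"
    using decode_iff[OF uv] decode_iff[OF uv(2,1)] sp_neq[OF uv \<open>x \<noteq> y\<close>] T unfolding tournament_def by blast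
qed

lemma at_tag_iff: "is_sp m z n x \<Longrightarrow> is_sp m w n y \<Longrightarrow> at_tag m T n x y \<longleftrightarrow> decode m T z w"
  unfolding at_tag_def using sp_ext by blast

lemma tournament_at_tag:
  assumes "tournament T"
  shows "tournament (at_tag m T n)"
proof -
  note T = tournament_decode[OF assms]
  show ?thesis unfolding tournament_def
  proof (intro conjI allI HOL.impI)
    fix x
    obtain u where "is_sp m u n x" using ex_sp' by blast
    then show "\<not> at_tag m T n x x" using at_tag_iff[of u n x u] T unfolding tournament_def by blast
  next
    fix x y :: 'a assume "x \<noteq> y"
    obtain u v where uv: "is_sp m u n x" "is_sp m v n y" using ex_sp' by metis
    then have "u \<noteq> v" using sp_inj \<open>x \<noteq> y\<close> by blast
    then show "at_tag m T n x y \<longleftrightarrow> \<not> at_tag m T n y x"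
      using at_tag_iff[OF uv] at_tag_iff[OF uv(2,1)] T unfolding tournament_def by blast
  qed
qed

lemma tournament_entry: "tournament T \<Longrightarrow> tournament (entry m T n)"
  unfolding entry_eq using tournament_at_tag by simp

lemma is_suc_inj: "is_suc m s k \<Longrightarrow> is_suc m s k' \<Longrightarrow> k = k'"
  using G(1,2,6) unfolding is_suc_def by metis

lemma push_at_suc: "is_suc m n k \<Longrightarrow> push_at m P n = entry m (decode m P) k"
  unfolding push_at_def[abs_def] using is_suc_inj by (intro ext) blast

lemma push_at_nonsuc: "\<not> (\<exists>k. is_suc m n k) \<Longrightarrow> push_at m P n = P"
  unfolding push_at_def[abs_def] by simp

lemma tournament_push_at:
  assumes P: "tournament P"
  shows "tournament (push_at m P n)"
proof (cases "\<exists>k. is_suc m n k")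
  case True
  then show ?thesis using push_at_suc tournament_entry[OF tournament_decode[OF P]] by metis
next
  case False
  then show ?thesis using push_at_nonsuc P by metis
qed

lemma push_iff: "is_sp m z n x \<Longrightarrow> is_sp m w n y \<Longrightarrow> push m P z w \<longleftrightarrow> push_at m P n x y"
proof -
  assume zw: "is_sp m z n x" "is_sp m w n y"
  have "n' = n \<and> x' = x \<and> y' = y" if "is_sp m z n' x'" "is_sp m w n' y'" for n' x' y'
    using sp_inj[OF zw(1) that(1)] sp_inj[OF zw(2) that(2)] by blast
  then show ?thesis unfolding push_def using zw by blast
qed

lemma tournament_push:
  assumes P: "tournament P"
  shows "tournament (push m P)"
proof -
  have *: "(z = w \<longrightarrow> \<not> push m P z w) \<and> (z \<noteq> w \<longrightarrow> (push m P z w \<longleftrightarrow> \<not> push m P w z))" for z w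
  proof (cases "\<exists>n x y. is_sp m z n x \<and> is_sp m w n y")
    case True
    then obtain n x y where zw: "is_sp m z n x" "is_sp m w n y" by blast
    have "z = w \<longleftrightarrow> x = y"
    proof
      show "x = y" if "z = w" using sp_inj[OF zw(1)] zw(2) that by blast
      show "z = w" if "x = y" using sp_ext[OF zw(1)] zw(2) that by blast
    qed
    have "(x = y \<longrightarrow> \<not> push_at m P n x y) \<and> (x \<noteq> y \<longrightarrow> (push_at m P n x y \<longleftrightarrow> \<not> push_at m P n y x))"
      using tournament_push_at[OF P, of n] unfolding tournament_def by blast
    then show ?thesis unfolding push_iff[OF zw] push_iff[OF zw(2,1)] \<open>z = w \<longleftrightarrow> x = y\<close> .
  next
    case False
    then have "push m P z w \<longleftrightarrow> P z w" "push m P w z \<longleftrightarrow> P w z" unfolding push_def by blast+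
    then show ?thesis using P unfolding tournament_def by metis
  qed
  then show ?thesis unfolding tournament_def by blast
qed

text \<open>The constructions rearrange the base order of the locale; to rearrange another definable
  order, that order is made the base.\<close>

lemma zfp_change: "cls2 m r S \<Longrightarrow> gwo m S \<Longrightarrow> zfp m S"
  using zf_change_order[OF zf] pow by unfold_locales

lemma tw_rank:
  assumes "cls2 m r S" "gwo m S"
  shows "zf_tw m S S"
proof -
  interpret S: zfp m S by (rule zfp_change[OF assms])
  show ?thesis
    using S.r tournament_gwo[OF assms(2)] unfolding tournament_def by unfold_locales blast+
qed

lemma tw_reg:
  assumes "cls2 m r P" "gwo m P"
  shows "zf_tw m P (push m P)"
proof -
  interpret P: zfp m P by (rule zfp_change[OF assms])
  have "cls2 m P (push m P)" by (rule df2_push[OF P.r])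
  then show ?thesis
    using tournament_push[OF tournament_gwo[OF assms(2)]] unfolding tournament_def by unfold_locales blast+
qed

lemma to_rank:
  assumes "cls2 m r S" "gwo m S"
  shows "rank_gwo m (to_rank m S)" "decode m (to_rank m S) = S" "cls2 m r (to_rank m S)"
proof -
  interpret zf_tw m S S by (rule tw_rank[OF assms])
  show "rank_gwo m (to_rank m S)" "decode m (to_rank m S) = S"
    unfolding rank_gwo_def to_rank_def using gwo_reorder rank_reorder decode_reorder by blast+
  show "cls2 m r (to_rank m S)" by (rule df2_to_rank[OF assms(1)])
qed

lemma to_reg:
  assumes "cls2 m r P" "gwo m P"
  shows "reg_gwo m (to_reg m P)" "at_tag m (to_reg m P) n = push_at m P n" "of_reg m (to_reg m P) = P"
    "cls2 m r (to_reg m P)"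
proof -
  interpret T: zf_tw m P "push m P" by (rule tw_reg[OF assms])
  show "reg_gwo m (to_reg m P)"
    unfolding reg_gwo_def to_reg_def using T.gwo_reorder T.regular_reorder by blast
  have *: "at_tag m (to_reg m P) n = push_at m P n" for n
  proof (intro ext)
    fix x y
    obtain z w where zw: "is_sp m z n x" "is_sp m w n y" using ex_sp' by metis
    have "decode m (to_reg m P) = push m P" unfolding to_reg_def by (rule T.decode_reorder)
    then show "at_tag m (to_reg m P) n x y \<longleftrightarrow> push_at m P n x y"
      using at_tag_iff[OF zw] push_iff[OF zw] by simp
  qed
  then show "at_tag m (to_reg m P) n = push_at m P n" .
  obtain n where "is_empty m n" using F(5) unfolding is_empty_def by blast
  \<comment> \<open>The empty set is not a successor, so the tag 0 holds the default
    \<open>P\<close>.\<close>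
  moreover have "push_at m P n = P" if "is_empty m n" for n
    using that push_at_nonsuc unfolding is_empty_def is_suc_def by blast
  ultimately show "of_reg m (to_reg m P) = P" unfolding of_reg_def[abs_def] * by (intro ext) metis
  show "cls2 m r (to_reg m P)" by (rule df2_to_reg[OF assms(1)])
qed

lemma to_reg_rank:
  assumes "cls2 m r S" "gwo m S"
  shows "of_reg m (to_reg m (to_rank m S)) = to_rank m S" "in_range m (to_reg m (to_rank m S))"
    "is_suc m s k \<Longrightarrow> entry m (to_reg m (to_rank m S)) s = entry m S k"
proof -
  note t = to_rank[OF assms]
  have g: "gwo m (to_rank m S)" using t(1) unfolding rank_gwo_def by blast
  show o: "of_reg m (to_reg m (to_rank m S)) = to_rank m S" by (rule to_reg(3)[OF t(3) g])
  show "in_range m (to_reg m (to_rank m S))" unfolding in_range_eq o using t(1) by simp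
  assume s: "is_suc m s k"
  then have "\<not> is_empty m s" unfolding is_empty_def is_suc_def by blast
  then show "entry m (to_reg m (to_rank m S)) s = entry m S k"
    using to_reg(2)[OF t(3) g] push_at_suc[OF s] t(2) by (simp add: entry_eq)
qed

lemma ex_suc: "\<exists>s. is_suc m s k"
proof -
  obtain c where c: "\<forall>x. m x c \<longleftrightarrow> x = k \<or> x = k" using F(3) by blast
  obtain p where p: "\<forall>x. m x p \<longleftrightarrow> x = k \<or> x = c" using F(3) by blast
  obtain s where "\<forall>y. m y s \<longleftrightarrow> (\<exists>x. m x p \<and> m y x)" using F(4) by blast
  then have "is_suc m s k" unfolding is_suc_def using c p by metis
  then show ?thesis by blast
qed

lemma suc_ext: "is_suc m s k \<Longrightarrow> is_suc m t k \<Longrightarrow> s = t"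
  unfolding is_suc_def using F(1) by simp

lemma natural_cases:
  assumes n: "natural m n"
  shows "is_empty m n \<or> (\<exists>k. is_suc m n k \<and> natural m k)"
proof (cases "is_empty m n")
  case False
  then obtain k where k: "is_suc m n k" using n unfolding natural_def by blast
  have "m x n" if "x = k \<or> m x k" for x using that k unfolding is_suc_def by blast
  then have "natural m k" using n unfolding natural_def by blast
  then show ?thesis using k by blast
qed simp

lemma natural_suc:
  assumes k: "natural m k" and s: "is_suc m s k"
  shows "natural m s"
proof -
  have *: "(\<forall>a b. m a i \<and> m b a \<longrightarrow> m b i) \<and> (is_empty m i \<or> (\<exists>j. is_suc m i j))" if "i = k \<or> m i k" for i
    using k that unfolding natural_def by blast
  have "m b s" if ab: "m a s" "m b a" for a b
  proof -
    have "m a k \<or> a = k" using ab(1) s unfolding is_suc_def by blast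
    then have "m b k" using *[of k] ab(2) by blast
    then show ?thesis using s unfolding is_suc_def by blast
  qed
  moreover have "i = k \<or> m i k" if "m i s" for i using s that unfolding is_suc_def by blast
  ultimately show ?thesis unfolding natural_def using s * by blast
qed

lemma natural_elem: "natural m n \<Longrightarrow> m i n \<Longrightarrow> natural m i"
  unfolding natural_def by blast

text \<open>When a chain is shifted by one place, an index in \<open>k\<close> becomes an index in
  the successor of \<open>k\<close>.\<close>

lemma suc_in_suc: "\<forall>n i s. natural m k \<and> is_suc m n k \<and> m i k \<and> is_suc m s i \<longrightarrow> m s n"
proof (rule induct[of _ k])
  show "cls m r (\<lambda>k. \<forall>n i s. natural m k \<and> is_suc m n k \<and> m i k \<and> is_suc m s i \<longrightarrow> m s n)"
    by (intro df_intros df_natural df_is_suc vr_const)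
next
  fix k
  assume IH: "\<And>j. r j k \<Longrightarrow> \<forall>n i s. natural m j \<and> is_suc m n j \<and> m i j \<and> is_suc m s i \<longrightarrow> m s n"
  show "\<forall>n i s. natural m k \<and> is_suc m n k \<and> m i k \<and> is_suc m s i \<longrightarrow> m s n"
  proof (intro allI HOL.impI)
    fix n i s assume *: "natural m k \<and> is_suc m n k \<and> m i k \<and> is_suc m s i"
    then have "\<not> is_empty m k" unfolding is_empty_def by blast
    then obtain j where j: "is_suc m k j" "natural m j" using natural_cases * by blast
    have "r j k" using j(1) G(6) unfolding is_suc_def by blast
    have "m i j \<or> i = j" using j(1) * unfolding is_suc_def by blast
    then have "m s k \<or> s = k"
    proof
      assume "m i j"
      then show ?thesis using IH[OF \<open>r j k\<close>] j * by blast
    next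
      assume "i = j"
      then show ?thesis using suc_ext j(1) * by blast
    qed
    then show "m s n" using * unfolding is_suc_def by blast
  qed
qed

text \<open>As \<open>S\<close> itself is in the range, its chain does not stop at 0, so there is an
  entry at 1, and this is the preimage. The chain of the preimage is that of \<open>S\<close>
  without the first entry, and it stops one place earlier.\<close>

lemma stops_in_range:
  assumes S: "cls2 m r S" and st: "stops m S" and ran: "in_range m S"
  shows "\<exists>Y. cls2 m r Y \<and> reg_gwo m Y \<and> stops m Y \<and> S = to_reg m (to_rank m Y)"
proof -
  obtain n where n: "natural m n" "\<not> in_range m (entry m S n)"
    "\<forall>i s. m i n \<and> is_suc m s i \<longrightarrow> link m (entry m S i) (entry m S s)"
    using st unfolding stops_def by blast
  have "\<not> is_empty m n" using n(2) ran by (auto simp: entry_eq)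
  then obtain k where k: "is_suc m n k" "natural m k" using natural_cases[OF n(1)] by blast
  obtain z where z: "is_empty m z" using F(5) unfolding is_empty_def by blast
  obtain z' where z': "is_suc m z' z" using ex_suc by blast
  let ?Y = "entry m S z'"
  \<comment> \<open>A non-zero natural number contains 0, since otherwise its natural members would
    all be non-empty and descend without end.\<close>
  have "m z n"
  proof (rule ccontr)
    assume nz: "\<not> m z n"
    have "natural m j \<and> m j n \<longrightarrow> False" for j
    proof (rule induct[of _ j])
      show "cls m r (\<lambda>j. natural m j \<and> m j n \<longrightarrow> False)" by (intro df_intros df_natural vr_const)
      fix x assume IH: "\<And>y. r y x \<Longrightarrow> natural m y \<and> m y n \<longrightarrow> False"
      show "natural m x \<and> m x n \<longrightarrow> False"
      proof
        assume x: "natural m x \<and> m x n"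
        show False
        proof (cases "is_empty m x")
          case True
          then have "x = z" using z F(1) unfolding is_empty_def by blast
          then show False using nz x by blast
        next
          case False
          then obtain y where "m y x" unfolding is_empty_def by blast
          moreover have "m y n" using n(1) x calculation unfolding natural_def by blast
          ultimately show False using IH[of y] natural_elem[of x y] x G(6) by blast
        qed
      qed
    qed
    then show False using k unfolding is_suc_def by blast
  qed
  then have "link m (entry m S z) ?Y" using n(3) z' by blast
  then have Y: "reg_gwo m ?Y" "S = to_reg m (to_rank m ?Y)" unfolding link_eq using z by (simp_all add: entry_eq)
  have c: "cls2 m r ?Y" by (rule df2_entry[OF S vr_const])
  have "gwo m ?Y" using Y(1) unfolding reg_gwo_def by blast
  note t = to_reg_rank(3)[OF c this, folded Y(2)]
  have "\<not> in_range m (entry m ?Y k)" using n(2) t[OF k(1)] by simp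
  moreover have "link m (entry m ?Y i) (entry m ?Y s)" if i: "m i k" "is_suc m s i" for i s
  proof -
    obtain s' where s': "is_suc m s' s" using ex_suc by blast
    have "m s n" using suc_in_suc[of k] k i by blast
    then have "link m (entry m S s) (entry m S s')" using n(3) s' by blast
    then show ?thesis using t[OF i(2)] t[OF s'] by simp
  qed
  ultimately have "stops m ?Y" unfolding stops_def using k(2) by blast
  then show ?thesis using c Y by blast
qed

text \<open>The chain is prolonged at its beginning: the new link at 0 holds by the definition of
  the image, and the others are the old links moved up one place.\<close>

lemma stops_shift:
  assumes S: "cls2 m r S" and g: "reg_gwo m S" and st: "stops m S"
  shows "stops m (to_reg m (to_rank m S))"
proof -
  let ?T = "to_reg m (to_rank m S)"
  obtain n where n: "natural m n" "\<not> in_range m (entry m S n)"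
    "\<forall>i s. m i n \<and> is_suc m s i \<longrightarrow> link m (entry m S i) (entry m S s)"
    using st unfolding stops_def by blast
  have "gwo m S" using g unfolding reg_gwo_def by blast
  note t = to_reg_rank(3)[OF S this]
  obtain n' where n': "is_suc m n' n" using ex_suc by blast
  have nat: "natural m n'" by (rule natural_suc[OF n(1) n'])
  have "\<not> in_range m (entry m ?T n')" using n(2) t[OF n'] by simp
  moreover have "link m (entry m ?T i) (entry m ?T s)" if i: "m i n'" "is_suc m s i" for i s
  proof (cases "is_empty m i")
    case True
    then show ?thesis using t[OF i(2)] g by (simp add: entry_eq link_eq)
  next
    case False
    then obtain j where j: "is_suc m i j" using natural_cases natural_elem[OF nat i(1)] by blast
    have "m j i" using j unfolding is_suc_def by blast
    have "m i n \<or> i = n" using i(1) n' unfolding is_suc_def by blast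
    then have "m j n" using \<open>m j i\<close> n(1) unfolding natural_def by blast
    then have "link m (entry m S j) (entry m S i)" using n(3) j by blast
    then show ?thesis using t[OF i(2)] t[OF j] by simp
  qed
  ultimately show ?thesis unfolding stops_def using nat by blast
qed

text \<open>Otherwise the chain would stop at 0.\<close>

lemma in_range_if_not_stops: "\<not> stops m S \<Longrightarrow> in_range m S"
proof -
  assume st: "\<not> stops m S"
  obtain z where z: "is_empty m z" using F(5) unfolding is_empty_def by blast
  have "natural m z" using z unfolding natural_def is_empty_def by blast
  then have "in_range m (entry m S z)"
    using st z unfolding stops_def is_empty_def by blast
  then show ?thesis using z by (simp add: entry_eq)
qed

text \<open>The point is that \<open>csb_inv\<close> recognises which map was applied. A value of
  \<open>to_rank m\<close> decodes to the stopping order that it came from; if a value of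
  \<open>of_reg m\<close> also decoded to such an order, then \<open>S\<close> itself would stop, by
  \<open>stops_shift\<close>.\<close>

lemma csb:
  assumes S: "cls2 m r S" and g: "reg_gwo m S"
  shows "rank_gwo m (csb m S) \<and> csb_inv m (csb m S) = S"
proof -
  have gS: "gwo m S" using g unfolding reg_gwo_def by blast
  show ?thesis
  proof (cases "stops m S")
    case True
    then have "from_stop m (to_rank m S)"
      unfolding from_stop_def link_eq using to_rank(2)[OF S gS] g by simp
    then show ?thesis using True to_rank(1,2)[OF S gS] by (simp add: csb_eq csb_inv_eq)
  next
    case False
    let ?P = "of_reg m S"
    have P: "rank_gwo m ?P" "S = to_reg m ?P"
      using in_range_if_not_stops[OF False] unfolding in_range_eq by blast+
    have "\<not> from_stop m ?P"
    proof
      assume f: "from_stop m ?P"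
      have "cls2 m r (decode m ?P)" by (rule cls2_decode[OF df2_of_reg[OF S]])
      then have "stops m (to_reg m ?P)"
        using stops_shift[of "decode m ?P"] f unfolding from_stop_def link_eq by simp
      then show False using False P(2) by simp
    qed
    then show ?thesis using False P by (simp add: csb_eq csb_inv_eq)
  qed
qed

lemma csb_inv:
  assumes P: "cls2 m r P" and g: "rank_gwo m P"
  shows "reg_gwo m (csb_inv m P) \<and> csb m (csb_inv m P) = P"
proof -
  have gP: "gwo m P" using g unfolding rank_gwo_def by blast
  note t = to_reg[OF P gP]
  show ?thesis
  proof (cases "from_stop m P")
    case True
    then have d: "stops m (decode m P)" "reg_gwo m (decode m P)" "to_reg m P = to_reg m (to_rank m (decode m P))"
      unfolding from_stop_def link_eq by blast+
    have "gwo m (decode m P)" using d(2) unfolding reg_gwo_def by blast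
    from to_reg_rank(1)[OF cls2_decode[OF P] this] have "to_rank m (decode m P) = P"
      using t(3) d(3) by simp
    then show ?thesis using True d by (simp add: csb_eq csb_inv_eq)
  next
    case False
    \<comment> \<open>If the image stopped, then by \<open>stops_in_range\<close> it would come from
      a stopping order \<open>Y\<close> one round back, and \<open>P\<close> would be the image of
      \<open>Y\<close> under \<open>to_rank m\<close>.\<close>
    have "\<not> stops m (to_reg m P)"
    proof
      assume st: "stops m (to_reg m P)"
      have "in_range m (to_reg m P)" unfolding in_range_eq t(3) using g by simp
      from stops_in_range[OF t(4) st this] obtain Y where
        Y: "cls2 m r Y" "reg_gwo m Y" "stops m Y" "to_reg m P = to_reg m (to_rank m Y)" by blast
      have gY: "gwo m Y" using Y(2) unfolding reg_gwo_def by blast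
      have "P = to_rank m Y" using to_reg_rank(1)[OF Y(1) gY] t(3) Y(4) by simp
      then have "decode m P = Y" using to_rank(2)[OF Y(1) gY] by simp
      then have "from_stop m P" unfolding from_stop_def link_eq using Y by simp
      then show False using False by simp
    qed
    then show ?thesis using False t by (simp add: csb_eq csb_inv_eq)
  qed
qed

end

text \<open>Membership is kept, and one formula each for \<open>csb\<close> and
  \<open>csb_inv\<close>, obtained from \<open>df_uniform\<close>, changes the order in all models;
  \<open>zf_change_order\<close> keeps the axioms. Power Set is an axiom on one side and follows
  from regularity on the other.\<close>

lemma bi_interpretable_SC_reg: "bi_interpretable sc_sig SC_reg set_sig ZFGC_plus"
proof -
  have R: "df2 False (fst :: nat rel2 \<times> nat rel2 \<Rightarrow> _) snd (\<lambda>i _. snd i)"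
    by (rule df2I) (intro df_prec vr_var)
  obtain \<theta> where \<theta>: "wff set_sig [(), ()] \<theta>"
    "\<And>(m :: nat rel2) r x y. sat (set_str m r) (case_nat x (\<lambda>_. y)) \<theta> \<longleftrightarrow> csb m r x y"
    by (rule df_uniform[of csb, OF df2_use[OF df2_csb[OF R] vr_var vr_var]], blast)
  obtain \<psi> where \<psi>: "wff set_sig [(), ()] \<psi>"
    "\<And>(m :: nat rel2) r x y. sat (set_str m r) (case_nat x (\<lambda>_. y)) \<psi> \<longleftrightarrow> csb_inv m r x y"
    by (rule df_uniform[of csb_inv, OF df2_use[OF df2_csb_inv[OF R] vr_var vr_var]], blast)
  have ev: "ev \<theta> m r = csb m r" "ev \<psi> m r = csb_inv m r" for m r :: "nat rel2"
    by (simp_all add: fun_eq_iff ev_def \<theta>(2) \<psi>(2))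
  show ?thesis
  proof (rule bi_interpretable_extI[OF \<psi>(1) \<theta>(1)])
    fix l i :: "nat rel2" and c
    assume M: "sc_str l i c \<Turnstile> SC_reg"
    then have c: "bij c" and so: "so (Emem i c) l" using sc_so[of l i c] unfolding SC_reg_def by blast+
    have reg: "regular (Emem i c) l"
      using M sat_regularity[OF c] unfolding SC_reg_def by blast
    interpret zfp "Emem i c" l
      using so_zf[OF so] regular_pow[OF so_zf[OF so] reg] by unfold_locales
    have "reg_gwo (Emem i c) l" unfolding reg_gwo_def using zfD(2)[OF zf] reg by blast
    note C = csb[OF r this]
    have "zf (Emem i c) (csb (Emem i c) l)"
      by (rule zf_change_order[OF zf df2_csb[OF r]]) (use C rank_gwo_def in blast)
    then show "bij c \<and> set_str (Emem i c) (ev \<theta> (Emem i c) l) \<Turnstile> ZFGC_plus \<and>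
        ev \<psi> (Emem i c) (ev \<theta> (Emem i c) l) = l"
      unfolding ev sat_ZFGC_plus using C c pow unfolding rank_gwo_def by blast
  next
    fix m r :: "nat rel2"
    assume "set_str m r \<Turnstile> ZFGC_plus"
    then have zf: "zf m r" and "pow m" and rank: "rank_order m r" unfolding sat_ZFGC_plus by blast+
    then interpret zfp m r by unfold_locales
    have "rank_gwo m r" unfolding rank_gwo_def using zfD(2)[OF zf] rank by blast
    note C = csb_inv[OF r this]
    have "zf m (csb_inv m r)"
      by (rule zf_change_order[OF zf df2_csb_inv[OF r]]) (use C reg_gwo_def in blast)
    from zf_sc[OF this] have S: "sc_str (csb_inv m r) m (\<lambda>x. x) \<Turnstile> SC_minus" .
    have "bij (\<lambda>x :: nat. x)" by (auto simp: bij_def inj_def)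
    from sat_regularity[OF this, of "csb_inv m r" m]
    have "sat (sc_str (csb_inv m r) m (\<lambda>x. x)) e regularity_ax" for e
      using C unfolding reg_gwo_def Emem_id by blast
    then show "sc_str (ev \<psi> m r) m (\<lambda>x. x) \<Turnstile> SC_reg \<and> ev \<theta> m (ev \<psi> m r) = r"
      unfolding ev SC_reg_def using S C by blast
  next
    fix p assume "p \<in> SC_reg" then show "wff sc_sig [] p"
      using wff_SC_minus wff_SC_axs unfolding SC_reg_def by blast
  next
    fix p assume "p \<in> ZFGC_plus" then show "wff set_sig [] p"
      using wff_ZFGC_minus wff_power_set wff_rank_ax unfolding ZFGC_plus_def ZFGC_def by blast
  qed (auto simp: SC_reg_def ZFGC_plus_def ZFGC_def)
qed

theorem theorem5:
  shows "bi_interpretable sc_sig SC_plus set_sig ZFGC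
    \<and> bi_interpretable sc_sig SC set_sig (ZFGC_minus \<union> {successor_cardinals_ax})
    \<and> bi_interpretable sc_sig SC_reg set_sig ZFGC_plus"
  using bi_interpretable_SC_plus bi_interpretable_SC bi_interpretable_SC_reg by blast

end
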